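(* Let $k\ge 0$ and $c>0$ be fixed, and for each $n$ let $C_n\sim C(n,p)$ be a random clique complex with $p=(c/n)^{1/(k+1)}$. Then for every $r\in[1,\infty)$, \[ \lim_{n\to\infty}\mathbb{E}\left[\left|\frac{\beta_k(C_n)}{n^{k/2+1}}-\frac{c^{k/2}h_k(c)}{(k+1)!}\right|^r\right]=0 . \]
   Context: The random clique complex $C(n,p)$: take an Erdős–Rényi graph $G\sim G(n,p)$ on vertex set $[n]=\{1,\dots,n\}$ (each edge present independently with probability $p$) and form its clique complex, i.e. the simplicial complex whose simplices are all subsets of $[n]$ (including $\emptyset$) that span complete subgraphs of $G$. For a finite simplicial complex $X$, $\beta_k(X)=\dim_{\mathbb{R}}H^k(X)$, where cohomology with real coefficients is computed from the augmented cochain complex that includes $C^{-1}(X)=\mathbb{R}^{\{\emptyset\}}\cong\mathbb{R}$ and the coboundary $d_{-1}$ (so these are the reduced Betti numbers). For $d\in\mathbb{N}$ and $c\ge 0$ let $t_{d,c}\in(0,1]$ be the smallest positive root of $t=\exp(-c(1-t)^d)$, and for $k\ge0$ define \[ h_k(c)=\max\Bigl\{1-\tfrac{c}{k+2},\; t+ct(1-t)^{k+1}-\tfrac{c}{k+2}\bigl(1-(1-t)^{k+2}\bigr)\Bigr\},\qquad t=t_{k+1,c}. \] *)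

theory Defs
  imports "HOL-Analysis.Analysis" "HOL-Library.Function_Algebras"
begin

definition all_edges :: "nat \<Rightarrow> nat set set" where
  "all_edges n = {e. e \<subseteq> {1..n} \<and> card e = 2}"

definition gnp_weight :: "nat \<Rightarrow> real \<Rightarrow> nat set set \<Rightarrow> real" where
  "gnp_weight n p E = p ^ card E * (1 - p) ^ (card (all_edges n) - card E)"

definition gnp_expectation :: "nat \<Rightarrow> real \<Rightarrow> (nat set set \<Rightarrow> real) \<Rightarrow> real" where
  "gnp_expectation n p f = (\<Sum>E\<in>Pow (all_edges n). gnp_weight n p E * f E)"

definition clique_complex :: "nat \<Rightarrow> nat set set \<Rightarrow> nat set set" where
  "clique_complex n E =
     {\<sigma>. \<sigma> \<subseteq> {1..n} \<and> (\<forall>x\<in>\<sigma>. \<forall>y\<in>\<sigma>. x \<noteq> y \<longrightarrow> {x, y} \<in> E)}"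

text \<open>Real cochains of the augmented cochain complex on simplices with m vertices
  (i.e. of dimension m - 1; m = 0 gives C^{-1} = R^{{empty}}).\<close>
definition cochains :: "nat set set \<Rightarrow> nat \<Rightarrow> (nat set \<Rightarrow> real) set" where
  "cochains K m = {\<phi>. \<forall>\<sigma>. \<phi> \<sigma> \<noteq> 0 \<longrightarrow> \<sigma> \<in> K \<and> finite \<sigma> \<and> card \<sigma> = m}"

definition coboundary :: "nat set set \<Rightarrow> nat \<Rightarrow> (nat set \<Rightarrow> real) \<Rightarrow> (nat set \<Rightarrow> real)" where
  "coboundary K m \<phi> = (\<lambda>\<tau>. if \<tau> \<in> K \<and> finite \<tau> \<and> card \<tau> = m + 1
       then (\<Sum>i<m + 1. (-1) ^ i * \<phi> (\<tau> - {sorted_list_of_set \<tau> ! i}))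
       else 0)"

definition fdim :: "(nat set \<Rightarrow> real) set \<Rightarrow> nat" where
  "fdim S = vector_space.dim (\<lambda>(a::real) (f::nat set \<Rightarrow> real). (\<lambda>x. a * f x)) S"

text \<open>Reduced k-th Betti number: dim H^k = dim Z^k - dim B^k, where
  Z^k = ker d_k and B^k = im d_{k-1} (cochains on simplices with k+1 vertices).\<close>
definition betti :: "nat \<Rightarrow> nat set set \<Rightarrow> nat" where
  "betti k K = fdim {\<phi> \<in> cochains K (k + 1). coboundary K (k + 1) \<phi> = 0}
               - fdim (coboundary K k ` cochains K k)"

definition t_root :: "nat \<Rightarrow> real \<Rightarrow> real" where
  "t_root d c = Inf {t. 0 < t \<and> t \<le> 1 \<and> t = exp (- c * (1 - t) ^ d)}"

definition h_fun :: "nat \<Rightarrow> real \<Rightarrow> real" where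
  "h_fun k c = (let t = t_root (k + 1) c in
     max (1 - c / real (k + 2))
         (t + c * t * (1 - t) ^ (k + 1) - c / real (k + 2) * (1 - (1 - t) ^ (k + 2))))"

end

theory Submission
  imports Defs "HOL-Probability.Probability"
begin

text \<open>Put \<open>d = k + 1\<close>, call the cliques with \<open>d\<close> vertices faces and those with \<open>d + 1\<close> vertices cofaces.
  The image of the coboundary into degree \<open>k\<close> has dimension at most the number of cliques with \<open>k\<close> vertices, which is
  of smaller order than \<open>n^(k/2+1)\<close>; so the Betti number may be replaced by the dimension \<open>nu\<close> of the space of cocycles.

  Around a typical face the complex looks like a random tree: a face has a Poisson(c) number of cofaces,
  each of them has \<open>d\<close> further facets, and so on. From above, \<open>nu\<close> is at most the sum of
  the squared norms of any vectors \<open>z \<sigma>\<close> representing the evaluations at the faces \<open>\<sigma>\<close> on the space of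
  cocycles. On a tree of finite depth the best such vector has squared norm given by the recursion
  \<open>x = 1 / (1 + (\<Sum>j. 1 / (\<Sum>i. x j i)))\<close>. In the infinite tree the recursion has a limit \<open>X\<close>; the
  Mecke formula and the exchangeability of the \<open>d + 1\<close> facets of a coface give its mean exactly, namely \<open>g t\<close> with
  \<open>g t = t + c t (1-t)^d - c/(d+1) (1 - (1-t)^(d+1))\<close> and \<open>t = P (X > 0)\<close>, which is a root of
  \<open>t = exp (- c (1-t)^d)\<close>. Among these roots, \<open>g\<close> is largest at the smallest one or at \<open>1\<close>.

  From below, a set \<open>Z\<close> of faces gives \<open>nu \<ge> card Z - m\<close>, where \<open>m\<close> is the number of cofaces having a facet
  in \<open>Z\<close>. The set of all faces yields \<open>g 1\<close>; the faces that survive finitely many rounds of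
  local pruning yield values converging to \<open>g\<close> at the smallest root.

  Both functionals are nonnegative after passing to complements, so the local comparison needs only lower bounds for
  the probabilities of finite trees. Finally, the Efron-Stein inequality shows that \<open>nu\<close> concentrates, and clique
  counts have bounded moments after normalisation, which upgrades convergence in \<open>L^1\<close> to \<open>L^r\<close>.\<close>

section \<open>The Poisson tree\<close>

text \<open>A vector representing the evaluation at \<open>\<sigma>\<close> on cocycles is not
  unique: the cocycle equation at a coface expresses \<open>b \<sigma>\<close> through the values at
  the other facets, so the unit vector at \<open>\<sigma>\<close> can be traded for vectors
  supported further away. Spreading the weight over the branches lowers the norm, and the optimal
  split is what produces the reciprocals in the recursion; depth \<open>0\<close>, where nothing is
  spread, gives the start value \<open>1\<close>. The two bounds approach the fixed point equation
  from opposite ends. Pruning starts from the empty set of faces, so its probabilities increase to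
  the smallest root. The recursion for the norms starts from \<open>1\<close> and decreases; its
  limit only yields some root, and comparing \<open>g\<close> over all roots closes the gap. No
  general theory of local convergence enters: a nonnegative functional of the Poisson tree is
  exhausted from below by finitely many shapes, and for each single shape an explicit lower bound of
  its probability converges.\<close>

definition shift :: "'a \<Rightarrow> ('a list \<Rightarrow> 'b) \<Rightarrow> 'a list \<Rightarrow> 'b" where
  "shift j \<omega> = (\<lambda>l. \<omega> (j # l))"

definition graft :: "'b \<Rightarrow> ('a \<Rightarrow> 'a list \<Rightarrow> 'b) \<Rightarrow> 'a list \<Rightarrow> 'b" where
  "graft N \<omega>s = (\<lambda>l. case l of [] \<Rightarrow> N | j # l' \<Rightarrow> \<omega>s j l')"

lemma graft_simps [simp]: "graft N \<omega>s [] = N" "shift j (graft N \<omega>s) = \<omega>s j"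
  by (auto simp: graft_def shift_def)

text \<open>A tree is coded by one Poisson variable for every address. If \<open>\<omega>\<close> belongs to a face, \<open>\<omega> []\<close> is the
  number of its cofaces, and \<open>shift i (shift j \<omega>)\<close> belongs to the \<open>i\<close>-th further facet of the \<open>j\<close>-th coface. The values
  at addresses of odd length are never used.\<close>

locale poisson_tree =
  fixes c :: real and d :: nat
  assumes c_pos: "c > 0" and d_pos: "d > 0"
begin

definition offspring :: "nat measure" where
  "offspring = measure_pmf (poisson_pmf c)"

definition treeM :: "(nat list \<Rightarrow> nat) measure" where
  "treeM = PiM UNIV (\<lambda>_. offspring)"

definition forestM :: "(nat \<Rightarrow> nat list \<Rightarrow> nat) measure" where
  "forestM = PiM UNIV (\<lambda>_. treeM)"

lemma space_offspring [simp]: "space offspring = UNIV" "sets offspring = UNIV"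
  by (auto simp: offspring_def)

lemma sets_offspring_cong [measurable_cong]: "sets offspring = sets (count_space UNIV)"
  by simp

lemma space_treeM [simp]: "space treeM = UNIV"
  by (simp add: treeM_def space_PiM)

lemma space_forestM [simp]: "space forestM = UNIV"
  by (simp add: forestM_def space_PiM)

sublocale offspring: prob_space offspring
  unfolding offspring_def by (rule measure_pmf.prob_space_axioms)

sublocale tree_prod: product_prob_space "\<lambda>_. offspring" "UNIV :: nat list set"
  by unfold_locales

sublocale treeM: prob_space treeM
  unfolding treeM_def by (rule tree_prod.prob_space_axioms)

sublocale forest_seq: sequence_space treeM
  by unfold_locales

sublocale forestM: prob_space forestM
  unfolding forestM_def by (rule forest_seq.prob_space_axioms)

lemma sets_treeM_cong [measurable_cong]: "sets treeM = sets (PiM UNIV (\<lambda>_. count_space UNIV))"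
  unfolding treeM_def by (rule sets_PiM_cong) auto

lemma sets_forestM_cong [measurable_cong]: "sets forestM = sets (PiM UNIV (\<lambda>_. treeM))"
  unfolding forestM_def by simp

lemma measurable_root [measurable]: "(\<lambda>\<omega>. \<omega> l) \<in> treeM \<rightarrow>\<^sub>M count_space UNIV"
  by measurable

lemma measurable_shift [measurable]: "shift j \<in> treeM \<rightarrow>\<^sub>M treeM"
proof -
  have "shift j \<in> treeM \<rightarrow>\<^sub>M PiM UNIV (\<lambda>_. count_space UNIV)"
    unfolding shift_def by (rule measurable_PiM_single') auto
  then show ?thesis by (simp cong: measurable_cong_sets add: sets_treeM_cong)
qed

lemma measurable_forest_component [measurable]: "(\<lambda>\<omega>s. \<omega>s j) \<in> forestM \<rightarrow>\<^sub>M treeM"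
  unfolding forestM_def by measurable

lemma measurable_graft [measurable]:
  "(\<lambda>(N, \<omega>s). graft N \<omega>s) \<in> offspring \<Otimes>\<^sub>M forestM \<rightarrow>\<^sub>M treeM"
proof -
  have "(\<lambda>(N, \<omega>s). graft N \<omega>s) \<in> offspring \<Otimes>\<^sub>M forestM \<rightarrow>\<^sub>M PiM UNIV (\<lambda>_. count_space UNIV)"
  proof (rule measurable_PiM_single')
    fix l :: "nat list"
    show "(\<lambda>x. (case x of (N, \<omega>s) \<Rightarrow> graft N \<omega>s) l) \<in> offspring \<Otimes>\<^sub>M forestM \<rightarrow>\<^sub>M count_space UNIV"
    proof (cases l)
      case Nil
      then show ?thesis by (simp add: graft_def split_beta')
    next
      case (Cons j l')
      have "(\<lambda>x. snd x j l') \<in> offspring \<Otimes>\<^sub>M forestM \<rightarrow>\<^sub>M count_space UNIV"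
        by measurable
      then show ?thesis using Cons by (simp add: graft_def split_beta')
    qed
  qed (auto simp: space_PiM)
  then show ?thesis by (simp cong: measurable_cong_sets add: sets_treeM_cong)
qed

text \<open>The branching property: the count at the root and the subtrees are independent. An
  address is empty or has a first letter \<open>j\<close>, so a finite cylinder splits into a
  condition on the root and finite cylinders for finitely many subtrees; finite cylinders determine
  the product measure.\<close>

lemma distr_graft: "distr (offspring \<Otimes>\<^sub>M forestM) treeM (\<lambda>(N, \<omega>s). graft N \<omega>s) = treeM"
  unfolding treeM_def
proof (rule tree_prod.PiM_eq)
  fix J :: "nat list set" and F :: "nat list \<Rightarrow> nat set"
  assume J: "finite J"
  define Jh where "Jh = {j. \<exists>l. j # l \<in> J}"
  define Jt where "Jt j = {l. j # l \<in> J}" for j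
  have Jh_im: "Jh \<subseteq> hd ` (J - {[]})" unfolding Jh_def by force
  have fin_h: "finite Jh" using J finite_subset[OF Jh_im] by auto
  have fin_t: "finite (Jt j)" for j
    unfolding Jt_def using finite_vimageI[OF J, of "(#) j"] by (auto simp: vimage_def)
  define X where "X = prod_emb UNIV (\<lambda>_. offspring) J (Pi\<^sub>E J F)"
  define Y where "Y j = prod_emb UNIV (\<lambda>_. offspring) (Jt j) (\<Pi>\<^sub>E l\<in>Jt j. F (j # l))" for j
  define W where "W = prod_emb UNIV (\<lambda>_. treeM) Jh (Pi\<^sub>E Jh Y)"
  have Y_sets: "Y j \<in> sets treeM" for j
    unfolding Y_def treeM_def by (rule sets_PiM_I) (auto simp: fin_t)
  have X_sets: "X \<in> sets treeM"
    unfolding X_def treeM_def by (rule sets_PiM_I) (auto simp: J)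
  have W_sets: "W \<in> sets forestM"
    unfolding W_def forestM_def by (rule sets_PiM_I) (auto simp: fin_h Y_sets)
  let ?r = "if [] \<in> J then F [] else UNIV"
  have pre: "(\<lambda>(N, \<omega>s). graft N \<omega>s) -` X \<inter> space (offspring \<Otimes>\<^sub>M forestM) = ?r \<times> W"
    unfolding X_def W_def Y_def
    by (auto simp: prod_emb_def PiE_iff space_pair_measure graft_def Jh_def Jt_def space_PiM
        split: list.splits if_splits) blast+
  have "emeasure (distr (offspring \<Otimes>\<^sub>M forestM) treeM (\<lambda>(N, \<omega>s). graft N \<omega>s)) X
      = emeasure (offspring \<Otimes>\<^sub>M forestM) (?r \<times> W)"
    using X_sets by (subst emeasure_distr) (auto simp: pre)
  also have "\<dots> = emeasure offspring ?r * emeasure forestM W"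
    using W_sets by (intro forestM.emeasure_pair_measure_Times) auto
  also have "emeasure forestM W = (\<Prod>j\<in>Jh. emeasure treeM (Y j))"
    unfolding W_def forestM_def using Y_sets fin_h
    by (intro emeasure_PiM_emb) (auto simp: treeM.prob_space_axioms)
  also have "\<dots> = (\<Prod>j\<in>Jh. \<Prod>l\<in>Jt j. emeasure offspring (F (j # l)))"
    unfolding Y_def treeM_def using fin_t
    by (intro prod.cong refl emeasure_PiM_emb) (auto simp: offspring.prob_space_axioms)
  also have "\<dots> = (\<Prod>(j, l)\<in>Sigma Jh Jt. emeasure offspring (F (j # l)))"
    using fin_h fin_t by (intro prod.Sigma) auto
  also have "\<dots> = (\<Prod>l\<in>J - {[]}. emeasure offspring (F l))"
    by (rule prod.reindex_bij_witness[of _ "\<lambda>l. (hd l, tl l)" "\<lambda>(j, l). j # l"])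
      (auto simp: Jh_def Jt_def neq_Nil_conv)
  also have "emeasure offspring ?r * \<dots> = (\<Prod>l\<in>J. emeasure offspring (F l))"
    using J offspring.emeasure_space_1 by (auto simp: prod.remove)
  finally show "emeasure (distr (offspring \<Otimes>\<^sub>M forestM) (PiM UNIV (\<lambda>_. offspring)) (\<lambda>(N, \<omega>s). graft N \<omega>s))
      (prod_emb UNIV (\<lambda>_. offspring) J (Pi\<^sub>E J F)) = (\<Prod>j\<in>J. emeasure offspring (F j))"
    unfolding X_def treeM_def .
qed (simp add: treeM_def)

section \<open>Integration by conditioning on the root\<close>

definition pois :: "nat \<Rightarrow> ennreal" where
  "pois N = ennreal (c ^ N / fact N * exp (- c))"

lemma nn_integral_offspring: "(\<integral>\<^sup>+N. f N \<partial>offspring) = (\<Sum>N. pois N * f N)"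
  unfolding offspring_def pois_def using c_pos
  by (simp add: nn_integral_measure_pmf nn_integral_count_space_nat)

text \<open>Fubini applied to \<open>distr_graft\<close>. Probabilities and means on the tree are
  computed by this expansion over the number of cofaces of the root.\<close>

lemma nn_integral_treeM:
  assumes [measurable]: "f \<in> borel_measurable treeM"
  shows "(\<integral>\<^sup>+\<omega>. f \<omega> \<partial>treeM) = (\<Sum>N. pois N * (\<integral>\<^sup>+\<omega>s. f (graft N \<omega>s) \<partial>forestM))"
proof -
  have "(\<integral>\<^sup>+\<omega>. f \<omega> \<partial>treeM) = (\<integral>\<^sup>+\<omega>. f \<omega> \<partial>distr (offspring \<Otimes>\<^sub>M forestM) treeM (\<lambda>(N, \<omega>s). graft N \<omega>s))"
    by (simp add: distr_graft)
  also have "\<dots> = (\<integral>\<^sup>+x. f (graft (fst x) (snd x)) \<partial>(offspring \<Otimes>\<^sub>M forestM))"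
    by (subst nn_integral_distr) (auto simp: split_beta')
  also have "\<dots> = (\<integral>\<^sup>+N. \<integral>\<^sup>+\<omega>s. f (graft N \<omega>s) \<partial>forestM \<partial>offspring)"
  proof -
    have [measurable]: "(\<lambda>x. graft (fst x) (snd x)) \<in> offspring \<Otimes>\<^sub>M forestM \<rightarrow>\<^sub>M treeM"
      using measurable_graft by (simp add: split_beta')
    show ?thesis by (subst forestM.nn_integral_fst[symmetric]) auto
  qed
  finally show ?thesis by (simp add: nn_integral_offspring)
qed

lemma emeasure_forestM_cylinder:
  assumes "finite J" "\<And>j. j \<in> J \<Longrightarrow> A j \<in> sets treeM"
  shows "emeasure forestM {\<omega>s. \<forall>j\<in>J. \<omega>s j \<in> A j} = (\<Prod>j\<in>J. emeasure treeM (A j))"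
proof -
  have "{\<omega>s. \<forall>j\<in>J. \<omega>s j \<in> A j} = prod_emb UNIV (\<lambda>_. treeM) J (Pi\<^sub>E J A)"
    by (auto simp: prod_emb_def PiE_iff space_PiM)
  then show ?thesis
    unfolding forestM_def using assms by (simp add: emeasure_PiM_emb treeM.prob_space_axioms)
qed

lemma nn_integral_forestM_split:
  assumes [measurable]: "f \<in> borel_measurable forestM"
  shows "(\<integral>\<^sup>+\<omega>s. f \<omega>s \<partial>forestM) = (\<integral>\<^sup>+\<omega>. \<integral>\<^sup>+\<omega>s. f (case_nat \<omega> \<omega>s) \<partial>forestM \<partial>treeM)"
proof -
  have [measurable]: "(\<lambda>x. case_nat (fst x) (snd x)) \<in> treeM \<Otimes>\<^sub>M forestM \<rightarrow>\<^sub>M forestM"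
    unfolding forestM_def by measurable
  have "(\<integral>\<^sup>+\<omega>s. f \<omega>s \<partial>forestM) =
      (\<integral>\<^sup>+\<omega>s. f \<omega>s \<partial>distr (treeM \<Otimes>\<^sub>M forestM) forestM (\<lambda>(s, \<omega>). case_nat s \<omega>))"
    using forest_seq.PiM_iter unfolding forestM_def by simp
  also have "\<dots> = (\<integral>\<^sup>+x. f (case_nat (fst x) (snd x)) \<partial>(treeM \<Otimes>\<^sub>M forestM))"
    by (subst nn_integral_distr) (auto simp: split_beta')
  also have "\<dots> = (\<integral>\<^sup>+\<omega>. \<integral>\<^sup>+\<omega>s. f (case_nat \<omega> \<omega>s) \<partial>forestM \<partial>treeM)"
    by (subst forestM.nn_integral_fst[symmetric]) auto
  finally show ?thesis .
qed

text \<open>Exchangeability of independent copies; it allows any chosen subtree to be moved to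
  position \<open>0\<close>, where \<open>nn_integral_forestM_split\<close> can separate it from the
  others.\<close>

lemma nn_integral_forestM_reindex:
  assumes [measurable]: "f \<in> borel_measurable forestM" and "inj \<pi>"
  shows "(\<integral>\<^sup>+\<omega>s. f (\<lambda>j. \<omega>s (\<pi> j)) \<partial>forestM) = (\<integral>\<^sup>+\<omega>s. f \<omega>s \<partial>forestM)"
proof -
  have [measurable]: "(\<lambda>\<omega>s j. \<omega>s (\<pi> j)) \<in> forestM \<rightarrow>\<^sub>M forestM"
    unfolding forestM_def by (rule measurable_PiM_single') (auto simp: space_PiM)
  have "distr forestM forestM (\<lambda>\<omega>s j. \<omega>s (\<pi> j)) = forestM"
    using distr_PiM_reindex[of UNIV "\<lambda>_. treeM" \<pi> UNIV] assms(2) treeM.prob_space_axioms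
    unfolding forestM_def by (simp add: restrict_def)
  then have "(\<integral>\<^sup>+\<omega>s. f \<omega>s \<partial>forestM) = (\<integral>\<^sup>+\<omega>s. f \<omega>s \<partial>distr forestM forestM (\<lambda>\<omega>s j. \<omega>s (\<pi> j)))"
    by simp
  then show ?thesis by (subst (asm) nn_integral_distr) auto
qed

end

text \<open>At \<open>Y = \<top>\<close> the left side is \<open>0\<close>, because
  \<open>\<top> * 0 = 0\<close> in \<open>ennreal\<close>.\<close>

lemma inverse_add_mult_inverse_ennreal:
  fixes Y :: ennreal
  assumes "Y \<noteq> \<top>"
  shows "inverse (1 + Y) + Y * inverse (1 + Y) = 1"
proof -
  obtain y where y: "Y = ennreal y" "y \<ge> 0" using assms by (cases Y) auto
  have "inverse (1 + Y) = ennreal (inverse (1 + y))"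
    unfolding y using y(2) by (subst inverse_ennreal[symmetric]) auto
  then show ?thesis
    unfolding y using y(2) by (simp add: ennreal_mult[symmetric] ennreal_plus[symmetric] field_simps del: ennreal_plus)
qed

context poisson_tree
begin

lemma sets_component: "A \<in> sets treeM \<Longrightarrow> {\<omega>s. \<omega>s i \<in> A} \<in> sets forestM"
  using measurable_sets[OF measurable_forest_component] by (simp add: vimage_def)

lemma sets_shift: "A \<in> sets treeM \<Longrightarrow> {\<omega>. shift i \<omega> \<in> A} \<in> sets treeM"
  using measurable_sets[OF measurable_shift] by (simp add: vimage_def)

lemma suminf_pois: "(\<Sum>N. pois N) = 1"
  using nn_integral_offspring[of "\<lambda>_. 1"] offspring.emeasure_space_1 by simp

lemma suminf_pois_power:
  assumes "0 \<le> q" "q \<le> 1"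
  shows "(\<Sum>N. pois N * ennreal q ^ N) = ennreal (exp (- c * (1 - q)))"
proof -
  have s: "(\<lambda>N. exp (- c) * ((c * q) ^ N /\<^sub>R fact N)) sums (exp (- c) * exp (c * q))"
    by (intro sums_mult exp_converges)
  have "pois N * ennreal q ^ N = ennreal (exp (- c) * ((c * q) ^ N /\<^sub>R fact N))" for N
    unfolding pois_def using assms c_pos
    by (simp add: ennreal_power ennreal_mult[symmetric] power_mult_distrib field_simps)
  then have "(\<Sum>N. pois N * ennreal q ^ N) = (\<Sum>N. ennreal (exp (- c) * ((c * q) ^ N /\<^sub>R fact N)))"
    by (simp only:)
  also have "\<dots> = ennreal (exp (- c) * exp (c * q))"
    by (rule suminf_ennreal_eq[OF _ s]) (use assms c_pos in simp)
  finally have "(\<Sum>N. pois N * ennreal q ^ N) = ennreal (exp (- c) * exp (c * q))" .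
  then show ?thesis by (simp add: exp_add[symmetric] algebra_simps)
qed

lemma measurable_random_sum [measurable]:
  assumes [measurable]: "\<And>j::nat. g j \<in> borel_measurable treeM"
  shows "(\<lambda>\<omega>. \<Sum>j<\<omega> []. g j \<omega> :: ennreal) \<in> borel_measurable treeM"
  by (rule measurable_compose_countable[where f = "\<lambda>N \<omega>. \<Sum>j<N. g j \<omega>" and g = "\<lambda>\<omega>. \<omega> []"]) auto

text \<open>The coding provides a subtree for every label, whatever the value at the root. A coface
  always has \<open>d\<close> further facets, so it uses the subtrees \<open>0, ..., d - 1\<close>
  of its address regardless of the number stored there.\<close>

lemma nn_integral_children:
  assumes [measurable]: "f \<in> borel_measurable forestM"
  shows "(\<integral>\<^sup>+\<omega>. f (\<lambda>i. shift i \<omega>) \<partial>treeM) = (\<integral>\<^sup>+\<omega>s. f \<omega>s \<partial>forestM)"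
proof -
  have [measurable]: "(\<lambda>\<omega> i. shift i \<omega>) \<in> treeM \<rightarrow>\<^sub>M forestM"
    unfolding forestM_def by (rule measurable_PiM_single') (auto simp: space_PiM)
  show ?thesis
    by (subst nn_integral_treeM) (auto simp: ennreal_suminf_multc suminf_pois)
qed

lemma sets_children:
  assumes [measurable]: "\<And>i. i < m \<Longrightarrow> B i \<in> sets treeM"
  shows "{\<omega>. \<forall>i<m. shift i \<omega> \<in> B i} \<in> sets treeM"
proof -
  have "{\<omega>. \<forall>i<m. shift i \<omega> \<in> B i} = {\<omega>\<in>space treeM. \<forall>i\<in>{..<m}. shift i \<omega> \<in> B i}" by auto
  also have "\<dots> \<in> sets treeM"
    by (intro sets.sets_Collect_finite_All) (auto intro!: sets_shift simp: assms)
  finally show ?thesis .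
qed

lemma emeasure_children:
  assumes [measurable]: "\<And>i. i < m \<Longrightarrow> B i \<in> sets treeM"
  shows "emeasure treeM {\<omega>. \<forall>i<m. shift i \<omega> \<in> B i} = (\<Prod>i<m. emeasure treeM (B i))"
proof -
  have [measurable]: "{\<omega>s. \<forall>i\<in>{..<m}. \<omega>s i \<in> B i} \<in> sets forestM"
  proof -
    have "{\<omega>s. \<forall>i\<in>{..<m}. \<omega>s i \<in> B i} = {\<omega>s\<in>space forestM. \<forall>i\<in>{..<m}. \<omega>s i \<in> B i}" by simp
    also have "\<dots> \<in> sets forestM"
      by (intro sets.sets_Collect_finite_All) (auto intro!: sets_component simp: assms)
    finally show ?thesis .
  qed
  have [measurable]: "{\<omega>. \<forall>i<m. shift i \<omega> \<in> B i} \<in> sets treeM"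
    using assms by (rule sets_children)
  have "emeasure treeM {\<omega>. \<forall>i<m. shift i \<omega> \<in> B i} = (\<integral>\<^sup>+\<omega>. indicator {\<omega>. \<forall>i<m. shift i \<omega> \<in> B i} \<omega> \<partial>treeM)"
    by simp
  also have "\<dots> = (\<integral>\<^sup>+\<omega>. indicator {\<omega>s. \<forall>i\<in>{..<m}. \<omega>s i \<in> B i} (\<lambda>i. shift i \<omega>) \<partial>treeM)"
    by (intro nn_integral_cong) (auto split: split_indicator)
  also have "\<dots> = emeasure forestM {\<omega>s. \<forall>i\<in>{..<m}. \<omega>s i \<in> B i}"
    by (subst nn_integral_children) auto
  also have "\<dots> = (\<Prod>i<m. emeasure treeM (B i))"
    by (subst emeasure_forestM_cylinder) (auto simp: assms)
  finally show ?thesis .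
qed

lemma sets_all_children:
  assumes [measurable]: "\<And>j. C j \<in> sets treeM"
  shows "{\<omega>. \<forall>j<\<omega> []. shift j \<omega> \<in> C j} \<in> sets treeM"
proof -
  have "{\<omega>. \<forall>j<\<omega> []. shift j \<omega> \<in> C j} = {\<omega>\<in>space treeM. \<forall>j. j < \<omega> [] \<longrightarrow> shift j \<omega> \<in> C j}" by auto
  also have "\<dots> \<in> sets treeM"
    by measurable
  finally show ?thesis .
qed

text \<open>Poisson thinning: the children outside \<open>C\<close> are Poisson in number with mean
  \<open>c * (1 - measure treeM C)\<close>, and the event is that there are none.\<close>

lemma emeasure_all_children:
  assumes C: "C \<in> sets treeM"
  shows "emeasure treeM {\<omega>. \<forall>j<\<omega> []. shift j \<omega> \<in> C} = ennreal (exp (- c * (1 - measure treeM C)))"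
proof -
  have [measurable]: "{\<omega>. \<forall>j<\<omega> []. shift j \<omega> \<in> C} \<in> sets treeM"
    using C by (intro sets_all_children)
  have N: "(\<integral>\<^sup>+\<omega>s. indicator {\<omega>. \<forall>j<\<omega> []. shift j \<omega> \<in> C} (graft N \<omega>s) \<partial>forestM) = emeasure treeM C ^ N" for N
  proof -
    have "(\<integral>\<^sup>+\<omega>s. indicator {\<omega>. \<forall>j<\<omega> []. shift j \<omega> \<in> C} (graft N \<omega>s) \<partial>forestM)
        = (\<integral>\<^sup>+\<omega>s. indicator {\<omega>s. \<forall>j\<in>{..<N}. \<omega>s j \<in> C} \<omega>s \<partial>forestM)"
      by (intro nn_integral_cong) (auto split: split_indicator)
    also have "\<dots> = emeasure forestM {\<omega>s. \<forall>j\<in>{..<N}. \<omega>s j \<in> C}"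
    proof (rule nn_integral_indicator)
      have "{\<omega>s. \<forall>i\<in>{..<N}. \<omega>s i \<in> C} = {\<omega>s\<in>space forestM. \<forall>i\<in>{..<N}. \<omega>s i \<in> C}" by simp
      also have "\<dots> \<in> sets forestM"
        by (intro sets.sets_Collect_finite_All) (auto intro!: sets_component simp: C)
      finally show "{\<omega>s. \<forall>j\<in>{..<N}. \<omega>s j \<in> C} \<in> sets forestM" .
    qed
    also have "\<dots> = emeasure treeM C ^ N"
      by (subst emeasure_forestM_cylinder) (auto simp: C)
    finally show ?thesis .
  qed
  have "emeasure treeM {\<omega>. \<forall>j<\<omega> []. shift j \<omega> \<in> C}
      = (\<integral>\<^sup>+\<omega>. indicator {\<omega>. \<forall>j<\<omega> []. shift j \<omega> \<in> C} \<omega> \<partial>treeM)" by simp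
  also have "\<dots> = (\<Sum>N. pois N * (\<integral>\<^sup>+\<omega>s. indicator {\<omega>. \<forall>j<\<omega> []. shift j \<omega> \<in> C} (graft N \<omega>s) \<partial>forestM))"
    by (rule nn_integral_treeM) simp
  also have "\<dots> = (\<Sum>N. pois N * emeasure treeM C ^ N)" by (simp only: N)
  also have "(\<Sum>N. pois N * emeasure treeM C ^ N) = (\<Sum>N. pois N * ennreal (measure treeM C) ^ N)"
    by (simp add: treeM.emeasure_eq_measure)
  also have "\<dots> = ennreal (exp (- c * (1 - measure treeM C)))"
    by (rule suminf_pois_power) auto
  finally show ?thesis .
qed

text \<open>The origin of the fixed point equation. A coface blocks when all its \<open>d\<close>
  independent further facets miss \<open>A\<close>, which has probability
  \<open>(1 - measure treeM A) ^ d\<close>; by thinning, no coface blocks with the stated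
  probability.\<close>

lemma emeasure_unblocked:
  assumes A: "A \<in> sets treeM"
  shows "emeasure treeM {\<omega>. \<forall>j<\<omega> []. \<exists>i<d. shift i (shift j \<omega>) \<in> A}
    = ennreal (exp (- c * (1 - measure treeM A) ^ d))"
proof -
  define B where "B = {\<omega>. \<forall>i<d. shift i \<omega> \<in> - A}"
  have mA: "- A \<in> sets treeM" using A sets.compl_sets[of A treeM] by (simp add: Compl_eq_Diff_UNIV)
  have B [measurable]: "B \<in> sets treeM" unfolding B_def by (intro sets_children mA)
  have mB: "- B \<in> sets treeM" using B sets.compl_sets[of B treeM] by (simp add: Compl_eq_Diff_UNIV)
  have pA: "measure treeM (- A) = 1 - measure treeM A"
    using treeM.prob_compl[OF A] by (simp add: Compl_eq_Diff_UNIV)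
  have "emeasure treeM B = ennreal ((1 - measure treeM A) ^ d)"
    unfolding B_def using mA
    by (subst emeasure_children) (auto simp: treeM.emeasure_eq_measure pA ennreal_power)
  then have "measure treeM B = (1 - measure treeM A) ^ d"
    unfolding treeM.emeasure_eq_measure by simp
  then have pB: "1 - measure treeM (- B) = (1 - measure treeM A) ^ d"
    using treeM.prob_compl[OF B] by (simp add: Compl_eq_Diff_UNIV)
  have "{\<omega>. \<forall>j<\<omega> []. \<exists>i<d. shift i (shift j \<omega>) \<in> A} = {\<omega>. \<forall>j<\<omega> []. shift j \<omega> \<in> - B}"
    by (auto simp: B_def)
  then show ?thesis using emeasure_all_children[OF mB] pB by simp
qed

text \<open>Rests on the identity \<open>N * pois N = c * pois (N - 1)\<close>.\<close>

lemma mecke: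
  fixes h :: "(nat list \<Rightarrow> nat) \<Rightarrow> ennreal \<Rightarrow> ennreal"
  assumes h [measurable]: "(\<lambda>(\<omega>, s). h \<omega> s) \<in> borel_measurable (treeM \<Otimes>\<^sub>M borel)"
    and B [measurable]: "B \<in> borel_measurable treeM"
  shows "(\<integral>\<^sup>+\<omega>. (\<Sum>j<\<omega> []. h (shift j \<omega>) (\<Sum>i\<in>{..<\<omega> []} - {j}. B (shift i \<omega>))) \<partial>treeM)
    = ennreal c * (\<integral>\<^sup>+\<omega>'. \<integral>\<^sup>+\<omega>. h \<omega>' (\<Sum>i<\<omega> []. B (shift i \<omega>)) \<partial>treeM \<partial>treeM)"
proof -
  have hm [measurable]: "(\<lambda>x. h (f x) (g x)) \<in> borel_measurable M"
    if "f \<in> M \<rightarrow>\<^sub>M treeM" "g \<in> borel_measurable M" for f g and M :: "'z measure"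
    using measurable_compose[OF measurable_Pair[OF that] h] by simp
  define I where "I M = (\<integral>\<^sup>+\<omega>'. \<integral>\<^sup>+\<omega>s. h \<omega>' (\<Sum>i<M. B (\<omega>s i)) \<partial>forestM \<partial>treeM)" for M :: nat
  \<comment> \<open>Transposing \<open>0\<close> and \<open>j\<close> brings the distinguished
    subtree to the front, where it is independent of the other \<open>M\<close>; hence all
    \<open>Suc M\<close> summands have the same integral.\<close>
  have one: "(\<integral>\<^sup>+\<omega>s. h (\<omega>s j) (\<Sum>i\<in>{..<Suc M} - {j}. B (\<omega>s i)) \<partial>forestM) = I M" if j: "j < Suc M" for j M
  proof -
    let ?\<pi> = "Transposition.transpose 0 j"
    have "(\<integral>\<^sup>+\<omega>s. h (\<omega>s j) (\<Sum>i\<in>{..<Suc M} - {j}. B (\<omega>s i)) \<partial>forestM)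
        = (\<integral>\<^sup>+\<omega>s. h (\<omega>s (?\<pi> j)) (\<Sum>i\<in>{..<Suc M} - {j}. B (\<omega>s (?\<pi> i))) \<partial>forestM)"
      by (rule nn_integral_forestM_reindex[symmetric, where \<pi> = ?\<pi> and f = "\<lambda>\<omega>s. h (\<omega>s j) (\<Sum>i\<in>{..<Suc M} - {j}. B (\<omega>s i))"])
        auto
    also have "\<dots> = (\<integral>\<^sup>+\<omega>s. h (\<omega>s 0) (\<Sum>i<M. B (\<omega>s (Suc i))) \<partial>forestM)"
    proof (intro nn_integral_cong arg_cong2[where f = h])
      fix \<omega>s :: "nat \<Rightarrow> nat list \<Rightarrow> nat"
      have "(\<Sum>i\<in>{..<Suc M} - {j}. B (\<omega>s (?\<pi> i))) = (\<Sum>i\<in>{..<Suc M} - {0}. B (\<omega>s i))"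
        by (rule sum.reindex_bij_witness[of _ ?\<pi> ?\<pi>]) (use j in \<open>auto simp: Transposition.transpose_def\<close>)
      also have "\<dots> = (\<Sum>i<M. B (\<omega>s (Suc i)))"
        by (rule sum.reindex_bij_witness[of _ Suc "\<lambda>i. i - 1"]) auto
      finally show "(\<Sum>i\<in>{..<Suc M} - {j}. B (\<omega>s (?\<pi> i))) = (\<Sum>i<M. B (\<omega>s (Suc i)))" .
    qed auto
    also have "\<dots> = I M"
      unfolding I_def by (subst nn_integral_forestM_split) auto
    finally show ?thesis .
  qed
  have meas: "(\<lambda>\<omega>. (\<Sum>j<\<omega> []. h (shift j \<omega>) (\<Sum>i\<in>{..<\<omega> []} - {j}. B (shift i \<omega>)))) \<in> borel_measurable treeM"
    by (rule measurable_compose_countable[where f = "\<lambda>N \<omega>. \<Sum>j<N. h (shift j \<omega>) (\<Sum>i\<in>{..<N} - {j}. B (shift i \<omega>))" and g = "\<lambda>\<omega>. \<omega> []"]) auto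
  have "(\<integral>\<^sup>+\<omega>. (\<Sum>j<\<omega> []. h (shift j \<omega>) (\<Sum>i\<in>{..<\<omega> []} - {j}. B (shift i \<omega>))) \<partial>treeM)
     = (\<Sum>N. pois N * (\<integral>\<^sup>+\<omega>s. (\<Sum>j<N. h (\<omega>s j) (\<Sum>i\<in>{..<N} - {j}. B (\<omega>s i))) \<partial>forestM))"
    by (subst nn_integral_treeM[OF meas]) simp
  also have "\<dots> = (\<Sum>N. pois (Suc N) * (\<integral>\<^sup>+\<omega>s. (\<Sum>j<Suc N. h (\<omega>s j) (\<Sum>i\<in>{..<Suc N} - {j}. B (\<omega>s i))) \<partial>forestM))"
    (is "suminf ?f = suminf (\<lambda>N. ?f (Suc N))")
  proof -
    have "?f sums (suminf (\<lambda>N. ?f (Suc N)) + ?f 0)"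
      by (intro sums_Suc summable_sums) auto
    then show ?thesis by (simp add: sums_unique[symmetric])
  qed
  also have "\<dots> = (\<Sum>N. ennreal c * (pois N * I N))"
  proof (intro suminf_cong)
    fix N
    have "(\<integral>\<^sup>+\<omega>s. (\<Sum>j<Suc N. h (\<omega>s j) (\<Sum>i\<in>{..<Suc N} - {j}. B (\<omega>s i))) \<partial>forestM)
      = (\<Sum>j<Suc N. \<integral>\<^sup>+\<omega>s. h (\<omega>s j) (\<Sum>i\<in>{..<Suc N} - {j}. B (\<omega>s i)) \<partial>forestM)"
      by (rule nn_integral_sum) measurable
    also have "\<dots> = of_nat (Suc N) * I N" using one by simp
    finally have e: "(\<integral>\<^sup>+\<omega>s. (\<Sum>j<Suc N. h (\<omega>s j) (\<Sum>i\<in>{..<Suc N} - {j}. B (\<omega>s i))) \<partial>forestM) = of_nat (Suc N) * I N" .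
    have "pois (Suc N) * of_nat (Suc N) = ennreal c * pois N"
      unfolding pois_def using c_pos
      by (simp add: ennreal_of_nat_eq_real_of_nat ennreal_mult[symmetric] del: of_nat_Suc)
    then show "pois (Suc N) * (\<integral>\<^sup>+\<omega>s. (\<Sum>j<Suc N. h (\<omega>s j) (\<Sum>i\<in>{..<Suc N} - {j}. B (\<omega>s i))) \<partial>forestM) = ennreal c * (pois N * I N)"
      unfolding e by (simp only: mult.assoc[symmetric])
  qed
  also have "\<dots> = ennreal c * (\<Sum>N. pois N * I N)" by simp
  also have "(\<Sum>N. pois N * I N) = (\<integral>\<^sup>+\<omega>'. \<integral>\<^sup>+\<omega>. h \<omega>' (\<Sum>i<\<omega> []. B (shift i \<omega>)) \<partial>treeM \<partial>treeM)"
  proof -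
    have "(\<integral>\<^sup>+\<omega>'. \<integral>\<^sup>+\<omega>. h \<omega>' (\<Sum>i<\<omega> []. B (shift i \<omega>)) \<partial>treeM \<partial>treeM)
        = (\<integral>\<^sup>+\<omega>'. (\<Sum>N. pois N * (\<integral>\<^sup>+\<omega>s. h \<omega>' (\<Sum>i<N. B (\<omega>s i)) \<partial>forestM)) \<partial>treeM)"
      by (intro nn_integral_cong, subst nn_integral_treeM) auto
    also have "\<dots> = (\<Sum>N. pois N * I N)"
      unfolding I_def by (subst nn_integral_suminf) (auto simp: nn_integral_cmult)
    finally show ?thesis by simp
  qed
  finally show ?thesis .
qed

end

context poisson_tree
begin

text \<open>In \<open>ennreal\<close> we have \<open>inverse 0 = \<top>\<close> and \<open>inverse \<top> = 0\<close>: one coface whose further facets all have value \<open>0\<close>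
  forces the value of the face to be \<open>0\<close>.\<close>

section \<open>The limiting recursion and its mean\<close>

primrec XR :: "nat \<Rightarrow> (nat list \<Rightarrow> nat) \<Rightarrow> ennreal" where
  "XR 0 \<omega> = 1"
| "XR (Suc R) \<omega> = inverse (1 + (\<Sum>j<\<omega> []. inverse (\<Sum>i<d. XR R (shift i (shift j \<omega>)))))"

definition X :: "(nat list \<Rightarrow> nat) \<Rightarrow> ennreal" where
  "X \<omega> = (INF R. XR R \<omega>)"

definition S :: "(nat list \<Rightarrow> nat) \<Rightarrow> ennreal" where
  "S \<omega> = (\<Sum>i<d. X (shift i \<omega>))"

lemma measurable_XR [measurable]: "XR R \<in> borel_measurable treeM"
proof (induction R)
  case 0
  have "XR 0 = (\<lambda>\<omega>. 1)" by auto
  then show ?case by simp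
next
  case (Suc R)
  note [measurable] = Suc
  have "XR (Suc R) = (\<lambda>\<omega>. inverse (1 + (\<Sum>j<\<omega> []. inverse (\<Sum>i<d. XR R (shift i (shift j \<omega>))))))" by auto
  then show ?case by simp
qed

lemma measurable_X [measurable]: "X \<in> borel_measurable treeM"
  unfolding X_def by measurable

lemma measurable_S [measurable]: "S \<in> borel_measurable treeM"
  unfolding S_def by measurable

lemma ennreal_inverse_antimono: "(x::ennreal) \<le> y \<Longrightarrow> inverse y \<le> inverse x"
proof (cases "x = 0 \<or> y = \<top>")
  case False
  assume "x \<le> y"
  obtain a where a: "x = ennreal a" "a > 0"
    using False \<open>x \<le> y\<close> by (cases x) (auto simp: top_unique less_le)
  obtain b where b: "y = ennreal b" "b > 0"
    using False \<open>x \<le> y\<close> a by (cases y) auto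
  show ?thesis using \<open>x \<le> y\<close> a b by (simp add: inverse_ennreal)
qed auto

lemma ennreal_inverse_inverse: "inverse (inverse x) = (x::ennreal)"
proof (cases "x = 0 \<or> x = \<top>")
  case False
  then obtain a where a: "x = ennreal a" "a > 0"
    by (cases x) (auto simp: less_le)
  then show ?thesis by (simp add: inverse_ennreal)
qed auto

lemma XR_le_1: "XR R \<omega> \<le> 1"
proof (cases R)
  case (Suc n)
  have "(1::ennreal) \<le> 1 + x" for x by simp
  then have "inverse (1 + x) \<le> (1::ennreal)" for x
    using ennreal_inverse_antimono[of 1 "1 + x"] by simp
  then show ?thesis using Suc by simp
qed simp

lemma XR_Suc_le: "XR (Suc R) \<omega> \<le> XR R \<omega>"
proof (induction R arbitrary: \<omega>)
  case 0
  then show ?case using XR_le_1[of "Suc 0" \<omega>] by simp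
next
  case (Suc R)
  show ?case
    by (subst XR.simps, subst (2) XR.simps)
      (intro ennreal_inverse_antimono add_left_mono sum_mono Suc.IH)
qed

lemma decseq_XR: "decseq (\<lambda>R. XR R \<omega>)"
  using XR_Suc_le by (rule decseq_SucI)

lemma XR_tendsto: "(\<lambda>R. XR R \<omega>) \<longlonglongrightarrow> X \<omega>"
  unfolding X_def by (rule LIMSEQ_INF[OF decseq_XR])

lemma tendsto_inverse_ennreal':
  "(f \<longlongrightarrow> (l::ennreal)) F \<Longrightarrow> ((\<lambda>x. inverse (f x)) \<longlongrightarrow> inverse l) F"
  using continuous_on_inverse_ennreal[OF continuous_on_id, of UNIV]
  by (auto simp: continuous_on_eq_continuous_within continuous_at intro: tendsto_compose)

text \<open>Inversion is continuous on all of \<open>ennreal\<close>, including \<open>0\<close> and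
  \<open>\<top>\<close>, so the limit passes through the recursion with no case distinction.\<close>

lemma X_fixpoint: "X \<omega> = inverse (1 + (\<Sum>j<\<omega> []. inverse (S (shift j \<omega>))))"
proof -
  have "(\<lambda>R. XR (Suc R) \<omega>) \<longlonglongrightarrow> inverse (1 + (\<Sum>j<\<omega> []. inverse (S (shift j \<omega>))))"
    unfolding XR.simps S_def
    by (intro tendsto_inverse_ennreal' tendsto_add tendsto_sum tendsto_const XR_tendsto)
  moreover have "(\<lambda>R. XR (Suc R) \<omega>) \<longlonglongrightarrow> X \<omega>"
    using XR_tendsto by (rule LIMSEQ_Suc)
  ultimately show ?thesis by (metis LIMSEQ_unique)
qed

lemma X_le_1: "X \<omega> \<le> 1"
  unfolding X_def using XR_le_1 by (meson INF_lower2 UNIV_I)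

lemma S_less_top: "S \<omega> < \<top>"
proof -
  have "S \<omega> \<le> (\<Sum>i<d. 1)" unfolding S_def by (intro sum_mono X_le_1)
  also have "\<dots> < \<top>" by (simp add: ennreal_of_nat_eq_real_of_nat)
  finally show ?thesis .
qed

text \<open>Monotone convergence for a decreasing sequence; the required finite member is the
  constant \<open>XR 0 = 1\<close> on a probability space.\<close>

lemma nn_integral_X: "(\<integral>\<^sup>+\<omega>. X \<omega> \<partial>treeM) = (INF R. \<integral>\<^sup>+\<omega>. XR R \<omega> \<partial>treeM)"
proof -
  have "(\<integral>\<^sup>+\<omega>. XR 0 \<omega> \<partial>treeM) < \<top>" by (simp add: treeM.emeasure_space_1[simplified])
  then show ?thesis unfolding X_def
    by (subst nn_integral_monotone_convergence_INF_decseq[where i = 0])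
      (auto intro!: decseq_SucI le_funI XR_Suc_le simp del: XR.simps)
qed

definition surv :: real where
  "surv = measure treeM {\<omega>. X \<omega> > 0}"

lemma sets_X_pos [measurable]: "{\<omega>. X \<omega> > 0} \<in> sets treeM"
proof -
  have "{\<omega>\<in>space treeM. X \<omega> > 0} \<in> sets treeM" by measurable
  then show ?thesis by simp
qed

text \<open>The sum in the fixed point equation is finite unless some summand is
  \<open>inverse 0\<close>, that is, unless some coface has \<open>S = 0\<close>.\<close>

lemma X_pos_iff: "X \<omega> > 0 \<longleftrightarrow> (\<forall>j<\<omega> []. \<exists>i<d. X (shift i (shift j \<omega>)) > 0)"
proof -
  have "X \<omega> > 0 \<longleftrightarrow> (\<forall>j<\<omega> []. S (shift j \<omega>) \<noteq> 0)"
    by (subst X_fixpoint) (auto simp: ennreal_inverse_positive zero_less_iff_neq_zero)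
  then show ?thesis unfolding S_def by (auto simp: zero_less_iff_neq_zero)
qed

lemma surv_eq: "surv = exp (- c * (1 - surv) ^ d)"
proof -
  have "{\<omega>. X \<omega> > 0} = {\<omega>. \<forall>j<\<omega> []. \<exists>i<d. shift i (shift j \<omega>) \<in> {\<omega>. X \<omega> > 0}}"
    unfolding mem_Collect_eq by (intro Collect_cong X_pos_iff)
  then have "emeasure treeM {\<omega>. X \<omega> > 0}
      = emeasure treeM {\<omega>. \<forall>j<\<omega> []. \<exists>i<d. shift i (shift j \<omega>) \<in> {\<omega>. X \<omega> > 0}}"
    by (rule arg_cong)
  also have "\<dots> = ennreal (exp (- c * (1 - surv) ^ d))"
    unfolding surv_def by (rule emeasure_unblocked[OF sets_X_pos])
  finally have "emeasure treeM {\<omega>. X \<omega> > 0} = ennreal (exp (- c * (1 - surv) ^ d))" .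
  then have *: "ennreal surv = ennreal (exp (- c * (1 - surv) ^ d))"
    unfolding surv_def treeM.emeasure_eq_measure .
  have "0 \<le> surv" by (simp add: surv_def)
  then show ?thesis by (rule ennreal_inj[THEN iffD1, OF _ _ *]) simp
qed

text \<open>With \<open>Y\<close> the sum of the reciprocals this is
  \<open>1 = inverse (1 + Y) + Y * inverse (1 + Y)\<close>, both sides being \<open>0\<close> when
  \<open>Y = \<top>\<close>. Each summand is written as a function of one child and of the sum over
  the other children, which is the form that \<open>mecke\<close> requires.\<close>

lemma indicator_X_pos:
  "indicator {\<omega>. X \<omega> > 0} \<omega> = X \<omega> + (\<Sum>j<\<omega> []. inverse (S (shift j \<omega>)) *
     inverse (1 + (\<Sum>i\<in>{..<\<omega> []} - {j}. inverse (S (shift i \<omega>))) + inverse (S (shift j \<omega>))))"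
proof -
  define Y where "Y = (\<Sum>j<\<omega> []. inverse (S (shift j \<omega>)))"
  have X: "X \<omega> = inverse (1 + Y)" unfolding Y_def by (rule X_fixpoint)
  have e: "1 + (\<Sum>i\<in>{..<\<omega> []} - {j}. inverse (S (shift i \<omega>))) + inverse (S (shift j \<omega>)) = 1 + Y"
    if "j < \<omega> []" for j
    unfolding Y_def using that by (subst sum.remove[of _ j]) (auto simp: ac_simps)
  have "(\<Sum>j<\<omega> []. inverse (S (shift j \<omega>)) *
     inverse (1 + (\<Sum>i\<in>{..<\<omega> []} - {j}. inverse (S (shift i \<omega>))) + inverse (S (shift j \<omega>))))
     = (\<Sum>j<\<omega> []. inverse (S (shift j \<omega>)) * inverse (1 + Y))"
    by (intro sum.cong refl arg_cong2[where f = "(*)"] arg_cong[where f = inverse] e) simp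
  also have "\<dots> = Y * inverse (1 + Y)"
    unfolding Y_def by (rule sum_distrib_right[symmetric])
  finally have "(\<Sum>j<\<omega> []. inverse (S (shift j \<omega>)) *
     inverse (1 + (\<Sum>i\<in>{..<\<omega> []} - {j}. inverse (S (shift i \<omega>))) + inverse (S (shift j \<omega>))))
     = Y * inverse (1 + Y)" .
  moreover have "indicator {\<omega>. X \<omega> > 0} \<omega> = inverse (1 + Y) + Y * inverse (1 + Y)"
  proof (cases "Y = \<top>")
    case True
    then show ?thesis by (simp add: X)
  next
    case False
    then show ?thesis by (simp add: X inverse_add_mult_inverse_ennreal ennreal_inverse_positive)
  qed
  ultimately show ?thesis by (simp add: X)
qed

text \<open>Where \<open>X \<omega> > 0\<close>, the fixed point equation reads \<open>1 = X \<omega> + (\<Sum>j. X \<omega> / S j)\<close>; the Mecke formula evaluates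
  the mean of the sum.\<close>

lemma surv_split:
  "ennreal surv = (\<integral>\<^sup>+\<omega>. X \<omega> \<partial>treeM) + ennreal c *
     (\<integral>\<^sup>+\<omega>'. \<integral>\<^sup>+\<omega>. inverse (S \<omega>') * inverse (inverse (X \<omega>) + inverse (S \<omega>')) \<partial>treeM \<partial>treeM)"
proof -
  define h where "h \<omega>' s = inverse (S \<omega>') * inverse (1 + s + inverse (S \<omega>'))" for \<omega>' s
  have h [measurable]: "(\<lambda>(\<omega>, s). h \<omega> s) \<in> borel_measurable (treeM \<Otimes>\<^sub>M borel)"
    unfolding h_def by measurable
  have meas [measurable]: "(\<lambda>\<omega>. (\<Sum>j<\<omega> []. h (shift j \<omega>) (\<Sum>i\<in>{..<\<omega> []} - {j}. inverse (S (shift i \<omega>))))) \<in> borel_measurable treeM"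
    unfolding h_def
    by (rule measurable_compose_countable[where f = "\<lambda>N \<omega>. \<Sum>j<N. inverse (S (shift j \<omega>)) * inverse (1 + (\<Sum>i\<in>{..<N} - {j}. inverse (S (shift i \<omega>))) + inverse (S (shift j \<omega>)))" and g = "\<lambda>\<omega>. \<omega> []"]) auto
  have inv: "1 + (\<Sum>i<\<omega> []. inverse (S (shift i \<omega>))) = inverse (X \<omega>)" for \<omega>
    by (subst X_fixpoint) (simp add: ennreal_inverse_inverse)
  have "ennreal surv = (\<integral>\<^sup>+\<omega>. indicator {\<omega>. X \<omega> > 0} \<omega> \<partial>treeM)"
    by (simp add: surv_def treeM.emeasure_eq_measure)
  also have "\<dots> = (\<integral>\<^sup>+\<omega>. X \<omega> + (\<Sum>j<\<omega> []. h (shift j \<omega>) (\<Sum>i\<in>{..<\<omega> []} - {j}. inverse (S (shift i \<omega>)))) \<partial>treeM)"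
    unfolding h_def by (intro nn_integral_cong indicator_X_pos)
  also have "\<dots> = (\<integral>\<^sup>+\<omega>. X \<omega> \<partial>treeM) + (\<integral>\<^sup>+\<omega>. (\<Sum>j<\<omega> []. h (shift j \<omega>) (\<Sum>i\<in>{..<\<omega> []} - {j}. inverse (S (shift i \<omega>)))) \<partial>treeM)"
    by (rule nn_integral_add) auto
  also have "(\<integral>\<^sup>+\<omega>. (\<Sum>j<\<omega> []. h (shift j \<omega>) (\<Sum>i\<in>{..<\<omega> []} - {j}. inverse (S (shift i \<omega>)))) \<partial>treeM)
     = ennreal c * (\<integral>\<^sup>+\<omega>'. \<integral>\<^sup>+\<omega>. h \<omega>' (\<Sum>i<\<omega> []. inverse (S (shift i \<omega>))) \<partial>treeM \<partial>treeM)"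
    by (rule mecke[OF h]) measurable
  finally show ?thesis unfolding h_def inv .
qed

text \<open>For positive \<open>x\<close> and \<open>s\<close> this is
  \<open>x / (x + s) = (1/s) / (1/x + 1/s)\<close>. If \<open>s = 0 < x\<close>, the left side is
  \<open>1\<close> while the product on the right is \<open>\<top> * 0 = 0\<close>; the indicators
  restore this case.\<close>

lemma harmonic_split:
  "X \<omega> * inverse (X \<omega> + S \<omega>') = inverse (S \<omega>') * inverse (inverse (X \<omega>) + inverse (S \<omega>'))
     + indicator {\<omega>. X \<omega> > 0} \<omega> * indicator {\<omega>. S \<omega> = 0} \<omega>'"
proof -
  have "X \<omega> < \<top>" using X_le_1[of \<omega>] by (simp add: order_le_less_trans)
  then obtain x where x: "X \<omega> = ennreal x" "x \<ge> 0" by (cases "X \<omega>") auto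
  obtain s where s: "S \<omega>' = ennreal s" "s \<ge> 0" using S_less_top[of \<omega>'] by (cases "S \<omega>'") auto
  consider "x = 0" | "x > 0" "s = 0" | "x > 0" "s > 0" using x s by fastforce
  then show ?thesis
  proof cases
    case 1
    then show ?thesis by (simp add: x s)
  next
    case 2
    then show ?thesis by (simp add: x s inverse_ennreal ennreal_mult[symmetric])
  next
    case 3
    have "X \<omega> * inverse (X \<omega> + S \<omega>') = ennreal (x * inverse (x + s))"
      using 3 by (simp add: x(1) s(1) inverse_ennreal ennreal_mult ennreal_plus[symmetric] del: ennreal_plus)
    moreover have "inverse (S \<omega>') * inverse (inverse (X \<omega>) + inverse (S \<omega>'))
        = ennreal (inverse s * inverse (inverse x + inverse s))"
      using 3 by (simp add: x(1) s(1) inverse_ennreal ennreal_mult ennreal_plus[symmetric] add_pos_pos del: ennreal_plus)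
    moreover have "x * inverse (x + s) = inverse s * inverse (inverse x + inverse s)"
      using 3 by (simp add: field_simps)
    ultimately show ?thesis using 3 by (simp add: s(1))
  qed
qed

lemma emeasure_S_zero: "emeasure treeM {\<omega>. S \<omega> = 0} = ennreal ((1 - surv) ^ d)"
proof -
  have m: "{\<omega>. X \<omega> = 0} \<in> sets treeM" and p: "measure treeM {\<omega>. X \<omega> = 0} = 1 - surv"
  proof -
    have "{\<omega>. X \<omega> = 0} = UNIV - {\<omega>. X \<omega> > 0}" by (auto simp: zero_less_iff_neq_zero)
    then show "{\<omega>. X \<omega> = 0} \<in> sets treeM" "measure treeM {\<omega>. X \<omega> = 0} = 1 - surv"
      using treeM.prob_compl[OF sets_X_pos] sets.compl_sets[OF sets_X_pos] by (auto simp: surv_def)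
  qed
  have "{\<omega>. S \<omega> = 0} = {\<omega>. \<forall>i<d. shift i \<omega> \<in> {\<omega>. X \<omega> = 0}}" by (auto simp: S_def)
  then show ?thesis
    using emeasure_children[of d "\<lambda>_. {\<omega>. X \<omega> = 0}"] m
    by (simp add: treeM.emeasure_eq_measure p ennreal_power surv_def)
qed

text \<open>\<open>X \<omega>\<close> and the summands of \<open>S \<omega>'\<close> are \<open>d + 1\<close> independent copies, so each has the same share in
  their total unless all of them vanish.\<close>

lemma exchangeable_ratio:
  "of_nat (Suc d) * (\<integral>\<^sup>+\<omega>'. \<integral>\<^sup>+\<omega>. X \<omega> * inverse (X \<omega> + S \<omega>') \<partial>treeM \<partial>treeM)
    = ennreal (1 - (1 - surv) ^ Suc d)"
proof -
  let ?T = "\<lambda>\<omega>s :: nat \<Rightarrow> nat list \<Rightarrow> nat. \<Sum>i<Suc d. X (\<omega>s i)"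
  have "(\<integral>\<^sup>+\<omega>'. \<integral>\<^sup>+\<omega>. X \<omega> * inverse (X \<omega> + S \<omega>') \<partial>treeM \<partial>treeM)
      = (\<integral>\<^sup>+\<omega>'. (\<integral>\<^sup>+\<omega>. X \<omega> * inverse (X \<omega> + (\<Sum>i<d. X (shift i \<omega>'))) \<partial>treeM) \<partial>treeM)"
    by (simp add: S_def)
  also have "\<dots> = (\<integral>\<^sup>+\<omega>s. (\<integral>\<^sup>+\<omega>. X \<omega> * inverse (X \<omega> + (\<Sum>i<d. X (\<omega>s i))) \<partial>treeM) \<partial>forestM)"
    by (rule nn_integral_children[where f = "\<lambda>\<omega>s. \<integral>\<^sup>+\<omega>. X \<omega> * inverse (X \<omega> + (\<Sum>i<d. X (\<omega>s i))) \<partial>treeM"])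
      measurable
  also have "\<dots> = (\<integral>\<^sup>+\<omega>. (\<integral>\<^sup>+\<omega>s. X \<omega> * inverse (X \<omega> + (\<Sum>i<d. X (\<omega>s i))) \<partial>forestM) \<partial>treeM)"
  proof -
    interpret pair_sigma_finite treeM forestM by unfold_locales
    show ?thesis by (rule Fubini') measurable
  qed
  also have "\<dots> = (\<integral>\<^sup>+\<omega>s. X (\<omega>s 0) * inverse (?T \<omega>s) \<partial>forestM)"
    by (subst nn_integral_forestM_split) (auto simp: sum.lessThan_Suc_shift simp del: sum.lessThan_Suc)
  finally have K: "(\<integral>\<^sup>+\<omega>'. \<integral>\<^sup>+\<omega>. X \<omega> * inverse (X \<omega> + S \<omega>') \<partial>treeM \<partial>treeM)
    = (\<integral>\<^sup>+\<omega>s. X (\<omega>s 0) * inverse (?T \<omega>s) \<partial>forestM)" .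
  have sym: "(\<integral>\<^sup>+\<omega>s. X (\<omega>s i) * inverse (?T \<omega>s) \<partial>forestM) = (\<integral>\<^sup>+\<omega>s. X (\<omega>s 0) * inverse (?T \<omega>s) \<partial>forestM)"
    if "i < Suc d" for i
  proof -
    let ?\<pi> = "Transposition.transpose 0 i"
    have "?T (\<lambda>j. \<omega>s (?\<pi> j)) = ?T \<omega>s" for \<omega>s
      by (rule sum.reindex_bij_witness[of _ ?\<pi> ?\<pi>]) (use that in \<open>auto simp: Transposition.transpose_def\<close>)
    then show ?thesis
      using nn_integral_forestM_reindex[of "\<lambda>\<omega>s. X (\<omega>s i) * inverse (?T \<omega>s)" ?\<pi>] by simp
  qed
  have Z: "{\<omega>s. \<forall>i\<in>{..<Suc d}. \<omega>s i \<in> {\<omega>. X \<omega> = 0}} \<in> sets forestM"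
  proof -
    have "{\<omega>s\<in>space forestM. \<forall>i\<in>{..<Suc d}. X (\<omega>s i) = 0} \<in> sets forestM" by measurable
    then show ?thesis by simp
  qed
  have m: "{\<omega>. X \<omega> = 0} \<in> sets treeM" and p: "measure treeM {\<omega>. X \<omega> = 0} = 1 - surv"
  proof -
    have "{\<omega>. X \<omega> = 0} = UNIV - {\<omega>. X \<omega> > 0}" by (auto simp: zero_less_iff_neq_zero)
    then show "{\<omega>. X \<omega> = 0} \<in> sets treeM" "measure treeM {\<omega>. X \<omega> = 0} = 1 - surv"
      using treeM.prob_compl[OF sets_X_pos] sets.compl_sets[OF sets_X_pos] by (auto simp: surv_def)
  qed
  have "of_nat (Suc d) * (\<integral>\<^sup>+\<omega>s. X (\<omega>s 0) * inverse (?T \<omega>s) \<partial>forestM)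
      = (\<Sum>i<Suc d. \<integral>\<^sup>+\<omega>s. X (\<omega>s 0) * inverse (?T \<omega>s) \<partial>forestM)"
    by (simp del: sum.lessThan_Suc)
  also have "\<dots> = (\<Sum>i<Suc d. \<integral>\<^sup>+\<omega>s. X (\<omega>s i) * inverse (?T \<omega>s) \<partial>forestM)"
    by (intro sum.cong refl sym[symmetric]) simp
  also have "\<dots> = (\<integral>\<^sup>+\<omega>s. (\<Sum>i<Suc d. X (\<omega>s i) * inverse (?T \<omega>s)) \<partial>forestM)"
    by (rule nn_integral_sum[symmetric]) measurable
  also have "\<dots> = (\<integral>\<^sup>+\<omega>s. indicator (space forestM - {\<omega>s. \<forall>i\<in>{..<Suc d}. \<omega>s i \<in> {\<omega>. X \<omega> = 0}}) \<omega>s \<partial>forestM)"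
  proof (intro nn_integral_cong)
    fix \<omega>s
    \<comment> \<open>In \<open>ennreal\<close> the rule \<open>x * inverse x = 1\<close> fails at
      \<open>0\<close> and at \<open>\<top>\<close>. The total is at most \<open>d + 1\<close>, so
      only the value \<open>0\<close> has to be excluded.\<close>
    have "?T \<omega>s \<noteq> \<top>"
    proof -
      have "?T \<omega>s \<le> (\<Sum>i<Suc d. 1)" by (intro sum_mono X_le_1)
      also have "\<dots> < \<top>" by (simp add: ennreal_of_nat_eq_real_of_nat del: of_nat_Suc)
      finally show ?thesis by (rule less_imp_neq)
    qed
    then have "?T \<omega>s * inverse (?T \<omega>s) = (if ?T \<omega>s = 0 then 0 else 1)"
      using ennreal_divide_self[of "?T \<omega>s"] by (auto simp: divide_ennreal_def top.not_eq_extremum)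
    moreover have "?T \<omega>s = 0 \<longleftrightarrow> (\<forall>i\<in>{..<Suc d}. X (\<omega>s i) = 0)" by (subst sum_eq_0_iff) auto
    ultimately show "(\<Sum>i<Suc d. X (\<omega>s i) * inverse (?T \<omega>s))
       = indicator (space forestM - {\<omega>s. \<forall>i\<in>{..<Suc d}. \<omega>s i \<in> {\<omega>. X \<omega> = 0}}) \<omega>s"
      unfolding sum_distrib_right[symmetric] by (auto split: split_indicator simp del: sum.lessThan_Suc)
  qed
  also have "\<dots> = emeasure forestM (space forestM - {\<omega>s. \<forall>i\<in>{..<Suc d}. \<omega>s i \<in> {\<omega>. X \<omega> = 0}})"
    using Z by (intro nn_integral_indicator sets.compl_sets)
  also have "\<dots> = ennreal (1 - (1 - surv) ^ Suc d)"
  proof -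
    have "emeasure forestM {\<omega>s. \<forall>i\<in>{..<Suc d}. \<omega>s i \<in> {\<omega>. X \<omega> = 0}} = (\<Prod>i<Suc d. emeasure treeM {\<omega>. X \<omega> = 0})"
      using m by (intro emeasure_forestM_cylinder) auto
    also have "\<dots> = ennreal ((1 - surv) ^ Suc d)"
      by (simp add: treeM.emeasure_eq_measure p surv_def ennreal_power del: power_Suc)
    finally have "measure forestM {\<omega>s. \<forall>i\<in>{..<Suc d}. \<omega>s i \<in> {\<omega>. X \<omega> = 0}} = (1 - surv) ^ Suc d"
      unfolding forestM.emeasure_eq_measure by (subst (asm) ennreal_inj) (auto simp: surv_def simp del: power_Suc)
    then show ?thesis
      unfolding forestM.emeasure_eq_measure using forestM.prob_compl[OF Z] by (simp del: power_Suc)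
  qed
  finally show ?thesis using K by simp
qed

text \<open>Three relations are combined: \<open>surv\<close> is the mean of \<open>X\<close> plus
  \<open>c * J\<close> by \<open>surv_split\<close>, \<open>K = J + surv * (1 - surv) ^ d\<close> by
  \<open>harmonic_split\<close>, and \<open>(d + 1) * K = 1 - (1 - surv) ^ (d + 1)\<close> by
  exchangeability. Eliminating \<open>J\<close> and \<open>K\<close> gives the mean; finiteness of
  each quantity is established first so that subtraction is legitimate.\<close>

lemma nn_integral_X_eq:
  "(\<integral>\<^sup>+\<omega>. X \<omega> \<partial>treeM) = ennreal (surv + c * surv * (1 - surv) ^ d - c / real (d + 1) * (1 - (1 - surv) ^ (d + 1)))"
  "0 \<le> surv + c * surv * (1 - surv) ^ d - c / real (d + 1) * (1 - (1 - surv) ^ (d + 1))"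
proof -
  define J where "J = (\<integral>\<^sup>+\<omega>'. \<integral>\<^sup>+\<omega>. inverse (S \<omega>') * inverse (inverse (X \<omega>) + inverse (S \<omega>')) \<partial>treeM \<partial>treeM)"
  define K where "K = (\<integral>\<^sup>+\<omega>'. \<integral>\<^sup>+\<omega>. X \<omega> * inverse (X \<omega> + S \<omega>') \<partial>treeM \<partial>treeM)"
  have s01: "0 \<le> surv" "surv \<le> 1" by (auto simp: surv_def)
  have Sm: "{\<omega>. S \<omega> = 0} \<in> sets treeM"
  proof -
    have "{\<omega>\<in>space treeM. S \<omega> = 0} \<in> sets treeM" by measurable
    then show ?thesis by simp
  qed
  have "K = (\<integral>\<^sup>+\<omega>'. (\<integral>\<^sup>+\<omega>. inverse (S \<omega>') * inverse (inverse (X \<omega>) + inverse (S \<omega>')) \<partial>treeM)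
      + ennreal surv * indicator {\<omega>. S \<omega> = 0} \<omega>' \<partial>treeM)"
    unfolding K_def harmonic_split
    by (intro nn_integral_cong, subst nn_integral_add)
      (auto simp: nn_integral_multc surv_def treeM.emeasure_eq_measure)
  also have "\<dots> = J + ennreal surv * emeasure treeM {\<omega>. S \<omega> = 0}"
    unfolding J_def using Sm by (subst nn_integral_add) (auto simp: nn_integral_cmult)
  finally have KJ: "K = J + ennreal (surv * (1 - surv) ^ d)"
    using s01 by (simp add: emeasure_S_zero ennreal_mult)
  have Kd: "of_nat (Suc d) * K = ennreal (1 - (1 - surv) ^ Suc d)"
    unfolding K_def by (rule exchangeable_ratio)
  have "K \<noteq> \<top>"
    using Kd by (auto simp: ennreal_mult_top)
  then obtain k where k: "K = ennreal k" "k \<ge> 0" by (cases K) auto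
  have "J \<noteq> \<top>" using KJ \<open>K \<noteq> \<top>\<close> by auto
  then obtain j where j: "J = ennreal j" "j \<ge> 0" by (cases J) auto
  have Xt: "(\<integral>\<^sup>+\<omega>. X \<omega> \<partial>treeM) \<noteq> \<top>"
  proof
    assume "(\<integral>\<^sup>+\<omega>. X \<omega> \<partial>treeM) = \<top>"
    then have "ennreal surv = \<top>" using surv_split by simp
    then show False by simp
  qed
  then obtain e where e: "(\<integral>\<^sup>+\<omega>. X \<omega> \<partial>treeM) = ennreal e" "e \<ge> 0" by (cases "\<integral>\<^sup>+\<omega>. X \<omega> \<partial>treeM") auto
  have pw: "(1 - surv) ^ Suc d \<le> 1" using s01 by (intro power_le_one) auto
  have "ennreal (real (Suc d) * k) = ennreal (1 - (1 - surv) ^ Suc d)"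
    using Kd k by (simp add: ennreal_of_nat_eq_real_of_nat ennreal_mult del: of_nat_Suc power_Suc)
  then have kd: "real (Suc d) * k = 1 - (1 - surv) ^ Suc d"
    using k pw by (subst (asm) ennreal_inj) auto
  have kj: "k = j + surv * (1 - surv) ^ d"
    using KJ k j s01 by (simp add: ennreal_plus[symmetric] del: ennreal_plus)
  have "ennreal surv = ennreal (e + c * j)"
    using surv_split e j c_pos unfolding J_def[symmetric]
    by (simp add: ennreal_mult[symmetric] ennreal_plus[symmetric] del: ennreal_plus)
  then have "surv = e + c * j" using s01 e j c_pos by (subst (asm) ennreal_inj) auto
  then have "e = surv + c * surv * (1 - surv) ^ d - c * k" using kj by (simp add: algebra_simps)
  also have "k = (1 - (1 - surv) ^ (d + 1)) / real (d + 1)" using kd by (simp add: field_simps)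
  finally have "e = surv + c * surv * (1 - surv) ^ d - c / real (d + 1) * (1 - (1 - surv) ^ (d + 1))" by simp
  then show "(\<integral>\<^sup>+\<omega>. X \<omega> \<partial>treeM) = ennreal (surv + c * surv * (1 - surv) ^ d - c / real (d + 1) * (1 - (1 - surv) ^ (d + 1)))"
    "0 \<le> surv + c * surv * (1 - surv) ^ d - c / real (d + 1) * (1 - (1 - surv) ^ (d + 1))"
    using e by simp_all
qed

end

text \<open>A node carries the list of its cofaces and the flat list of its grandchildren: the \<open>i\<close>-th facet of the \<open>j\<close>-th coface
  has index \<open>j * d + i\<close>.\<close>

section \<open>Finite trees and pruning\<close>

datatype 'a tree = Node "'a list" "'a tree list"

instance tree :: (countable) countable by countable_datatype

primrec xval :: "nat \<Rightarrow> nat \<Rightarrow> 'a tree \<Rightarrow> real" where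
  "xval d 0 T = 1"
| "xval d (Suc R) T = (case T of Node ws ts \<Rightarrow>
     1 / (1 + (\<Sum>j<length ws. 1 / (\<Sum>i<d. xval d R (ts ! (j * d + i))))))"

primrec zval :: "nat \<Rightarrow> nat \<Rightarrow> 'a tree \<Rightarrow> bool" where
  "zval d 0 T = False"
| "zval d (Suc R) T = (case T of Node ws ts \<Rightarrow>
     \<forall>j<length ws. \<exists>i<d. zval d R (ts ! (j * d + i)))"

text \<open>Let \<open>Z\<close> be the set of faces satisfying \<open>zval d (Suc R)\<close>. The cofaces counted by \<open>psi\<close> have no facet
  in \<open>Z\<close>: at most one of their \<open>d + 1\<close> facets survives when the coface itself is ignored.\<close>

definition psi :: "nat \<Rightarrow> nat \<Rightarrow> 'a tree \<Rightarrow> nat" where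
  "psi d R T = (case T of Node ws ts \<Rightarrow> card {j. j < length ws \<and>
     (let D = card {i. i < d \<and> zval d (Suc R) (ts ! (j * d + i))} in
      D = 0 \<or> D = 1 \<and> (\<exists>j'<length ws. j' \<noteq> j \<and> (\<forall>i<d. \<not> zval d R (ts ! (j' * d + i)))))})"

primrec wft :: "nat \<Rightarrow> nat \<Rightarrow> 'a tree \<Rightarrow> bool" where
  "wft d 0 T = (T = Node [] [])"
| "wft d (Suc R) T = (case T of Node ws ts \<Rightarrow> length ts = d * length ws \<and> (\<forall>q<d * length ws. wft d R (ts ! q)))"

text \<open>The probability that the Poisson tree cut at depth \<open>R\<close> equals
  \<open>T\<close>, as \<open>emeasure_TR\<close> confirms.\<close>

primrec wt :: "nat \<Rightarrow> real \<Rightarrow> nat \<Rightarrow> 'a tree \<Rightarrow> real" where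
  "wt d c 0 T = 1"
| "wt d c (Suc R) T = (case T of Node ws ts \<Rightarrow>
     c ^ length ws / fact (length ws) * exp (- c) * (\<Prod>q<d * length ws. wt d c R (ts ! q)))"

text \<open>At finite depth no value vanishes, so the recursion over the reals never divides by zero
  and agrees with \<open>XR\<close>. The value \<open>0\<close> arises only in the limit of infinite
  depth.\<close>

lemma xval_pos: "d > 0 \<Longrightarrow> xval d R T > 0"
proof (induction R arbitrary: T)
  case (Suc R)
  obtain ws ts where T: "T = Node ws ts" by (cases T)
  have "0 \<le> (\<Sum>j<length ws. 1 / (\<Sum>i<d. xval d R (ts ! (j * d + i))))"
    using Suc by (intro sum_nonneg divide_nonneg_nonneg) (auto intro: less_imp_le)
  then show ?case by (simp add: T add_pos_nonneg)
qed auto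

lemma xval_le_1: "d > 0 \<Longrightarrow> xval d R T \<le> 1"
proof (cases R)
  case (Suc R')
  assume "d > 0"
  obtain ws ts where T: "T = Node ws ts" by (cases T)
  have "0 \<le> (\<Sum>j<length ws. 1 / (\<Sum>i<d. xval d R' (ts ! (j * d + i))))"
    using xval_pos[OF \<open>d > 0\<close>] by (intro sum_nonneg divide_nonneg_nonneg) (auto intro: less_imp_le)
  then show ?thesis by (simp add: T Suc)
qed auto

lemma div_mod_block: "i < d \<Longrightarrow> (j * d + i) div d = j" "i < d \<Longrightarrow> (j * d + i) mod d = (i::nat)"
  by auto

lemma block_less: "j < N \<Longrightarrow> i < d \<Longrightarrow> j * d + i < d * (N::nat)"
proof -
  assume "j < N" "i < d"
  then have "j * d + i < Suc j * d" by simp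
  also have "\<dots> \<le> N * d" using \<open>j < N\<close> by (intro mult_le_mono1) simp
  finally show ?thesis by (simp add: mult.commute)
qed

lemma prod_block: "(\<Prod>j<N. \<Prod>i<d. f (j * d + i)) = (\<Prod>q<d * N. f (q::nat))"
proof -
  have "(\<Prod>i<d. f (j * d + i)) = prod f {j * d..<j * d + d}" for j
    by (rule prod.reindex_bij_witness[of _ "\<lambda>q. q - j * d" "\<lambda>i. j * d + i"]) auto
  then show ?thesis using prod.nat_group[of f d N] by (simp add: mult.commute)
qed

section \<open>The Poisson tree cut at finite depth\<close>

context poisson_tree
begin

text \<open>The labels are trivial because the Poisson tree carries no graph vertices; an
  exploration of the graph is compared with it after its own labels have been forgotten.\<close>

primrec TR :: "nat \<Rightarrow> (nat list \<Rightarrow> nat) \<Rightarrow> unit tree" where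
  "TR 0 \<omega> = Node [] []"
| "TR (Suc R) \<omega> = Node (replicate (\<omega> []) ())
     (map (\<lambda>q. TR R (shift (q mod d) (shift (q div d) \<omega>))) [0..<d * \<omega> []])"

lemma wft_TR: "wft d R (TR R \<omega>)"
  by (induction R arbitrary: \<omega>) auto

lemma wt_nonneg: "0 \<le> wt d c R T"
proof (induction R arbitrary: T)
  case (Suc R)
  obtain ws ts where T: "T = Node ws ts" by (cases T)
  have "0 \<le> (\<Prod>q<d * length ws. wt d c R (ts ! q))" by (intro prod_nonneg) (simp add: Suc)
  then show ?case using c_pos by (simp add: T)
qed simp

lemma TR_Suc_eq:
  fixes us ts R
  defines "N \<equiv> length us"
    and "A \<equiv> \<lambda>q. {\<omega>. TR R \<omega> = ts ! q}"
  defines "C \<equiv> \<lambda>j. {\<omega>. \<forall>i<d. shift i \<omega> \<in> A (j * d + i)}"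
  shows "{\<omega>. TR (Suc R) \<omega> = Node us ts} = (if length ts = d * N then
     {\<omega>. \<omega> [] = N \<and> (\<forall>j<N. shift j \<omega> \<in> C j)} else {})"
proof -
  have "TR (Suc R) \<omega> = Node us ts \<longleftrightarrow> \<omega> [] = N \<and> length ts = d * N \<and> (\<forall>q<d * N. TR R (shift (q mod d) (shift (q div d) \<omega>)) = ts ! q)" for \<omega>
  proof -
    have "replicate (\<omega> []) () = us \<longleftrightarrow> \<omega> [] = N"
      unfolding N_def by (metis length_replicate replicate_length_same old.unit.exhaust)
    then show ?thesis by (auto simp: list_eq_iff_nth_eq)
  qed
  moreover have "(\<forall>q<d * N. TR R (shift (q mod d) (shift (q div d) \<omega>)) = ts ! q) \<longleftrightarrow> (\<forall>j<N. shift j \<omega> \<in> C j)" for \<omega>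
  proof
    assume *: "\<forall>q<d * N. TR R (shift (q mod d) (shift (q div d) \<omega>)) = ts ! q"
    show "\<forall>j<N. shift j \<omega> \<in> C j"
      unfolding C_def A_def
    proof safe
      fix j i assume "j < N" "i < d"
      then show "TR R (shift i (shift j \<omega>)) = ts ! (j * d + i)"
        using *[rule_format, OF block_less[of j N i d]] by (simp add: div_mod_block)
    qed
  next
    assume *: "\<forall>j<N. shift j \<omega> \<in> C j"
    show "\<forall>q<d * N. TR R (shift (q mod d) (shift (q div d) \<omega>)) = ts ! q"
    proof safe
      fix q assume "q < d * N"
      then have q: "q div d < N" "q mod d < d"
        using d_pos by (auto simp: less_mult_imp_div_less mult.commute)
      have "shift (q mod d) (shift (q div d) \<omega>) \<in> A (q div d * d + q mod d)"
        using *[rule_format, OF q(1)] q(2) unfolding C_def by blast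
      then show "TR R (shift (q mod d) (shift (q div d) \<omega>)) = ts ! q"
        unfolding A_def by simp
    qed
  qed
  ultimately show ?thesis by auto
qed

lemma sets_TR: "{\<omega>. TR R \<omega> = T} \<in> sets treeM"
proof (induction R arbitrary: T)
  case 0
  show ?case using sets.top[of treeM] by (cases "T = Node [] []") auto
next
  case (Suc R)
  obtain us ts where T: "T = Node us ts" by (cases T)
  define C where "C j = {\<omega>. \<forall>i<d. shift i \<omega> \<in> {\<omega>. TR R \<omega> = ts ! (j * d + i)}}" for j
  have C: "C j \<in> sets treeM" for j unfolding C_def by (intro sets_children Suc.IH)
  have "{\<omega>. \<omega> [] = length us \<and> (\<forall>j<length us. shift j \<omega> \<in> C j)} \<in> sets treeM" (is "?E \<in> _")
  proof -
    have "?E = {\<omega>\<in>space treeM. \<omega> [] = length us} \<inter> {\<omega>. \<forall>j<length us. shift j \<omega> \<in> C j}" by auto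
    moreover have "{\<omega>\<in>space treeM. \<omega> [] = length us} \<in> sets treeM" by measurable
    ultimately show ?thesis using sets_children[of "length us" C] C by auto
  qed
  then show ?case unfolding T TR_Suc_eq C_def by simp
qed

lemma emeasure_TR: "wft d R T \<Longrightarrow> emeasure treeM {\<omega>. TR R \<omega> = T} = ennreal (wt d c R T)"
proof (induction R arbitrary: T)
  case 0
  then have "{\<omega>. TR 0 \<omega> = T} = space treeM" by auto
  then show ?case using treeM.emeasure_space_1 by simp
next
  case (Suc R)
  obtain us ts where T: "T = Node us ts" by (cases T)
  define N where "N = length us"
  define A where "A q = {\<omega>. TR R \<omega> = ts ! q}" for q
  define C where "C j = {\<omega>. \<forall>i<d. shift i \<omega> \<in> A (j * d + i)}" for j
  have A: "A q \<in> sets treeM" for q unfolding A_def by (rule sets_TR)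
  have C: "C j \<in> sets treeM" for j unfolding C_def by (intro sets_children A)
  define E where "E = {\<omega>. \<omega> [] = N \<and> (\<forall>j<N. shift j \<omega> \<in> C j)}"
  have len: "length ts = d * N" and wf: "\<And>q. q < d * N \<Longrightarrow> wft d R (ts ! q)"
    using Suc.prems by (auto simp: T N_def)
  have eq: "{\<omega>. TR (Suc R) \<omega> = T} = E"
    using len unfolding T TR_Suc_eq E_def C_def A_def N_def by simp
  have E: "E \<in> sets treeM" using sets_TR[of "Suc R" T] unfolding eq .
  have "emeasure treeM {\<omega>. TR (Suc R) \<omega> = T} = (\<integral>\<^sup>+\<omega>. indicator E \<omega> \<partial>treeM)"
    using E unfolding eq by simp
  also have "\<dots> = (\<Sum>M. pois M * (\<integral>\<^sup>+\<omega>s. indicator E (graft M \<omega>s) \<partial>forestM))"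
    using E by (intro nn_integral_treeM) simp
  also have "\<dots> = (\<Sum>M. if M = N then pois N * (\<integral>\<^sup>+\<omega>s. indicator E (graft N \<omega>s) \<partial>forestM) else 0)"
    by (intro suminf_cong) (auto simp: E_def)
  also have "\<dots> = pois N * (\<integral>\<^sup>+\<omega>s. indicator E (graft N \<omega>s) \<partial>forestM)"
    using sums_unique[OF sums_single[of N "\<lambda>_. pois N * (\<integral>\<^sup>+\<omega>s. indicator E (graft N \<omega>s) \<partial>forestM)"]] by simp
  also have "(\<integral>\<^sup>+\<omega>s. indicator E (graft N \<omega>s) \<partial>forestM) = (\<integral>\<^sup>+\<omega>s. indicator {\<omega>s. \<forall>j\<in>{..<N}. \<omega>s j \<in> C j} \<omega>s \<partial>forestM)"
    by (intro nn_integral_cong) (auto simp: E_def split: split_indicator)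
  also have "\<dots> = emeasure forestM {\<omega>s. \<forall>j\<in>{..<N}. \<omega>s j \<in> C j}"
  proof (rule nn_integral_indicator)
    have "{\<omega>s. \<forall>j\<in>{..<N}. \<omega>s j \<in> C j} = {\<omega>s\<in>space forestM. \<forall>j\<in>{..<N}. \<omega>s j \<in> C j}" by simp
    also have "\<dots> \<in> sets forestM"
      by (intro sets.sets_Collect_finite_All) (auto intro!: sets_component simp: C)
    finally show "{\<omega>s. \<forall>j\<in>{..<N}. \<omega>s j \<in> C j} \<in> sets forestM" .
  qed
  also have "\<dots> = (\<Prod>j<N. emeasure treeM (C j))"
    using C by (intro emeasure_forestM_cylinder) auto
  also have "\<dots> = (\<Prod>j<N. \<Prod>i<d. emeasure treeM (A (j * d + i)))"
    unfolding C_def using A by (intro prod.cong refl emeasure_children) auto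
  also have "\<dots> = (\<Prod>q<d * N. emeasure treeM (A q))" by (rule prod_block)
  also have "\<dots> = (\<Prod>q<d * N. ennreal (wt d c R (ts ! q)))"
    unfolding A_def using wf by (intro prod.cong refl Suc.IH) auto
  also have "\<dots> = ennreal (\<Prod>q<d * N. wt d c R (ts ! q))"
    by (intro prod_ennreal wt_nonneg)
  also have "pois N * \<dots> = ennreal (wt d c (Suc R) T)"
    unfolding pois_def using c_pos
    by (simp only: T N_def wt.simps tree.case) (rule ennreal_mult'[symmetric], simp)
  finally show ?case .
qed

lemma measurable_TR [measurable]: "TR R \<in> treeM \<rightarrow>\<^sub>M count_space UNIV"
  by (subst measurable_count_space_eq2_countable) (auto simp: vimage_def intro: sets_TR)

text \<open>There are only countably many shapes, so the integral is a series of nonnegative terms;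
  if it exceeds \<open>e\<close>, so does a partial sum. Only this one-sided approximation is
  transferred to the graph.\<close>

lemma finite_tree_sum:
  assumes "\<And>T. 0 \<le> \<Theta> T" and "ennreal e < (\<integral>\<^sup>+\<omega>. ennreal (\<Theta> (TR R \<omega>)) \<partial>treeM)"
  shows "\<exists>\<T>. finite \<T> \<and> (\<forall>T\<in>\<T>. wft d R T) \<and> e < (\<Sum>T\<in>\<T>. \<Theta> T * wt d c R T)"
proof -
  let ?t = "from_nat :: nat \<Rightarrow> unit tree"
  let ?P = "\<lambda>n::nat. {\<omega>. to_nat (TR R \<omega>) = n}"
  have P: "?P n \<in> sets treeM" for n
  proof -
    have "{\<omega>\<in>space treeM. to_nat (TR R \<omega>) = n} \<in> sets treeM" by measurable
    then show ?thesis by simp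
  qed
  have "(\<integral>\<^sup>+\<omega>. ennreal (\<Theta> (TR R \<omega>)) \<partial>treeM) = (\<integral>\<^sup>+\<omega>. (\<Sum>n. ennreal (\<Theta> (?t n)) * indicator (?P n) \<omega>) \<partial>treeM)"
  proof (intro nn_integral_cong)
    fix \<omega>
    have "(\<Sum>n. ennreal (\<Theta> (?t n)) * indicator (?P n) \<omega>)
       = (\<Sum>n. if n = to_nat (TR R \<omega>) then ennreal (\<Theta> (TR R \<omega>)) else 0)"
      by (intro suminf_cong) (auto split: split_indicator)
    then show "ennreal (\<Theta> (TR R \<omega>)) = (\<Sum>n. ennreal (\<Theta> (?t n)) * indicator (?P n) \<omega>)"
      using sums_unique[OF sums_single[of "to_nat (TR R \<omega>)" "\<lambda>_. ennreal (\<Theta> (TR R \<omega>))"]] by simp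
  qed
  also have "\<dots> = (\<Sum>n. ennreal (\<Theta> (?t n)) * emeasure treeM (?P n))"
    using P by (subst nn_integral_suminf) (auto simp: nn_integral_cmult)
  finally have "ennreal e < (\<Sum>n. ennreal (\<Theta> (?t n)) * emeasure treeM (?P n))"
    using assms(2) by simp
  then obtain K where K: "ennreal e < (\<Sum>n<K. ennreal (\<Theta> (?t n)) * emeasure treeM (?P n))"
    unfolding suminf_eq_SUP less_SUP_iff by auto
  \<comment> \<open>\<open>from_nat\<close> may send several indices to the same tree;
    \<open>I\<close> keeps the index \<open>to_nat T\<close> of each tree, so that no shape is
    counted twice.\<close>
  define I where "I = {n. n < K \<and> wft d R (?t n) \<and> to_nat (?t n) = n}"
  have Pn: "?P n = {\<omega>. TR R \<omega> = ?t n}" if "n \<in> I" for n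
  proof -
    have "?P n = {\<omega>. to_nat (TR R \<omega>) = to_nat (?t n)}" using that by (simp add: I_def)
    then show ?thesis by (simp only: inj_eq[OF inj_to_nat])
  qed
  have P0: "?P n = {}" if "n < K" "n \<notin> I" for n
    using that wft_TR unfolding I_def by (auto simp: from_nat_to_nat)
  have "(\<Sum>n<K. ennreal (\<Theta> (?t n)) * emeasure treeM (?P n))
      = (\<Sum>n\<in>I. ennreal (\<Theta> (?t n)) * emeasure treeM (?P n))"
    by (rule sum.mono_neutral_right) (auto simp: I_def[symmetric] P0, auto simp: I_def)
  also have "\<dots> = (\<Sum>n\<in>I. ennreal (\<Theta> (?t n) * wt d c R (?t n)))"
  proof (intro sum.cong refl)
    fix n assume n: "n \<in> I"
    then have "emeasure treeM (?P n) = ennreal (wt d c R (?t n))"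
      using emeasure_TR[of R "?t n"] Pn[OF n] by (simp add: I_def)
    then show "ennreal (\<Theta> (?t n)) * emeasure treeM (?P n) = ennreal (\<Theta> (?t n) * wt d c R (?t n))"
      using assms(1) by (simp add: ennreal_mult wt_nonneg)
  qed
  also have "\<dots> = ennreal (\<Sum>n\<in>I. \<Theta> (?t n) * wt d c R (?t n))"
    using assms(1) by (intro sum_ennreal mult_nonneg_nonneg wt_nonneg)
  finally have "ennreal e < ennreal (\<Sum>n\<in>I. \<Theta> (?t n) * wt d c R (?t n))" using K by simp
  then have lt: "e < (\<Sum>n\<in>I. \<Theta> (?t n) * wt d c R (?t n))"
    by (meson ennreal_leI leD not_le)
  have inj: "inj_on ?t I"
    by (rule inj_on_inverseI[where g = to_nat]) (simp add: I_def)
  show ?thesis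
  proof (intro exI[of _ "?t ` I"] conjI)
    show "e < (\<Sum>T\<in>?t ` I. \<Theta> T * wt d c R T)"
      using lt by (simp add: sum.reindex[OF inj])
  qed (auto simp: I_def)
qed

lemma xval_TR: "ennreal (xval d R (TR R \<omega>)) = XR R \<omega>"
proof (induction R arbitrary: \<omega>)
  case (Suc R)
  let ?s = "\<lambda>j. \<Sum>i<d. xval d R (TR R (shift i (shift j \<omega>)))"
  have pos: "?s j > 0" for j
    using d_pos by (intro sum_pos xval_pos) auto
  have xv: "xval d (Suc R) (TR (Suc R) \<omega>) = 1 / (1 + (\<Sum>j<\<omega> []. 1 / ?s j))"
  proof -
    have "(\<Sum>i<d. xval d R (map (\<lambda>q. TR R (shift (q mod d) (shift (q div d) \<omega>))) [0..<d * \<omega> []] ! (j * d + i))) = ?s j"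
      if "j < \<omega> []" for j
      using that block_less[OF that] by (intro sum.cong refl) (auto simp: div_mod_block)
    then show ?thesis by simp
  qed
  have XR: "XR (Suc R) \<omega> = inverse (ennreal (1 + (\<Sum>j<\<omega> []. 1 / ?s j)))"
  proof -
    have "inverse (\<Sum>i<d. XR R (shift i (shift j \<omega>))) = ennreal (1 / ?s j)" for j
      unfolding Suc.IH[symmetric] using pos xval_pos[OF d_pos]
      by (subst sum_ennreal) (auto simp: inverse_ennreal inverse_eq_divide intro: less_imp_le)
    then have "(\<Sum>j<\<omega> []. inverse (\<Sum>i<d. XR R (shift i (shift j \<omega>)))) = ennreal (\<Sum>j<\<omega> []. 1 / ?s j)"
      using pos by (simp add: sum_ennreal less_imp_le)
    moreover have "0 \<le> (\<Sum>j<\<omega> []. 1 / ?s j)"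
      using pos by (intro sum_nonneg) (auto intro: less_imp_le)
    ultimately show ?thesis using ennreal_plus[of 1 "\<Sum>j<\<omega> []. 1 / ?s j"] by simp
  qed
  have pos1: "0 < 1 + (\<Sum>j<\<omega> []. 1 / ?s j)"
    using pos by (intro add_pos_nonneg sum_nonneg) (auto intro: less_imp_le)
  show ?case unfolding xv XR by (subst inverse_ennreal[OF pos1]) (simp only: inverse_eq_divide)
qed simp

section \<open>Survival under pruning on the Poisson tree\<close>

primrec ZR :: "nat \<Rightarrow> (nat list \<Rightarrow> nat) \<Rightarrow> bool" where
  "ZR 0 \<omega> = False"
| "ZR (Suc R) \<omega> = (\<forall>j<\<omega> []. \<exists>i<d. ZR R (shift i (shift j \<omega>)))"

primrec \<theta> :: "nat \<Rightarrow> real" where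
  "\<theta> 0 = 0"
| "\<theta> (Suc R) = exp (- c * (1 - \<theta> R) ^ d)"

lemma TR_child: "j < \<omega> [] \<Longrightarrow> i < d \<Longrightarrow>
  map (\<lambda>q. TR R (shift (q mod d) (shift (q div d) \<omega>))) [0..<d * \<omega> []] ! (j * d + i) = TR R (shift i (shift j \<omega>))"
  using block_less[of j "\<omega> []" i d] by (simp add: div_mod_block)

text \<open>\<open>zval d R\<close> inspects only \<open>R\<close> levels, so cutting the tree
  deeper does not change it.\<close>

lemma zval_TR: "R \<le> R' \<Longrightarrow> zval d R (TR R' \<omega>) = ZR R \<omega>"
proof (induction R arbitrary: R' \<omega>)
  case (Suc R)
  then obtain R'' where R': "R' = Suc R''" "R \<le> R''" by (cases R') auto
  show ?case using TR_child[of _ \<omega> _ R''] by (simp add: R' Suc.IH[OF R'(2)] cong: conj_cong)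
qed simp

lemma sets_ZR: "{\<omega>. ZR R \<omega>} \<in> sets treeM"
proof -
  have "{\<omega>\<in>space treeM. zval d R (TR R \<omega>)} \<in> sets treeM" by measurable
  then show ?thesis by (simp add: zval_TR)
qed

lemma measure_ZR: "measure treeM {\<omega>. ZR R \<omega>} = \<theta> R"
proof (induction R)
  case (Suc R)
  have "emeasure treeM {\<omega>. ZR (Suc R) \<omega>} = ennreal (\<theta> (Suc R))"
    using emeasure_unblocked[OF sets_ZR[of R]] unfolding Suc by simp
  then show ?case
    unfolding treeM.emeasure_eq_measure by (subst (asm) ennreal_inj) (simp_all del: ZR.simps)
qed simp

end

context poisson_tree
begin

lemma psi_TR:
  "psi d R (TR (Suc (Suc R)) \<omega>) = card {j. j < \<omega> [] \<and>
     (let D = card {i. i < d \<and> ZR (Suc R) (shift i (shift j \<omega>))} in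
      D = 0 \<or> D = 1 \<and> (\<exists>j'<\<omega> []. j' \<noteq> j \<and> (\<forall>i<d. \<not> ZR R (shift i (shift j' \<omega>)))))}"
proof -
  have "zval d (Suc R) (map (\<lambda>q. TR (Suc R) (shift (q mod d) (shift (q div d) \<omega>))) [0..<d * \<omega> []] ! (j * d + i))
      = ZR (Suc R) (shift i (shift j \<omega>))"
    "zval d R (map (\<lambda>q. TR (Suc R) (shift (q mod d) (shift (q div d) \<omega>))) [0..<d * \<omega> []] ! (j * d + i))
      = ZR R (shift i (shift j \<omega>))"
    if "j < \<omega> []" "i < d" for i j
    using that by (simp_all only: TR_child zval_TR[OF order_refl] zval_TR[of R "Suc R", OF le_SucI[OF order_refl]])
  then show ?thesis
    by (simp only: psi_def TR.simps(2)[of "Suc R"] tree.case length_replicate cong: conj_cong imp_cong)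
qed

lemma sets_ZR_compl: "- {\<omega>. ZR R \<omega>} \<in> sets treeM" "measure treeM (- {\<omega>. ZR R \<omega>}) = 1 - \<theta> R"
  using sets.compl_sets[OF sets_ZR[of R]] treeM.prob_compl[OF sets_ZR[of R]]
  by (auto simp: Compl_eq_Diff_UNIV measure_ZR)

lemma \<theta>_bounds: "0 \<le> \<theta> R" "\<theta> R \<le> 1"
proof -
  show "0 \<le> \<theta> R" by (cases R) auto
  have "measure treeM {\<omega>. ZR R \<omega>} \<le> 1" by simp
  then show "\<theta> R \<le> 1" by (simp add: measure_ZR)
qed

text \<open>By \<open>mecke\<close>, a distinguished coface is an additional independent one. With
  \<open>q = \<theta> (Suc R)\<close>, its number of surviving further facets is binomial with
  parameters \<open>d\<close> and \<open>q\<close>, and the face without this coface is again a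
  Poisson tree, blocked with probability \<open>1 - q\<close>. Hence the mean is \<open>c\<close>
  times \<open>(1 - q) ^ d + d * q * (1 - q) ^ (d - 1) * (1 - q)\<close>.\<close>

lemma sum_psi_TR:
  fixes R
  defines "D \<equiv> \<lambda>\<omega>. card {i. i < d \<and> ZR (Suc R) (shift i \<omega>)}"
  shows "(\<integral>\<^sup>+\<omega>. of_nat (psi d R (TR (Suc (Suc R)) \<omega>)) \<partial>treeM)
    = ennreal (c * ((1 - \<theta> (Suc R)) ^ d * (1 + real d * \<theta> (Suc R))))"
proof -
  define q where "q = \<theta> (Suc R)"
  have q: "0 \<le> q" "q \<le> 1" unfolding q_def by (rule \<theta>_bounds)+
  \<comment> \<open>\<open>B\<close> marks a coface none of whose further facets survives
    \<open>R\<close> rounds. The second argument of \<open>h\<close> receives the number of such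
    cofaces other than the distinguished one; it matters only whether this is
    \<open>0\<close>.\<close>
  define B :: "(nat list \<Rightarrow> nat) \<Rightarrow> ennreal" where "B \<omega> = (if \<forall>i<d. \<not> ZR R (shift i \<omega>) then 1 else 0)" for \<omega>
  define h :: "(nat list \<Rightarrow> nat) \<Rightarrow> ennreal \<Rightarrow> ennreal" where
    "h \<omega> s = (if D \<omega> = 0 then 1 else 0) + (if D \<omega> = 1 then 1 else 0) * (if s \<noteq> 0 then 1 else 0)" for \<omega> s
  have Zm: "Measurable.pred treeM (\<lambda>\<omega>. ZR R \<omega>)" for R
    using sets_ZR[of R] by (simp add: pred_def)
  note [measurable] = Zm[of R] Zm[of "Suc R"]
  have Zs [measurable]: "Measurable.pred treeM (\<lambda>\<omega>. ZR R (shift i \<omega>))" for R i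
    using Zm[of R] by (rule measurable_compose[OF measurable_shift])
  have B_meas [measurable]: "B \<in> borel_measurable treeM"
    unfolding B_def by measurable
  have D_eq: "D \<omega> = (\<Sum>i<d. if ZR (Suc R) (shift i \<omega>) then 1 else 0)" for \<omega>
    unfolding D_def by (simp add: sum.If_cases Int_def lessThan_def del: ZR.simps)
  have D_meas [measurable]: "D \<in> treeM \<rightarrow>\<^sub>M count_space UNIV"
    unfolding D_eq[abs_def] by measurable
  have h [measurable]: "(\<lambda>(\<omega>, s). h \<omega> s) \<in> borel_measurable (treeM \<Otimes>\<^sub>M borel)"
    unfolding h_def by measurable
  have psi: "of_nat (psi d R (TR (Suc (Suc R)) \<omega>)) =
      (\<Sum>j<\<omega> []. h (shift j \<omega>) (\<Sum>i\<in>{..<\<omega> []} - {j}. B (shift i \<omega>)))" for \<omega>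
  proof -
    define Q where "Q j \<longleftrightarrow> (let D = D (shift j \<omega>) in
      D = 0 \<or> D = 1 \<and> (\<exists>j'<\<omega> []. j' \<noteq> j \<and> (\<forall>i<d. \<not> ZR R (shift i (shift j' \<omega>)))))" for j
    have "h (shift j \<omega>) (\<Sum>i\<in>{..<\<omega> []} - {j}. B (shift i \<omega>)) = (if Q j then 1 else 0)" for j
    proof -
      have "(\<Sum>i\<in>{..<\<omega> []} - {j}. B (shift i \<omega>)) \<noteq> 0 \<longleftrightarrow>
        (\<exists>j'<\<omega> []. j' \<noteq> j \<and> (\<forall>i<d. \<not> ZR R (shift i (shift j' \<omega>))))"
        by (subst sum_eq_0_iff) (auto simp: B_def)
      then show ?thesis by (auto simp: h_def Q_def Let_def)
    qed
    then have "(\<Sum>j<\<omega> []. h (shift j \<omega>) (\<Sum>i\<in>{..<\<omega> []} - {j}. B (shift i \<omega>))) = of_nat (card {j. j < \<omega> [] \<and> Q j})"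
      by (simp add: sum.If_cases Int_def lessThan_def)
    then show ?thesis by (simp only: psi_TR Q_def D_def)
  qed
  have B0: "(\<Sum>i<\<omega> []. B (shift i \<omega>)) \<noteq> 0 \<longleftrightarrow> \<not> ZR (Suc R) \<omega>" for \<omega>
    by (subst sum_eq_0_iff) (auto simp: B_def)
  have PD0: "emeasure treeM {\<omega>. D \<omega> = 0} = ennreal ((1 - q) ^ d)"
  proof -
    have "{\<omega>. D \<omega> = 0} = {\<omega>. \<forall>i<d. shift i \<omega> \<in> - {\<omega>. ZR (Suc R) \<omega>}}"
      unfolding D_def by (auto simp: card_eq_0_iff simp del: ZR.simps)
    then have "emeasure treeM {\<omega>. D \<omega> = 0} = (\<Prod>i<d. emeasure treeM (- {\<omega>. ZR (Suc R) \<omega>}))"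
      using sets_ZR_compl(1)[of "Suc R"] by (simp only: emeasure_children)
    then show ?thesis
      using q by (simp add: treeM.emeasure_eq_measure sets_ZR_compl(2) q_def[symmetric] ennreal_power del: ZR.simps \<theta>.simps)
  qed
  define Ei where "Ei i = {\<omega>. \<forall>i'<d. shift i' \<omega> \<in> (if i' = i then {\<omega>. ZR (Suc R) \<omega>} else - {\<omega>. ZR (Suc R) \<omega>})}" for i
  have Ei_sets: "Ei i \<in> sets treeM" for i
    unfolding Ei_def using sets_ZR[of "Suc R"] sets_ZR_compl(1)[of "Suc R"] by (intro sets_children) (auto simp del: ZR.simps)
  have PEi: "emeasure treeM (Ei i) = ennreal (q * (1 - q) ^ (d - 1))" if i: "i < d" for i
  proof -
    have "emeasure treeM (Ei i) = (\<Prod>i'<d. emeasure treeM (if i' = i then {\<omega>. ZR (Suc R) \<omega>} else - {\<omega>. ZR (Suc R) \<omega>}))"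
      unfolding Ei_def using sets_ZR[of "Suc R"] sets_ZR_compl(1)[of "Suc R"]
      by (intro emeasure_children) (auto simp del: ZR.simps)
    also have "\<dots> = (\<Prod>i'<d. ennreal (if i' = i then q else 1 - q))"
      by (intro prod.cong refl)
        (simp add: treeM.emeasure_eq_measure sets_ZR_compl(2) measure_ZR q_def[symmetric] del: ZR.simps \<theta>.simps)
    also have "\<dots> = ennreal (\<Prod>i'<d. if i' = i then q else 1 - q)"
      using q by (intro prod_ennreal) auto
    also have "(\<Prod>i'<d. if i' = i then q else 1 - q) = q * (\<Prod>i'\<in>{..<d} - {i}. 1 - q)"
      using i by (subst prod.remove[of _ i]) (auto intro!: prod.cong)
    also have "\<dots> = q * (1 - q) ^ (d - 1)" using i by simp
    finally show ?thesis .
  qed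
  have ind1: "(if D \<omega> = 1 then 1 else 0 :: ennreal) = (\<Sum>i<d. indicator (Ei i) \<omega>)" for \<omega>
  proof -
    let ?S = "{i. i < d \<and> ZR (Suc R) (shift i \<omega>)}"
    have "\<omega> \<in> Ei i \<longleftrightarrow> ?S = {i}" if "i < d" for i
      using that unfolding Ei_def by (auto split: if_splits simp del: ZR.simps)
    then have "(\<Sum>i<d. indicator (Ei i) \<omega> :: ennreal) = (\<Sum>i<d. if ?S = {i} then 1 else 0)"
      by (intro sum.cong refl) (auto split: split_indicator simp del: ZR.simps)
    also have "\<dots> = (if D \<omega> = 1 then 1 else 0)"
    proof (cases "D \<omega> = 1")
      case True
      then obtain a where a: "?S = {a}" unfolding D_def by (auto simp: card_1_singleton_iff simp del: ZR.simps)
      then have "a < d" by blast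
      have "(\<Sum>i<d. if ?S = {i} then 1 else 0 :: ennreal) = (\<Sum>i<d. if i = a then 1 else 0)"
        unfolding a by (intro sum.cong refl) auto
      then show ?thesis using True \<open>a < d\<close> by (simp del: ZR.simps)
    next
      case False
      then have "?S \<noteq> {i}" for i unfolding D_def by (metis card.empty card.insert empty_iff finite.emptyI One_nat_def)
      then show ?thesis using False by (simp del: ZR.simps)
    qed
    finally show ?thesis by simp
  qed
  have PD1: "(\<integral>\<^sup>+\<omega>. (if D \<omega> = 1 then 1 else 0) \<partial>treeM) = ennreal (real d * q * (1 - q) ^ (d - 1))"
    unfolding ind1 using Ei_sets PEi q
    by (subst nn_integral_sum) (auto simp: ennreal_of_nat_eq_real_of_nat ennreal_mult[symmetric] mult.assoc)
  have PZ: "(\<integral>\<^sup>+\<omega>. (if (\<Sum>i<\<omega> []. B (shift i \<omega>)) \<noteq> 0 then 1 else 0) \<partial>treeM) = ennreal (1 - q)"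
  proof -
    have "(\<integral>\<^sup>+\<omega>. (if (\<Sum>i<\<omega> []. B (shift i \<omega>)) \<noteq> 0 then 1 else 0) \<partial>treeM) = (\<integral>\<^sup>+\<omega>. indicator (- {\<omega>. ZR (Suc R) \<omega>}) \<omega> \<partial>treeM)"
      unfolding B0 by (intro nn_integral_cong) (auto split: split_indicator simp del: ZR.simps)
    then show ?thesis
      using sets_ZR_compl[of "Suc R"] by (simp add: treeM.emeasure_eq_measure q_def del: ZR.simps \<theta>.simps)
  qed
  have "(\<integral>\<^sup>+\<omega>. of_nat (psi d R (TR (Suc (Suc R)) \<omega>)) \<partial>treeM)
      = ennreal c * (\<integral>\<^sup>+\<omega>'. \<integral>\<^sup>+\<omega>. h \<omega>' (\<Sum>i<\<omega> []. B (shift i \<omega>)) \<partial>treeM \<partial>treeM)"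
    unfolding psi by (rule mecke) measurable
  also have "(\<integral>\<^sup>+\<omega>'. \<integral>\<^sup>+\<omega>. h \<omega>' (\<Sum>i<\<omega> []. B (shift i \<omega>)) \<partial>treeM \<partial>treeM)
    = (\<integral>\<^sup>+\<omega>'. (if D \<omega>' = 0 then 1 else 0) + (if D \<omega>' = 1 then 1 else 0) * ennreal (1 - q) \<partial>treeM)"
    unfolding h_def
    by (intro nn_integral_cong, subst nn_integral_add) (auto simp: nn_integral_cmult PZ treeM.emeasure_space_1[simplified] simp del: sum_eq_0_iff)
  also have "\<dots> = (\<integral>\<^sup>+\<omega>'. indicator {\<omega>. D \<omega> = 0} \<omega>' \<partial>treeM) + (\<integral>\<^sup>+\<omega>'. (if D \<omega>' = 1 then 1 else 0) \<partial>treeM) * ennreal (1 - q)"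
  proof -
    have "{\<omega>\<in>space treeM. D \<omega> = 0} \<in> sets treeM" by measurable
    then have [measurable]: "{\<omega>. D \<omega> = 0} \<in> sets treeM" by simp
    show ?thesis
      by (subst nn_integral_add[symmetric] nn_integral_multc[symmetric]; (subst nn_integral_add[symmetric] nn_integral_multc[symmetric])?)
        (auto intro!: nn_integral_cong split: split_indicator simp: nn_integral_multc)
  qed
  also have "\<dots> = ennreal ((1 - q) ^ d + real d * q * (1 - q) ^ (d - 1) * (1 - q))"
  proof -
    have "{\<omega>\<in>space treeM. D \<omega> = 0} \<in> sets treeM" by measurable
    then have [measurable]: "{\<omega>. D \<omega> = 0} \<in> sets treeM" by simp
    show ?thesis unfolding PD1 using q PD0
      by (simp add: ennreal_mult[symmetric] ennreal_plus[symmetric] del: ennreal_plus)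
  qed
  also have "(1 - q) ^ d + real d * q * (1 - q) ^ (d - 1) * (1 - q) = (1 - q) ^ d * (1 + real d * q)"
  proof -
    have "(1 - q) ^ (d - 1) * (1 - q) = (1 - q) ^ d" using d_pos by (metis power_minus_mult)
    then have "real d * q * (1 - q) ^ (d - 1) * (1 - q) = real d * q * (1 - q) ^ d" by (simp only: mult.assoc)
    then show ?thesis by (simp add: algebra_simps)
  qed
  also have "ennreal c * ennreal ((1 - q) ^ d * (1 + real d * q)) = ennreal (c * ((1 - q) ^ d * (1 + real d * q)))"
    using c_pos by (simp add: ennreal_mult')
  finally show ?thesis unfolding q_def .
qed

lemma nn_integral_lower_functional:
  "(\<integral>\<^sup>+\<omega>. ennreal ((if zval d (Suc R) (TR (Suc (Suc R)) \<omega>) then 1 else 0) + real (psi d R (TR (Suc (Suc R)) \<omega>)) / real (d + 1)) \<partial>treeM)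
   = ennreal (\<theta> (Suc R) + c / real (d + 1) * ((1 - \<theta> (Suc R)) ^ d * (1 + real d * \<theta> (Suc R))))"
proof -
  define P where "P \<omega> = psi d R (TR (Suc (Suc R)) \<omega>)" for \<omega>
  have [measurable]: "P \<in> treeM \<rightarrow>\<^sub>M count_space UNIV" unfolding P_def by measurable
  have z: "zval d (Suc R) (TR (Suc (Suc R)) \<omega>) = ZR (Suc R) \<omega>" for \<omega> by (rule zval_TR) simp
  have [measurable]: "{\<omega>. ZR (Suc R) \<omega>} \<in> sets treeM" by (rule sets_ZR)
  have one: "ennreal (1 + y) = 1 + ennreal y" if "y \<ge> 0" for y :: real
    using that ennreal_plus[of 1 y] by simp
  have "(\<integral>\<^sup>+\<omega>. ennreal ((if ZR (Suc R) \<omega> then 1 else 0) + real (P \<omega>) / real (d + 1)) \<partial>treeM)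
     = (\<integral>\<^sup>+\<omega>. indicator {\<omega>. ZR (Suc R) \<omega>} \<omega> + ennreal (1 / real (d + 1)) * of_nat (P \<omega>) \<partial>treeM)"
    by (intro nn_integral_cong)
      (auto simp: ennreal_of_nat_eq_real_of_nat ennreal_mult[symmetric] one split: split_indicator simp del: ZR.simps)
  also have "\<dots> = emeasure treeM {\<omega>. ZR (Suc R) \<omega>} + ennreal (1 / real (d + 1)) * (\<integral>\<^sup>+\<omega>. of_nat (P \<omega>) \<partial>treeM)"
    by (subst nn_integral_add) (auto simp: nn_integral_cmult simp del: ZR.simps)
  also have "\<dots> = ennreal (\<theta> (Suc R) + c / real (d + 1) * ((1 - \<theta> (Suc R)) ^ d * (1 + real d * \<theta> (Suc R))))"
    unfolding P_def sum_psi_TR using c_pos \<theta>_bounds[of "Suc R"]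
    by (simp add: treeM.emeasure_eq_measure measure_ZR ennreal_mult[symmetric] ennreal_plus[symmetric] del: ZR.simps \<theta>.simps ennreal_plus of_nat_Suc)
  finally show ?thesis unfolding z P_def .
qed

end

section \<open>Roots of the fixed point equation\<close>

text \<open>The second entry of the maximum in \<open>h_fun\<close> as a function of
  \<open>t\<close>; the first entry is its value at \<open>1\<close>.\<close>

definition gfun :: "nat \<Rightarrow> real \<Rightarrow> real \<Rightarrow> real" where
  "gfun d c t = t + c * t * (1 - t) ^ d - c / real (d + 1) * (1 - (1 - t) ^ (d + 1))"

lemma gfun_1: "d > 0 \<Longrightarrow> gfun d c 1 = 1 - c / real (d + 1)"
  by (simp add: gfun_def)

context poisson_tree
begin

text \<open>On roots of \<open>t = exp (- c (1 - t)^d)\<close> this function agrees with \<^const>\<open>gfun\<close>, and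
  the sign of its derivative is that of \<open>exp (- c (1 - t)^d) - t\<close>.\<close>

definition Phi :: "real \<Rightarrow> real" where
  "Phi t = exp (- c * (1 - t) ^ d) + c * t * (1 - t) ^ d - c / real (d + 1) * (1 - (1 - t) ^ (d + 1))"

lemma Phi_deriv:
  "(Phi has_real_derivative c * real d * (1 - t) ^ (d - 1) * (exp (- c * (1 - t) ^ d) - t)) (at t)"
  unfolding Phi_def
  by (rule derivative_eq_intros refl | simp)+ (simp add: field_simps)

lemma root_ln:
  assumes "0 < t" "t < 1" "t = exp (- c * (1 - t) ^ d)"
  shows "ln t = - c * (1 - t) ^ d"
  using assms by (metis ln_exp)

text \<open>Here \<open>m\<close> is the numerator of the derivative of
  \<open>- ln x / (1 - x) ^ d\<close>. Its own derivative has the sign of \<open>1 - d * x\<close>,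
  so \<open>m\<close> rises up to \<open>1 / d\<close> and then falls to \<open>m 1 = 0\<close>.
  Once nonnegative, it is therefore positive until \<open>1\<close>.\<close>

lemma unimodal_sign:
  fixes m :: "real \<Rightarrow> real"
  defines "m \<equiv> \<lambda>t. 1 - 1 / t - real d * ln t"
  assumes "0 < s" "s < t" "t < 1" "m s \<ge> 0"
  shows "m t > 0"
proof -
  have d1: "(m has_real_derivative (1 / x\<^sup>2 - real d / x)) (at x)" if "x > 0" for x
    unfolding m_def using that
    by (auto intro!: derivative_eq_intros simp: power2_eq_square field_simps)
  have m1: "m 1 = 0" by (simp add: m_def)
  show ?thesis
  proof (cases "real d * t \<le> 1")
    case True
    have "m s < m t"
    proof (rule DERIV_pos_imp_increasing_open[OF assms(3)])
      fix x assume x: "s < x" "x < t"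
      then have "real d * x < 1"
        using True d_pos by (smt (verit) mult_strict_left_mono of_nat_0_less_iff)
      then have "1 / x\<^sup>2 - real d / x > 0"
        using x assms by (simp add: power2_eq_square field_simps)
      then show "\<exists>y. (m has_real_derivative y) (at x) \<and> 0 < y"
        using d1 x assms by (intro exI[of _ "1 / x\<^sup>2 - real d / x"]) auto
    next
      show "continuous_on {s..t} m"
        by (intro continuous_at_imp_continuous_on ballI DERIV_isCont[OF d1]) (use assms(2) in auto)
    qed
    then show ?thesis using assms by simp
  next
    case False
    have "m 1 < m t"
    proof (rule DERIV_neg_imp_decreasing_open[OF assms(4)])
      fix x assume x: "t < x" "x < 1"
      then have "real d * x > 1"
        using False d_pos by (smt (verit) mult_strict_left_mono of_nat_0_less_iff)
      then have "1 / x\<^sup>2 - real d / x < 0"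
        using x assms by (simp add: power2_eq_square field_simps)
      then show "\<exists>y. (m has_real_derivative y) (at x) \<and> y < 0"
        using d1 x assms by (intro exI[of _ "1 / x\<^sup>2 - real d / x"]) auto
    next
      show "continuous_on {t..1} m"
        by (intro continuous_at_imp_continuous_on ballI DERIV_isCont[OF d1]) (use assms(2,3) in auto)
    qed
    then show ?thesis using m1 by simp
  qed
qed

text \<open>\<open>- ln t / (1 - t)^d\<close> is first decreasing and then increasing on \<open>(0, 1)\<close>, so it takes the
  value \<open>c\<close> at most twice and exceeds it beyond the second time.\<close>

lemma sign_beyond_second_root:
  assumes "0 < s" "s < t" "t < u" "u < 1"
    and "s = exp (- c * (1 - s) ^ d)" "t = exp (- c * (1 - t) ^ d)"
  shows "u < exp (- c * (1 - u) ^ d)"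
proof -
  define L where "L x = - ln x / (1 - x) ^ d" for x :: real
  define m where "m x = 1 - 1 / x - real d * ln x" for x :: real
  have dL: "(L has_real_derivative m x / (1 - x) ^ (d + 1)) (at x)" if "0 < x" "x < 1" for x
  proof -
    define P where "P = (1 - x) ^ (d - 1)"
    have P: "P > 0" using that by (simp add: P_def)
    have e: "(1 - x) ^ d = (1 - x) * P" "(1 - x) ^ (d + 1) = (1 - x) * ((1 - x) * P)"
      unfolding P_def using d_pos by (cases d; simp)+
    have "(L has_real_derivative (- (1 / x) * (1 - x) ^ d - - ln x * - (real d * (1 - x) ^ (d - 1))) / ((1 - x) ^ d * (1 - x) ^ d)) (at x)"
      unfolding L_def using that
      by (auto intro!: derivative_eq_intros) (simp only: minus_divide_left minus_add_distrib diff_conv_add_uminus)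
    also have "(- (1 / x) * (1 - x) ^ d - - ln x * - (real d * (1 - x) ^ (d - 1))) / ((1 - x) ^ d * (1 - x) ^ d)
        = m x / (1 - x) ^ (d + 1)"
      unfolding e P_def[symmetric] m_def using that P by (simp add: divide_simps) (simp add: algebra_simps)
    finally show ?thesis .
  qed
  have Lc: "L x = c" if "0 < x" "x < 1" "x = exp (- c * (1 - x) ^ d)" for x
    using root_ln[OF that] that by (simp add: L_def)
  \<comment> \<open>Equal values of \<open>L\<close> at the two roots force a zero of
    \<open>m\<close> between them; by \<open>unimodal_sign\<close>, \<open>m\<close> is positive
    beyond that zero, and \<open>L\<close> increases there.\<close>
  obtain z where z: "s < z" "z < t" "L t - L s = (t - s) * (m z / (1 - z) ^ (d + 1))"
    using MVT2[of s t L "\<lambda>x. m x / (1 - x) ^ (d + 1)"] assms dL by fastforce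
  have "m z = 0" using z assms Lc[of s] Lc[of t] by auto
  obtain y where y: "t < y" "y < u" "L u - L t = (u - t) * (m y / (1 - y) ^ (d + 1))"
    using MVT2[of t u L "\<lambda>x. m x / (1 - x) ^ (d + 1)"] assms dL by fastforce
  have "m y > 0"
    using unimodal_sign[of z y] z y assms \<open>m z = 0\<close> unfolding m_def by auto
  then have "L u > L t" using y assms by (smt (verit) divide_pos_pos mult_pos_pos zero_less_power)
  then have "c < - ln u / (1 - u) ^ d" using Lc[of t] assms by (simp add: L_def)
  moreover have "(1 - u) ^ d > 0" using assms by simp
  ultimately have "c * (1 - u) ^ d < - ln u" by (simp only: pos_less_divide_eq)
  then have "ln u < - c * (1 - u) ^ d" by simp
  then show ?thesis using assms by (metis exp_less_mono exp_ln less_trans)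
qed

text \<open>If \<open>t\<close> is a second root below \<open>1\<close>, the derivative of
  \<open>Phi\<close> is nonnegative on the whole interval from \<open>t\<close> to \<open>1\<close>,
  so the value at \<open>t\<close> is at most the value at \<open>1\<close>. Otherwise
  \<open>t\<close> is \<open>s\<close> or \<open>1\<close> itself.\<close>

lemma gfun_root_le:
  assumes "0 < s" "s \<le> t" "t \<le> 1"
    and "s = exp (- c * (1 - s) ^ d)" "t = exp (- c * (1 - t) ^ d)"
  shows "gfun d c t \<le> max (gfun d c s) (gfun d c 1)"
proof -
  have Phi_eq: "Phi x = gfun d c x" if "x = exp (- c * (1 - x) ^ d)" for x
    using that by (simp add: Phi_def gfun_def)
  show ?thesis
  proof (cases "s = t \<or> t = 1")
    case False
    have "Phi t \<le> Phi 1"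
    proof (rule DERIV_nonneg_imp_nondecreasing[OF assms(3)])
      fix x assume x: "t \<le> x" "x \<le> 1"
      have "x \<le> exp (- c * (1 - x) ^ d)"
      proof (cases "x = t \<or> x = 1")
        case True
        then show ?thesis using assms(5) d_pos by (auto simp: zero_power)
      next
        case ne: False
        have "x < exp (- c * (1 - x) ^ d)"
          using sign_beyond_second_root[of s t x] assms False x ne by auto
        then show ?thesis by simp
      qed
      then show "\<exists>y. (Phi has_real_derivative y) (at x) \<and> 0 \<le> y"
        using Phi_deriv[of x] x c_pos by (intro exI conjI) (auto intro!: mult_nonneg_nonneg)
    qed
    moreover have "Phi 1 = gfun d c 1" using d_pos by (intro Phi_eq) simp
    ultimately show ?thesis using Phi_eq[OF assms(5)] by simp
  qed auto
qed

lemma exp_map_mono: "s \<le> t \<Longrightarrow> t \<le> 1 \<Longrightarrow> exp (- c * (1 - s) ^ d) \<le> exp (- c * (1 - t) ^ d)"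
  using c_pos by (auto intro!: mult_left_mono power_mono)

lemma \<theta>_incseq: "incseq \<theta>"
proof (rule incseq_SucI)
  show "\<theta> R \<le> \<theta> (Suc R)" for R
  proof (induction R)
    case (Suc R)
    then show ?case using \<theta>_bounds[of "Suc R"] by (subst (1 2) \<theta>.simps) (rule exp_map_mono)
  qed simp
qed

text \<open>Iterating an increasing map from \<open>0\<close> stays below every root, so the limit
  is itself the least root; in particular the infimum defining \<open>t_root\<close> is
  attained.\<close>

lemma \<theta>_tendsto: "\<theta> \<longlonglongrightarrow> t_root d c"
  and t_root_root: "t_root d c = exp (- c * (1 - t_root d c) ^ d)"
  and t_root_bounds: "0 < t_root d c" "t_root d c \<le> 1"
  and t_root_least: "0 < t \<Longrightarrow> t \<le> 1 \<Longrightarrow> t = exp (- c * (1 - t) ^ d) \<Longrightarrow> t_root d c \<le> t"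
proof -
  obtain l where l: "\<theta> \<longlonglongrightarrow> l"
    using incseq_convergent[OF \<theta>_incseq] \<theta>_bounds(2) by metis
  have "(\<lambda>R. exp (- c * (1 - \<theta> R) ^ d)) \<longlonglongrightarrow> exp (- c * (1 - l) ^ d)"
    by (intro tendsto_intros l)
  moreover have "(\<lambda>R. \<theta> (Suc R)) \<longlonglongrightarrow> l" using l by (rule LIMSEQ_Suc)
  ultimately have root: "l = exp (- c * (1 - l) ^ d)" by (simp add: LIMSEQ_unique)
  have "l > 0" by (subst root) simp
  have "l \<le> 1" using l \<theta>_bounds by (intro LIMSEQ_le_const2[OF l]) auto
  have least: "l \<le> t" if t: "0 < t" "t \<le> 1" "t = exp (- c * (1 - t) ^ d)" for t
  proof (rule LIMSEQ_le_const2[OF l], intro exI allI impI)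
    fix R show "\<theta> R \<le> t"
    proof (induction R)
      case (Suc R)
      have "\<theta> (Suc R) \<le> exp (- c * (1 - t) ^ d)"
        using exp_map_mono[OF Suc t(2)] by simp
      then show ?case by (rule order_trans) (rule eq_refl[OF t(3)[symmetric]])
    qed (use t in simp)
  qed
  have "t_root d c = l"
    unfolding t_root_def
    by (rule cInf_eq_minimum) (use root \<open>l > 0\<close> \<open>l \<le> 1\<close> least in auto)
  then show "\<theta> \<longlonglongrightarrow> t_root d c" "t_root d c = exp (- c * (1 - t_root d c) ^ d)"
    "0 < t_root d c" "t_root d c \<le> 1"
    "0 < t \<Longrightarrow> t \<le> 1 \<Longrightarrow> t = exp (- c * (1 - t) ^ d) \<Longrightarrow> t_root d c \<le> t"
    using l root \<open>l > 0\<close> \<open>l \<le> 1\<close> least by auto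
qed

lemma gfun_root_le_max:
  assumes "0 < t" "t \<le> 1" "t = exp (- c * (1 - t) ^ d)"
  shows "gfun d c t \<le> max (gfun d c (t_root d c)) (gfun d c 1)"
  using gfun_root_le[OF t_root_bounds(1) t_root_least[OF assms] assms(2) t_root_root assms(3)] .

end

lemma h_fun_eq: "h_fun k c = max (gfun (k + 1) c 1) (gfun (k + 1) c (t_root (k + 1) c))"
  by (simp add: h_fun_def gfun_def Let_def add.commute)

global_interpretation fs: vector_space "\<lambda>(a::real) (f :: nat set \<Rightarrow> real) x. a * f x"
  rewrites "vector_space.dim (\<lambda>(a::real) (f :: nat set \<Rightarrow> real) x. a * f x) = fdim"
proof -
  show vs: "vector_space (\<lambda>(a::real) (f :: nat set \<Rightarrow> real) x. a * f x)"
    by unfold_locales (auto simp: fun_eq_iff algebra_simps)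
  show "vector_space.dim (\<lambda>(a::real) (f :: nat set \<Rightarrow> real) x. a * f x) = fdim"
    by (simp add: fdim_def fun_eq_iff)
qed

section \<open>Dimension bounds for cocycles\<close>

definition fun_on :: "nat set set \<Rightarrow> (nat set \<Rightarrow> real) set" where
  "fun_on F = {\<phi>. \<forall>\<sigma>. \<phi> \<sigma> \<noteq> 0 \<longrightarrow> \<sigma> \<in> F}"

definition delta :: "nat set \<Rightarrow> nat set \<Rightarrow> real" where
  "delta \<sigma> = (\<lambda>\<sigma>'. if \<sigma>' = \<sigma> then 1 else 0)"

definition ip :: "nat set set \<Rightarrow> (nat set \<Rightarrow> real) \<Rightarrow> (nat set \<Rightarrow> real) \<Rightarrow> real" where
  "ip F f g = (\<Sum>\<sigma>\<in>F. f \<sigma> * g \<sigma>)"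

lemma sum_fun_apply: "(\<Sum>i\<in>I. f i :: 'b \<Rightarrow> real) x = (\<Sum>i\<in>I. f i x)"
  by (induction I rule: infinite_finite_induct) auto

lemma fun_on_expand:
  assumes "finite F" "\<phi> \<in> fun_on F"
  shows "\<phi> = (\<Sum>\<sigma>\<in>F. (\<lambda>x. \<phi> \<sigma> * delta \<sigma> x))"
proof
  fix x
  have "(\<Sum>\<sigma>\<in>F. \<phi> \<sigma> * delta \<sigma> x) = (\<Sum>\<sigma>\<in>F. if \<sigma> = x then \<phi> x else 0)"
    by (intro sum.cong) (auto simp: delta_def)
  also have "\<dots> = \<phi> x" using assms by (auto simp: fun_on_def)
  finally show "\<phi> x = (\<Sum>\<sigma>\<in>F. (\<lambda>x. \<phi> \<sigma> * delta \<sigma> x)) x" by (simp add: sum_fun_apply)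
qed

lemma fun_on_subspace: "fs.subspace (fun_on F)"
  unfolding fs.subspace_def fun_on_def mem_Collect_eq
proof (intro conjI ballI allI impI)
  fix f g :: "nat set \<Rightarrow> real" and \<sigma>
  assume "f \<in> {\<phi>. \<forall>\<sigma>. \<phi> \<sigma> \<noteq> 0 \<longrightarrow> \<sigma> \<in> F}" "g \<in> {\<phi>. \<forall>\<sigma>. \<phi> \<sigma> \<noteq> 0 \<longrightarrow> \<sigma> \<in> F}" "(f + g) \<sigma> \<noteq> 0"
  then show "\<sigma> \<in> F" by (cases "f \<sigma> = 0") auto
qed auto

lemma fun_on_span:
  assumes "finite F"
  shows "fun_on F \<subseteq> fs.span (delta ` F)"
proof
  fix \<phi> assume "\<phi> \<in> fun_on F"
  have "(\<Sum>\<sigma>\<in>F. (\<lambda>x. \<phi> \<sigma> * delta \<sigma> x)) \<in> fs.span (delta ` F)"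
    by (intro fs.span_sum fs.span_scale fs.span_base) auto
  then show "\<phi> \<in> fs.span (delta ` F)"
    using fun_on_expand[OF assms \<open>\<phi> \<in> fun_on F\<close>] by simp
qed

text \<open>The ambient function space is infinite-dimensional, where the dimension function is not
  monotone in general. Containment in \<open>fun_on F\<close> with \<open>F\<close> finite supplies
  a finite basis of \<open>W\<close>.\<close>

lemma fdim_mono:
  assumes "finite F" "W \<subseteq> fun_on F" "V \<subseteq> W"
  shows "fdim V \<le> fdim W"
proof -
  obtain B where B: "B \<subseteq> W" "fs.independent B" "W \<subseteq> fs.span B" "card B = fdim W"
    by (rule fs.basis_exists)
  have "finite B"
    using fs.independent_span_bound[of "delta ` F" B] B fun_on_span[OF assms(1)] assms by auto
  then show ?thesis
    using fs.dim_le_card[of V B] B assms by auto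
qed

lemma ip_scale: "ip F (\<lambda>x. a * f x) h = a * ip F f h"
  and ip_commute: "ip F f h = ip F h f"
  and ip_sum: "ip F (\<Sum>i\<in>I. f' i) h = (\<Sum>i\<in>I. ip F (f' i) h)"
  and ip_diff: "ip F (f - g) h = ip F f h - ip F g h"
  by (simp_all add: ip_def sum.distrib algebra_simps sum_distrib_left sum_distrib_right sum_fun_apply sum_subtractf
      sum.swap[of _ I])

lemma ip_self_nonneg: "0 \<le> ip F f f"
  by (simp add: ip_def sum_nonneg)

definition orthonormal :: "nat set set \<Rightarrow> (nat set \<Rightarrow> real) set \<Rightarrow> bool" where
  "orthonormal F B \<longleftrightarrow> finite B \<and> (\<forall>b\<in>B. \<forall>b'\<in>B. ip F b b' = (if b = b' then 1 else 0))"

lemma bessel: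
  assumes "orthonormal F B"
  shows "(\<Sum>b\<in>B. (ip F b z)\<^sup>2) \<le> ip F z z"
proof -
  define w where "w = (\<Sum>b\<in>B. (\<lambda>x. ip F b z * b x))"
  have fin: "finite B" using assms by (simp add: orthonormal_def)
  have zw: "ip F w z = (\<Sum>b\<in>B. (ip F b z)\<^sup>2)"
    by (simp add: w_def ip_sum ip_scale power2_eq_square)
  have bw: "ip F w b = ip F b z" if "b \<in> B" for b
  proof -
    have "ip F w b = (\<Sum>b'\<in>B. ip F b' z * ip F b' b)" by (simp add: w_def ip_sum ip_scale)
    also have "\<dots> = (\<Sum>b'\<in>B. if b' = b then ip F b z else 0)"
      using assms that by (intro sum.cong) (auto simp: orthonormal_def)
    finally show ?thesis using fin that by simp
  qed
  have "ip F w w = (\<Sum>b\<in>B. ip F b z * ip F b w)"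
    by (subst (1) w_def) (simp add: ip_sum ip_scale)
  also have "\<dots> = (\<Sum>b\<in>B. (ip F b z)\<^sup>2)"
    using bw by (intro sum.cong) (auto simp: ip_commute[of F _ w] power2_eq_square)
  finally have ww: "ip F w w = (\<Sum>b\<in>B. (ip F b z)\<^sup>2)" .
  have "0 \<le> ip F (z - w) (z - w)" by (rule ip_self_nonneg)
  also have "\<dots> = ip F z z - 2 * ip F w z + ip F w w"
    by (simp add: ip_diff ip_commute[of F _ "z - w"]) (simp add: ip_commute)
  finally show ?thesis using zw ww by simp
qed

text \<open>Each \<open>b\<close> has norm \<open>1\<close>, and its entry at
  \<open>\<sigma>\<close> is its inner product with \<open>z \<sigma>\<close>. Exchanging the sums
  over \<open>b\<close> and \<open>\<sigma>\<close> leaves Bessel's inequality for each single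
  \<open>z \<sigma>\<close>.\<close>

lemma orthonormal_card_le:
  assumes "finite F" "orthonormal F B"
    and "\<And>b \<sigma>. b \<in> B \<Longrightarrow> \<sigma> \<in> F \<Longrightarrow> ip F b (z \<sigma>) = b \<sigma>"
  shows "real (card B) \<le> (\<Sum>\<sigma>\<in>F. ip F (z \<sigma>) (z \<sigma>))"
proof -
  have "real (card B) = (\<Sum>b\<in>B. ip F b b)"
    using assms(2) by (simp add: orthonormal_def)
  also have "\<dots> = (\<Sum>\<sigma>\<in>F. \<Sum>b\<in>B. (ip F b (z \<sigma>))\<^sup>2)"
    unfolding ip_def[of F "_" "_"] using assms(3)
    by (subst sum.swap) (auto simp: ip_def[symmetric] power2_eq_square intro!: sum.cong)
  also have "\<dots> \<le> (\<Sum>\<sigma>\<in>F. ip F (z \<sigma>) (z \<sigma>))"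
    by (intro sum_mono bessel assms)
  finally show ?thesis .
qed

text \<open>The right-hand side dominates the trace of the orthogonal projection onto \<open>V\<close>, by Bessel's inequality.\<close>

lemma fdim_le_trace:
  assumes "finite F" "fs.subspace V" "V \<subseteq> fun_on F"
    and z: "\<And>b \<sigma>. b \<in> V \<Longrightarrow> \<sigma> \<in> F \<Longrightarrow> ip F b (z \<sigma>) = b \<sigma>"
  shows "real (fdim V) \<le> (\<Sum>\<sigma>\<in>F. ip F (z \<sigma>) (z \<sigma>))"
proof -
  \<comment> \<open>An orthonormal subset of \<open>V\<close> of maximal size will be an orthonormal
    basis. That a maximum exists follows from \<open>orthonormal_card_le\<close> with the unit
    vectors, which represent the evaluations and have norm \<open>1\<close>.\<close>
  define P where "P n \<longleftrightarrow> (\<exists>B. B \<subseteq> V \<and> orthonormal F B \<and> card B = n)" for n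
  have "P 0" unfolding P_def by (intro exI[of _ "{}"]) (auto simp: orthonormal_def)
  moreover have "n \<le> card F" if Pn: "P n" for n
  proof -
    obtain B where B: "B \<subseteq> V" "orthonormal F B" "card B = n" using Pn P_def by auto
    have d: "ip F b (delta \<sigma>) = b \<sigma>" if "\<sigma> \<in> F" for b \<sigma>
    proof -
      have "ip F b (delta \<sigma>) = (\<Sum>x\<in>F. if x = \<sigma> then b \<sigma> else 0)"
        unfolding ip_def by (intro sum.cong) (auto simp: delta_def)
      then show ?thesis using assms(1) that by simp
    qed
    have "real (card B) \<le> (\<Sum>\<sigma>\<in>F. ip F (delta \<sigma>) (delta \<sigma>))"
      using B by (intro orthonormal_card_le assms d)
    also have "\<dots> = real (card F)" using d by (simp add: delta_def)
    finally show ?thesis using B by simp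
  qed
  ultimately have n: "P (Greatest P)" "\<And>m. P m \<Longrightarrow> m \<le> Greatest P"
    using GreatestI_nat[of P 0 "card F"] Greatest_le_nat[of P _ "card F"] by auto
  define n where "n = Greatest P"
  note n = n[folded n_def]
  from n(1) obtain B where B: "B \<subseteq> V" "orthonormal F B" "card B = n" using P_def by auto
  have fin: "finite B" using B by (simp add: orthonormal_def)
  \<comment> \<open>A vector of \<open>V\<close> outside the span, reduced by its projection and
    normalised, would enlarge the maximal system.\<close>
  have "V \<subseteq> fs.span B"
  proof (rule ccontr)
    assume "\<not> V \<subseteq> fs.span B"
    then obtain v where v: "v \<in> V" "v \<notin> fs.span B" by auto
    define u where "u = (\<Sum>b\<in>B. (\<lambda>x. ip F b v * b x))"
    define w where "w = v - u"
    have uB: "u \<in> fs.span B" unfolding u_def by (intro fs.span_sum fs.span_scale fs.span_base)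
    have uV: "u \<in> V" unfolding u_def using B assms(2)
      by (intro fs.subspace_sum[OF assms(2)] fs.subspace_scale[OF assms(2)]) auto
    have wV: "w \<in> V" unfolding w_def using v uV by (intro fs.subspace_diff[OF assms(2)])
    have "w \<noteq> 0" using v uB unfolding w_def by auto
    have wb: "ip F w b = 0" if "b \<in> B" for b
    proof -
      have "ip F u b = (\<Sum>b'\<in>B. ip F b' v * ip F b' b)" by (simp add: u_def ip_sum ip_scale)
      also have "\<dots> = (\<Sum>b'\<in>B. if b' = b then ip F b v else 0)"
        using B that by (intro sum.cong) (auto simp: orthonormal_def)
      also have "\<dots> = ip F v b" using fin that by (simp add: ip_commute)
      finally show ?thesis by (simp add: w_def ip_diff)
    qed
    obtain \<sigma> where \<sigma>: "w \<sigma> \<noteq> 0" using \<open>w \<noteq> 0\<close> by (auto simp: fun_eq_iff)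
    then have "\<sigma> \<in> F" using wV assms(3) by (auto simp: fun_on_def)
    then have "0 < ip F w w"
      unfolding ip_def using \<sigma> assms(1) by (intro sum_pos2[of _ \<sigma>]) (auto simp: zero_less_mult_iff linorder_neq_iff)
    define e where "e = (\<lambda>x. (1 / sqrt (ip F w w)) * w x)"
    have ee: "ip F e e = 1"
    proof -
      let ?r = "sqrt (ip F w w)"
      have "ip F e e = (1 / ?r) * ip F w e" unfolding e_def by (rule ip_scale)
      also have "ip F w e = ip F e w" by (rule ip_commute)
      also have "ip F e w = (1 / ?r) * ip F w w" unfolding e_def by (rule ip_scale)
      also have "ip F w w = ?r * ?r" using \<open>0 < ip F w w\<close> by simp
      finally show ?thesis using \<open>0 < ip F w w\<close> by (simp del: real_sqrt_mult_self)
    qed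
    have eb: "ip F e b = 0" "ip F b e = 0" if "b \<in> B" for b
    proof -
      show "ip F e b = 0" unfolding e_def ip_scale using wb[OF that] by simp
      then show "ip F b e = 0" by (subst ip_commute)
    qed
    have eV: "e \<in> V" unfolding e_def by (rule fs.subspace_scale[OF assms(2) wV])
    have "e \<notin> B" using eb ee by force
    have "orthonormal F (insert e B)"
      using B(2) ee eb \<open>e \<notin> B\<close> by (auto simp: orthonormal_def)
    then have "P (Suc n)" unfolding P_def
      using B eV fin \<open>e \<notin> B\<close> by (intro exI[of _ "insert e B"]) auto
    then show False using n(2) by fastforce
  qed
  then have "fdim V \<le> card B" using fin by (intro fs.dim_le_card)
  also have "real (card B) \<le> (\<Sum>\<sigma>\<in>F. ip F (z \<sigma>) (z \<sigma>))"
    using B z by (intro orthonormal_card_le assms) auto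
  finally show ?thesis by simp
qed

lemma fdim_fun_on:
  assumes "finite F"
  shows "card F \<le> fdim (fun_on F)"
proof -
  have inj: "inj_on delta F"
  proof (rule inj_onI)
    fix \<sigma> \<tau> assume "delta \<sigma> = delta \<tau>"
    then have "delta \<sigma> \<sigma> = delta \<tau> \<sigma>" by simp
    then show "\<sigma> = \<tau>" by (simp add: delta_def split: if_splits)
  qed
  have "fs.independent (delta ` F)"
  proof
    assume "fs.dependent (delta ` F)"
    then obtain u \<sigma> where \<sigma>: "\<sigma> \<in> F" "u (delta \<sigma>) \<noteq> 0"
      and z: "(\<Sum>v\<in>delta ` F. (\<lambda>x. u v * v x)) = 0"
      using fs.dependent_finite[OF finite_imageI[OF assms]] by auto
    have "0 = (\<Sum>v\<in>delta ` F. (\<lambda>x. u v * v x)) \<sigma>" by (simp add: z)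
    also have "\<dots> = (\<Sum>\<sigma>'\<in>F. if \<sigma>' = \<sigma> then u (delta \<sigma>) else 0)"
      unfolding sum.reindex[OF inj] o_def sum_fun_apply by (intro sum.cong) (auto simp: delta_def)
    finally show False using \<sigma> assms by simp
  qed
  then have "card (delta ` F) \<le> fdim (delta ` F)"
    by (simp add: fs.dim_eq_card_independent)
  also have "\<dots> \<le> fdim (fun_on F)"
    by (rule fdim_mono[OF assms order_refl]) (auto simp: fun_on_def delta_def split: if_splits)
  finally show ?thesis by (simp add: card_image inj)
qed

definition linear_functional :: "((nat set \<Rightarrow> real) \<Rightarrow> real) \<Rightarrow> bool" where
  "linear_functional l \<longleftrightarrow> (\<forall>f g. l (f + g) = l f + l g) \<and> (\<forall>a f. l (\<lambda>x. a * f x) = a * l f)"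

lemma subspace_constraint:
  assumes "fs.subspace V" "linear_functional l"
  shows "fs.subspace {\<phi>\<in>V. l \<phi> = 0}"
proof -
  have "l (\<lambda>x. 0 * (0 :: nat set \<Rightarrow> real) x) = 0 * l 0"
    using assms(2) unfolding linear_functional_def by blast
  then have "l 0 = 0" by (simp add: zero_fun_def)
  then show ?thesis using assms by (auto simp: fs.subspace_def linear_functional_def)
qed

lemma fdim_constraint:
  assumes "finite F" "fs.subspace V" "V \<subseteq> fun_on F" and l: "linear_functional l"
  shows "fdim V \<le> fdim {\<phi>\<in>V. l \<phi> = 0} + 1"
proof (cases "\<exists>v\<in>V. l v \<noteq> 0")
  case True
  then obtain v where v: "v \<in> V" "l v \<noteq> 0" by auto
  let ?W = "{\<phi>\<in>V. l \<phi> = 0}"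
  obtain B where B: "B \<subseteq> ?W" "fs.independent B" "?W \<subseteq> fs.span B" "card B = fdim ?W"
    by (rule fs.basis_exists)
  have fin: "finite B"
    using fs.independent_span_bound[of "delta ` F" B] B fun_on_span[OF assms(1)] assms by auto
  have "V \<subseteq> fs.span (insert v B)"
  proof
    fix \<phi> assume \<phi>: "\<phi> \<in> V"
    define w where "w = \<phi> - (\<lambda>x. (l \<phi> / l v) * v x)"
    have "w \<in> V" unfolding w_def
      by (intro fs.subspace_diff[OF assms(2)] fs.subspace_scale[OF assms(2)] \<phi> v)
    moreover have "l w = 0"
    proof -
      have "l \<phi> = l (w + (\<lambda>x. (l \<phi> / l v) * v x))" by (simp add: w_def)
      also have "\<dots> = l w + l (\<lambda>x. (l \<phi> / l v) * v x)"
        using l unfolding linear_functional_def by blast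
      also have "l (\<lambda>x. (l \<phi> / l v) * v x) = (l \<phi> / l v) * l v"
        using l unfolding linear_functional_def by blast
      finally have "l \<phi> = l w + l \<phi> / l v * l v" .
      then show ?thesis using v by simp
    qed
    ultimately have "w \<in> fs.span (insert v B)"
      using B fs.span_mono[of B "insert v B"] by auto
    moreover have "(\<lambda>x. (l \<phi> / l v) * v x) \<in> fs.span (insert v B)"
      by (intro fs.span_scale fs.span_base) auto
    ultimately have "w + (\<lambda>x. (l \<phi> / l v) * v x) \<in> fs.span (insert v B)" by (rule fs.span_add)
    then show "\<phi> \<in> fs.span (insert v B)" by (simp add: w_def)
  qed
  then have "fdim V \<le> card (insert v B)" using fin by (intro fs.dim_le_card) auto
  also have "\<dots> \<le> fdim ?W + 1" using fin B(4) by (simp add: card_insert_if)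
  finally show ?thesis .
next
  case False
  then have "{\<phi>\<in>V. l \<phi> = 0} = V" by auto
  then show ?thesis by simp
qed

lemma fdim_constraints:
  assumes "finite F" "finite T" "fs.subspace V" "V \<subseteq> fun_on F" "\<And>\<tau>. \<tau> \<in> T \<Longrightarrow> linear_functional (l \<tau>)"
  shows "fdim V \<le> fdim {\<phi>\<in>V. \<forall>\<tau>\<in>T. l \<tau> \<phi> = 0} + card T"
  using assms(2,5)
proof (induction T rule: finite_induct)
  case (insert t T)
  let ?W = "{\<phi>\<in>V. \<forall>\<tau>\<in>T. l \<tau> \<phi> = 0}"
  have sub: "fs.subspace ?W"
    using insert(1,4)
  proof (induction T rule: finite_induct)
    case (insert t T)
    have "{\<phi>\<in>V. \<forall>\<tau>\<in>insert t T. l \<tau> \<phi> = 0} = {\<phi>\<in>{\<phi>\<in>V. \<forall>\<tau>\<in>T. l \<tau> \<phi> = 0}. l t \<phi> = 0}" by auto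
    then show ?case using subspace_constraint[of "{\<phi>\<in>V. \<forall>\<tau>\<in>T. l \<tau> \<phi> = 0}" "l t"] insert by auto
  qed (use assms(3) in simp)
  have "fdim V \<le> fdim ?W + card T" using insert by auto
  also have "fdim ?W \<le> fdim {\<phi>\<in>?W. l t \<phi> = 0} + 1"
    using assms insert by (intro fdim_constraint[OF assms(1) sub]) auto
  also have "{\<phi>\<in>?W. l t \<phi> = 0} = {\<phi>\<in>V. \<forall>\<tau>\<in>insert t T. l \<tau> \<phi> = 0}" by auto
  finally show ?case using insert by simp
qed simp

section \<open>Cocycles of a simplicial complex\<close>

definition faces :: "nat set set \<Rightarrow> nat \<Rightarrow> nat set set" where
  "faces K m = {\<sigma> \<in> K. finite \<sigma> \<and> card \<sigma> = m}"

lemma finite_faces: "finite K \<Longrightarrow> finite (faces K m)"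
  by (simp add: faces_def)

lemma cochains_eq: "cochains K m = fun_on (faces K m)"
  by (auto simp: cochains_def fun_on_def faces_def)

text \<open>The sign that the coboundary attaches to the facet of \<open>\<tau>\<close> opposite to \<open>u\<close>.\<close>

definition sgn_at :: "nat set \<Rightarrow> nat \<Rightarrow> real" where
  "sgn_at \<tau> u = (- 1) ^ the_inv_into {..<card \<tau>} (nth (sorted_list_of_set \<tau>)) u"

lemma sgn_at_square: "sgn_at \<tau> u * sgn_at \<tau> u = 1"
  by (simp add: sgn_at_def flip: power_mult_distrib)

text \<open>Indexing the facets by the omitted vertex instead of its position lets the cocycle
  equation be solved for any chosen facet.\<close>

lemma coboundary_eq:
  assumes "\<tau> \<in> faces K (m + 1)"
  shows "coboundary K m \<phi> \<tau> = (\<Sum>u\<in>\<tau>. sgn_at \<tau> u * \<phi> (\<tau> - {u}))"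
proof -
  have \<tau>: "\<tau> \<in> K" "finite \<tau>" "card \<tau> = m + 1" using assms by (auto simp: faces_def)
  have bij: "bij_betw (nth (sorted_list_of_set \<tau>)) {..<card \<tau>} \<tau>"
    by (rule bij_betw_nth) (auto simp: \<tau>)
  have "(\<Sum>u\<in>\<tau>. sgn_at \<tau> u * \<phi> (\<tau> - {u}))
      = (\<Sum>i<card \<tau>. sgn_at \<tau> (sorted_list_of_set \<tau> ! i) * \<phi> (\<tau> - {sorted_list_of_set \<tau> ! i}))"
    by (rule sum.reindex_bij_betw[OF bij, symmetric])
  also have "\<dots> = (\<Sum>i<card \<tau>. (- 1) ^ i * \<phi> (\<tau> - {sorted_list_of_set \<tau> ! i}))"
    using bij by (intro sum.cong refl) (simp add: sgn_at_def the_inv_into_f_f bij_betw_def)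
  finally show ?thesis using \<tau> by (simp add: coboundary_def)
qed

lemma coboundary_eq_0: "\<tau> \<notin> faces K (m + 1) \<Longrightarrow> coboundary K m \<phi> \<tau> = 0"
  by (auto simp: coboundary_def faces_def)

lemma coboundary_zero_iff:
  "coboundary K m \<phi> = 0 \<longleftrightarrow> (\<forall>\<tau>\<in>faces K (m + 1). (\<Sum>u\<in>\<tau>. sgn_at \<tau> u * \<phi> (\<tau> - {u})) = 0)"
proof
  assume "coboundary K m \<phi> = 0"
  then show "\<forall>\<tau>\<in>faces K (m + 1). (\<Sum>u\<in>\<tau>. sgn_at \<tau> u * \<phi> (\<tau> - {u})) = 0"
    using coboundary_eq[of _ K m \<phi>] by simp
next
  assume *: "\<forall>\<tau>\<in>faces K (m + 1). (\<Sum>u\<in>\<tau>. sgn_at \<tau> u * \<phi> (\<tau> - {u})) = 0"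
  show "coboundary K m \<phi> = 0"
  proof
    fix \<tau>
    show "coboundary K m \<phi> \<tau> = 0 \<tau>"
      using * coboundary_eq[of \<tau> K m \<phi>] coboundary_eq_0[of \<tau> K m \<phi>]
      by (cases "\<tau> \<in> faces K (m + 1)") simp_all
  qed
qed

definition cocycles :: "nat set set \<Rightarrow> nat \<Rightarrow> (nat set \<Rightarrow> real) set" where
  "cocycles K m = {\<phi> \<in> cochains K m. coboundary K m \<phi> = 0}"

definition nu :: "nat set set \<Rightarrow> nat \<Rightarrow> nat" where
  "nu K m = fdim (cocycles K m)"

lemma linear_functional_face: "linear_functional (\<lambda>\<phi>. \<Sum>u\<in>\<tau>. sgn_at \<tau> u * \<phi> (\<tau> - {u}))"
  by (auto simp: linear_functional_def sum.distrib sum_distrib_left algebra_simps)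

lemma linear_functional_eval: "linear_functional (\<lambda>\<phi>. \<phi> \<sigma>)"
  by (auto simp: linear_functional_def)

lemma cocycles_eq:
  "cocycles K m = {\<phi> \<in> fun_on (faces K m). \<forall>\<tau>\<in>faces K (m + 1). (\<Sum>u\<in>\<tau>. sgn_at \<tau> u * \<phi> (\<tau> - {u})) = 0}"
  by (simp add: cocycles_def cochains_eq coboundary_zero_iff)

lemma cocycles_subspace: "fs.subspace (cocycles K m)"
proof -
  have l: "linear_functional (\<lambda>\<phi>. \<Sum>u\<in>\<tau>. sgn_at \<tau> u * \<phi> (\<tau> - {u}))" for \<tau>
    by (rule linear_functional_face)
  have "cocycles K m = fun_on (faces K m) \<inter> (\<Inter>\<tau>\<in>faces K (m + 1). {\<phi>\<in>UNIV. (\<Sum>u\<in>\<tau>. sgn_at \<tau> u * \<phi> (\<tau> - {u})) = 0})"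
    by (auto simp: cocycles_eq)
  then show ?thesis
    using fun_on_subspace subspace_constraint[OF fs.subspace_UNIV l]
    by (auto intro!: fs.subspace_inter fs.subspace_Int)
qed

lemma cocycles_sub: "cocycles K m \<subseteq> fun_on (faces K m)"
  by (auto simp: cocycles_eq)

text \<open>The image of the coboundary is spanned by the images of the unit cochains, one for each
  face with \<open>k\<close> vertices. Both bounds are valid for truncated subtraction.\<close>

lemma betti_bounds:
  assumes "finite K"
  shows "betti k K \<le> nu K (k + 1)" "nu K (k + 1) \<le> betti k K + card (faces K k)"
proof -
  show "betti k K \<le> nu K (k + 1)" by (simp add: betti_def nu_def cocycles_def)
  let ?F = "faces K k"
  have "coboundary K k ` cochains K k \<subseteq> fs.span (coboundary K k ` delta ` ?F)"
  proof
    fix \<psi> assume "\<psi> \<in> coboundary K k ` cochains K k"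
    then obtain \<phi> where \<phi>: "\<phi> \<in> fun_on ?F" "\<psi> = coboundary K k \<phi>" by (auto simp: cochains_eq)
    have "\<psi> = (\<Sum>\<sigma>\<in>?F. (\<lambda>x. \<phi> \<sigma> * coboundary K k (delta \<sigma>) x))"
    proof
      fix \<tau>
      show "\<psi> \<tau> = (\<Sum>\<sigma>\<in>?F. (\<lambda>x. \<phi> \<sigma> * coboundary K k (delta \<sigma>) x)) \<tau>"
      proof (cases "\<tau> \<in> faces K (k + 1)")
        case True
        have e: "\<phi> x = (\<Sum>\<sigma>\<in>?F. \<phi> \<sigma> * delta \<sigma> x)" for x
        proof -
          have "\<phi> x = (\<Sum>\<sigma>\<in>?F. (\<lambda>x. \<phi> \<sigma> * delta \<sigma> x)) x"
            by (rule fun_cong[OF fun_on_expand[OF finite_faces[OF assms] \<phi>(1)]])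
          then show ?thesis unfolding sum_fun_apply .
        qed
        have "\<psi> \<tau> = (\<Sum>u\<in>\<tau>. sgn_at \<tau> u * (\<Sum>\<sigma>\<in>?F. \<phi> \<sigma> * delta \<sigma> (\<tau> - {u})))"
          unfolding \<phi>(2) coboundary_eq[OF True] by (simp only: e[of "\<tau> - {u}" for u])
        also have "\<dots> = (\<Sum>\<sigma>\<in>?F. \<phi> \<sigma> * (\<Sum>u\<in>\<tau>. sgn_at \<tau> u * delta \<sigma> (\<tau> - {u})))"
          unfolding sum_distrib_left by (subst sum.swap) (simp add: ac_simps)
        finally show ?thesis unfolding sum_fun_apply coboundary_eq[OF True] .
      next
        case False
        then show ?thesis by (simp add: \<phi>(2) coboundary_eq_0 sum_fun_apply)
      qed
    qed
    note * = this
    show "\<psi> \<in> fs.span (coboundary K k ` delta ` ?F)"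
      unfolding * by (intro fs.span_sum fs.span_scale, rule fs.span_base) simp
  qed
  then have "fdim (coboundary K k ` cochains K k) \<le> card (coboundary K k ` delta ` ?F)"
    using finite_faces[OF assms] by (intro fs.dim_le_card) auto
  also have "\<dots> \<le> card ?F"
    using finite_faces[OF assms] by (metis card_image_le finite_imageI le_trans)
  finally show "nu K (k + 1) \<le> betti k K + card ?F" by (simp add: betti_def nu_def cocycles_def)
qed

text \<open>Among cochains supported on \<open>Z\<close>, the cocycle equation is automatic at every
  coface without a facet in \<open>Z\<close>. Only the remaining cofaces impose conditions, each
  lowering the dimension by at most one.\<close>

lemma nu_ge:
  assumes "finite K" "Z \<subseteq> faces K m"
  shows "card Z \<le> nu K m + card {\<tau> \<in> faces K (m + 1). \<exists>u\<in>\<tau>. \<tau> - {u} \<in> Z}"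
proof -
  let ?F = "faces K m" and ?B = "{\<tau> \<in> faces K (m + 1). \<exists>u\<in>\<tau>. \<tau> - {u} \<in> Z}"
  let ?l = "\<lambda>\<tau> \<phi>. \<Sum>u\<in>\<tau>. sgn_at \<tau> u * \<phi> (\<tau> - {u}) :: real"
  have finZ: "finite Z" using assms finite_faces finite_subset by blast
  have "card Z \<le> fdim (fun_on Z)" using finZ by (rule fdim_fun_on)
  also have "\<dots> \<le> fdim {\<phi>\<in>fun_on Z. \<forall>\<tau>\<in>?B. ?l \<tau> \<phi> = 0} + card ?B"
    using finite_faces[OF assms(1)]
    by (intro fdim_constraints[OF finZ _ fun_on_subspace order_refl] linear_functional_face) auto
  also have "fdim {\<phi>\<in>fun_on Z. \<forall>\<tau>\<in>?B. ?l \<tau> \<phi> = 0} \<le> nu K m"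
    unfolding nu_def
  proof (rule fdim_mono[OF finite_faces[OF assms(1)] cocycles_sub])
    show "{\<phi>\<in>fun_on Z. \<forall>\<tau>\<in>?B. ?l \<tau> \<phi> = 0} \<subseteq> cocycles K m"
    proof
      fix \<phi> assume \<phi>: "\<phi> \<in> {\<phi>\<in>fun_on Z. \<forall>\<tau>\<in>?B. ?l \<tau> \<phi> = 0}"
      have "?l \<tau> \<phi> = 0" if "\<tau> \<in> faces K (m + 1)" for \<tau>
      proof (cases "\<tau> \<in> ?B")
        case False
        then have "\<phi> (\<tau> - {u}) = 0" if "u \<in> \<tau>" for u
          using \<phi> that \<open>\<tau> \<in> faces K (m + 1)\<close> by (auto simp: fun_on_def)
        then show ?thesis by simp
      qed (use \<phi> in auto)
      moreover have "\<phi> \<in> fun_on ?F" using \<phi> assms(2) by (auto simp: fun_on_def)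
      ultimately show "\<phi> \<in> cocycles K m" by (auto simp: cocycles_eq)
    qed
  qed
  finally show ?thesis by simp
qed

lemma nu_le_trace:
  assumes "finite K"
    and "\<And>b \<sigma>. b \<in> cocycles K m \<Longrightarrow> \<sigma> \<in> faces K m \<Longrightarrow> ip (faces K m) b (z \<sigma>) = b \<sigma>"
  shows "real (nu K m) \<le> (\<Sum>\<sigma>\<in>faces K m. ip (faces K m) (z \<sigma>) (z \<sigma>))"
  unfolding nu_def
  by (intro fdim_le_trace finite_faces assms(1) cocycles_subspace cocycles_sub assms(2))

text \<open>Imposing the equations at the new cofaces turns a cocycle of \<open>K'\<close> into one
  of \<open>K\<close>; requiring a cocycle of \<open>K\<close> to vanish on the new faces turns it
  into one of \<open>K'\<close>. This controls the effect of a single edge in the variance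
  estimate.\<close>

lemma nu_subcomplex:
  assumes "finite K" "K' \<subseteq> K"
  shows "nu K' m \<le> nu K m + card (faces K (m + 1) - faces K' (m + 1))"
    and "nu K m \<le> nu K' m + card (faces K m - faces K' m)"
proof -
  let ?l = "\<lambda>\<tau> \<phi>. \<Sum>u\<in>\<tau>. sgn_at \<tau> u * \<phi> (\<tau> - {u}) :: real"
  have finK': "finite K'" using assms finite_subset by blast
  have sub: "faces K' j \<subseteq> faces K j" for j using assms by (auto simp: faces_def)
  note fin = finite_faces[OF assms(1)] finite_faces[OF finK']
  let ?N = "faces K (m + 1) - faces K' (m + 1)" and ?M = "faces K m - faces K' m"
  have "nu K' m \<le> fdim {\<phi>\<in>cocycles K' m. \<forall>\<tau>\<in>?N. ?l \<tau> \<phi> = 0} + card ?N"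
    unfolding nu_def using fin
    by (intro fdim_constraints[OF fin(2)[of m] _ cocycles_subspace cocycles_sub] linear_functional_face) auto
  also have "fdim {\<phi>\<in>cocycles K' m. \<forall>\<tau>\<in>?N. ?l \<tau> \<phi> = 0} \<le> nu K m"
    unfolding nu_def
    by (rule fdim_mono[OF fin(1) cocycles_sub]) (use sub[of m] in \<open>auto simp: cocycles_eq fun_on_def\<close>)
  finally show "nu K' m \<le> nu K m + card ?N" by simp
  have "nu K m \<le> fdim {\<phi>\<in>cocycles K m. \<forall>\<sigma>\<in>?M. \<phi> \<sigma> = 0} + card ?M"
    unfolding nu_def using fin
    by (intro fdim_constraints[OF fin(1)[of m] _ cocycles_subspace cocycles_sub] linear_functional_eval) auto
  also have "fdim {\<phi>\<in>cocycles K m. \<forall>\<sigma>\<in>?M. \<phi> \<sigma> = 0} \<le> nu K' m"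
    unfolding nu_def
    by (rule fdim_mono[OF fin(2) cocycles_sub]) (use sub[of "m + 1"] in \<open>auto simp: cocycles_eq fun_on_def\<close>)
  finally show "nu K m \<le> nu K' m + card ?M" by simp
qed

lemma nu_le_faces: "finite K \<Longrightarrow> nu K m \<le> card (faces K m)"
proof -
  assume "finite K"
  note fin = finite_faces[OF this, of m]
  have "nu K m \<le> card (delta ` faces K m)"
    unfolding nu_def using fin fun_on_span[OF fin] cocycles_sub[of K m]
    by (intro fs.dim_le_card) auto
  also have "\<dots> \<le> card (faces K m)" using fin by (rule card_image_le)
  finally show ?thesis .
qed

section \<open>Exploration of the neighbourhood of a face\<close>

text \<open>For a face \<open>Y\<close> these vertices correspond to its cofaces. For empty
  \<open>Y\<close> the condition is vacuous and the set infinite, hence the nonemptiness assumptions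
  later on.\<close>

definition cof :: "nat set set \<Rightarrow> nat set \<Rightarrow> nat set" where
  "cof G Y = {w. w \<notin> Y \<and> (\<forall>y\<in>Y. {w, y} \<in> G)}"

text \<open>Faces are ordered lists \<open>xs\<close>; replacing entry \<open>i\<close> by a common neighbour \<open>w\<close> leads to the facet of the coface
  \<open>insert w (set xs)\<close> that misses \<open>xs ! i\<close>. The set \<open>ex\<close> contains this missed vertex, which would otherwise lead back to the
  coface just left.\<close>

primrec explore :: "nat \<Rightarrow> nat \<Rightarrow> nat set set \<Rightarrow> nat set \<Rightarrow> nat list \<Rightarrow> nat tree" where
  "explore d 0 G ex xs = Node [] []"
| "explore d (Suc R) G ex xs = (let ws = sorted_list_of_set (cof G (set xs) - ex) in
     Node ws (map (\<lambda>q. explore d R G {xs ! (q mod d)} (xs[q mod d := ws ! (q div d)])) [0..<d * length ws]))"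

text \<open>The possible outcomes of an exploration that never meets a vertex twice. The lists are
  sorted because \<open>explore\<close> enumerates cofaces in increasing order, so every outcome has
  a single representation.\<close>

primrec lt :: "nat \<Rightarrow> nat \<Rightarrow> nat tree \<Rightarrow> bool" where
  "lt d 0 L = (L = Node [] [])"
| "lt d (Suc R) L = (case L of Node ws ts \<Rightarrow> sorted ws \<and> distinct ws \<and> length ts = d * length ws \<and>
     (\<forall>q<d * length ws. lt d R (ts ! q) \<and> set ws \<inter> set_tree (ts ! q) = {} \<and>
       (\<forall>q'<d * length ws. q \<noteq> q' \<longrightarrow> set_tree (ts ! q) \<inter> set_tree (ts ! q') = {})))"

text \<open>The faces met in the exploration, each with its remaining depth, its excluded vertices and its list of cofaces, and
  the edges \<open>SE\<close> found on the way.\<close>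

primrec nd :: "nat \<Rightarrow> nat \<Rightarrow> nat set \<Rightarrow> nat list \<Rightarrow> nat tree \<Rightarrow> (nat \<times> nat set \<times> nat list \<times> nat list) set" where
  "nd d 0 ex xs L = {(0, ex, xs, [])}"
| "nd d (Suc R) ex xs L = (case L of Node ws ts \<Rightarrow> insert (Suc R, ex, xs, ws)
     (\<Union>q<d * length ws. nd d R {xs ! (q mod d)} (xs[q mod d := ws ! (q div d)]) (ts ! q)))"

primrec SE :: "nat \<Rightarrow> nat \<Rightarrow> nat list \<Rightarrow> nat tree \<Rightarrow> nat set set" where
  "SE d 0 xs L = {}"
| "SE d (Suc R) xs L = (case L of Node ws ts \<Rightarrow> (\<lambda>(w, y). {w, y}) ` (set ws \<times> set xs) \<union>
     (\<Union>q<d * length ws. SE d R (xs[q mod d := ws ! (q div d)]) (ts ! q)))"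

definition Kn :: "nat set \<Rightarrow> nat set set" where
  "Kn Y = {e. e \<subseteq> Y \<and> card e = 2}"

lemma set_list_update_distinct:
  assumes "distinct xs" "i < length xs"
  shows "set (xs[i := w]) = insert w (set xs - {xs ! i})"
  using assms by (simp add: set_update_distinct)

lemma nth_block_less: "q < d * (N::nat) \<Longrightarrow> q div d < N" "q < d * N \<Longrightarrow> q mod d < d"
  by (auto simp: less_mult_imp_div_less mult.commute) (cases "d = 0"; simp)

definition rooted :: "nat \<Rightarrow> nat \<Rightarrow> nat list \<Rightarrow> nat tree \<Rightarrow> bool" where
  "rooted d R xs L \<longleftrightarrow> lt d R L \<and> length xs = d \<and> distinct xs \<and> set xs \<inter> set_tree L = {}"

lemma set_tree_Node: "length ts = n \<Longrightarrow> set_tree (Node ws ts) = set ws \<union> (\<Union>q<n. set_tree (ts ! q))"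
proof -
  assume "length ts = n"
  then have "set ts = (\<lambda>q. ts ! q) ` {..<n}" by (auto simp: set_conv_nth)
  then show ?thesis by simp
qed

lemma rooted_Suc:
  assumes "rooted d (Suc R) xs (Node ws ts)"
  shows "sorted ws" "distinct ws" "length ts = d * length ws" "length xs = d" "distinct xs"
    "set xs \<inter> set ws = {}"
    "set_tree (Node ws ts) = set ws \<union> (\<Union>q<d * length ws. set_tree (ts ! q))"
    "q < d * length ws \<Longrightarrow> rooted d R (xs[q mod d := ws ! (q div d)]) (ts ! q)"
    "q < d * length ws \<Longrightarrow> set (xs[q mod d := ws ! (q div d)]) = insert (ws ! (q div d)) (set xs - {xs ! (q mod d)})"
    "q < d * length ws \<Longrightarrow> ws ! (q div d) \<in> set ws"
    "q < d * length ws \<Longrightarrow> xs ! (q mod d) \<in> set xs"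
    "q < d * length ws \<Longrightarrow> (set xs \<union> set ws) \<inter> set_tree (ts ! q) = {}"
    "q < d * length ws \<Longrightarrow> q' < d * length ws \<Longrightarrow> q \<noteq> q' \<Longrightarrow> set_tree (ts ! q) \<inter> set_tree (ts ! q') = {}"
proof -
  show 1: "sorted ws" "distinct ws" "length ts = d * length ws" "length xs = d" "distinct xs"
    using assms by (auto simp: rooted_def)
  show tr: "set_tree (Node ws ts) = set ws \<union> (\<Union>q<d * length ws. set_tree (ts ! q))"
    using 1 by (intro set_tree_Node)
  show dj: "set xs \<inter> set ws = {}" using assms tr by (auto simp: rooted_def)
  {
    assume q: "q < d * length ws"
    note ql = nth_block_less[OF q]
    show upd: "set (xs[q mod d := ws ! (q div d)]) = insert (ws ! (q div d)) (set xs - {xs ! (q mod d)})"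
      using 1 ql by (intro set_list_update_distinct) auto
    show w: "ws ! (q div d) \<in> set ws" using ql by simp
    show "xs ! (q mod d) \<in> set xs" using ql 1 by simp
    show dj2: "(set xs \<union> set ws) \<inter> set_tree (ts ! q) = {}"
      using assms q unfolding rooted_def tr by auto
    have "distinct (xs[q mod d := ws ! (q div d)])"
      using 1 w dj by (intro distinct_list_update) auto
    then show "rooted d R (xs[q mod d := ws ! (q div d)]) (ts ! q)"
      using assms q 1 dj2 w unfolding rooted_def upd by auto
    show "q' < d * length ws \<Longrightarrow> q \<noteq> q' \<Longrightarrow> set_tree (ts ! q) \<inter> set_tree (ts ! q') = {}"
      using assms q by (auto simp: rooted_def)
  }
qed

lemma nd_root: "\<exists>r ws. (r, ex, xs, ws) \<in> nd d R ex xs L"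
  by (cases R; cases L) auto

lemma nd_props:
  assumes "rooted d R xs L" "ex \<inter> set_tree L = {}" "(r, ex', ys, ws') \<in> nd d R ex xs L"
  shows "length ys = d \<and> distinct ys \<and> set ys \<subseteq> set xs \<union> set_tree L \<and> set ws' \<subseteq> set_tree L \<and>
    set ws' \<inter> set ys = {} \<and> set ws' \<inter> ex' = {} \<and> (ws' \<noteq> [] \<longrightarrow> r > 0) \<and>
    (\<forall>w\<in>set ws'. \<forall>y\<in>set ys. {w, y} \<in> SE d R xs L)"
  using assms
proof (induction R arbitrary: xs L ex)
  case 0
  then show ?case by (auto simp: rooted_def)
next
  case (Suc R)
  obtain ws ts where L: "L = Node ws ts" by (cases L)
  note rt = rooted_Suc[OF Suc.prems(1)[unfolded L]]
  consider "(r, ex', ys, ws') = (Suc R, ex, xs, ws)"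
    | q where "q < d * length ws" "(r, ex', ys, ws') \<in> nd d R {xs ! (q mod d)} (xs[q mod d := ws ! (q div d)]) (ts ! q)"
    using Suc.prems(3) by (auto simp: L)
  then show ?case
  proof cases
    case 1
    then show ?thesis using rt(1-7) Suc.prems(2) by (auto simp: L)
  next
    case 2
    have "{xs ! (q mod d)} \<inter> set_tree (ts ! q) = {}"
      using rt(11,12)[OF 2(1)] by auto
    note ih = Suc.IH[OF rt(8)[OF 2(1)] this 2(2)]
    have sub: "set_tree (ts ! q) \<subseteq> set_tree L"
      "set (xs[q mod d := ws ! (q div d)]) \<subseteq> set xs \<union> set_tree L"
      "SE d R (xs[q mod d := ws ! (q div d)]) (ts ! q) \<subseteq> SE d (Suc R) xs L"
      using rt(10)[OF 2(1)] 2(1) unfolding rt(9)[OF 2(1)] unfolding L rt(7) by auto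
    show ?thesis using ih sub by blast
  qed
qed

text \<open>A position that has been replaced holds a label of the tree from then on, since it can
  only be overwritten by another label. Hence every face met below the root contains a label and
  differs from the root face.\<close>

lemma nd_nonroot:
  assumes "rooted d R xs L" "(r, ex', ys, ws') \<in> nd d R ex xs L"
  shows "(ex' = ex \<and> ys = xs \<and> (\<forall>r2 ws2. (r2, ex, xs, ws2) \<in> nd d R ex xs L \<longrightarrow> r2 = r \<and> ws2 = ws')) \<or> set ys \<inter> set_tree L \<noteq> {}"
  using assms
proof (induction R arbitrary: xs L ex r ex' ys ws')
  case 0
  then show ?case by auto
next
  case (Suc R)
  obtain ws ts where L: "L = Node ws ts" by (cases L)
  note rt = rooted_Suc[OF Suc.prems(1)[unfolded L]]
  have child: "set zs \<inter> set_tree L \<noteq> {}"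
    if q: "q < d * length ws" and n: "(r2, e2, zs, ws2) \<in> nd d R {xs ! (q mod d)} (xs[q mod d := ws ! (q div d)]) (ts ! q)" for q r2 e2 zs ws2
  proof -
    have sub: "set_tree (ts ! q) \<subseteq> set_tree L" "ws ! (q div d) \<in> set_tree L"
      using rt(10)[OF q] q unfolding L rt(7) by auto
    from Suc.IH[OF rt(8)[OF q] n] show ?thesis
    proof (elim disjE conjE)
      assume "zs = xs[q mod d := ws ! (q div d)]"
      then have "ws ! (q div d) \<in> set zs" using rt(9)[OF q] by simp
      then show ?thesis using sub(2) by blast
    qed (use sub(1) in blast)
  qed
  have split: "(r2, e2, zs, ws2) = (Suc R, ex, xs, ws) \<or> set zs \<inter> set_tree L \<noteq> {}"
    if n: "(r2, e2, zs, ws2) \<in> nd d (Suc R) ex xs L" for r2 e2 zs ws2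
  proof -
    have "(r2, e2, zs, ws2) = (Suc R, ex, xs, ws) \<or> (\<exists>q<d * length ws. (r2, e2, zs, ws2) \<in> nd d R {xs ! (q mod d)} (xs[q mod d := ws ! (q div d)]) (ts ! q))"
      using n unfolding L nd.simps tree.case by blast
    then show ?thesis using child by blast
  qed
  have "set xs \<inter> set_tree L = {}" using Suc.prems(1) by (simp add: rooted_def)
  then have root: "r2 = Suc R \<and> ws2 = ws" if "(r2, ex, xs, ws2) \<in> nd d (Suc R) ex xs L" for r2 ws2
    using split[OF that] by simp
  show ?case using split[OF Suc.prems(2)] root by (elim disjE) simp_all
qed

text \<open>Different branches have disjoint labels. A face shared by two branches could thus
  contain labels of neither and would be the starting face of both; but the starting face determines
  the new vertex and the missed vertex, hence both \<open>q div d\<close> and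
  \<open>q mod d\<close>.\<close>

lemma nd_disjoint:
  assumes "rooted d (Suc R) xs (Node ws ts)"
  defines "ch \<equiv> \<lambda>q. nd d R {xs ! (q mod d)} (xs[q mod d := ws ! (q div d)]) (ts ! q)"
  shows "q < d * length ws \<Longrightarrow> (r, e, ys, ws') \<in> ch q \<Longrightarrow> \<not> set ys \<subseteq> set xs"
    and "q < d * length ws \<Longrightarrow> q' < d * length ws \<Longrightarrow> q \<noteq> q' \<Longrightarrow>
      (ra, ea, ya, wa) \<in> ch q \<Longrightarrow> (rb, eb, yb, wb) \<in> ch q' \<Longrightarrow> set ya \<noteq> set yb"
proof -
  note rt = rooted_Suc[OF assms(1)]
  have ex0: "{xs ! (q mod d)} \<inter> set_tree (ts ! q) = {}" if "q < d * length ws" for q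
    using rt(11,12)[OF that] by auto
  have sub: "set ys \<subseteq> insert (ws ! (q div d)) (set xs - {xs ! (q mod d)}) \<union> set_tree (ts ! q)"
    if "q < d * length ws" "(r, e, ys, ws') \<in> ch q" for q r e ys ws'
    using nd_props[OF rt(8)[OF that(1)] ex0[OF that(1)] that(2)[unfolded ch_def]] rt(9)[OF that(1)] by auto
  have nr: "ys = xs[q mod d := ws ! (q div d)] \<or> set ys \<inter> set_tree (ts ! q) \<noteq> {}"
    if "q < d * length ws" "(r, e, ys, ws') \<in> ch q" for q r e ys ws'
    using nd_nonroot[OF rt(8)[OF that(1)] that(2)[unfolded ch_def]] by auto
  have notroot: "\<not> set ys \<subseteq> set xs" if "q < d * length ws" "(r, e, ys, ws') \<in> ch q" for q r e ys ws'
    using nr[OF that] rt(9,10,12)[OF that(1)] rt(6) by auto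
  have diff: "set ya \<noteq> set yb"
    if q: "q < d * length ws" "q' < d * length ws" "q \<noteq> q'"
      and a: "(ra, ea, ya, wa) \<in> ch q" and b: "(rb, eb, yb, wb) \<in> ch q'" for q q' ra ea ya wa rb eb yb wb
  proof
    assume eq: "set ya = set yb"
    note d1 = rt(12)[OF q(1)] rt(12)[OF q(2)] rt(13)[OF q] rt(6)
    have "set ya \<inter> set_tree (ts ! q) = {}"
      using sub[OF q(2) b] d1 rt(10)[OF q(2)] unfolding eq by auto
    then have ya: "ya = xs[q mod d := ws ! (q div d)]" using nr[OF q(1) a] by auto
    have "set yb \<inter> set_tree (ts ! q') = {}"
      using sub[OF q(1) a] d1 rt(10)[OF q(1)] unfolding eq[symmetric] by auto
    then have yb: "yb = xs[q' mod d := ws ! (q' div d)]" using nr[OF q(2) b] by auto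
    have e: "insert (ws ! (q div d)) (set xs - {xs ! (q mod d)}) = insert (ws ! (q' div d)) (set xs - {xs ! (q' mod d)})"
      using eq rt(9)[OF q(1)] rt(9)[OF q(2)] unfolding ya yb by simp
    have w1: "ws ! (q div d) \<notin> set xs" "ws ! (q' div d) \<notin> set xs"
      using rt(10)[OF q(1)] rt(10)[OF q(2)] rt(6) by auto
    have "ws ! (q div d) = ws ! (q' div d)" using e w1 by auto
    then have dv: "q div d = q' div d"
      using rt(2) nth_block_less[OF q(1)] nth_block_less[OF q(2)] by (simp add: nth_eq_iff_index_eq)
    have "set xs - {xs ! (q mod d)} = set xs - {xs ! (q' mod d)}"
      using e w1 unfolding \<open>ws ! (q div d) = ws ! (q' div d)\<close> by (simp add: insert_ident)
    then have "xs ! (q mod d) \<notin> set xs - {xs ! (q' mod d)}" by blast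
    then have "xs ! (q mod d) = xs ! (q' mod d)" using rt(11)[OF q(1)] by blast
    then have "q mod d = q' mod d"
      using rt(4,5) nth_block_less[OF q(1)] nth_block_less[OF q(2)] by (simp add: nth_eq_iff_index_eq)
    then have "q = q'" using dv by (metis div_mult_mod_eq)
    then show False using q by simp
  qed
  show "q < d * length ws \<Longrightarrow> (r, e, ys, ws') \<in> ch q \<Longrightarrow> \<not> set ys \<subseteq> set xs" by (rule notroot)
  show "q < d * length ws \<Longrightarrow> q' < d * length ws \<Longrightarrow> q \<noteq> q' \<Longrightarrow>
      (ra, ea, ya, wa) \<in> ch q \<Longrightarrow> (rb, eb, yb, wb) \<in> ch q' \<Longrightarrow> set ya \<noteq> set yb" by (rule diff)
qed

text \<open>Obtained from \<open>nd_disjoint\<close> branch by branch. It identifies a node,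
  including its excluded set and its cofaces, from the vertex set of its face alone.\<close>

lemma nd_face_inj:
  assumes "rooted d R xs L" "ex \<inter> set_tree L = {}"
    and "(r1, e1, ys1, ws1) \<in> nd d R ex xs L" "(r2, e2, ys2, ws2) \<in> nd d R ex xs L" "set ys1 = set ys2"
  shows "r1 = r2 \<and> e1 = e2 \<and> ys1 = ys2 \<and> ws1 = ws2"
  using assms
proof (induction R arbitrary: xs L ex)
  case 0
  then show ?case by auto
next
  case (Suc R)
  obtain ws ts where L: "L = Node ws ts" by (cases L)
  note rt = rooted_Suc[OF Suc.prems(1)[unfolded L]]
  define ch where "ch q = nd d R {xs ! (q mod d)} (xs[q mod d := ws ! (q div d)]) (ts ! q)" for q
  have ex0: "{xs ! (q mod d)} \<inter> set_tree (ts ! q) = {}" if "q < d * length ws" for q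
    using rt(11,12)[OF that] by auto
  note notroot = nd_disjoint(1)[OF Suc.prems(1)[unfolded L], folded ch_def]
  note diff = nd_disjoint(2)[OF Suc.prems(1)[unfolded L], folded ch_def]
  have split: "(r, e, ys, ws') = (Suc R, ex, xs, ws) \<or> (\<exists>q<d * length ws. (r, e, ys, ws') \<in> ch q)"
    if "(r, e, ys, ws') \<in> nd d (Suc R) ex xs L" for r e ys ws'
    using that by (auto simp: L ch_def)
  from split[OF Suc.prems(3)] split[OF Suc.prems(4)] show ?case
  proof (elim disjE exE conjE)
    fix q assume "(r1, e1, ys1, ws1) = (Suc R, ex, xs, ws)" "q < d * length ws" "(r2, e2, ys2, ws2) \<in> ch q"
    then show ?thesis using notroot[of q r2 e2 ys2 ws2] Suc.prems(5) by auto
  next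
    fix q assume "(r2, e2, ys2, ws2) = (Suc R, ex, xs, ws)" "q < d * length ws" "(r1, e1, ys1, ws1) \<in> ch q"
    then show ?thesis using notroot[of q r1 e1 ys1 ws1] Suc.prems(5) by auto
  next
    fix q q' assume q: "q < d * length ws" "(r1, e1, ys1, ws1) \<in> ch q" "q' < d * length ws" "(r2, e2, ys2, ws2) \<in> ch q'"
    have "q = q'" using diff[OF q(1,3) _ q(2,4)] Suc.prems(5) by auto
    then have "(r2, e2, ys2, ws2) \<in> ch q" using q by simp
    then show ?thesis
      using Suc.IH[OF rt(8)[OF q(1)] ex0[OF q(1)] q(2)[unfolded ch_def] _ Suc.prems(5)]
      unfolding ch_def by simp
  qed auto
qed

lemma SE_props:
  assumes "rooted d R xs L" "e \<in> SE d R xs L"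
  shows "\<exists>l y. e = {l, y} \<and> l \<in> set_tree L \<and> y \<in> set xs \<union> set_tree L \<and> l \<noteq> y"
  using assms
proof (induction R arbitrary: xs L)
  case (Suc R)
  obtain ws ts where L: "L = Node ws ts" by (cases L)
  note rt = rooted_Suc[OF Suc.prems(1)[unfolded L]]
  consider w y where "w \<in> set ws" "y \<in> set xs" "e = {w, y}"
    | q where "q < d * length ws" "e \<in> SE d R (xs[q mod d := ws ! (q div d)]) (ts ! q)"
    using Suc.prems(2) by (auto simp: L)
  then show ?case
  proof cases
    case 1
    then show ?thesis using rt(6,7) by (intro exI[of _ w] exI[of _ y]) (auto simp: L)
  next
    case 2
    from Suc.IH[OF rt(8)[OF 2(1)] 2(2)] obtain l y where
      ly: "e = {l, y}" "l \<in> set_tree (ts ! q)" "y \<in> insert (ws ! (q div d)) (set xs - {xs ! (q mod d)}) \<union> set_tree (ts ! q)" "l \<noteq> y"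
      unfolding rt(9)[OF 2(1)] by blast
    then show ?thesis using rt(7) rt(10)[OF 2(1)] 2(1)
      by (intro exI[of _ l] exI[of _ y]) (auto simp: L)
  qed
qed simp

text \<open>The tree edges create no coface beyond the recorded ones: labels of different branches
  are never joined, nor are two vertices of the same list \<open>ws\<close>.\<close>

lemma tree_clique:
  assumes "rooted d R xs L" "C \<subseteq> set xs \<union> set_tree L" "\<not> C \<subseteq> set xs"
    and "\<And>a b. a \<in> C \<Longrightarrow> b \<in> C \<Longrightarrow> a \<noteq> b \<Longrightarrow> {a, b} \<in> Kn (set xs) \<union> SE d R xs L"
  shows "\<exists>r e ys ws w. (r, e, ys, ws) \<in> nd d R ex xs L \<and> w \<in> set ws \<and> w \<in> C \<and> C \<subseteq> insert w (set ys)"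
  using assms
proof (induction R arbitrary: xs L ex)
  case 0
  then show ?case by (auto simp: rooted_def)
next
  case (Suc R)
  obtain ws ts where L: "L = Node ws ts" by (cases L)
  note rt = rooted_Suc[OF Suc.prems(1)[unfolded L]]
  have edge_q: "{a, b} \<in> SE d R (xs[q mod d := ws ! (q div d)]) (ts ! q) \<or>
      ({a, b} \<inter> set_tree (ts ! q) = {})  \<or>
      (\<exists>w\<in>set ws. \<exists>y\<in>set xs. {a, b} = {w, y}) \<or> (\<exists>q'<d * length ws. q' \<noteq> q \<and> {a, b} \<inter> set_tree (ts ! q') \<noteq> {})"
    if ab: "a \<in> C" "b \<in> C" "a \<noteq> b" and q: "q < d * length ws" for a b q
  proof -
    have "{a, b} \<in> Kn (set xs) \<union> SE d (Suc R) xs L" by (rule Suc.prems(4)[OF ab])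
    then consider "{a, b} \<in> Kn (set xs)" | w y where "w \<in> set ws" "y \<in> set xs" "{a, b} = {w, y}"
      | q' where "q' < d * length ws" "{a, b} \<in> SE d R (xs[q' mod d := ws ! (q' div d)]) (ts ! q')"
      by (auto simp: L)
    then show ?thesis
    proof cases
      case 1
      then show ?thesis using rt(12)[OF q] by (auto simp: Kn_def)
    next
      case 2
      then show ?thesis by blast
    next
      case 3
      have "{a, b} \<inter> set_tree (ts ! q') \<noteq> {}"
        using SE_props[OF rt(8)[OF 3(1)] 3(2)] by auto
      then show ?thesis using 3 by (cases "q' = q") auto
    qed
  qed
  \<comment> \<open>If \<open>C\<close> reaches a label below the first generation, all of
    \<open>C\<close> lies in that branch and the induction applies. Otherwise \<open>C\<close>
    consists of root vertices and exactly one vertex of \<open>ws\<close>.\<close>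
  show ?case
  proof (cases "\<exists>q<d * length ws. C \<inter> set_tree (ts ! q) \<noteq> {}")
    case True
    then obtain q l where q: "q < d * length ws" and l: "l \<in> C" "l \<in> set_tree (ts ! q)" by auto
    let ?xs = "xs[q mod d := ws ! (q div d)]"
    have nb: "b \<in> set ?xs \<union> set_tree (ts ! q)" if "b \<in> C" for b
    proof (cases "b = l")
      case False
      have "{l, b} \<in> Kn (set xs) \<union> SE d (Suc R) xs L" using Suc.prems(4)[OF l(1) that] False by auto
      then consider "{l, b} \<in> Kn (set xs)" | w y where "w \<in> set ws" "y \<in> set xs" "{l, b} = {w, y}"
        | q' where "q' < d * length ws" "{l, b} \<in> SE d R (xs[q' mod d := ws ! (q' div d)]) (ts ! q')"
        by (auto simp: L)
      then show ?thesis
      proof cases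
        case 1
        then show ?thesis using rt(12)[OF q] l by (auto simp: Kn_def)
      next
        case 2
        then show ?thesis using rt(12)[OF q] l by (auto simp: doubleton_eq_iff)
      next
        case 3
        obtain l' y where ly: "{l, b} = {l', y}" "l' \<in> set_tree (ts ! q')"
          "y \<in> set (xs[q' mod d := ws ! (q' div d)]) \<union> set_tree (ts ! q')"
          using SE_props[OF rt(8)[OF 3(1)] 3(2)] by blast
        have "l \<in> set (xs[q' mod d := ws ! (q' div d)]) \<union> set_tree (ts ! q')"
          and b: "b \<in> set (xs[q' mod d := ws ! (q' div d)]) \<union> set_tree (ts ! q')"
          using ly by (auto simp: doubleton_eq_iff)
        then have "l \<in> set xs \<union> set ws \<union> set_tree (ts ! q')" using rt(9,10)[OF 3(1)] by auto
        then have "l \<in> set_tree (ts ! q')" using l rt(12)[OF q] by auto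
        then have "q' = q" using rt(13)[OF q 3(1)] l by auto
        then show ?thesis using b by simp
      qed
    qed (use l in simp)
    have pairs: "{a, b} \<in> Kn (set ?xs) \<union> SE d R ?xs (ts ! q)" if ab: "a \<in> C" "b \<in> C" "a \<noteq> b" for a b
    proof -
      have an: "a \<in> set ?xs \<union> set_tree (ts ! q)" and bn: "b \<in> set ?xs \<union> set_tree (ts ! q)"
        using nb ab by auto
      show ?thesis
      proof (cases "{a, b} \<inter> set_tree (ts ! q) = {}")
        case True
        then show ?thesis using an bn ab by (auto simp: Kn_def)
      next
        case False
        have "\<not> (\<exists>w\<in>set ws. \<exists>y\<in>set xs. {a, b} = {w, y})"
          using False rt(12)[OF q] by (auto simp: doubleton_eq_iff)
        moreover have "{a, b} \<inter> set_tree (ts ! q') = {}" if "q' < d * length ws" "q' \<noteq> q" for q'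
          using an bn rt(9,10)[OF q] rt(12)[OF that(1)] rt(13)[OF that(1) q that(2)] by auto
        ultimately show ?thesis using edge_q[OF ab q] False by blast
      qed
    qed
    have "\<not> C \<subseteq> set ?xs" using l rt(12)[OF q] rt(9,10)[OF q] by auto
    moreover have "C \<subseteq> set ?xs \<union> set_tree (ts ! q)" using nb by blast
    ultimately have "\<exists>r e ys ws' w. (r, e, ys, ws') \<in> nd d R {xs ! (q mod d)} ?xs (ts ! q) \<and> w \<in> set ws' \<and> w \<in> C \<and> C \<subseteq> insert w (set ys)"
      by (intro Suc.IH[OF rt(8)[OF q]] pairs)
    then obtain r e ys ws' w where "(r, e, ys, ws') \<in> nd d R {xs ! (q mod d)} ?xs (ts ! q)" "w \<in> set ws'" "w \<in> C" "C \<subseteq> insert w (set ys)"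
      by blast
    moreover from this(1) have "(r, e, ys, ws') \<in> nd d (Suc R) ex xs L"
      using q by (auto simp: L)
    ultimately show ?thesis by blast
  next
    case False
    then have Cs: "C \<subseteq> set xs \<union> set ws" using Suc.prems(2) unfolding L rt(7) by blast
    then obtain w where w: "w \<in> C" "w \<in> set ws" using Suc.prems(3) by auto
    have "C \<subseteq> insert w (set xs)"
    proof
      fix b assume b: "b \<in> C"
      show "b \<in> insert w (set xs)"
      proof (rule ccontr)
        assume nb: "b \<notin> insert w (set xs)"
        then have "b \<in> set ws" using b Cs by auto
        have "{w, b} \<in> Kn (set xs) \<union> SE d (Suc R) xs L" using Suc.prems(4)[OF w(1) b] nb by auto
        then consider "{w, b} \<in> Kn (set xs)" | w' y where "w' \<in> set ws" "y \<in> set xs" "{w, b} = {w', y}"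
          | q' where "q' < d * length ws" "{w, b} \<in> SE d R (xs[q' mod d := ws ! (q' div d)]) (ts ! q')"
          by (auto simp: L)
        then show False
        proof cases
          case 1
          then show ?thesis using nb by (auto simp: Kn_def)
        next
          case 2
          then show ?thesis using w nb rt(6) by (auto simp: doubleton_eq_iff)
        next
          case 3
          then have "{w, b} \<inter> set_tree (ts ! q') \<noteq> {}" using SE_props[OF rt(8)[OF 3(1)] 3(2)] by auto
          then show ?thesis using False 3 w b by auto
        qed
      qed
    qed
    then show ?thesis using w by (intro exI[of _ "Suc R"] exI[of _ ex] exI[of _ xs] exI[of _ ws] exI[of _ w]) (auto simp: L)
  qed
qed

lemma nd_child:
  assumes "(r, e, ys, ws') \<in> nd d R ex xs L" "j < length ws'" "i < d"
  shows "\<exists>r3 ws3. (r3, {ys ! i}, ys[i := ws' ! j], ws3) \<in> nd d R ex xs L"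
  using assms
proof (induction R arbitrary: xs L ex)
  case (Suc R)
  obtain ws ts where L: "L = Node ws ts" by (cases L)
  consider "(r, e, ys, ws') = (Suc R, ex, xs, ws)"
    | q where "q < d * length ws" "(r, e, ys, ws') \<in> nd d R {xs ! (q mod d)} (xs[q mod d := ws ! (q div d)]) (ts ! q)"
    using Suc.prems(1) by (auto simp: L)
  then show ?case
  proof cases
    case 1
    let ?q = "j * d + i"
    have q: "?q < d * length ws" "?q div d = j" "?q mod d = i"
      using block_less[of j "length ws" i d] Suc.prems 1 by auto
    obtain r3 ws3 where "(r3, {xs ! i}, xs[i := ws ! j], ws3) \<in> nd d R {xs ! i} (xs[i := ws ! j]) (ts ! ?q)"
      using nd_root by blast
    then have "(r3, {xs ! i}, xs[i := ws ! j], ws3) \<in> nd d (Suc R) ex xs L"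
      using q by (auto simp: L intro!: bexI[of _ ?q])
    then show ?thesis using 1 by auto
  next
    case 2
    show ?thesis using Suc.IH[OF 2(2) Suc.prems(2,3)] 2(1) by (auto simp: L)
  qed
qed auto

lemma nd_face_clique:
  assumes "rooted d R xs L" "(r, e, ys, ws') \<in> nd d R ex xs L" "a \<in> set ys" "b \<in> set ys" "a \<noteq> b"
  shows "{a, b} \<in> Kn (set xs) \<union> SE d R xs L"
  using assms
proof (induction R arbitrary: xs L ex)
  case 0
  then show ?case by (auto simp: Kn_def)
next
  case (Suc R)
  obtain ws ts where L: "L = Node ws ts" by (cases L)
  note rt = rooted_Suc[OF Suc.prems(1)[unfolded L]]
  consider "ys = xs"
    | q where "q < d * length ws" "(r, e, ys, ws') \<in> nd d R {xs ! (q mod d)} (xs[q mod d := ws ! (q div d)]) (ts ! q)"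
    using Suc.prems(2) by (auto simp: L)
  then show ?case
  proof cases
    case 1
    then show ?thesis using Suc.prems by (auto simp: Kn_def)
  next
    case 2
    let ?w = "ws ! (q div d)"
    from Suc.IH[OF rt(8)[OF 2(1)] 2(2) Suc.prems(3-5)]
    have "{a, b} \<in> Kn (insert ?w (set xs - {xs ! (q mod d)})) \<union> SE d R (xs[q mod d := ?w]) (ts ! q)"
      unfolding rt(9)[OF 2(1)] .
    then consider "{a, b} \<subseteq> set xs" | "a = ?w" "b \<in> set xs" | "b = ?w" "a \<in> set xs"
      | "{a, b} \<in> SE d R (xs[q mod d := ?w]) (ts ! q)"
      using Suc.prems(5) unfolding Kn_def by auto
    then show ?thesis
    proof cases
      case 1
      then show ?thesis using Suc.prems(5) by (auto simp: Kn_def)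
    next
      case 2
      then show ?thesis using rt(10)[OF \<open>q < d * length ws\<close>] by (force simp: L)
    next
      case 3
      then have "{b, a} \<in> SE d (Suc R) xs L" using rt(10)[OF \<open>q < d * length ws\<close>] by (force simp: L)
      then show ?thesis by (simp add: insert_commute)
    next
      case 4
      then show ?thesis using \<open>q < d * length ws\<close> by (auto simp: L)
    qed
  qed
qed

text \<open>A coface of \<open>set ys\<close> is a clique on \<open>d + 1\<close> vertices inside
  the explored region, hence by \<open>tree_clique\<close> recorded at some node. Either this is the
  node of \<open>ys\<close>, or the coface is the one through which \<open>ys\<close> was reached,
  and then the additional vertex is the excluded one. The depth is \<open>Suc r\<close> because the
  cofaces of faces at depth \<open>0\<close> are not listed.\<close>

lemma cof_eq_labels:
  assumes rt: "rooted d R xs L" and node: "(Suc r, e, ys, ws') \<in> nd d R {} xs L" and d: "d > 0"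
    and G: "\<And>a b. a \<in> set xs \<union> set_tree L \<Longrightarrow> b \<in> set xs \<union> set_tree L \<Longrightarrow> a \<noteq> b \<Longrightarrow>
      {a, b} \<in> G \<longleftrightarrow> {a, b} \<in> Kn (set xs) \<union> SE d R xs L"
    and out: "\<And>u. u \<notin> set xs \<union> set_tree L \<Longrightarrow> \<exists>y\<in>set ys. {u, y} \<notin> G"
  shows "cof G (set ys) - e = set ws'"
proof
  note pr = nd_props[OF rt _ node, simplified]
  show "set ws' \<subseteq> cof G (set ys) - e"
  proof
    fix w assume w: "w \<in> set ws'"
    have "{w, y} \<in> G" if y: "y \<in> set ys" for y
    proof -
      have "w \<noteq> y" using pr w y by auto
      then show ?thesis using G[of w y] pr w y by auto
    qed
    then show "w \<in> cof G (set ys) - e" using pr w by (auto simp: cof_def)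
  qed
  show "cof G (set ys) - e \<subseteq> set ws'"
  proof
    fix w assume w: "w \<in> cof G (set ys) - e"
    then have w1: "w \<notin> set ys" "\<And>y. y \<in> set ys \<Longrightarrow> {w, y} \<in> G" "w \<notin> e" by (auto simp: cof_def)
    have wV: "w \<in> set xs \<union> set_tree L" using out[of w] w1 by blast
    define C where "C = insert w (set ys)"
    have cys: "card (set ys) = d" using pr distinct_card by blast
    have cC: "card C = Suc d" unfolding C_def using w1 cys by simp
    have CV: "C \<subseteq> set xs \<union> set_tree L" using pr wV by (auto simp: C_def)
    have "card (set xs) = d" using rt distinct_card by (auto simp: rooted_def)
    then have nC: "\<not> C \<subseteq> set xs" using cC card_mono[of "set xs" C] by auto
    have cl: "{a, b} \<in> Kn (set xs) \<union> SE d R xs L" if ab: "a \<in> C" "b \<in> C" "a \<noteq> b" for a b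
    proof -
      consider "a = w" "b \<in> set ys" | "b = w" "a \<in> set ys" | "a \<in> set ys" "b \<in> set ys"
        using ab by (auto simp: C_def)
      then show ?thesis
      proof cases
        case 1
        then show ?thesis using G[of a b] ab CV w1 by auto
      next
        case 2
        then show ?thesis using G[of b a] ab CV w1 by (auto simp: insert_commute)
      next
        case 3
        show ?thesis using nd_face_clique[OF rt node 3 ab(3)] .
      qed
    qed
    obtain r2 e2 ys2 ws2 z where n2: "(r2, e2, ys2, ws2) \<in> nd d R {} xs L" "z \<in> set ws2" "z \<in> C" "C \<subseteq> insert z (set ys2)"
      using tree_clique[OF rt CV nC cl, of "{}"] by blast
    note pr2 = nd_props[OF rt _ n2(1), simplified]
    have "card (insert z (set ys2)) = Suc d"
      using pr2 n2(2) distinct_card[of ys2] by (subst card_insert_disjoint) auto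
    then have Ceq: "C = insert z (set ys2)"
      using n2(4) cC by (intro card_subset_eq) auto
    have z: "z \<notin> set ys2" using pr2 n2(2) by auto
    show "w \<in> set ws'"
    proof (cases "z = w")
      case True
      then have "set ys = set ys2" using Ceq z w1 unfolding C_def by (simp add: insert_ident)
      then show ?thesis using nd_face_inj[OF rt _ node n2(1)] n2(2) True by auto
    next
      case False
      then have zy: "z \<in> set ys" "w \<in> set ys2" using n2(3) Ceq unfolding C_def by auto
      obtain i where i: "i < d" "ys2 ! i = w" using zy(2) pr2 by (auto simp: in_set_conv_nth)
      obtain j where j: "j < length ws2" "ws2 ! j = z" using n2(2) by (auto simp: in_set_conv_nth)
      \<comment> \<open>The coface was discovered from another of its facets, the one missing
        \<open>z\<close>. Replacing \<open>w\<close> by \<open>z\<close> there produces the face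
        \<open>set ys\<close>, so the node of \<open>ys\<close> is this child and excludes
        \<open>w\<close>.\<close>
      obtain r3 ws3 where n3: "(r3, {w}, ys2[i := z], ws3) \<in> nd d R {} xs L"
        using nd_child[OF n2(1) j(1) i(1)] i j by auto
      have "set (ys2[i := z]) = insert z (set ys2 - {w})"
        using set_list_update_distinct[of ys2 i z] pr2 i by auto
      also have "\<dots> = set ys" using Ceq z w1 zy False unfolding C_def by auto
      finally have "e = {w}" using nd_face_inj[OF rt _ n3 node] by auto
      then show ?thesis using w1 by auto
    qed
  qed
qed

lemma explore_eq:
  assumes "rooted d R xs L"
    and "\<And>r e ys ws'. (Suc r, e, ys, ws') \<in> nd d R ex xs L \<Longrightarrow> cof G (set ys) - e = set ws'"
  shows "explore d R G ex xs = L"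
  using assms
proof (induction R arbitrary: xs L ex)
  case 0
  then show ?case by (auto simp: rooted_def)
next
  case (Suc R)
  obtain ws ts where L: "L = Node ws ts" by (cases L)
  note rt = rooted_Suc[OF Suc.prems(1)[unfolded L]]
  have "cof G (set xs) - ex = set ws" by (rule Suc.prems(2)[of R ex xs ws]) (simp add: L)
  then have ws: "sorted_list_of_set (cof G (set xs) - ex) = ws"
    using rt(1,2) by (simp add: sorted_list_of_set.idem_if_sorted_distinct)
  have "explore d R G {xs ! (q mod d)} (xs[q mod d := ws ! (q div d)]) = ts ! q" if q: "q < d * length ws" for q
  proof (rule Suc.IH[OF rt(8)[OF q]])
    fix r e ys ws'
    assume n: "(Suc r, e, ys, ws') \<in> nd d R {xs ! (q mod d)} (xs[q mod d := ws ! (q div d)]) (ts ! q)"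
    have "(Suc r, e, ys, ws') \<in> nd d (Suc R) ex xs L" using n q by (auto simp: L)
    then show "cof G (set ys) - e = set ws'" by (rule Suc.prems(2))
  qed
  then have "map (\<lambda>q. explore d R G {xs ! (q mod d)} (xs[q mod d := ws ! (q div d)])) [0..<d * length ws] = ts"
    using rt(3) by (intro nth_equalityI) auto
  then show ?case by (simp add: ws L)
qed

section \<open>Vectors representing evaluations at faces\<close>

lemma sum_block: "(\<Sum>j<N. \<Sum>i<d. f (j * d + i)) = (\<Sum>q<d * N. f (q::nat))"
proof -
  have "(\<Sum>i<d. f (j * d + i)) = sum f {j * d..<j * d + d}" for j
    by (rule sum.reindex_bij_witness[of _ "\<lambda>q. q - j * d" "\<lambda>i. j * d + i"]) auto
  then show ?thesis using sum.nat_group[of f d N] by (simp add: mult.commute)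
qed

lemma ip_disjoint_sum:
  assumes "finite I" "\<And>i j \<sigma>. i \<in> I \<Longrightarrow> j \<in> I \<Longrightarrow> i \<noteq> j \<Longrightarrow> f i \<sigma> * f j \<sigma> = 0"
  shows "ip F (\<lambda>\<sigma>. \<Sum>i\<in>I. f i \<sigma>) (\<lambda>\<sigma>. \<Sum>i\<in>I. f i \<sigma>) = (\<Sum>i\<in>I. ip F (f i) (f i))"
proof -
  have "(\<Sum>i\<in>I. f i \<sigma>) * (\<Sum>i\<in>I. f i \<sigma>) = (\<Sum>i\<in>I. f i \<sigma> * f i \<sigma>)" for \<sigma>
  proof -
    have "(\<Sum>i\<in>I. f i \<sigma>) * (\<Sum>i\<in>I. f i \<sigma>) = (\<Sum>i\<in>I. \<Sum>j\<in>I. f i \<sigma> * f j \<sigma>)" by (rule sum_product)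
    also have "\<dots> = (\<Sum>i\<in>I. \<Sum>j\<in>I. if j = i then f i \<sigma> * f i \<sigma> else 0)"
      using assms(2) by (intro sum.cong refl) auto
    finally show ?thesis using assms(1) by simp
  qed
  then show ?thesis unfolding ip_def by (simp add: sum.swap[of _ I])
qed

lemma cof_subset:
  assumes "E \<subseteq> all_edges n" "Y \<noteq> {}"
  shows "cof E Y \<subseteq> {1..n}"
  using assms by (fastforce simp: cof_def all_edges_def)

lemma faces_clique_insert:
  assumes "E \<subseteq> all_edges n" "Y \<in> faces (clique_complex n E) d" "d > 0" "w \<in> cof E Y"
  shows "insert w Y \<in> faces (clique_complex n E) (Suc d)"
proof -
  have "Y \<noteq> {}" using assms by (auto simp: faces_def)
  then have "w \<in> {1..n}" using cof_subset assms by blast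
  moreover have "w \<notin> Y" "\<And>y. y \<in> Y \<Longrightarrow> {w, y} \<in> E \<and> {y, w} \<in> E"
    using assms(4) by (auto simp: cof_def insert_commute)
  ultimately show ?thesis using assms(2) by (auto simp: faces_def clique_complex_def)
qed

lemma faces_clique_diff:
  assumes "\<tau> \<in> faces (clique_complex n E) (Suc d)" "u \<in> \<tau>"
  shows "\<tau> - {u} \<in> faces (clique_complex n E) d" "u \<in> cof E (\<tau> - {u})"
  using assms by (auto simp: faces_def clique_complex_def cof_def)

lemma finite_clique_complex: "finite (clique_complex n E)"
  by (rule finite_subset[of _ "Pow {1..n}"]) (auto simp: clique_complex_def)

text \<open>These weights, inversely proportional to \<open>S j\<close>, minimise the quadratic form on the left; they combine the vectors of
  the subtrees in the induction step of the next lemma.\<close>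

lemma weights_norm:
  fixes S :: "nat \<Rightarrow> real"
  assumes "\<And>j. j < N \<Longrightarrow> S j > 0"
  defines "D \<equiv> 1 + (\<Sum>j<N. 1 / S j)"
  defines "a \<equiv> \<lambda>j. 1 / (S j * D)"
  shows "(1 - (\<Sum>j<N. a j))\<^sup>2 + (\<Sum>j<N. (a j)\<^sup>2 * S j) = 1 / D"
proof -
  have "0 \<le> (\<Sum>j<N. 1 / S j)" using assms(1) by (intro sum_nonneg) (auto intro: less_imp_le)
  then have D: "D > 0" by (simp add: D_def)
  have "(\<Sum>j<N. a j) = (\<Sum>j<N. 1 / S j) / D"
    by (simp add: a_def sum_divide_distrib)
  then have A: "(\<Sum>j<N. a j) = (D - 1) / D" by (simp add: D_def)
  have "(\<Sum>j<N. (a j)\<^sup>2 * S j) = (\<Sum>j<N. 1 / S j) / D\<^sup>2"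
    unfolding sum_divide_distrib
  proof (intro sum.cong refl)
    fix j assume "j \<in> {..<N}"
    then have "S j > 0" using assms(1) by auto
    then show "(a j)\<^sup>2 * S j = 1 / S j / D\<^sup>2" using D by (simp add: a_def power2_eq_square field_simps)
  qed
  then have "(\<Sum>j<N. (a j)\<^sup>2 * S j) = (D - 1) / D\<^sup>2" by (simp add: D_def)
  then show ?thesis unfolding A using D by (simp add: field_simps power2_eq_square)
qed

text \<open>The vector combines the unit vector at the root face with the vectors of all children,
  signed by the cocycle equation and weighted as in \<open>weights_norm\<close>. The clause on the
  support is carried through the induction because it makes the supports of different branches
  disjoint, so that squared norms add.\<close>

lemma certificate:
  assumes E: "E \<subseteq> all_edges n" and d: "d > 0"
  defines "F \<equiv> faces (clique_complex n E) d" and "Z \<equiv> cocycles (clique_complex n E) d"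
  assumes "rooted d R xs (explore d R E ex xs)" "set xs \<in> F"
  shows "\<exists>z. (\<forall>b\<in>Z. ip F b z = b (set xs)) \<and> ip F z z = xval d R (explore d R E ex xs) \<and>
    (\<forall>\<sigma>. z \<sigma> \<noteq> 0 \<longrightarrow> (\<exists>r e ys ws. (r, e, ys, ws) \<in> nd d R ex xs (explore d R E ex xs) \<and> \<sigma> = set ys))"
  using assms(5,6)
proof (induction R arbitrary: xs ex)
  case 0
  have fin: "finite F" unfolding F_def by (intro finite_faces finite_clique_complex)
  have d: "ip F b (delta (set xs)) = b (set xs)" for b
  proof -
    have "ip F b (delta (set xs)) = (\<Sum>x\<in>F. if x = set xs then b (set xs) else 0)"
      unfolding ip_def by (intro sum.cong) (auto simp: delta_def)
    then show ?thesis using fin 0 by simp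
  qed
  have "ip F (delta (set xs)) (delta (set xs)) = 1" using d[of "delta (set xs)"] by (simp add: delta_def)
  then show ?case using d by (intro exI[of _ "delta (set xs)"]) (auto simp: delta_def)
next
  case (Suc R)
  define ws where "ws = sorted_list_of_set (cof E (set xs) - ex)"
  define N where "N = length ws"
  define chx where "chx q = xs[q mod d := ws ! (q div d)]" for q
  define T where "T q = explore d R E {xs ! (q mod d)} (chx q)" for q
  define ts where "ts = map T [0..<d * N]"
  have L: "explore d (Suc R) E ex xs = Node ws ts"
    by (simp add: ws_def[symmetric] Let_def ts_def T_def[abs_def] chx_def N_def)
  have tsq: "ts ! q = T q" if "q < d * N" for q using that by (simp add: ts_def)
  note rt = rooted_Suc[OF Suc.prems(1)[unfolded L], folded N_def, folded chx_def]
  have fin: "finite F" unfolding F_def by (intro finite_faces finite_clique_complex)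
  have xsne: "set xs \<noteq> {}" using rt(4) d by auto
  have fc: "finite (cof E (set xs) - ex)"
    using cof_subset[OF E xsne] finite_subset by blast
  have setws: "set ws = cof E (set xs) - ex" unfolding ws_def using fc by simp
  have \<tau>: "insert w (set xs) \<in> faces (clique_complex n E) (Suc d)" if "w \<in> set ws" for w
    using faces_clique_insert[OF E Suc.prems(2)[unfolded F_def] d] that setws by auto
  have chF: "set (chx q) \<in> F" if q: "q < d * N" for q
  proof -
    have "set (chx q) = insert (ws ! (q div d)) (set xs) - {xs ! (q mod d)}"
      using rt(9,10,11)[OF q] rt(6) by auto
    then show ?thesis
      unfolding F_def using faces_clique_diff(1)[OF \<tau>[OF rt(10)[OF q]], of "xs ! (q mod d)"] rt(11)[OF q] by simp
  qed
  have "\<exists>z. (\<forall>b\<in>Z. ip F b z = b (set (chx q))) \<and> ip F z z = xval d R (T q) \<and>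
    (\<forall>\<sigma>. z \<sigma> \<noteq> 0 \<longrightarrow> (\<exists>r e ys ws. (r, e, ys, ws) \<in> nd d R {xs ! (q mod d)} (chx q) (T q) \<and> \<sigma> = set ys))"
    if q: "q < d * N" for q
    unfolding T_def by (rule Suc.IH) (use rt(8)[OF q] chF[OF q] tsq[OF q] in \<open>simp_all add: T_def\<close>)
  then obtain zz where zz: "\<And>q b. q < d * N \<Longrightarrow> b \<in> Z \<Longrightarrow> ip F b (zz q) = b (set (chx q))"
    "\<And>q. q < d * N \<Longrightarrow> ip F (zz q) (zz q) = xval d R (T q)"
    "\<And>q \<sigma>. q < d * N \<Longrightarrow> zz q \<sigma> \<noteq> 0 \<Longrightarrow> (\<exists>r e ys ws. (r, e, ys, ws) \<in> nd d R {xs ! (q mod d)} (chx q) (T q) \<and> \<sigma> = set ys)"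
    by metis
  define S where "S j = (\<Sum>i<d. xval d R (T (j * d + i)))" for j
  have Spos: "S j > 0" for j unfolding S_def using d by (intro sum_pos xval_pos) auto
  define D where "D = 1 + (\<Sum>j<N. 1 / S j)"
  define a where "a j = 1 / (S j * D)" for j
  \<comment> \<open>Solving the cocycle equation at the coface for the value at the root face:
    multiplication by the sign of the new vertex, which squares to \<open>1\<close>, moves the other
    facets to the right with these coefficients.\<close>
  define s where "s q = - sgn_at (insert (ws ! (q div d)) (set xs)) (ws ! (q div d)) * sgn_at (insert (ws ! (q div d)) (set xs)) (xs ! (q mod d))" for q
  have s2: "s q * s q = 1" for q
  proof -
    have "(- x * y) * (- x * y) = (x * x) * (y * y)" for x y :: real by (simp add: mult_ac)
    then show ?thesis unfolding s_def by (simp only: sgn_at_square mult_1)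
  qed
  \<comment> \<open>The index \<open>d * N\<close>, one past the last child, carries the part at the
    root face, so that all parts form one orthogonal family.\<close>
  define f where "f q = (if q < d * N then (\<lambda>\<sigma>. a (q div d) * s q * zz q \<sigma>) else (\<lambda>\<sigma>. (1 - (\<Sum>j<N. a j)) * delta (set xs) \<sigma>))" for q
  define z where "z = (\<lambda>\<sigma>. \<Sum>q<Suc (d * N). f q \<sigma>)"
  have cocycle: "(\<Sum>i<d. s (j * d + i) * b (set (chx (j * d + i)))) = b (set xs)" if b: "b \<in> Z" and j: "j < N" for b j
  proof -
    define w where "w = ws ! j"
    define t where "t = insert w (set xs)"
    have w: "w \<in> set ws" using j by (simp add: w_def N_def)
    then have wx: "w \<notin> set xs" using rt(6) by auto
    have bt: "(\<Sum>u\<in>t. sgn_at t u * b (t - {u})) = 0"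
      using b \<tau>[OF w] by (auto simp: Z_def cocycles_eq t_def)
    have "(\<Sum>u\<in>t. sgn_at t u * b (t - {u})) = sgn_at t w * b (set xs) + (\<Sum>u\<in>set xs. sgn_at t u * b (t - {u}))"
      unfolding t_def using wx by (subst sum.insert) auto
    also have "(\<Sum>u\<in>set xs. sgn_at t u * b (t - {u})) = (\<Sum>i<d. sgn_at t (xs ! i) * b (t - {xs ! i}))"
      using sum.reindex_bij_betw[OF bij_betw_nth[OF rt(5) refl refl], of "\<lambda>u. sgn_at t u * b (t - {u})"] rt(4) by simp
    finally have "sgn_at t w * b (set xs) = - (\<Sum>i<d. sgn_at t (xs ! i) * b (t - {xs ! i}))"
      using bt by linarith
    then have "sgn_at t w * (sgn_at t w * b (set xs)) = sgn_at t w * - (\<Sum>i<d. sgn_at t (xs ! i) * b (t - {xs ! i}))"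
      by (rule arg_cong)
    then have "b (set xs) = - (sgn_at t w * (\<Sum>i<d. sgn_at t (xs ! i) * b (t - {xs ! i})))"
      by (simp only: mult.assoc[symmetric] sgn_at_square mult_1 mult_minus_right)
    then have "b (set xs) = - (\<Sum>i<d. sgn_at t w * (sgn_at t (xs ! i) * b (t - {xs ! i})))"
      by (simp only: sum_distrib_left)
    also have "\<dots> = (\<Sum>i<d. s (j * d + i) * b (set (chx (j * d + i))))"
      unfolding sum_negf[symmetric]
    proof (intro sum.cong refl)
      fix i assume "i \<in> {..<d}"
      then have i: "i < d" by simp
      note q = block_less[OF j i] and dm = div_mod_block[OF i, of j]
      have "set (chx (j * d + i)) = t - {xs ! i}"
        using rt(9)[OF q] rt(11)[OF q] wx unfolding dm t_def w_def by auto
      then show "- (sgn_at t w * (sgn_at t (xs ! i) * b (t - {xs ! i}))) = s (j * d + i) * b (set (chx (j * d + i)))"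
        unfolding s_def dm t_def w_def by simp
    qed
    finally show ?thesis by simp
  qed
  have ipd: "ip F b (delta (set xs)) = b (set xs)" for b
  proof -
    have "ip F b (delta (set xs)) = (\<Sum>x\<in>F. if x = set xs then b (set xs) else 0)"
      unfolding ip_def by (intro sum.cong) (auto simp: delta_def)
    then show ?thesis using fin Suc.prems(2) by simp
  qed
  have ip_right: "ip F b (\<lambda>\<sigma>. k * g \<sigma>) = k * ip F b g" for b g k
    by (simp add: ip_def sum_distrib_left mult_ac)
  have ipb: "ip F b z = b (set xs)" if b: "b \<in> Z" for b
  proof -
    have "ip F b z = (\<Sum>q<Suc (d * N). ip F b (f q))"
      unfolding z_def ip_def by (simp only: sum_distrib_left) (rule sum.swap)
    also have "\<dots> = (\<Sum>q<d * N. a (q div d) * s q * b (set (chx q))) + (1 - (\<Sum>j<N. a j)) * b (set xs)"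
    proof -
      have "ip F b (f q) = a (q div d) * s q * b (set (chx q))" if "q < d * N" for q
        using that zz(1)[OF that b] by (simp add: f_def ip_right)
      moreover have "ip F b (f (d * N)) = (1 - (\<Sum>j<N. a j)) * b (set xs)"
        by (simp add: f_def ip_right ipd)
      ultimately show ?thesis by simp
    qed
    also have "(\<Sum>q<d * N. a (q div d) * s q * b (set (chx q))) = (\<Sum>j<N. \<Sum>i<d. a j * (s (j * d + i) * b (set (chx (j * d + i)))))"
      unfolding sum_block[symmetric] by (intro sum.cong refl) (simp add: div_mod_block)
    also have "\<dots> = (\<Sum>j<N. a j * b (set xs))"
      unfolding sum_distrib_left[symmetric] by (intro sum.cong refl) (simp add: cocycle[OF b])
    finally show ?thesis by (simp add: sum_distrib_right[symmetric] algebra_simps)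
  qed
  define nf where "nf q \<sigma> \<longleftrightarrow> (\<exists>r e ys ws'. (r, e, ys, ws') \<in> nd d R {xs ! (q mod d)} (chx q) (ts ! q) \<and> \<sigma> = set ys)" for q \<sigma>
  have supp1: "nf q \<sigma>" if "q < d * N" "f q \<sigma> \<noteq> 0" for q \<sigma>
  proof -
    have "zz q \<sigma> \<noteq> 0" using that by (simp add: f_def)
    then show ?thesis using zz(3)[OF that(1)] unfolding nf_def tsq[OF that(1)] by simp
  qed
  have supp2: "\<sigma> = set xs" if "f (d * N) \<sigma> \<noteq> 0" for \<sigma>
    using that by (simp add: f_def delta_def split: if_splits)
  note dis = nd_disjoint[OF Suc.prems(1)[unfolded L], folded N_def, folded chx_def]
  have nf1: "\<not> \<sigma> \<subseteq> set xs" if "q < d * N" "nf q \<sigma>" for q \<sigma>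
    using that(2) dis(1)[OF that(1)] unfolding nf_def by blast
  have nf2: False if "q < d * N" "q' < d * N" "q \<noteq> q'" "nf q \<sigma>" "nf q' \<sigma>" for q q' \<sigma>
    using that(4,5) dis(2)[OF that(1-3)] unfolding nf_def by blast
  have orth: "f q \<sigma> * f q' \<sigma> = 0" if q: "q < Suc (d * N)" "q' < Suc (d * N)" "q \<noteq> q'" for q q' \<sigma>
  proof (rule ccontr)
    assume "f q \<sigma> * f q' \<sigma> \<noteq> 0"
    then have nz: "f q \<sigma> \<noteq> 0" "f q' \<sigma> \<noteq> 0" by auto
    consider "q < d * N" "q' < d * N" | "q = d * N" "q' < d * N" | "q < d * N" "q' = d * N"
      using q by linarith
    then show False
    proof cases
      case 1
      then show ?thesis using nf2[OF 1 q(3)] supp1 nz by blast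
    next
      case 2
      then show ?thesis using nf1[OF 2(2)] supp1[OF 2(2)] supp2 nz by blast
    next
      case 3
      then show ?thesis using nf1[OF 3(1)] supp1[OF 3(1)] supp2 nz by blast
    qed
  qed
  have "ip F z z = (\<Sum>q<Suc (d * N). ip F (f q) (f q))"
    unfolding z_def by (rule ip_disjoint_sum) (use orth in auto)
  also have "\<dots> = (\<Sum>q<d * N. (a (q div d))\<^sup>2 * xval d R (T q)) + (1 - (\<Sum>j<N. a j))\<^sup>2"
  proof -
    have sc: "ip F (\<lambda>\<sigma>. k * g \<sigma>) (\<lambda>\<sigma>. k * g \<sigma>) = k * k * ip F g g" for k g
      by (simp add: ip_def sum_distrib_left mult_ac)
    have "ip F (f q) (f q) = (a (q div d))\<^sup>2 * xval d R (T q)" if "q < d * N" for q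
    proof -
      have "ip F (f q) (f q) = (a (q div d) * s q) * (a (q div d) * s q) * xval d R (T q)"
        using that zz(2)[OF that] by (simp add: f_def sc)
      also have "(a (q div d) * s q) * (a (q div d) * s q) = (a (q div d))\<^sup>2 * (s q * s q)"
        by (simp add: power2_eq_square mult_ac)
      finally show ?thesis by (simp add: s2)
    qed
    moreover have "ip F (f (d * N)) (f (d * N)) = (1 - (\<Sum>j<N. a j))\<^sup>2"
      using ipd[of "delta (set xs)"] by (simp add: f_def sc power2_eq_square delta_def)
    ultimately show ?thesis by simp
  qed
  also have "(\<Sum>q<d * N. (a (q div d))\<^sup>2 * xval d R (T q)) = (\<Sum>j<N. \<Sum>i<d. (a j)\<^sup>2 * xval d R (T (j * d + i)))"
    unfolding sum_block[symmetric] by (intro sum.cong refl) (simp add: div_mod_block)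
  also have "\<dots> = (\<Sum>j<N. (a j)\<^sup>2 * S j)"
    by (simp add: S_def sum_distrib_left)
  also have "(\<Sum>j<N. (a j)\<^sup>2 * S j) + (1 - (\<Sum>j<N. a j))\<^sup>2 = 1 / D"
    using weights_norm[of N S] Spos unfolding a_def D_def by (simp add: add.commute)
  also have "1 / D = xval d (Suc R) (explore d (Suc R) E ex xs)"
  proof -
    have "(\<Sum>i<d. xval d R (ts ! (j * d + i))) = S j" if "j < N" for j
      unfolding S_def by (intro sum.cong refl) (simp add: tsq[OF block_less[OF that]])
    then show ?thesis unfolding L by (simp add: D_def N_def[symmetric])
  qed
  finally have norm: "ip F z z = xval d (Suc R) (explore d (Suc R) E ex xs)" .
  have nds: "nd d (Suc R) ex xs (explore d (Suc R) E ex xs) = insert (Suc R, ex, xs, ws)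
      (\<Union>q<d * N. nd d R {xs ! (q mod d)} (chx q) (ts ! q))"
    unfolding L nd.simps tree.case N_def[symmetric] chx_def[symmetric] by (rule refl)
  have "\<exists>r e ys ws'. (r, e, ys, ws') \<in> nd d (Suc R) ex xs (explore d (Suc R) E ex xs) \<and> \<sigma> = set ys" if "z \<sigma> \<noteq> 0" for \<sigma>
  proof -
    have "\<exists>q. q < Suc (d * N) \<and> f q \<sigma> \<noteq> 0"
    proof (rule ccontr)
      assume "\<nexists>q. q < Suc (d * N) \<and> f q \<sigma> \<noteq> 0"
      then have "z \<sigma> = 0" unfolding z_def by (intro sum.neutral) blast
      then show False using that by simp
    qed
    then obtain q where q: "q < Suc (d * N)" "f q \<sigma> \<noteq> 0" by blast
    show ?thesis
    proof (cases "q < d * N")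
      case True
      then show ?thesis using supp1[OF True q(2)] True unfolding nds nf_def by (elim exE conjE) (intro exI conjI, rule insertI2, rule UN_I[of q], simp_all)
    next
      case False
      then have "q = d * N" using q(1) by simp
      then have "\<sigma> = set xs" using supp2 q(2) by simp
      then show ?thesis unfolding nds by (intro exI[of _ "Suc R"] exI[of _ ex] exI[of _ xs] exI[of _ ws]) simp
    qed
  qed
  then show ?case using ipb norm by (intro exI[of _ z] conjI ballI allI impI) simp_all
qed

text \<open>At a face whose exploration is not a tree, the unit vector is used; it represents the
  evaluation and has squared norm \<open>1\<close>.\<close>

lemma nu_upper:
  assumes E: "E \<subseteq> all_edges n" and d: "d > 0"
  shows "real (nu (clique_complex n E) d) \<le> (\<Sum>\<sigma>\<in>faces (clique_complex n E) d.
    if rooted d R (sorted_list_of_set \<sigma>) (explore d R E {} (sorted_list_of_set \<sigma>))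
    then xval d R (explore d R E {} (sorted_list_of_set \<sigma>)) else 1)"
proof -
  let ?K = "clique_complex n E"
  let ?F = "faces ?K d"
  let ?L = "\<lambda>\<sigma>. explore d R E {} (sorted_list_of_set \<sigma>)"
  have fin: "finite ?F" by (intro finite_faces finite_clique_complex)
  have "\<exists>z. (\<forall>b\<in>cocycles ?K d. ip ?F b z = b \<sigma>) \<and>
      ip ?F z z = (if rooted d R (sorted_list_of_set \<sigma>) (?L \<sigma>) then xval d R (?L \<sigma>) else 1)"
    if \<sigma>: "\<sigma> \<in> ?F" for \<sigma>
  proof (cases "rooted d R (sorted_list_of_set \<sigma>) (?L \<sigma>)")
    case True
    have "finite \<sigma>" using \<sigma> by (simp add: faces_def)
    then have "set (sorted_list_of_set \<sigma>) \<in> ?F" using \<sigma> by simp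
    from certificate[OF E d True this] show ?thesis using True \<open>finite \<sigma>\<close> by auto
  next
    case False
    have "ip ?F b (delta \<sigma>) = b \<sigma>" for b
    proof -
      have "ip ?F b (delta \<sigma>) = (\<Sum>x\<in>?F. if x = \<sigma> then b \<sigma> else 0)"
        unfolding ip_def by (intro sum.cong) (auto simp: delta_def)
      then show ?thesis using fin \<sigma> by simp
    qed
    then show ?thesis using False by (intro exI[of _ "delta \<sigma>"]) (auto simp: delta_def)
  qed
  then obtain z where z: "\<And>\<sigma> b. \<sigma> \<in> ?F \<Longrightarrow> b \<in> cocycles ?K d \<Longrightarrow> ip ?F b (z \<sigma>) = b \<sigma>"
    "\<And>\<sigma>. \<sigma> \<in> ?F \<Longrightarrow> ip ?F (z \<sigma>) (z \<sigma>) = (if rooted d R (sorted_list_of_set \<sigma>) (?L \<sigma>) then xval d R (?L \<sigma>) else 1)"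
    by metis
  have "real (nu ?K d) \<le> (\<Sum>\<sigma>\<in>?F. ip ?F (z \<sigma>) (z \<sigma>))"
    by (rule nu_le_trace[OF finite_clique_complex z(1)])
  then show ?thesis using z(2) by simp
qed

section \<open>The lower bound by pruning\<close>

text \<open>The counterpart of \<open>zval\<close> on the graph itself; cofaces \<open>insert w \<sigma>\<close> with \<open>w \<in> e\<close> are ignored.\<close>

primrec zG :: "nat \<Rightarrow> nat set set \<Rightarrow> nat set \<Rightarrow> nat set \<Rightarrow> bool" where
  "zG 0 G e \<sigma> = False"
| "zG (Suc R) G e \<sigma> = (\<forall>w\<in>cof G \<sigma> - e. \<exists>u\<in>\<sigma>. zG R G {u} (insert w (\<sigma> - {u})))"

lemma zG_mono: "zG R G e \<sigma> \<Longrightarrow> zG (Suc R) G e \<sigma>"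
proof (induction R arbitrary: e \<sigma>)
  case (Suc R)
  show ?case
    unfolding zG.simps(2)[of "Suc R"]
  proof
    fix w assume "w \<in> cof G \<sigma> - e"
    then obtain u where "u \<in> \<sigma>" "zG R G {u} (insert w (\<sigma> - {u}))" using Suc.prems by auto
    then show "\<exists>u\<in>\<sigma>. zG (Suc R) G {u} (insert w (\<sigma> - {u}))" using Suc.IH by blast
  qed
qed simp

lemma zG_restrict: "zG R G {} \<sigma> \<Longrightarrow> zG R G e \<sigma>"
  by (cases R) auto

lemma explore_child:
  assumes "finite (cof G (set xs))" "length xs = d" "distinct xs" "j < length (sorted_list_of_set (cof G (set xs) - ex))" "i < d"
  shows "(\<exists>ts. explore d (Suc R) G ex xs = Node (sorted_list_of_set (cof G (set xs) - ex)) ts \<and>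
    ts ! (j * d + i) = explore d R G {xs ! i} (xs[i := sorted_list_of_set (cof G (set xs) - ex) ! j]))"
  using block_less[OF assms(4,5)] div_mod_block[OF assms(5), of j] by (auto simp: Let_def)

lemma face_update:
  assumes "length xs = d" "distinct xs" "i < d" "w \<notin> set xs"
  shows "length (xs[i := w]) = d" "distinct (xs[i := w])" "set (xs[i := w]) = insert w (set xs - {xs ! i})"
  using assms by (auto simp: set_list_update_distinct intro: distinct_list_update)

lemma finite_cof:
  assumes "E \<subseteq> all_edges n" "Y \<noteq> {}"
  shows "finite (cof E Y)"
proof -
  have "cof E Y \<subseteq> {1..n}" using assms by (fastforce simp: cof_def all_edges_def)
  then show ?thesis using finite_subset by blast
qed

text \<open>Both recursions unfold in the same way whether or not the exploration is a tree. The
  lower bound therefore holds for every graph, and probability enters only when its mean is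
  estimated.\<close>

lemma zval_explore:
  assumes "E \<subseteq> all_edges n" "length xs = d" "distinct xs" "d > 0" "R \<le> R'"
  shows "zval d R (explore d R' E ex xs) = zG R E ex (set xs)"
  using assms(2,3,5)
proof (induction R arbitrary: R' ex xs)
  case (Suc R)
  obtain R'' where R': "R' = Suc R''" "R \<le> R''" using Suc.prems(3) by (cases R') auto
  define ws where "ws = sorted_list_of_set (cof E (set xs) - ex)"
  have xsne: "set xs \<noteq> {}" using Suc.prems assms(4) by auto
  have fin: "finite (cof E (set xs))" by (rule finite_cof[OF assms(1) xsne])
  have setws: "set ws = cof E (set xs) - ex" unfolding ws_def using fin by simp
  obtain ts where ts: "explore d R' E ex xs = Node ws ts" "\<And>j i. j < length ws \<Longrightarrow> i < d \<Longrightarrow>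
    ts ! (j * d + i) = explore d R'' E {xs ! i} (xs[i := ws ! j])"
    using explore_child[OF fin Suc.prems(1,2), of _ ex _ R''] unfolding R' ws_def[symmetric]
    by (simp add: ws_def[symmetric] Let_def)
  have ch: "zval d R (ts ! (j * d + i)) = zG R E {xs ! i} (insert (ws ! j) (set xs - {xs ! i}))"
    if "j < length ws" "i < d" for i j
  proof -
    have "ws ! j \<notin> set xs" using setws that(1) nth_mem[OF that(1)] by (auto simp: cof_def)
    note fu = face_update[OF Suc.prems(1,2) that(2) this]
    show ?thesis unfolding ts(2)[OF that] using Suc.IH[OF fu(1,2) R'(2)] fu(3) by simp
  qed
  have "zval d (Suc R) (explore d R' E ex xs) \<longleftrightarrow> (\<forall>j<length ws. \<exists>i<d. zG R E {xs ! i} (insert (ws ! j) (set xs - {xs ! i})))"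
    unfolding ts(1) zval.simps tree.case by (simp add: ch cong: conj_cong)
  also have "\<dots> \<longleftrightarrow> (\<forall>w\<in>set ws. \<exists>u\<in>set xs. zG R E {u} (insert w (set xs - {u})))"
  proof -
    have e: "(\<exists>i<d. zG R E {xs ! i} (insert w (set xs - {xs ! i}))) \<longleftrightarrow> (\<exists>u\<in>set xs. zG R E {u} (insert w (set xs - {u})))" for w
      using Suc.prems(1) by (metis in_set_conv_nth)
    show ?thesis unfolding e all_set_conv_all_nth ..
  qed
  finally show ?case by (simp add: setws)
qed simp

text \<open>If the facet \<open>\<tau> - {u}\<close> survives, its coface \<open>\<tau>\<close> does
  not block it, so another facet of \<open>\<tau>\<close> survives already when
  \<open>\<tau>\<close> is ignored. A coface with a facet in the surviving set thus has at least two
  facets surviving in this weaker sense.\<close>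

lemma two_survivors:
  assumes "zG (Suc R) E {} (\<tau> - {u})" "u \<in> \<tau>" "u \<in> cof E (\<tau> - {u})"
  shows "\<exists>u'\<in>\<tau>. u' \<noteq> u \<and> zG (Suc R) E {u'} (\<tau> - {u'}) \<and> zG (Suc R) E {u} (\<tau> - {u})"
proof -
  obtain u' where u': "u' \<in> \<tau> - {u}" "zG R E {u'} (insert u (\<tau> - {u} - {u'}))"
    using assms(1,3) by auto
  have "insert u (\<tau> - {u} - {u'}) = \<tau> - {u'}" using assms(2) u' by auto
  then have "zG (Suc R) E {u'} (\<tau> - {u'})" using zG_mono[OF u'(2)] by (simp del: zG.simps)
  then show ?thesis using u' zG_restrict[OF assms(1)] by blast
qed

text \<open>The condition in \<open>psi\<close> says that at most one of the \<open>d + 1\<close>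
  facets survives when the coface is ignored: for \<open>D = 0\<close> only the face itself can, and
  for \<open>D = 1\<close> the face is blocked by another coface. By \<open>two_survivors\<close> no
  facet then survives altogether.\<close>

lemma psi_explore_le:
  assumes E: "E \<subseteq> all_edges n" and "length xs = d" "distinct xs" "d > 0"
  defines "\<sigma> \<equiv> set xs"
  shows "psi d R (explore d (Suc (Suc R)) E {} xs)
    \<le> card {w \<in> cof E \<sigma>. \<not> (\<exists>u\<in>insert w \<sigma>. u \<in> cof E (insert w \<sigma> - {u}) \<and> zG (Suc R) E {} (insert w \<sigma> - {u}))}"
    (is "_ \<le> card ?A")
proof -
  define ws where "ws = sorted_list_of_set (cof E \<sigma>)"
  have \<sigma>ne: "\<sigma> \<noteq> {}" using assms by auto
  have fin: "finite (cof E \<sigma>)" by (rule finite_cof[OF E \<sigma>ne])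
  have ws: "set ws = cof E \<sigma>" "distinct ws" unfolding ws_def using fin by auto
  obtain ts where ts: "explore d (Suc (Suc R)) E {} xs = Node ws ts" "\<And>j i. j < length ws \<Longrightarrow> i < d \<Longrightarrow>
    ts ! (j * d + i) = explore d (Suc R) E {xs ! i} (xs[i := ws ! j])"
    using explore_child[of E xs d _ "{}" _ "Suc R"] fin assms(2,3) unfolding \<sigma>_def ws_def
    by (simp add: Let_def)
  have zc: "zval d R' (ts ! (j * d + i)) = zG R' E {xs ! i} (insert (ws ! j) (\<sigma> - {xs ! i}))"
    if "j < length ws" "i < d" "R' \<le> Suc R" for i j R'
  proof -
    have "ws ! j \<notin> set xs" using ws(1) nth_mem[OF that(1)] by (auto simp: cof_def \<sigma>_def)
    note fu = face_update[OF assms(2,3) that(2) this]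
    show ?thesis
      unfolding ts(2)[OF that(1,2)] using zval_explore[OF E fu(1,2) assms(4) that(3)] fu(3) by (simp add: \<sigma>_def)
  qed
  define Q where "Q j \<longleftrightarrow> (let D = card {i. i < d \<and> zval d (Suc R) (ts ! (j * d + i))} in
      D = 0 \<or> D = 1 \<and> (\<exists>j'<length ws. j' \<noteq> j \<and> (\<forall>i<d. \<not> zval d R (ts ! (j' * d + i)))))" for j
  have good: "ws ! j \<in> ?A" if j: "j < length ws" and Q: "Q j" for j
  proof -
    define w where "w = ws ! j"
    define \<tau> where "\<tau> = insert w \<sigma>"
    have w: "w \<in> cof E \<sigma>" "w \<notin> \<sigma>" using j nth_mem[OF j] ws(1) by (auto simp: w_def cof_def)
    define I where "I = {i. i < d \<and> zval d (Suc R) (ts ! (j * d + i))}"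
    have finI: "finite I" by (simp add: I_def)
    have inI: "i \<in> I" if "i < d" "zG (Suc R) E {xs ! i} (\<tau> - {xs ! i})" for i
    proof -
      have "xs ! i \<noteq> w" using w(2) that(1) assms(2) by (auto simp: \<sigma>_def)
      then have "\<tau> - {xs ! i} = insert w (\<sigma> - {xs ! i})" by (auto simp: \<tau>_def)
      then show ?thesis using zc[OF j that(1), of "Suc R"] that by (simp add: I_def w_def del: zG.simps zval.simps)
    qed
    have "\<not> (\<exists>u\<in>\<tau>. u \<in> cof E (\<tau> - {u}) \<and> zG (Suc R) E {} (\<tau> - {u}))"
    proof
      assume "\<exists>u\<in>\<tau>. u \<in> cof E (\<tau> - {u}) \<and> zG (Suc R) E {} (\<tau> - {u})"
      then obtain u u' where u: "u \<in> \<tau>" "u' \<in> \<tau>" "u' \<noteq> u" "zG (Suc R) E {u'} (\<tau> - {u'})" "zG (Suc R) E {u} (\<tau> - {u})"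
        using two_survivors by blast
      have idx: "\<exists>i<d. xs ! i = v" if "v \<in> \<sigma>" for v
        using that assms(2) by (auto simp: \<sigma>_def in_set_conv_nth)
      have "Suc 0 \<le> card I"
      proof -
        obtain v where v: "v \<in> \<sigma>" "zG (Suc R) E {v} (\<tau> - {v})" using u unfolding \<tau>_def by blast
        obtain i where "i < d" "xs ! i = v" using idx[OF v(1)] by auto
        then have "i \<in> I" using inI v by auto
        then show ?thesis using finI by (metis Suc_leI card_gt_0_iff empty_iff)
      qed
      then have D1: "card I = 1" and ex: "\<exists>j'<length ws. j' \<noteq> j \<and> (\<forall>i<d. \<not> zval d R (ts ! (j' * d + i)))"
        using Q unfolding Q_def Let_def I_def[symmetric] by auto
      \<comment> \<open>Two survivors among the \<open>d\<close> further facets contradict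
        \<open>D = 1\<close>. Otherwise one survivor is the face itself, which contradicts its being
        blocked by another coface.\<close>
      show False
      proof (cases "u \<in> \<sigma> \<and> u' \<in> \<sigma>")
        case True
        obtain i i' where i: "i < d" "xs ! i = u" "i' < d" "xs ! i' = u'" using idx True by metis
        then have "{i, i'} \<subseteq> I" "i \<noteq> i'" using inI[of i] inI[of i'] u by auto
        then have "card {i, i'} \<le> card I" using finI card_mono by blast
        then show False using D1 \<open>i \<noteq> i'\<close> by simp
      next
        case False
        then have "zG (Suc R) E {w} \<sigma>"
        proof -
          have "\<tau> - {w} = \<sigma>" using w(2) by (auto simp: \<tau>_def)
          moreover have "u = w \<or> u' = w" using False u by (auto simp: \<tau>_def)
          ultimately show ?thesis using u by (auto simp del: zG.simps)
        qed
        obtain j' where j': "j' < length ws" "j' \<noteq> j" "\<forall>i<d. \<not> zval d R (ts ! (j' * d + i))" using ex by auto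
        have "ws ! j' \<in> cof E \<sigma> - {w}"
          using ws j' j nth_mem[OF j'(1)] by (auto simp: w_def nth_eq_iff_index_eq)
        then obtain v where v: "v \<in> \<sigma>" "zG R E {v} (insert (ws ! j') (\<sigma> - {v}))"
          using \<open>zG (Suc R) E {w} \<sigma>\<close> by auto
        obtain i where "i < d" "xs ! i = v" using idx[OF v(1)] by auto
        then show False using j'(3) v zc[OF j'(1), of i R] by auto
      qed
    qed
    then show ?thesis using w by (simp add: w_def \<tau>_def)
  qed
  have "psi d R (explore d (Suc (Suc R)) E {} xs) = card {j. j < length ws \<and> Q j}"
    unfolding ts(1) psi_def tree.case Q_def ..
  also have "\<dots> = card ((!) ws ` {j. j < length ws \<and> Q j})"
    using ws(2) by (intro card_image[symmetric] inj_onI) (simp add: nth_eq_iff_index_eq)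
  also have "\<dots> \<le> card ?A"
    using good fin by (intro card_mono) auto
  finally show ?thesis .
qed

text \<open>In the bound \<open>card Z - card B\<close> from \<open>nu_ge\<close>, the negative term
  is rewritten as the number of all cofaces minus those that avoid \<open>Z\<close>. The latter are
  counted by \<open>psi\<close> from each of their \<open>d + 1\<close> facets, hence the divisor;
  the resulting functional is nonnegative.\<close>

lemma nu_lower:
  fixes R :: nat
  assumes E: "E \<subseteq> all_edges n" and d: "d > 0"
  defines "K \<equiv> clique_complex n E"
  defines "L \<equiv> \<lambda>\<sigma>. explore d (Suc (Suc R)) E {} (sorted_list_of_set \<sigma>)"
  shows "(\<Sum>\<sigma>\<in>faces K d. (if zval d (Suc R) (L \<sigma>) then 1 else 0) + real (psi d R (L \<sigma>)) / real (d + 1))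
    \<le> real (nu K d) + real (card (faces K (d + 1)))"
proof -
  define Z where "Z = {\<sigma> \<in> faces K d. zG (Suc R) E {} \<sigma>}"
  define B where "B = {\<tau> \<in> faces K (d + 1). \<exists>u\<in>\<tau>. \<tau> - {u} \<in> Z}"
  have finK: "finite K" unfolding K_def by (rule finite_subset[of _ "Pow {1..n}"]) (auto simp: clique_complex_def)
  note fin = finite_faces[OF finK]
  have xs: "length (sorted_list_of_set \<sigma>) = d" "distinct (sorted_list_of_set \<sigma>)" "set (sorted_list_of_set \<sigma>) = \<sigma>"
    if "\<sigma> \<in> faces K d" for \<sigma> using that by (auto simp: faces_def)
  have "(\<Sum>\<sigma>\<in>faces K d. if zval d (Suc R) (L \<sigma>) then 1 else 0 :: real) = (\<Sum>\<sigma>\<in>faces K d. if zG (Suc R) E {} \<sigma> then 1 else 0)"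
    by (intro sum.cong refl)
      (simp add: L_def zval_explore[OF E xs(1,2) d] xs del: zG.simps zval.simps explore.simps)
  also have "\<dots> = real (card Z)"
    using fin by (simp add: Z_def sum.If_cases Int_def del: zG.simps)
  finally have sz: "(\<Sum>\<sigma>\<in>faces K d. if zval d (Suc R) (L \<sigma>) then 1 else 0 :: real) = real (card Z)" .
  define A where "A \<sigma> = {w \<in> cof E \<sigma>. \<not> (\<exists>u\<in>insert w \<sigma>. u \<in> cof E (insert w \<sigma> - {u}) \<and> zG (Suc R) E {} (insert w \<sigma> - {u}))}" for \<sigma>
  have ne: "\<sigma> \<noteq> {}" if "\<sigma> \<in> faces K d" for \<sigma> using that d by (auto simp: faces_def)
  have finA: "finite (A \<sigma>)" if "\<sigma> \<in> faces K d" for \<sigma>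
    unfolding A_def using finite_cof[OF E ne[OF that]] by simp
  have ins: "insert w \<sigma> \<in> faces K (d + 1)" if "\<sigma> \<in> faces K d" "w \<in> cof E \<sigma>" for \<sigma> w
  proof -
    have "cof E \<sigma> \<subseteq> {1..n}" using E ne[OF that(1)] by (fastforce simp: cof_def all_edges_def)
    then have "w \<in> {1..n}" using that by blast
    moreover have "w \<notin> \<sigma>" "\<And>y. y \<in> \<sigma> \<Longrightarrow> {w, y} \<in> E \<and> {y, w} \<in> E"
      using that(2) by (auto simp: cof_def insert_commute)
    ultimately show ?thesis using that(1) by (auto simp: K_def faces_def clique_complex_def)
  qed
  have "(\<Sum>\<sigma>\<in>faces K d. psi d R (L \<sigma>)) \<le> (\<Sum>\<sigma>\<in>faces K d. card (A \<sigma>))"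
  proof (rule sum_mono)
    fix \<sigma> assume \<sigma>: "\<sigma> \<in> faces K d"
    show "psi d R (L \<sigma>) \<le> card (A \<sigma>)"
      using psi_explore_le[OF E xs(1,2)[OF \<sigma>] d, of R] unfolding xs(3)[OF \<sigma>] L_def A_def .
  qed
  also have "\<dots> = card (Sigma (faces K d) A)" using fin finA by simp
  \<comment> \<open>A pair of a face and an additional vertex is sent to the coface with that vertex
    marked. This is injective, and each coface has \<open>d + 1\<close> possible marks.\<close>
  also have "\<dots> \<le> card (Sigma (faces K (d + 1) - B) (\<lambda>\<tau>. \<tau>))"
  proof (rule card_inj_on_le[where f = "\<lambda>(\<sigma>, w). (insert w \<sigma>, w)"])
    show "inj_on (\<lambda>(\<sigma>, w). (insert w \<sigma>, w)) (Sigma (faces K d) A)"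
      by (rule inj_onI) (auto simp: A_def cof_def insert_ident)
    show "(\<lambda>(\<sigma>, w). (insert w \<sigma>, w)) ` Sigma (faces K d) A \<subseteq> Sigma (faces K (d + 1) - B) (\<lambda>\<tau>. \<tau>)"
    proof
      fix x assume "x \<in> (\<lambda>(\<sigma>, w). (insert w \<sigma>, w)) ` Sigma (faces K d) A"
      then obtain \<sigma> w where x: "x = (insert w \<sigma>, w)" and \<sigma>: "\<sigma> \<in> faces K d" and w: "w \<in> A \<sigma>" by auto
      then have \<tau>: "insert w \<sigma> \<in> faces K (d + 1)" using ins by (auto simp: A_def)
      have "insert w \<sigma> \<notin> B"
      proof
        assume "insert w \<sigma> \<in> B"
        then obtain u where u: "u \<in> insert w \<sigma>" "insert w \<sigma> - {u} \<in> Z" unfolding B_def by blast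
        have "u \<in> cof E (insert w \<sigma> - {u})"
          using \<tau> u(1) by (auto simp: K_def faces_def clique_complex_def cof_def)
        then show False using w u by (auto simp: A_def Z_def simp del: zG.simps)
      qed
      then show "x \<in> Sigma (faces K (d + 1) - B) (\<lambda>\<tau>. \<tau>)" unfolding x using \<tau> by auto
    qed
    show "finite (Sigma (faces K (d + 1) - B) (\<lambda>\<tau>. \<tau>))"
      using fin by (intro finite_SigmaI) (auto simp: faces_def)
  qed
  also have "\<dots> = (\<Sum>\<tau>\<in>faces K (d + 1) - B. card \<tau>)"
    using fin by (intro card_SigmaI) (auto simp: faces_def)
  also have "\<dots> = card (faces K (d + 1) - B) * (d + 1)"
    by (simp add: faces_def)
  also have "card (faces K (d + 1) - B) = card (faces K (d + 1)) - card B"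
    using fin by (intro card_Diff_subset) (auto simp: B_def)
  finally have "(\<Sum>\<sigma>\<in>faces K d. psi d R (L \<sigma>)) \<le> (card (faces K (d + 1)) - card B) * (d + 1)" .
  then have le: "real (\<Sum>\<sigma>\<in>faces K d. psi d R (L \<sigma>)) \<le> real ((card (faces K (d + 1)) - card B) * (d + 1))"
    by (rule of_nat_mono)
  have "card B \<le> card (faces K (d + 1))"
    using fin by (intro card_mono) (auto simp: B_def)
  then have "real ((card (faces K (d + 1)) - card B) * (d + 1)) = (real (card (faces K (d + 1))) - real (card B)) * real (d + 1)"
    by (simp only: of_nat_mult of_nat_diff)
  then have "(\<Sum>\<sigma>\<in>faces K d. real (psi d R (L \<sigma>))) / real (d + 1) \<le> real (card (faces K (d + 1))) - real (card B)"
    using le by (subst pos_divide_le_eq) simp_all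
  then have sp: "(\<Sum>\<sigma>\<in>faces K d. real (psi d R (L \<sigma>)) / real (d + 1)) \<le> real (card (faces K (d + 1))) - real (card B)"
    unfolding sum_divide_distrib .
  have "card Z \<le> nu K d + card B"
    unfolding B_def by (rule nu_ge[OF finK]) (auto simp: Z_def)
  then show ?thesis using sz sp by (simp add: sum.distrib)
qed

section \<open>Counting labelled trees\<close>

text \<open>Together with \<open>isize\<close> and \<open>fprod\<close>, the data that determine the
  probability of a shape: the number of new vertices, the number of faces whose cofaces are
  explored, and the product of the factorials of the offspring numbers.\<close>

primrec msize :: "nat \<Rightarrow> nat \<Rightarrow> 'a tree \<Rightarrow> nat" where
  "msize d 0 T = 0"
| "msize d (Suc R) T = (case T of Node ws ts \<Rightarrow> length ws + (\<Sum>q<d * length ws. msize d R (ts ! q)))"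

primrec isize :: "nat \<Rightarrow> nat \<Rightarrow> 'a tree \<Rightarrow> nat" where
  "isize d 0 T = 0"
| "isize d (Suc R) T = (case T of Node ws ts \<Rightarrow> 1 + (\<Sum>q<d * length ws. isize d R (ts ! q)))"

primrec fprod :: "nat \<Rightarrow> nat \<Rightarrow> 'a tree \<Rightarrow> real" where
  "fprod d 0 T = 1"
| "fprod d (Suc R) T = (case T of Node ws ts \<Rightarrow> fact (length ws) * (\<Prod>q<d * length ws. fprod d R (ts ! q)))"

lemma fprod_pos: "fprod d R T > 0"
  by (induction R arbitrary: T) (auto split: tree.split intro!: mult_pos_pos prod_pos)

lemma wt_eq: "wt d c R T = c ^ msize d R T / fprod d R T * exp (- c) ^ isize d R T"
proof (induction R arbitrary: T)
  case (Suc R)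
  obtain ws ts where T: "T = Node ws ts" by (cases T)
  show ?case
    by (simp add: T Suc prod.distrib prod_dividef power_sum power_add)
qed simp

definition shape :: "'a tree \<Rightarrow> unit tree" where
  "shape = map_tree (\<lambda>_. ())"

lemma shape_Node: "shape (Node ws ts) = Node (replicate (length ws) ()) (map shape ts)"
  by (simp add: shape_def map_replicate_const)

lemma shape_invariants:
  assumes "lt d R L"
  shows "wft d R (shape L)" "xval d R (shape L) = xval d R L" "R' \<le> R \<Longrightarrow> zval d R' (shape L) = zval d R' L"
    "msize d R (shape L) = msize d R L" "isize d R (shape L) = isize d R L"
proof -
  have "wft d R (shape L) \<and> xval d R (shape L) = xval d R L \<and> (\<forall>R'\<le>R. zval d R' (shape L) = zval d R' L)
    \<and> msize d R (shape L) = msize d R L \<and> isize d R (shape L) = isize d R L"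
    using assms
  proof (induction R arbitrary: L)
    case 0
    then show ?case by (simp add: shape_def)
  next
    case (Suc R)
    obtain ws ts where L: "L = Node ws ts" by (cases L)
    have len: "length ts = d * length ws" and sub: "\<And>q. q < d * length ws \<Longrightarrow> lt d R (ts ! q)"
      using Suc.prems by (auto simp: L)
    have nth: "map shape ts ! q = shape (ts ! q)" if "q < d * length ws" for q using that len by simp
    note ih = Suc.IH[OF sub]
    have z: "zval d R' (shape L) = zval d R' L" if "R' \<le> Suc R" for R'
    proof (cases R')
      case (Suc R'')
      have "zval d R'' (map shape ts ! (j * d + i)) = zval d R'' (ts ! (j * d + i))" if "j < length ws" "i < d" for i j
        using ih[OF block_less[OF that]] nth[OF block_less[OF that]] \<open>R' \<le> Suc R\<close> Suc by simp
      then show ?thesis unfolding Suc L shape_Node by (simp cong: conj_cong)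
    qed simp
    have x: "(\<Sum>i<d. xval d R (map shape ts ! (j * d + i))) = (\<Sum>i<d. xval d R (ts ! (j * d + i)))" if "j < length ws" for j
      using ih[OF block_less[OF that]] nth[OF block_less[OF that]] by (intro sum.cong) auto
    show ?case
    proof (intro conjI allI impI z)
      show "wft d (Suc R) (shape L)" unfolding L shape_Node using len nth ih by simp
      show "xval d (Suc R) (shape L) = xval d (Suc R) L" unfolding L shape_Node using x by simp
      show "msize d (Suc R) (shape L) = msize d (Suc R) L" unfolding L shape_Node using nth ih by simp
      show "isize d (Suc R) (shape L) = isize d (Suc R) L" unfolding L shape_Node using nth ih by simp
    qed
  qed
  then show "wft d R (shape L)" "xval d R (shape L) = xval d R L" "R' \<le> R \<Longrightarrow> zval d R' (shape L) = zval d R' L"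
    "msize d R (shape L) = msize d R L" "isize d R (shape L) = isize d R L" by auto
qed

lemma shape_psi:
  assumes "lt d (Suc (Suc R)) L"
  shows "psi d R (shape L) = psi d R L"
proof -
  obtain ws ts where L: "L = Node ws ts" by (cases L)
  have len: "length ts = d * length ws" and sub: "\<And>q. q < d * length ws \<Longrightarrow> lt d (Suc R) (ts ! q)"
    using assms by (auto simp: L)
  have "zval d R' (map shape ts ! (j * d + i)) = zval d R' (ts ! (j * d + i))" if "j < length ws" "i < d" "R' \<le> Suc R" for i j R'
  proof -
    have q: "j * d + i < d * length ws" by (rule block_less[OF that(1,2)])
    show ?thesis using shape_invariants(3)[OF sub[OF q] that(3)] q len by simp
  qed
  from this[of _ _ "Suc R"] this[of _ _ R] show ?thesis
    unfolding L shape_Node psi_def tree.case length_replicate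
    by (simp del: zval.simps cong: conj_cong imp_cong)
qed

primrec labs :: "nat \<Rightarrow> nat \<Rightarrow> unit tree \<Rightarrow> nat set \<Rightarrow> nat tree set" where
  "labs d 0 T S = {Node [] []}"
| "labs d (Suc R) T S = {L. lt d (Suc R) L \<and> shape L = T \<and> set_tree L \<subseteq> S}"

lemma labs_eq: "wft d R T \<Longrightarrow> labs d R T S = {L. lt d R L \<and> shape L = T \<and> set_tree L \<subseteq> S}"
  by (cases R) (auto simp: shape_def)

primrec forests :: "nat \<Rightarrow> nat \<Rightarrow> unit tree list \<Rightarrow> nat set \<Rightarrow> nat tree list set" where
  "forests d R [] S = {[]}"
| "forests d R (T # Ts) S = (\<Union>L\<in>labs d R T S. (#) L ` forests d R Ts (S - set_tree L))"

lemma forests_props: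
  assumes "\<And>T. T \<in> set Ts \<Longrightarrow> wft d R T" "Ls \<in> forests d R Ts S"
  shows "length Ls = length Ts \<and> (\<forall>q<length Ts. lt d R (Ls ! q) \<and> shape (Ls ! q) = Ts ! q \<and> set_tree (Ls ! q) \<subseteq> S \<and>
    (\<forall>q'<length Ts. q \<noteq> q' \<longrightarrow> set_tree (Ls ! q) \<inter> set_tree (Ls ! q') = {}))"
  using assms
proof (induction Ts arbitrary: Ls S)
  case (Cons T Ts)
  obtain L Ls' where Ls: "Ls = L # Ls'" and L: "L \<in> labs d R T S" and Ls': "Ls' \<in> forests d R Ts (S - set_tree L)"
    using Cons.prems by auto
  have ih: "length Ls' = length Ts" "\<And>q. q < length Ts \<Longrightarrow> lt d R (Ls' ! q) \<and> shape (Ls' ! q) = Ts ! q \<and> set_tree (Ls' ! q) \<subseteq> S - set_tree L \<and>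
    (\<forall>q'<length Ts. q \<noteq> q' \<longrightarrow> set_tree (Ls' ! q) \<inter> set_tree (Ls' ! q') = {})"
    using Cons.IH[OF _ Ls'] Cons.prems(1) by auto
  have L': "lt d R L" "shape L = T" "set_tree L \<subseteq> S"
    using L Cons.prems(1)[of T] by (auto simp: labs_eq)
  show ?case
  proof (intro conjI allI impI)
    show "length Ls = length (T # Ts)" using ih(1) Ls by simp
  next
    fix q assume q: "q < length (T # Ts)"
    show "lt d R (Ls ! q)" "shape (Ls ! q) = (T # Ts) ! q" "set_tree (Ls ! q) \<subseteq> S"
      using q ih(2)[of "q - 1"] L' by (cases q; auto simp: Ls)+
    fix q' assume q': "q' < length (T # Ts)" "q \<noteq> q'"
    show "set_tree (Ls ! q) \<inter> set_tree (Ls ! q') = {}"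
    proof (cases q)
      case 0
      then obtain p where "q' = Suc p" "p < length Ts" using q' by (cases q') auto
      then show ?thesis using 0 ih(2)[of p] by (auto simp: Ls)
    next
      case (Suc p)
      then have p: "p < length Ts" using q by simp
      show ?thesis
      proof (cases q')
        case 0
        then show ?thesis using Suc ih(2)[OF p] by (auto simp: Ls)
      next
        case (Suc p')
        then show ?thesis using \<open>q = Suc p\<close> ih(2)[OF p] q' by (auto simp: Ls)
      qed
    qed
  qed
qed simp

lemma card_set_tree_le:
  assumes "lt d R L"
  shows "finite (set_tree L)" "card (set_tree L) \<le> msize d R L"
proof -
  have "finite (set_tree L) \<and> card (set_tree L) \<le> msize d R L"
    using assms
  proof (induction R arbitrary: L)
    case (Suc R)
    obtain ws ts where L: "L = Node ws ts" by (cases L)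
    have len: "length ts = d * length ws" and sub: "\<And>q. q < d * length ws \<Longrightarrow> lt d R (ts ! q)"
      using Suc.prems by (auto simp: L)
    have tr: "set_tree L = set ws \<union> (\<Union>q<d * length ws. set_tree (ts ! q))"
      unfolding L using len by (rule set_tree_Node)
    have "card (set_tree L) \<le> card (set ws) + card (\<Union>q<d * length ws. set_tree (ts ! q))"
      unfolding tr by (rule card_Un_le)
    also have "\<dots> \<le> length ws + (\<Sum>q<d * length ws. card (set_tree (ts ! q)))"
      by (intro add_mono card_length card_UN_le) simp
    also have "\<dots> \<le> msize d (Suc R) L"
      using Suc.IH[OF sub] by (auto simp: L intro!: sum_mono)
    finally show ?case using Suc.IH[OF sub] unfolding tr by simp
  qed simp
  then show "finite (set_tree L)" "card (set_tree L) \<le> msize d R L" by auto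
qed

text \<open>The right side is the product of the \<open>N\<close> factors
  \<open>N0 + 1, ..., N0 + N\<close>.\<close>

lemma falling_ge_power: "N0 ^ N \<le> fact N * ((N0 + N) choose N)"
proof (induction N)
  case (Suc N)
  have "N0 ^ Suc N \<le> (N0 + Suc N) * (fact N * ((N0 + N) choose N))"
    unfolding power_Suc by (intro mult_mono Suc) auto
  also have "\<dots> = fact N * (Suc (N0 + N) * ((N0 + N) choose N))"
    by (simp only: add_Suc_right mult.left_commute)
  also have "Suc (N0 + N) * ((N0 + N) choose N) = Suc N * (Suc (N0 + N) choose Suc N)"
    by (rule Suc_times_binomial_eq[symmetric, unfolded mult.commute[of _ "Suc _"]] Suc_times_binomial[symmetric])
  finally show ?case by (simp only: add_Suc_right fact_Suc of_nat_id mult.assoc mult.left_commute)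
qed simp

text \<open>Labels are chosen node by node from the vertices still free. Since \<open>N0\<close>
  vertices remain beyond all that will be used, a node with \<open>N\<close> cofaces offers at least
  \<open>N0 ^ N / fact N\<close> sets of labels; sets are counted because the lists are sorted, and
  \<open>fprod\<close> collects the factorials.\<close>

lemma card_labs:
  assumes "wft d R T" "finite S" "N0 + msize d R T \<le> card S"
  shows "finite (labs d R T S)" "real N0 ^ msize d R T \<le> fprod d R T * real (card (labs d R T S))"
proof -
  have "finite (labs d R T S) \<and> (N0 + msize d R T \<le> card S \<longrightarrow>
      real N0 ^ msize d R T \<le> fprod d R T * real (card (labs d R T S)))"
    using assms(1,2)
  proof (induction R arbitrary: T S N0)
    case 0
    then show ?case by simp
  next
    case (Suc R)
    \<comment> \<open>An inner induction over the list of subtrees, each avoiding the labels of its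
      predecessors; it uses the outer hypothesis for arbitrary finite sets of free labels.\<close>
    have forest: "finite (forests d R Ts S) \<and> (N0 + (\<Sum>T\<leftarrow>Ts. msize d R T) \<le> card S \<longrightarrow>
        real N0 ^ (\<Sum>T\<leftarrow>Ts. msize d R T) \<le> (\<Prod>T\<leftarrow>Ts. fprod d R T) * real (card (forests d R Ts S)))"
      if "\<And>T. T \<in> set Ts \<Longrightarrow> wft d R T" "finite S" for Ts S
      using that
    proof (induction Ts arbitrary: S)
      case (Cons T Ts)
      have wT: "wft d R T" using Cons.prems by simp
      have labT: "L \<in> labs d R T S \<Longrightarrow> lt d R L \<and> msize d R L = msize d R T \<and> set_tree L \<subseteq> S" for L
        using shape_invariants(4)[of d R L] by (auto simp: labs_eq[OF wT])
      have finS: "finite (S - set_tree L)" for L using Cons.prems(2) by simp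
      have fin1: "finite (labs d R T S)" using Suc.IH[OF wT Cons.prems(2)] by simp
      have fin2: "finite (forests d R Ts (S - set_tree L))" for L
        using Cons.IH[OF _ finS] Cons.prems(1) by simp
      have card_eq: "card (forests d R (T # Ts) S) = (\<Sum>L\<in>labs d R T S. card (forests d R Ts (S - set_tree L)))"
      proof -
        have "card (forests d R (T # Ts) S) = (\<Sum>L\<in>labs d R T S. card ((#) L ` forests d R Ts (S - set_tree L)))"
          unfolding forests.simps using fin1 fin2 by (intro card_UN_disjoint) auto
        then show ?thesis by (simp add: card_image)
      qed
      have "real N0 ^ (\<Sum>T\<leftarrow>T # Ts. msize d R T) \<le> (\<Prod>T\<leftarrow>T # Ts. fprod d R T) * real (card (forests d R (T # Ts) S))"
        if big: "N0 + (\<Sum>T\<leftarrow>T # Ts. msize d R T) \<le> card S"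
      proof -
        let ?M = "\<Sum>T\<leftarrow>Ts. msize d R T" and ?P = "\<Prod>T\<leftarrow>Ts. fprod d R T"
        have P: "?P \<ge> 0" by (intro prod_list_nonneg) (auto intro: less_imp_le[OF fprod_pos])
        have each: "real N0 ^ ?M \<le> ?P * real (card (forests d R Ts (S - set_tree L)))" if L: "L \<in> labs d R T S" for L
        proof -
          have "card (S - set_tree L) \<ge> card S - msize d R T"
            using labT[OF L] card_set_tree_le[of d R L] diff_card_le_card_Diff[of "set_tree L" S] by linarith
          then have "N0 + ?M \<le> card (S - set_tree L)" using big by simp
          then show ?thesis using Cons.IH[OF _ finS] Cons.prems(1) by simp
        qed
        have "real N0 ^ (\<Sum>T\<leftarrow>T # Ts. msize d R T) = real N0 ^ msize d R T * real N0 ^ ?M"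
          by (simp add: power_add)
        also have "\<dots> \<le> (fprod d R T * real (card (labs d R T S))) * real N0 ^ ?M"
          using Suc.IH[OF wT Cons.prems(2), of N0] big by (intro mult_right_mono) auto
        also have "\<dots> = fprod d R T * (\<Sum>L\<in>labs d R T S. real N0 ^ ?M)" by simp
        also have "\<dots> \<le> fprod d R T * (\<Sum>L\<in>labs d R T S. ?P * real (card (forests d R Ts (S - set_tree L))))"
          using each less_imp_le[OF fprod_pos] by (intro mult_left_mono sum_mono) auto
        finally show ?thesis unfolding card_eq by (simp add: sum_distrib_left mult.assoc del: forests.simps)
      qed
      moreover have "finite (forests d R (T # Ts) S)" using fin1 fin2 by simp
      ultimately show ?case by blast
    qed simp
    obtain us Ts where T: "T = Node us Ts" by (cases T)
    define N where "N = length us"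
    have len: "length Ts = d * N" and wfs: "\<And>q. q < d * N \<Longrightarrow> wft d R (Ts ! q)"
      using Suc.prems(1) by (auto simp: T N_def)
    then have wfs': "\<And>T. T \<in> set Ts \<Longrightarrow> wft d R T" by (auto simp: in_set_conv_nth)
    have us: "us = replicate N ()" unfolding N_def by (simp add: list_eq_iff_nth_eq)
    have ms: "(\<Sum>T\<leftarrow>Ts. msize d R T) = (\<Sum>q<d * N. msize d R (Ts ! q))"
      by (simp add: sum_list_sum_nth len lessThan_atLeast0)
    have fs: "(\<Prod>T\<leftarrow>Ts. fprod d R T) = (\<Prod>q<d * N. fprod d R (Ts ! q))"
      by (simp add: prod.list_conv_set_nth len lessThan_atLeast0)
    define WW where "WW = {W. W \<subseteq> S \<and> card W = N}"
    define f where "f = (\<lambda>(W, Ls). Node (sorted_list_of_set W) Ls :: nat tree)"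
    have finW: "W \<in> WW \<Longrightarrow> finite W" for W unfolding WW_def using Suc.prems(2) finite_subset by blast
    have finWW: "finite WW" unfolding WW_def using Suc.prems(2) by simp
    \<comment> \<open>A labelled tree amounts to the set of vertices completing the cofaces of the
      root together with a forest on the remaining labels.\<close>
    have img: "f ` (SIGMA W:WW. forests d R Ts (S - W)) = labs d (Suc R) T S"
    proof (intro equalityI subsetI)
      fix L assume "L \<in> f ` (SIGMA W:WW. forests d R Ts (S - W))"
      then obtain W Ls where L: "L = Node (sorted_list_of_set W) Ls" and W: "W \<in> WW" and Ls: "Ls \<in> forests d R Ts (S - W)"
        by (auto simp: f_def)
      have lW: "length (sorted_list_of_set W) = N" "set (sorted_list_of_set W) = W"
        using W finW[OF W] by (auto simp: WW_def)
      note fp = forests_props[OF wfs' Ls]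
      have lLs: "length Ls = d * N" using fp len by simp
      have "lt d (Suc R) L"
        unfolding L lt.simps tree.case lW using fp len by auto
      moreover have "shape L = T"
        unfolding L T shape_Node us lW using fp len by (auto simp: list_eq_iff_nth_eq)
      moreover have "set_tree L \<subseteq> S"
      proof -
        have "set_tree L = W \<union> (\<Union>q<d * N. set_tree (Ls ! q))"
          unfolding L using set_tree_Node[OF lLs, of "sorted_list_of_set W"] by (simp only: lW)
        then show ?thesis using fp len W by (auto simp: WW_def)
      qed
      ultimately show "L \<in> labs d (Suc R) T S" by simp
    next
      fix L assume "L \<in> labs d (Suc R) T S"
      then have L: "lt d (Suc R) L" "shape L = T" "set_tree L \<subseteq> S" by auto
      obtain ws Ls where Lf: "L = Node ws Ls" by (cases L)
      have lw: "length ws = N" "map shape Ls = Ts" using L(2) unfolding Lf shape_Node T N_def by auto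
      have lLs: "length Ls = d * N" using lw len by (metis length_map)
      have tr: "set_tree L = set ws \<union> (\<Union>q<d * N. set_tree (Ls ! q))"
        unfolding Lf using lLs by (rule set_tree_Node)
      have ws: "sorted ws" "distinct ws" and sub: "\<And>q. q < d * N \<Longrightarrow> lt d R (Ls ! q) \<and> set ws \<inter> set_tree (Ls ! q) = {} \<and>
         (\<forall>q'<d * N. q \<noteq> q' \<longrightarrow> set_tree (Ls ! q) \<inter> set_tree (Ls ! q') = {})"
        using L(1) unfolding Lf by (auto simp: lw)
      have fr: "Ls' \<in> forests d R Ts' S'"
        if "length Ls' = length Ts'" "\<And>T. T \<in> set Ts' \<Longrightarrow> wft d R T"
          "\<And>q. q < length Ts' \<Longrightarrow> lt d R (Ls' ! q) \<and> shape (Ls' ! q) = Ts' ! q \<and> set_tree (Ls' ! q) \<subseteq> S' \<and>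
           (\<forall>q'<length Ts'. q \<noteq> q' \<longrightarrow> set_tree (Ls' ! q) \<inter> set_tree (Ls' ! q') = {})" for Ls' Ts' S'
        using that
      proof (induction Ts' arbitrary: Ls' S')
        case (Cons T' Ts')
        obtain L' Ls'' where Ls': "Ls' = L' # Ls''" using Cons.prems(1) by (cases Ls') auto
        have "L' \<in> labs d R T' S'"
          using Cons.prems(2)[of T'] Cons.prems(3)[of 0] by (simp add: labs_eq Ls')
        moreover have "Ls'' \<in> forests d R Ts' (S' - set_tree L')"
        proof (rule Cons.IH)
          show "length Ls'' = length Ts'" using Cons.prems(1) Ls' by simp
          fix q assume q: "q < length Ts'"
          have "set_tree L' \<inter> set_tree (Ls'' ! q) = {}"
          proof -
            have "\<forall>q'<length (T' # Ts'). 0 \<noteq> q' \<longrightarrow> set_tree (Ls' ! 0) \<inter> set_tree (Ls' ! q') = {}"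
              using Cons.prems(3)[of 0] by simp
            from this[rule_format, of "Suc q"] q show ?thesis by (simp add: Ls')
          qed
          then show "lt d R (Ls'' ! q) \<and> shape (Ls'' ! q) = Ts' ! q \<and> set_tree (Ls'' ! q) \<subseteq> S' - set_tree L' \<and>
           (\<forall>q'<length Ts'. q \<noteq> q' \<longrightarrow> set_tree (Ls'' ! q) \<inter> set_tree (Ls'' ! q') = {})"
          proof -
            assume dj: "set_tree L' \<inter> set_tree (Ls'' ! q) = {}"
            have A: "lt d R (Ls'' ! q)" "shape (Ls'' ! q) = Ts' ! q" "set_tree (Ls'' ! q) \<subseteq> S'"
              and B: "\<forall>q'<length (T' # Ts'). Suc q \<noteq> q' \<longrightarrow> set_tree (Ls' ! Suc q) \<inter> set_tree (Ls' ! q') = {}"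
              using Cons.prems(3)[of "Suc q"] q by (simp_all add: Ls')
            have "set_tree (Ls'' ! q) \<inter> set_tree (Ls'' ! q') = {}" if "q' < length Ts'" "q \<noteq> q'" for q'
              using B[rule_format, of "Suc q'"] that by (simp add: Ls')
            then show ?thesis using A dj by blast
          qed
        qed (use Cons.prems(2) in simp)
        ultimately show ?case by (auto simp: Ls')
      qed simp
      have "Ls \<in> forests d R Ts (S - set ws)"
      proof (rule fr)
        fix q assume "q < length Ts"
        then have q: "q < d * N" using len by simp
        have "shape (Ls ! q) = Ts ! q" using lw(2) lLs q by (metis nth_map)
        moreover have "set_tree (Ls ! q) \<subseteq> S" using L(3) tr q by auto
        ultimately show "lt d R (Ls ! q) \<and> shape (Ls ! q) = Ts ! q \<and> set_tree (Ls ! q) \<subseteq> S - set ws \<and>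
           (\<forall>q'<length Ts. q \<noteq> q' \<longrightarrow> set_tree (Ls ! q) \<inter> set_tree (Ls ! q') = {})"
          using sub[OF q] len by auto
      qed (use lLs len wfs' in auto)
      moreover have "set ws \<in> WW" unfolding WW_def using L(3) tr ws lw distinct_card[of ws] by auto
      moreover have "L = f (set ws, Ls)"
        unfolding f_def Lf using ws by (simp add: sorted_list_of_set.idem_if_sorted_distinct)
      ultimately show "L \<in> f ` (SIGMA W:WW. forests d R Ts (S - W))" by blast
    qed
    have inj: "inj_on f (SIGMA W:WW. forests d R Ts (S - W))"
    proof (rule inj_onI)
      fix x y assume xy: "x \<in> (SIGMA W:WW. forests d R Ts (S - W))" "y \<in> (SIGMA W:WW. forests d R Ts (S - W))" "f x = f y"
      then have "finite (fst x)" "finite (fst y)" using finW by auto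
      moreover have "sorted_list_of_set (fst x) = sorted_list_of_set (fst y)" "snd x = snd y"
        using xy(3) by (auto simp: f_def split_beta)
      ultimately show "x = y" by (metis prod_eqI set_sorted_list_of_set)
    qed
    have finF: "finite (forests d R Ts (S - W))" for W using forest[OF wfs'] Suc.prems(2) by simp
    have finL: "finite (labs d (Suc R) T S)"
      unfolding img[symmetric] using finWW finF by auto
    have cardL: "card (labs d (Suc R) T S) = (\<Sum>W\<in>WW. card (forests d R Ts (S - W)))"
      unfolding img[symmetric] card_image[OF inj] using finWW finF by simp
    have "real N0 ^ msize d (Suc R) T \<le> fprod d (Suc R) T * real (card (labs d (Suc R) T S))"
      if big: "N0 + msize d (Suc R) T \<le> card S"
    proof -
      let ?M = "\<Sum>T\<leftarrow>Ts. msize d R T" and ?P = "\<Prod>T\<leftarrow>Ts. fprod d R T"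
      have P: "?P \<ge> 0" by (intro prod_list_nonneg) (auto intro: less_imp_le[OF fprod_pos])
      have big': "N0 + (N + ?M) \<le> card S" using big by (simp add: T N_def ms)
      have each: "real N0 ^ ?M \<le> ?P * real (card (forests d R Ts (S - W)))" if W: "W \<in> WW" for W
      proof -
        have "card (S - W) = card S - N"
          using W finW[OF W] by (simp add: WW_def card_Diff_subset)
        then have "N0 + ?M \<le> card (S - W)" using big' by simp
        then show ?thesis using forest[OF wfs', where S = "S - W"] Suc.prems(2) by simp
      qed
      have "card WW = card S choose N" unfolding WW_def using Suc.prems(2) by (rule n_subsets)
      then have "fact N * ((N0 + N) choose N) \<le> fact N * card WW"
        using big' by (intro mult_left_mono) (auto intro!: binomial_right_mono)
      with falling_ge_power[of N0 N] have "N0 ^ N \<le> fact N * card WW" by linarith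
      then have c1: "real N0 ^ N \<le> fact N * real (card WW)"
        by (metis of_nat_fact of_nat_le_iff of_nat_mult of_nat_power)
      have "real N0 ^ msize d (Suc R) T = real N0 ^ N * real N0 ^ ?M"
        by (simp add: T N_def[symmetric] ms power_add)
      also have "\<dots> \<le> (fact N * real (card WW)) * real N0 ^ ?M"
        using c1 by (intro mult_right_mono) auto
      also have "\<dots> = fact N * (\<Sum>W\<in>WW. real N0 ^ ?M)" by simp
      also have "\<dots> \<le> fact N * (\<Sum>W\<in>WW. ?P * real (card (forests d R Ts (S - W))))"
        using each by (intro mult_left_mono sum_mono) auto
      also have "\<dots> = fprod d (Suc R) T * real (card (labs d (Suc R) T S))"
        unfolding cardL by (simp add: T N_def[symmetric] fs sum_distrib_left mult.assoc)
      finally show ?thesis .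
    qed
    then show ?case using finL by blast
  qed
  then show "finite (labs d R T S)" "real N0 ^ msize d R T \<le> fprod d R T * real (card (labs d R T S))"
    using assms(3) by auto
qed

lemma card_SE_le:
  assumes "lt d R L" "length xs = d"
  shows "finite (SE d R xs L) \<and> card (SE d R xs L) \<le> d * msize d R L"
  using assms
proof (induction R arbitrary: xs L)
  case (Suc R)
  obtain ws ts where L: "L = Node ws ts" by (cases L)
  have sub: "\<And>q. q < d * length ws \<Longrightarrow> lt d R (ts ! q)" using Suc.prems by (auto simp: L)
  let ?c = "\<lambda>q. SE d R (xs[q mod d := ws ! (q div d)]) (ts ! q)"
  have ih: "finite (?c q) \<and> card (?c q) \<le> d * msize d R (ts ! q)" if "q < d * length ws" for q
    using Suc.IH[OF sub[OF that]] Suc.prems(2) by simp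
  have SEq: "SE d (Suc R) xs L = (\<lambda>(w, y). {w, y}) ` (set ws \<times> set xs) \<union> (\<Union>q<d * length ws. ?c q)"
    by (simp add: L)
  have "card ((\<lambda>(w, y). {w, y}) ` (set ws \<times> set xs)) \<le> card (set ws \<times> set xs)"
    by (rule card_image_le) simp
  also have "\<dots> \<le> length ws * d"
    using Suc.prems(2) card_length[of ws] card_length[of xs] by (simp add: mult_mono)
  finally have "card (SE d (Suc R) xs L) \<le> length ws * d + card (\<Union>q<d * length ws. ?c q)"
    unfolding SEq using card_Un_le[of "(\<lambda>(w, y). {w, y}) ` (set ws \<times> set xs)"] by (meson add_le_mono1 order_trans)
  also have "card (\<Union>q<d * length ws. ?c q) \<le> (\<Sum>q<d * length ws. card (?c q))"
    by (rule card_UN_le) simp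
  also have "\<dots> \<le> (\<Sum>q<d * length ws. d * msize d R (ts ! q))"
    using ih by (intro sum_mono) auto
  finally have "card (SE d (Suc R) xs L) \<le> d * msize d (Suc R) L"
    by (simp add: L sum_distrib_left algebra_simps)
  moreover have "finite (SE d (Suc R) xs L)" unfolding SEq using ih by auto
  ultimately show ?case by simp
qed simp

definition inner_faces :: "nat \<Rightarrow> nat \<Rightarrow> nat list \<Rightarrow> nat tree \<Rightarrow> nat set set" where
  "inner_faces d R xs L = {set ys | r e ys ws. (Suc r, e, ys, ws) \<in> nd d R {} xs L}"

lemma card_inner_faces: "finite (inner_faces d R xs L) \<and> card (inner_faces d R xs L) \<le> isize d R L"
proof -
  \<comment> \<open>The excluded set is generalised because it changes from a node to its children;
    the union over the children bounds the count by \<open>isize\<close>.\<close>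
  define g where "g R ex xs L = {set ys | r e ys ws. (Suc r, e, ys, ws) \<in> nd d R ex xs L}" for R ex xs L
  have "finite (g R ex xs L) \<and> card (g R ex xs L) \<le> isize d R L" for ex
  proof (induction R arbitrary: ex xs L)
    case 0
    then show ?case by (simp add: g_def)
  next
    case (Suc R)
    obtain ws ts where L: "L = Node ws ts" by (cases L)
    let ?c = "\<lambda>q. g R {xs ! (q mod d)} (xs[q mod d := ws ! (q div d)]) (ts ! q)"
    have eq: "g (Suc R) ex xs L = insert (set xs) (\<Union>q<d * length ws. ?c q)"
      by (auto simp: g_def L) blast+
    have "card (g (Suc R) ex xs L) \<le> Suc (card (\<Union>q<d * length ws. ?c q))"
      unfolding eq by (rule card_insert_le_m1) simp_all
    also have "card (\<Union>q<d * length ws. ?c q) \<le> (\<Sum>q<d * length ws. card (?c q))"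
      by (rule card_UN_le) simp
    also have "\<dots> \<le> (\<Sum>q<d * length ws. isize d R (ts ! q))"
      using Suc by (intro sum_mono) auto
    finally show ?case using Suc unfolding eq by (simp add: L)
  qed
  then show ?thesis unfolding inner_faces_def g_def by blast
qed

section \<open>Expectations over random edge sets\<close>

text \<open>The expectation is formed over an arbitrary finite edge set, so that edges can be added
  one at a time and split into independent parts.\<close>

definition edgeE :: "nat set set \<Rightarrow> real \<Rightarrow> (nat set set \<Rightarrow> real) \<Rightarrow> real" where
  "edgeE A p f = (\<Sum>E\<in>Pow A. p ^ card E * (1 - p) ^ (card A - card E) * f E)"

lemma gnp_expectation_eq: "gnp_expectation n p f = edgeE (all_edges n) p f"
  by (simp add: gnp_expectation_def gnp_weight_def edgeE_def)

lemma finite_all_edges: "finite (all_edges n)"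
  by (rule finite_subset[of _ "Pow {1..n}"]) (auto simp: all_edges_def)

lemma edgeE_empty [simp]: "edgeE {} p f = f {}"
  by (simp add: edgeE_def)

lemma edgeE_insert:
  assumes "finite A" "e \<notin> A"
  shows "edgeE (insert e A) p f = p * edgeE A p (\<lambda>E. f (insert e E)) + (1 - p) * edgeE A p f"
proof -
  have disj: "Pow A \<inter> insert e ` Pow A = {}" using assms by auto
  have inj: "inj_on (insert e) (Pow A)" using assms by (auto simp: inj_on_def insert_ident subset_eq)
  have c: "card (insert e E) = Suc (card E)" "card E \<le> card A" if "E \<in> Pow A" for E
  proof -
    have "finite E" "e \<notin> E" "E \<subseteq> A" using that assms finite_subset[of E A] by auto
    then show "card (insert e E) = Suc (card E)" "card E \<le> card A"
      using assms by (auto intro: card_mono)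
  qed
  have "edgeE (insert e A) p f = (\<Sum>E\<in>Pow A. p ^ card E * (1 - p) ^ (card (insert e A) - card E) * f E)
      + (\<Sum>E\<in>insert e ` Pow A. p ^ card E * (1 - p) ^ (card (insert e A) - card E) * f E)"
    unfolding edgeE_def Pow_insert using assms disj by (intro sum.union_disjoint) auto
  also have "(\<Sum>E\<in>Pow A. p ^ card E * (1 - p) ^ (card (insert e A) - card E) * f E) = (1 - p) * edgeE A p f"
    unfolding edgeE_def sum_distrib_left
    by (intro sum.cong refl) (use assms c in \<open>simp add: Suc_diff_le mult_ac\<close>)
  also have "(\<Sum>E\<in>insert e ` Pow A. p ^ card E * (1 - p) ^ (card (insert e A) - card E) * f E)
      = p * edgeE A p (\<lambda>E. f (insert e E))"
    unfolding edgeE_def sum_distrib_left sum.reindex[OF inj] o_def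
    by (intro sum.cong refl) (use assms c in \<open>simp add: mult_ac\<close>)
  finally show ?thesis by simp
qed

lemma edgeE_cong: "(\<And>E. E \<subseteq> A \<Longrightarrow> f E = g E) \<Longrightarrow> edgeE A p f = edgeE A p g"
  unfolding edgeE_def by (intro sum.cong) auto

lemma edgeE_add: "edgeE A p (\<lambda>E. f E + g E) = edgeE A p f + edgeE A p g"
  by (simp add: edgeE_def sum.distrib distrib_left)

lemma edgeE_diff: "edgeE A p (\<lambda>E. f E - g E) = edgeE A p f - edgeE A p g"
  by (simp add: edgeE_def sum_subtractf right_diff_distrib)

lemma edgeE_cmult: "edgeE A p (\<lambda>E. a * f E) = a * edgeE A p f"
  by (simp add: edgeE_def sum_distrib_left mult_ac)

lemma edgeE_sum: "edgeE A p (\<lambda>E. \<Sum>i\<in>I. f i E) = (\<Sum>i\<in>I. edgeE A p (f i))"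
  unfolding edgeE_def by (simp add: sum_distrib_left sum.swap[of _ I])

lemma edgeE_const: "finite A \<Longrightarrow> edgeE A p (\<lambda>E. a) = a"
proof (induction A rule: finite_induct)
  case (insert e A)
  then show ?case by (simp add: edgeE_insert algebra_simps)
qed simp

lemma edgeE_mono:
  assumes "0 \<le> p" "p \<le> 1" "\<And>E. E \<subseteq> A \<Longrightarrow> f E \<le> g E"
  shows "edgeE A p f \<le> edgeE A p g"
  unfolding edgeE_def using assms by (intro sum_mono mult_left_mono) auto

lemma edgeE_nonneg:
  assumes "0 \<le> p" "p \<le> 1" "\<And>E. E \<subseteq> A \<Longrightarrow> 0 \<le> f E"
  shows "0 \<le> edgeE A p f"
  unfolding edgeE_def using assms by (intro sum_nonneg mult_nonneg_nonneg) auto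

lemma edgeE_union:
  assumes "finite A" "finite B" "A \<inter> B = {}"
  shows "edgeE (A \<union> B) p f = edgeE A p (\<lambda>E. edgeE B p (\<lambda>E'. f (E \<union> E')))"
  using assms
proof (induction A arbitrary: f rule: finite_induct)
  case (insert e A)
  then show ?case by (simp add: edgeE_insert)
qed simp

lemma edgeE_restrict:
  assumes "finite A" "A0 \<subseteq> A"
  shows "edgeE A p (\<lambda>E. f (E \<inter> A0)) = edgeE A0 p f"
proof -
  have fin: "finite A0" "finite (A - A0)" using assms finite_subset by auto
  have "edgeE A p (\<lambda>E. f (E \<inter> A0)) = edgeE (A0 \<union> (A - A0)) p (\<lambda>E. f (E \<inter> A0))"
    using assms by (simp add: Un_absorb1)
  also have "\<dots> = edgeE A0 p (\<lambda>E. edgeE (A - A0) p (\<lambda>E'. f ((E \<union> E') \<inter> A0)))"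
    using fin by (intro edgeE_union) auto
  also have "\<dots> = edgeE A0 p (\<lambda>E. edgeE (A - A0) p (\<lambda>E'. f E))"
    by (intro edgeE_cong arg_cong[of _ _ f]) auto
  finally show ?thesis using fin by (simp add: edgeE_const)
qed

lemma edgeE_indep:
  assumes "finite A" "finite B" "A \<inter> B = {}"
  shows "edgeE (A \<union> B) p (\<lambda>E. f (E \<inter> A) * g (E \<inter> B)) = edgeE A p f * edgeE B p g"
proof -
  have "edgeE (A \<union> B) p (\<lambda>E. f (E \<inter> A) * g (E \<inter> B))
      = edgeE A p (\<lambda>E. edgeE B p (\<lambda>E'. f ((E \<union> E') \<inter> A) * g ((E \<union> E') \<inter> B)))"
    by (rule edgeE_union[OF assms])
  also have "\<dots> = edgeE A p (\<lambda>E. edgeE B p (\<lambda>E'. f E * g E'))"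
    using assms(3) by (intro edgeE_cong arg_cong2[of _ _ _ _ "(*)"] arg_cong[of _ _ f] arg_cong[of _ _ g]) auto
  also have "\<dots> = edgeE A p (\<lambda>E. f E * edgeE B p g)"
    by (simp only: edgeE_cmult)
  also have "\<dots> = edgeE A p (\<lambda>E. edgeE B p g * f E)"
    by (rule edgeE_cong) (rule mult.commute)
  also have "\<dots> = edgeE B p g * edgeE A p f" by (rule edgeE_cmult)
  finally show ?thesis by (simp add: mult.commute)
qed

lemma edgeE_eq_set:
  assumes "finite A" "H \<subseteq> A"
  shows "edgeE A p (\<lambda>E. of_bool (E = H)) = p ^ card H * (1 - p) ^ (card A - card H)"
proof -
  have "edgeE A p (\<lambda>E. of_bool (E = H)) = (\<Sum>E\<in>Pow A. if E = H then p ^ card H * (1 - p) ^ (card A - card H) else 0)"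
    unfolding edgeE_def by (intro sum.cong) auto
  then show ?thesis using assms by simp
qed

lemma edgeE_superset:
  assumes "finite A" "H \<subseteq> A"
  shows "edgeE A p (\<lambda>E. of_bool (H \<subseteq> E)) = p ^ card H"
proof -
  have fin: "finite H" using assms finite_subset by auto
  have "edgeE A p (\<lambda>E. of_bool (H \<subseteq> E)) = edgeE A p (\<lambda>E. of_bool (E \<inter> H = H))"
    by (intro edgeE_cong) (auto intro!: arg_cong[of _ _ of_bool])
  also have "\<dots> = edgeE H p (\<lambda>E. of_bool (E = H))"
    using assms by (rule edgeE_restrict)
  finally show ?thesis using edgeE_eq_set[OF fin order_refl] by simp
qed

lemma edgeE_abs_le_sqrt:
  assumes "finite A" "0 \<le> p" "p \<le> 1"
  shows "(edgeE A p (\<lambda>E. \<bar>f E\<bar>))\<^sup>2 \<le> edgeE A p (\<lambda>E. (f E)\<^sup>2)"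
proof -
  define m where "m = edgeE A p (\<lambda>E. \<bar>f E\<bar>)"
  have "0 \<le> edgeE A p (\<lambda>E. (\<bar>f E\<bar> - m)\<^sup>2)" using assms by (intro edgeE_nonneg) auto
  also have "edgeE A p (\<lambda>E. (\<bar>f E\<bar> - m)\<^sup>2) = edgeE A p (\<lambda>E. ((f E)\<^sup>2 - 2 * m * \<bar>f E\<bar>) + m\<^sup>2)"
    by (intro edgeE_cong) (simp add: power2_diff)
  also have "\<dots> = edgeE A p (\<lambda>E. (f E)\<^sup>2) - 2 * m * m + m\<^sup>2"
    by (simp add: edgeE_add edgeE_diff edgeE_cmult edgeE_const assms m_def)
  finally show ?thesis by (simp add: m_def power2_eq_square)
qed

text \<open>Induction on \<open>A\<close>; the step splits the variance of one further edge by convexity of the square.\<close>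

lemma efron_stein:
  assumes "finite A" "0 \<le> p" "p \<le> 1"
  shows "edgeE A p (\<lambda>E. (f E)\<^sup>2) - (edgeE A p f)\<^sup>2
    \<le> (\<Sum>e\<in>A. p * (1 - p) * edgeE A p (\<lambda>E. (f (insert e E) - f (E - {e}))\<^sup>2))"
  using assms(1)
proof (induction A arbitrary: f rule: finite_induct)
  case (insert e A)
  define f1 where "f1 E = f (insert e E)" for E
  define m1 where "m1 = edgeE A p f1"
  define m0 where "m0 = edgeE A p f"
  let ?D = "\<lambda>e f E. (f (insert e E) - f (E - {e}) :: real)\<^sup>2"
  have e1: "edgeE (insert e A) p (\<lambda>E. (f E)\<^sup>2) = p * edgeE A p (\<lambda>E. (f1 E)\<^sup>2) + (1 - p) * edgeE A p (\<lambda>E. (f E)\<^sup>2)"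
    "edgeE (insert e A) p f = p * m1 + (1 - p) * m0"
    unfolding f1_def[abs_def] m1_def m0_def using insert by (simp_all add: edgeE_insert)
  have De: "edgeE (insert e A) p (?D e f) = edgeE A p (\<lambda>E. (f1 E - f E)\<^sup>2)"
  proof -
    have "edgeE A p (\<lambda>E. ?D e f (insert e E)) = edgeE A p (\<lambda>E. (f1 E - f E)\<^sup>2)"
      using insert(2) by (intro edgeE_cong) (auto simp: f1_def subset_eq Diff_insert_absorb)
    moreover have "edgeE A p (\<lambda>E. ?D e f E) = edgeE A p (\<lambda>E. (f1 E - f E)\<^sup>2)"
    proof (intro edgeE_cong)
      fix E assume "E \<subseteq> A"
      then have "E - {e} = E" using insert(2) by auto
      then show "?D e f E = (f1 E - f E)\<^sup>2" by (simp add: f1_def)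
    qed
    ultimately show ?thesis using insert by (simp add: edgeE_insert algebra_simps)
  qed
  have De': "edgeE (insert e A) p (?D e' f) = p * edgeE A p (?D e' f1) + (1 - p) * edgeE A p (?D e' f)" if "e' \<in> A" for e'
  proof -
    have "edgeE A p (\<lambda>E. ?D e' f (insert e E)) = edgeE A p (?D e' f1)"
    proof (intro edgeE_cong)
      fix E assume "E \<subseteq> A"
      have "insert e E - {e'} = insert e (E - {e'})" using that insert(2) by auto
      then show "?D e' f (insert e E) = ?D e' f1 E" by (simp add: f1_def insert_commute)
    qed
    then show ?thesis using insert by (simp add: edgeE_insert)
  qed
  have J: "(m1 - m0)\<^sup>2 \<le> edgeE A p (\<lambda>E. (f1 E - f E)\<^sup>2)"
  proof -
    have "0 \<le> edgeE A p (\<lambda>E. ((f1 E - f E) - (m1 - m0))\<^sup>2)" using assms by (intro edgeE_nonneg) auto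
    also have "\<dots> = edgeE A p (\<lambda>E. ((f1 E - f E)\<^sup>2 - 2 * (m1 - m0) * (f1 E - f E)) + (m1 - m0)\<^sup>2)"
      by (intro edgeE_cong) (simp add: power2_eq_square algebra_simps)
    also have "\<dots> = edgeE A p (\<lambda>E. (f1 E - f E)\<^sup>2) - 2 * (m1 - m0) * (m1 - m0) + (m1 - m0)\<^sup>2"
      unfolding edgeE_add edgeE_diff edgeE_cmult edgeE_const[OF insert(1)] m1_def m0_def ..
    finally have "0 \<le> edgeE A p (\<lambda>E. (f1 E - f E)\<^sup>2) - 2 * (m1 - m0) * (m1 - m0) + (m1 - m0)\<^sup>2" .
    moreover have "2 * (m1 - m0) * (m1 - m0) = 2 * (m1 - m0)\<^sup>2" by (simp only: power2_eq_square mult.assoc)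
    ultimately show ?thesis by linarith
  qed
  \<comment> \<open>Conditioning on the edge \<open>e\<close>: the mean of the two conditional
    variances plus the variance of the conditional mean, which takes the values \<open>m1\<close>
    and \<open>m0\<close>.\<close>
  have "edgeE (insert e A) p (\<lambda>E. (f E)\<^sup>2) - (edgeE (insert e A) p f)\<^sup>2
      = p * (edgeE A p (\<lambda>E. (f1 E)\<^sup>2) - m1\<^sup>2) + (1 - p) * (edgeE A p (\<lambda>E. (f E)\<^sup>2) - m0\<^sup>2) + p * (1 - p) * (m1 - m0)\<^sup>2"
    unfolding e1 by (simp add: algebra_simps power2_eq_square)
  also have "\<dots> \<le> p * (\<Sum>e'\<in>A. p * (1 - p) * edgeE A p (?D e' f1)) + (1 - p) * (\<Sum>e'\<in>A. p * (1 - p) * edgeE A p (?D e' f))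
      + p * (1 - p) * edgeE A p (\<lambda>E. (f1 E - f E)\<^sup>2)"
    using insert.IH[of f1] insert.IH[of f] J assms
    by (intro add_mono mult_left_mono) (auto simp: m1_def m0_def)
  also have "\<dots> = (\<Sum>e'\<in>A. p * (1 - p) * edgeE (insert e A) p (?D e' f)) + p * (1 - p) * edgeE (insert e A) p (?D e f)"
  proof -
    have S: "(\<Sum>e'\<in>A. p * (1 - p) * edgeE (insert e A) p (?D e' f))
      = (\<Sum>e'\<in>A. p * (1 - p) * (p * edgeE A p (?D e' f1) + (1 - p) * edgeE A p (?D e' f)))"
      by (intro sum.cong refl) (simp only: De')
    show ?thesis
      unfolding S De sum_distrib_left sum.distrib[symmetric]
      by (intro arg_cong2[where f = "(+)"] sum.cong refl) (simp add: algebra_simps)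
  qed
  finally show ?case using insert by simp
qed simp

section \<open>Clique counts, their moments, and the variance of \<open>nu\<close>\<close>

definition Sub :: "nat \<Rightarrow> nat \<Rightarrow> nat set set" where
  "Sub n s = {\<sigma>. \<sigma> \<subseteq> {1..n} \<and> card \<sigma> = s}"

lemma finite_Sub: "finite (Sub n s)"
  by (rule finite_subset[of _ "Pow {1..n}"]) (auto simp: Sub_def)

lemma card_Sub: "card (Sub n s) = n choose s"
  unfolding Sub_def using n_subsets[of "{1..n}" s] by simp

lemma card_Kn: "finite Y \<Longrightarrow> card (Kn Y) = card Y choose 2"
  unfolding Kn_def by (rule n_subsets)

lemma finite_Kn: "finite Y \<Longrightarrow> finite (Kn Y)"
  unfolding Kn_def by (rule finite_subset[of _ "Pow Y"]) auto

lemma Kn_all_edges: "Y \<subseteq> {1..n} \<Longrightarrow> Kn Y \<subseteq> all_edges n"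
  by (auto simp: Kn_def all_edges_def)

lemma faces_eq: "faces (clique_complex n E) s = {\<sigma> \<in> Sub n s. Kn \<sigma> \<subseteq> E}"
proof -
  have "(\<forall>x\<in>\<sigma>. \<forall>y\<in>\<sigma>. x \<noteq> y \<longrightarrow> {x, y} \<in> E) \<longleftrightarrow> Kn \<sigma> \<subseteq> E" for \<sigma>
  proof
    assume *: "\<forall>x\<in>\<sigma>. \<forall>y\<in>\<sigma>. x \<noteq> y \<longrightarrow> {x, y} \<in> E"
    show "Kn \<sigma> \<subseteq> E"
    proof
      fix e assume e: "e \<in> Kn \<sigma>"
      then obtain x y where "e = {x, y}" "x \<noteq> y" unfolding Kn_def card_2_iff by blast
      then show "e \<in> E" using * e unfolding Kn_def by blast
    qed
  next
    assume *: "Kn \<sigma> \<subseteq> E"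
    have "{x, y} \<in> Kn \<sigma>" if "x \<in> \<sigma>" "y \<in> \<sigma>" "x \<noteq> y" for x y using that by (simp add: Kn_def)
    then show "\<forall>x\<in>\<sigma>. \<forall>y\<in>\<sigma>. x \<noteq> y \<longrightarrow> {x, y} \<in> E" using * by blast
  qed
  moreover have "\<sigma> \<subseteq> {1..n} \<Longrightarrow> finite \<sigma>" for \<sigma> using finite_subset by blast
  ultimately show ?thesis by (auto simp: faces_def clique_complex_def Sub_def)
qed

lemma Sub_props: "\<sigma> \<in> Sub n s \<Longrightarrow> finite \<sigma> \<and> card \<sigma> = s \<and> Kn \<sigma> \<subseteq> all_edges n \<and> card (Kn \<sigma>) = s choose 2"
  using finite_subset[of \<sigma> "{1..n}"] Kn_all_edges[of \<sigma> n] card_Kn[of \<sigma>] by (auto simp: Sub_def)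

lemma card_faces_eq: "real (card (faces (clique_complex n E) s)) = (\<Sum>\<sigma>\<in>Sub n s. of_bool (Kn \<sigma> \<subseteq> E))"
  using finite_Sub[of n s] by (simp add: faces_eq of_bool_def sum.If_cases Int_def)

lemma edgeE_card_faces:
  "edgeE (all_edges n) p (\<lambda>E. real (card (faces (clique_complex n E) s))) = real (n choose s) * p ^ (s choose 2)"
proof -
  have "edgeE (all_edges n) p (\<lambda>E. real (card (faces (clique_complex n E) s))) = (\<Sum>\<sigma>\<in>Sub n s. p ^ (s choose 2))"
    unfolding card_faces_eq edgeE_sum
    by (intro sum.cong refl) (use Sub_props in \<open>simp add: edgeE_superset finite_all_edges\<close>)
  then show ?thesis by (simp add: card_Sub)
qed

text \<open>Up to the factor \<open>fact j\<close>, the order of the mean number of cliques with \<open>j\<close> vertices.\<close>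

definition wn :: "nat \<Rightarrow> real \<Rightarrow> nat \<Rightarrow> real" where
  "wn n p j = real n ^ j * p ^ (j choose 2)"

text \<open>The sets are grouped by their trace on \<open>V\<close>. A trace of size
  \<open>j\<close> saves at most \<open>j choose 2\<close> edges and leaves at most
  \<open>n ^ (s - j)\<close> choices, so its group contributes at most
  \<open>wn n p s / wn n p j\<close>. The factor \<open>2 ^ M\<close> bounds the number of
  traces.\<close>

lemma overlap_sum:
  assumes p: "0 < p" "p \<le> 1" and n: "n > 0" and V: "finite V" "card V \<le> M" and H: "H \<subseteq> Kn V"
    and w: "\<And>j. i0 \<le> j \<Longrightarrow> j \<le> s \<Longrightarrow> wn n p j \<ge> \<kappa>" and \<kappa>: "\<kappa> > 0"
  shows "(\<Sum>\<sigma>\<in>{\<sigma>\<in>Sub n s. i0 \<le> card (\<sigma> \<inter> V)}. p ^ card (Kn \<sigma> - H)) \<le> 2 ^ M * wn n p s / \<kappa>"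
proof -
  let ?A = "{\<sigma>\<in>Sub n s. i0 \<le> card (\<sigma> \<inter> V)}"
  have finA: "finite ?A" using finite_Sub by auto
  have each: "p ^ card (Kn \<sigma> - H) \<le> p ^ (s choose 2) / p ^ (card (\<sigma> \<inter> V) choose 2)" if \<sigma>: "\<sigma> \<in> Sub n s" for \<sigma>
  proof -
    note sp = Sub_props[OF \<sigma>]
    have "Kn \<sigma> \<inter> H \<subseteq> Kn (\<sigma> \<inter> V)" using H by (auto simp: Kn_def)
    then have "card (Kn \<sigma> \<inter> H) \<le> card (\<sigma> \<inter> V) choose 2"
      using sp card_mono[OF finite_Kn[of "\<sigma> \<inter> V"], of "Kn \<sigma> \<inter> H"] card_Kn[of "\<sigma> \<inter> V"] by simp
    moreover have "card (Kn \<sigma>) = card (Kn \<sigma> \<inter> H) + card (Kn \<sigma> - H)"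
      using sp finite_Kn[of \<sigma>] by (intro card_Int_Diff[symmetric, THEN sym]) simp
    ultimately have "s choose 2 \<le> card (Kn \<sigma> - H) + (card (\<sigma> \<inter> V) choose 2)" using sp by simp
    then have "p ^ (card (Kn \<sigma> - H) + (card (\<sigma> \<inter> V) choose 2)) \<le> p ^ (s choose 2)"
      using p by (intro power_decreasing) auto
    then show ?thesis using p by (simp add: power_add pos_le_divide_eq)
  qed
  have "(\<Sum>\<sigma>\<in>?A. p ^ card (Kn \<sigma> - H)) \<le> (\<Sum>\<sigma>\<in>?A. p ^ (s choose 2) / p ^ (card (\<sigma> \<inter> V) choose 2))"
    using each by (intro sum_mono) auto
  also have "\<dots> = (\<Sum>J\<in>Pow V. \<Sum>\<sigma>\<in>{\<sigma>\<in>?A. \<sigma> \<inter> V = J}. p ^ (s choose 2) / p ^ (card (\<sigma> \<inter> V) choose 2))"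
    using finA V(1) by (intro sum.group[symmetric]) auto
  also have "\<dots> \<le> (\<Sum>J\<in>Pow V. wn n p s / \<kappa>)"
  proof (rule sum_mono)
    fix J assume J: "J \<in> Pow V"
    let ?B = "{\<sigma>\<in>?A. \<sigma> \<inter> V = J}"
    have finJ: "finite J" using J V finite_subset by auto
    show "(\<Sum>\<sigma>\<in>?B. p ^ (s choose 2) / p ^ (card (\<sigma> \<inter> V) choose 2)) \<le> wn n p s / \<kappa>"
    proof (cases "?B = {}")
      case False
      then obtain \<sigma>0 where \<sigma>0: "\<sigma>0 \<in> Sub n s" "\<sigma>0 \<inter> V = J" "i0 \<le> card J" by auto
      then have Js: "card J \<le> s" using Sub_props[OF \<sigma>0(1)] card_mono[of \<sigma>0 J] by auto
      have "card ?B \<le> card (Sub n (s - card J))"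
      proof (rule card_inj_on_le[where f = "\<lambda>\<sigma>. \<sigma> - J"])
        show "inj_on (\<lambda>\<sigma>. \<sigma> - J) ?B" by (rule inj_onI) blast
        show "(\<lambda>\<sigma>. \<sigma> - J) ` ?B \<subseteq> Sub n (s - card J)"
          using finJ by (auto simp: Sub_def card_Diff_subset)
      qed (rule finite_Sub)
      also have "\<dots> \<le> n ^ (s - card J)"
        unfolding card_Sub by (cases "s - card J \<le> n") (auto simp: binomial_le_pow binomial_eq_0)
      finally have cB: "real (card ?B) \<le> real n ^ (s - card J)"
        unfolding of_nat_power[symmetric] of_nat_le_iff .
      have "(\<Sum>\<sigma>\<in>?B. p ^ (s choose 2) / p ^ (card (\<sigma> \<inter> V) choose 2)) = real (card ?B) * (p ^ (s choose 2) / p ^ (card J choose 2))"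
      proof -
        have "(\<Sum>\<sigma>\<in>?B. p ^ (s choose 2) / p ^ (card (\<sigma> \<inter> V) choose 2)) = (\<Sum>\<sigma>\<in>?B. p ^ (s choose 2) / p ^ (card J choose 2))"
          by (intro sum.cong refl) simp
        then show ?thesis by simp
      qed
      also have "\<dots> \<le> real n ^ (s - card J) * (p ^ (s choose 2) / p ^ (card J choose 2))"
        using cB p by (intro mult_right_mono) auto
      also have "\<dots> = wn n p s / wn n p (card J)"
        using Js n p by (simp add: wn_def power_diff)
      also have "\<dots> \<le> wn n p s / \<kappa>"
        using w[OF \<sigma>0(3) Js] \<kappa> p by (intro divide_left_mono) (auto simp: wn_def intro!: mult_pos_pos n)
      finally show ?thesis .
    next
      case True
      then show ?thesis using \<kappa> p by (simp only: sum.empty) (simp add: wn_def)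
    qed
  qed
  also have "\<dots> = 2 ^ card V * (wn n p s / \<kappa>)" using V by (simp add: card_Pow)
  also have "\<dots> \<le> 2 ^ M * (wn n p s / \<kappa>)"
    using V \<kappa> p by (intro mult_right_mono power_increasing) (auto simp: wn_def)
  finally show ?thesis by simp
qed

text \<open>The power is expanded one factor at a time: given the edges \<open>H\<close> already
  required, the next clique contributes a factor from \<open>overlap_sum\<close> with no condition
  on the overlap. Carrying \<open>H\<close> along makes the induction work; the \<open>d * q\<close>
  in the exponent provides for \<open>d\<close> new vertices in each of the \<open>q\<close>
  steps.\<close>

lemma moment_bound_aux:
  assumes p: "0 < p" "p \<le> 1" and n: "n > 0"
    and w: "\<And>j. j \<le> d \<Longrightarrow> wn n p j \<ge> 1"
    and "finite V" "card V \<le> M" "H \<subseteq> Kn V" "H \<subseteq> all_edges n"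
  shows "edgeE (all_edges n) p (\<lambda>E. of_bool (H \<subseteq> E) * real (card (faces (clique_complex n E) d)) ^ q)
     \<le> (2 ^ (M + d * q)) ^ q * wn n p d ^ q * p ^ card H"
  using assms(5-8)
proof (induction q arbitrary: V H M)
  case 0
  then show ?case by (simp add: edgeE_superset finite_all_edges)
next
  case (Suc q)
  let ?f = "\<lambda>E. real (card (faces (clique_complex n E) d))"
  have w0: "wn n p d \<ge> 0" using p by (simp add: wn_def)
  have finH: "finite H" using Suc.prems finite_Kn finite_subset by blast
  have "edgeE (all_edges n) p (\<lambda>E. of_bool (H \<subseteq> E) * ?f E ^ Suc q)
      = edgeE (all_edges n) p (\<lambda>E. \<Sum>\<sigma>\<in>Sub n d. of_bool (H \<union> Kn \<sigma> \<subseteq> E) * ?f E ^ q)"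
  proof (intro edgeE_cong)
    fix E
    have "of_bool (H \<subseteq> E) * ?f E ^ Suc q = (\<Sum>\<sigma>\<in>Sub n d. of_bool (Kn \<sigma> \<subseteq> E)) * (of_bool (H \<subseteq> E) * ?f E ^ q)"
      unfolding card_faces_eq[symmetric] by simp
    also have "\<dots> = (\<Sum>\<sigma>\<in>Sub n d. of_bool (H \<union> Kn \<sigma> \<subseteq> E) * ?f E ^ q)"
      unfolding sum_distrib_right by (intro sum.cong refl) auto
    finally show "of_bool (H \<subseteq> E) * ?f E ^ Suc q = (\<Sum>\<sigma>\<in>Sub n d. of_bool (H \<union> Kn \<sigma> \<subseteq> E) * ?f E ^ q)" .
  qed
  also have "\<dots> = (\<Sum>\<sigma>\<in>Sub n d. edgeE (all_edges n) p (\<lambda>E. of_bool (H \<union> Kn \<sigma> \<subseteq> E) * ?f E ^ q))"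
    by (rule edgeE_sum)
  also have "\<dots> \<le> (\<Sum>\<sigma>\<in>Sub n d. (2 ^ (M + d + d * q)) ^ q * wn n p d ^ q * p ^ card (H \<union> Kn \<sigma>))"
  proof (rule sum_mono)
    fix \<sigma> assume \<sigma>: "\<sigma> \<in> Sub n d"
    note sp = Sub_props[OF \<sigma>]
    show "edgeE (all_edges n) p (\<lambda>E. of_bool (H \<union> Kn \<sigma> \<subseteq> E) * ?f E ^ q)
      \<le> (2 ^ (M + d + d * q)) ^ q * wn n p d ^ q * p ^ card (H \<union> Kn \<sigma>)"
    proof (rule Suc.IH)
      show "finite (V \<union> \<sigma>)" using Suc.prems sp by simp
      show "card (V \<union> \<sigma>) \<le> M + d" using Suc.prems sp card_Un_le[of V \<sigma>] by simp
      show "H \<union> Kn \<sigma> \<subseteq> Kn (V \<union> \<sigma>)" using Suc.prems by (auto simp: Kn_def)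
      show "H \<union> Kn \<sigma> \<subseteq> all_edges n" using Suc.prems sp by simp
    qed
  qed
  also have "\<dots> = (2 ^ (M + d + d * q)) ^ q * wn n p d ^ q * p ^ card H * (\<Sum>\<sigma>\<in>Sub n d. p ^ card (Kn \<sigma> - H))"
    unfolding sum_distrib_left
  proof (intro sum.cong refl)
    fix \<sigma> assume \<sigma>: "\<sigma> \<in> Sub n d"
    have "card (H \<union> Kn \<sigma>) = card H + card (Kn \<sigma> - H)"
      using finH Sub_props[OF \<sigma>] finite_Kn[of \<sigma>] card_Un_disjoint[of H "Kn \<sigma> - H"] by simp
    then show "(2 ^ (M + d + d * q)) ^ q * wn n p d ^ q * p ^ card (H \<union> Kn \<sigma>)
      = (2 ^ (M + d + d * q)) ^ q * wn n p d ^ q * p ^ card H * p ^ card (Kn \<sigma> - H)"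
      by (simp add: power_add)
  qed
  also have "\<dots> \<le> (2 ^ (M + d + d * q)) ^ q * wn n p d ^ q * p ^ card H * (2 ^ M * wn n p d)"
    using overlap_sum[OF p n Suc.prems(1,2,3), of 0 d 1] w w0 p
    by (intro mult_left_mono) (auto intro!: mult_nonneg_nonneg)
  also have "\<dots> = ((2 ^ (M + d + d * q)) ^ q * 2 ^ M) * wn n p d ^ Suc q * p ^ card H" by simp
  also have "\<dots> \<le> (2 ^ (M + d * Suc q)) ^ Suc q * wn n p d ^ Suc q * p ^ card H"
  proof (intro mult_right_mono)
    have "(2 ^ (M + d + d * q)) ^ q * 2 ^ M \<le> (2 ^ (M + d * Suc q)) ^ q * (2::real) ^ (M + d * Suc q)"
      by (intro mult_mono) (auto intro!: power_increasing simp: algebra_simps)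
    then show "(2 ^ (M + d + d * q)) ^ q * (2::real) ^ M \<le> (2 ^ (M + d * Suc q)) ^ Suc q"
      by (simp only: power_Suc2)
  qed (use w0 p in auto)
  finally show ?case .
qed

lemma moment_bound:
  assumes "0 < p" "p \<le> 1" "n > 0" "\<And>j. j \<le> d \<Longrightarrow> wn n p j \<ge> 1"
  shows "edgeE (all_edges n) p (\<lambda>E. real (card (faces (clique_complex n E) d)) ^ q) \<le> (2 ^ (d * q)) ^ q * wn n p d ^ q"
  using moment_bound_aux[OF assms, where V = "{}" and M = 0 and H = "{}" and q = q] by simp

text \<open>Expanding the square gives pairs of cliques containing a common edge \<open>e\<close>;
  the factor \<open>p\<close> pays for \<open>e\<close>, whose presence is not demanded of
  \<open>E\<close>. Such pairs share at least two vertices, so the bound of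
  \<open>overlap_sum\<close> gains the factor \<open>1 / \<kappa>\<close> over the square of the
  mean.\<close>

lemma pair_sum:
  assumes p: "0 < p" "p \<le> 1" and n: "n > 0" and \<kappa>: "\<kappa> > 0"
    and w: "\<And>j. 2 \<le> j \<Longrightarrow> j \<le> s \<Longrightarrow> wn n p j \<ge> \<kappa>"
  defines "N \<equiv> \<lambda>e E. real (card {\<sigma>\<in>Sub n s. e \<in> Kn \<sigma> \<and> Kn \<sigma> \<subseteq> insert e E})"
  shows "(\<Sum>e\<in>all_edges n. p * edgeE (all_edges n) p (\<lambda>E. (N e E)\<^sup>2)) \<le> real (s choose 2) * 2 ^ s * (wn n p s)\<^sup>2 / \<kappa>"
proof -
  have w0: "wn n p s \<ge> 0" using p by (simp add: wn_def)
  have Ne: "N e E = (\<Sum>\<sigma>\<in>Sub n s. of_bool (e \<in> Kn \<sigma> \<and> Kn \<sigma> \<subseteq> insert e E))" for e E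
    using finite_Sub[of n s] by (simp add: N_def of_bool_def sum.If_cases Int_def)
  have each: "p * edgeE (all_edges n) p (\<lambda>E. (N e E)\<^sup>2) = (\<Sum>\<sigma>\<in>Sub n s. \<Sum>\<sigma>'\<in>Sub n s. of_bool (e \<in> Kn \<sigma> \<inter> Kn \<sigma>') * p ^ card (Kn \<sigma> \<union> Kn \<sigma>'))"
    for e
  proof -
    have "edgeE (all_edges n) p (\<lambda>E. (N e E)\<^sup>2)
        = edgeE (all_edges n) p (\<lambda>E. \<Sum>\<sigma>\<in>Sub n s. \<Sum>\<sigma>'\<in>Sub n s. of_bool (e \<in> Kn \<sigma> \<inter> Kn \<sigma>') * of_bool ((Kn \<sigma> \<union> Kn \<sigma>') - {e} \<subseteq> E))"
      unfolding Ne power2_eq_square sum_product by (intro edgeE_cong sum.cong refl) auto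
    also have "\<dots> = (\<Sum>\<sigma>\<in>Sub n s. \<Sum>\<sigma>'\<in>Sub n s. of_bool (e \<in> Kn \<sigma> \<inter> Kn \<sigma>') * edgeE (all_edges n) p (\<lambda>E. of_bool ((Kn \<sigma> \<union> Kn \<sigma>') - {e} \<subseteq> E)))"
      unfolding edgeE_sum edgeE_cmult ..
    also have "p * \<dots> = (\<Sum>\<sigma>\<in>Sub n s. \<Sum>\<sigma>'\<in>Sub n s. of_bool (e \<in> Kn \<sigma> \<inter> Kn \<sigma>') * p ^ card (Kn \<sigma> \<union> Kn \<sigma>'))"
      unfolding sum_distrib_left
    proof (intro sum.cong refl)
      fix \<sigma> \<sigma>' assume \<sigma>: "\<sigma> \<in> Sub n s" "\<sigma>' \<in> Sub n s"
      note sp = Sub_props[OF \<sigma>(1)] Sub_props[OF \<sigma>(2)]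
      have fin: "finite (Kn \<sigma> \<union> Kn \<sigma>')" using sp finite_Kn by auto
      have "edgeE (all_edges n) p (\<lambda>E. of_bool ((Kn \<sigma> \<union> Kn \<sigma>') - {e} \<subseteq> E)) = p ^ card ((Kn \<sigma> \<union> Kn \<sigma>') - {e})"
        using sp by (intro edgeE_superset finite_all_edges) auto
      moreover have "p * p ^ card ((Kn \<sigma> \<union> Kn \<sigma>') - {e}) = p ^ card (Kn \<sigma> \<union> Kn \<sigma>')" if "e \<in> Kn \<sigma>"
        using card_Suc_Diff1[OF fin, of e] that by (metis UnI1 power_Suc)
      ultimately show "p * (of_bool (e \<in> Kn \<sigma> \<inter> Kn \<sigma>') * edgeE (all_edges n) p (\<lambda>E. of_bool ((Kn \<sigma> \<union> Kn \<sigma>') - {e} \<subseteq> E)))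
         = of_bool (e \<in> Kn \<sigma> \<inter> Kn \<sigma>') * p ^ card (Kn \<sigma> \<union> Kn \<sigma>')"
        by auto
    qed
    finally show ?thesis .
  qed
  have "(\<Sum>e\<in>all_edges n. p * edgeE (all_edges n) p (\<lambda>E. (N e E)\<^sup>2))
      = (\<Sum>e\<in>all_edges n. \<Sum>\<sigma>\<in>Sub n s. \<Sum>\<sigma>'\<in>Sub n s. of_bool (e \<in> Kn \<sigma> \<inter> Kn \<sigma>') * p ^ card (Kn \<sigma> \<union> Kn \<sigma>'))"
    unfolding each ..
  also have "\<dots> = (\<Sum>\<sigma>\<in>Sub n s. \<Sum>e\<in>all_edges n. \<Sum>\<sigma>'\<in>Sub n s. of_bool (e \<in> Kn \<sigma> \<inter> Kn \<sigma>') * p ^ card (Kn \<sigma> \<union> Kn \<sigma>'))"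
    by (rule sum.swap)
  also have "\<dots> = (\<Sum>\<sigma>\<in>Sub n s. \<Sum>\<sigma>'\<in>Sub n s. \<Sum>e\<in>all_edges n. of_bool (e \<in> Kn \<sigma> \<inter> Kn \<sigma>') * p ^ card (Kn \<sigma> \<union> Kn \<sigma>'))"
    by (intro sum.cong refl sum.swap)
  also have "\<dots> \<le> (\<Sum>\<sigma>\<in>Sub n s. real (s choose 2) * p ^ (s choose 2) * (2 ^ s * wn n p s / \<kappa>))"
  proof (rule sum_mono)
    fix \<sigma> assume \<sigma>: "\<sigma> \<in> Sub n s"
    note sp = Sub_props[OF \<sigma>]
    have inner: "(\<Sum>e\<in>all_edges n. of_bool (e \<in> Kn \<sigma> \<inter> Kn \<sigma>') * p ^ card (Kn \<sigma> \<union> Kn \<sigma>'))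
        \<le> (if 2 \<le> card (\<sigma>' \<inter> \<sigma>) then real (s choose 2) * p ^ (s choose 2) * p ^ card (Kn \<sigma>' - Kn \<sigma>) else 0)"
      if \<sigma>': "\<sigma>' \<in> Sub n s" for \<sigma>'
    proof -
      have finK: "finite (Kn \<sigma>)" "finite (Kn \<sigma>')" using sp Sub_props[OF \<sigma>'] finite_Kn by auto
      have s1: "(\<Sum>e\<in>all_edges n. of_bool (e \<in> Kn \<sigma> \<inter> Kn \<sigma>') * x) = real (card (all_edges n \<inter> (Kn \<sigma> \<inter> Kn \<sigma>'))) * x" for x :: real
        unfolding sum_distrib_right[symmetric] using finite_all_edges[of n]
        by (simp add: of_bool_def sum.If_cases Int_def)
      have s2: "all_edges n \<inter> (Kn \<sigma> \<inter> Kn \<sigma>') = Kn \<sigma> \<inter> Kn \<sigma>'" using sp by auto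
      have s3: "card (Kn \<sigma> \<union> Kn \<sigma>') = (s choose 2) + card (Kn \<sigma>' - Kn \<sigma>)"
        using sp finK card_Un_disjoint[of "Kn \<sigma>" "Kn \<sigma>' - Kn \<sigma>"] by simp
      have e1: "(\<Sum>e\<in>all_edges n. of_bool (e \<in> Kn \<sigma> \<inter> Kn \<sigma>') * p ^ card (Kn \<sigma> \<union> Kn \<sigma>'))
          = real (card (Kn \<sigma> \<inter> Kn \<sigma>')) * (p ^ (s choose 2) * p ^ card (Kn \<sigma>' - Kn \<sigma>))"
        unfolding s1 s2 s3 power_add ..
      show ?thesis
      proof (cases "2 \<le> card (\<sigma>' \<inter> \<sigma>)")
        case True
        have "card (Kn \<sigma> \<inter> Kn \<sigma>') \<le> s choose 2" using sp finK by (metis card_mono inf_le1)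
        then show ?thesis using True p unfolding e1 by (simp add: mult.assoc mult_right_mono)
      next
        case False
        have "Kn \<sigma> \<inter> Kn \<sigma>' = {}"
        proof (rule ccontr)
          assume "Kn \<sigma> \<inter> Kn \<sigma>' \<noteq> {}"
          then obtain e where "e \<subseteq> \<sigma>' \<inter> \<sigma>" "card e = 2" by (auto simp: Kn_def)
          then have "2 \<le> card (\<sigma>' \<inter> \<sigma>)" using sp by (metis card_mono finite_Int)
          then show False using False by simp
        qed
        then show ?thesis using False unfolding e1 by simp
      qed
    qed
    have "(\<Sum>\<sigma>'\<in>Sub n s. \<Sum>e\<in>all_edges n. of_bool (e \<in> Kn \<sigma> \<inter> Kn \<sigma>') * p ^ card (Kn \<sigma> \<union> Kn \<sigma>'))
        \<le> (\<Sum>\<sigma>'\<in>Sub n s. if 2 \<le> card (\<sigma>' \<inter> \<sigma>) then real (s choose 2) * p ^ (s choose 2) * p ^ card (Kn \<sigma>' - Kn \<sigma>) else 0)"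
      by (intro sum_mono inner)
    also have "\<dots> = (\<Sum>\<sigma>'\<in>{\<sigma>'\<in>Sub n s. 2 \<le> card (\<sigma>' \<inter> \<sigma>)}. real (s choose 2) * p ^ (s choose 2) * p ^ card (Kn \<sigma>' - Kn \<sigma>))"
      using finite_Sub by (simp add: sum.inter_filter)
    also have "\<dots> = real (s choose 2) * p ^ (s choose 2) * (\<Sum>\<sigma>'\<in>{\<sigma>'\<in>Sub n s. 2 \<le> card (\<sigma>' \<inter> \<sigma>)}. p ^ card (Kn \<sigma>' - Kn \<sigma>))"
      by (simp add: sum_distrib_left)
    also have "\<dots> \<le> real (s choose 2) * p ^ (s choose 2) * (2 ^ s * wn n p s / \<kappa>)"
      using sp p by (intro mult_left_mono overlap_sum[OF p n _ _ order_refl w \<kappa>]) auto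
    finally show "(\<Sum>\<sigma>'\<in>Sub n s. \<Sum>e\<in>all_edges n. of_bool (e \<in> Kn \<sigma> \<inter> Kn \<sigma>') * p ^ card (Kn \<sigma> \<union> Kn \<sigma>'))
        \<le> real (s choose 2) * p ^ (s choose 2) * (2 ^ s * wn n p s / \<kappa>)" .
  qed
  also have "\<dots> = real (n choose s) * p ^ (s choose 2) * (real (s choose 2) * (2 ^ s * wn n p s / \<kappa>))"
    by (simp add: card_Sub)
  also have "\<dots> \<le> wn n p s * (real (s choose 2) * (2 ^ s * wn n p s / \<kappa>))"
  proof (rule mult_right_mono)
    have "n choose s \<le> n ^ s" by (cases "s \<le> n") (auto simp: binomial_le_pow binomial_eq_0)
    then have "real (n choose s) \<le> real n ^ s" by (metis of_nat_le_iff of_nat_power)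
    then show "real (n choose s) * p ^ (s choose 2) \<le> wn n p s"
      unfolding wn_def using p by (intro mult_right_mono) auto
  qed (use w0 \<kappa> in auto)
  finally show ?thesis by (simp add: power2_eq_square mult_ac)
qed

text \<open>By \<open>nu_subcomplex\<close>, adding an edge changes \<open>nu\<close> by at most the
  number of cliques with \<open>d\<close> or \<open>d + 1\<close> vertices through that edge.
  Efron-Stein then reduces the variance to \<open>pair_sum\<close>.\<close>

lemma var_nu:
  assumes p: "0 < p" "p \<le> 1" and n: "n > 0" and \<kappa>: "\<kappa> > 0"
    and w: "\<And>j. 2 \<le> j \<Longrightarrow> j \<le> d + 1 \<Longrightarrow> wn n p j \<ge> \<kappa>"
  defines "f \<equiv> \<lambda>E. real (nu (clique_complex n E) d)"
  shows "edgeE (all_edges n) p (\<lambda>E. (f E - edgeE (all_edges n) p f)\<^sup>2)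
    \<le> 2 * (real (d choose 2) * 2 ^ d * (wn n p d)\<^sup>2 + real ((d + 1) choose 2) * 2 ^ (d + 1) * (wn n p (d + 1))\<^sup>2) / \<kappa>"
proof -
  let ?A = "all_edges n"
  define N where "N s e E = real (card {\<sigma>\<in>Sub n s. e \<in> Kn \<sigma> \<and> Kn \<sigma> \<subseteq> insert e E})" for s e E
  have new: "card (faces (clique_complex n (insert e E)) s - faces (clique_complex n (E - {e})) s)
      = card {\<sigma>\<in>Sub n s. e \<in> Kn \<sigma> \<and> Kn \<sigma> \<subseteq> insert e E}" for e E s
    unfolding faces_eq by (rule arg_cong[of _ _ card]) auto
  have D: "(f (insert e E) - f (E - {e}))\<^sup>2 \<le> 2 * (N d e E)\<^sup>2 + 2 * (N (d + 1) e E)\<^sup>2" for e E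
  proof -
    have sub: "clique_complex n (E - {e}) \<subseteq> clique_complex n (insert e E)" by (auto simp: clique_complex_def)
    have fin: "finite (clique_complex n (insert e E))"
      by (rule finite_subset[of _ "Pow {1..n}"]) (auto simp: clique_complex_def)
    have "f (E - {e}) \<le> f (insert e E) + N (d + 1) e E" "f (insert e E) \<le> f (E - {e}) + N d e E"
      using nu_subcomplex[OF fin sub, of d] unfolding f_def N_def new by linarith+
    moreover have "0 \<le> N d e E" "0 \<le> N (d + 1) e E" by (simp_all add: N_def)
    ultimately have "\<bar>f (insert e E) - f (E - {e})\<bar> \<le> N d e E + N (d + 1) e E" by linarith
    then have "(f (insert e E) - f (E - {e}))\<^sup>2 \<le> (N d e E + N (d + 1) e E)\<^sup>2"
      by (metis abs_le_square_iff abs_of_nonneg abs_ge_zero order_trans)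
    also have "\<dots> \<le> 2 * (N d e E)\<^sup>2 + 2 * (N (d + 1) e E)\<^sup>2"
      using sum_squares_bound[of "N d e E" "N (d + 1) e E"] by (simp add: power2_sum)
    finally show ?thesis .
  qed
  have "edgeE ?A p (\<lambda>E. (f E - edgeE ?A p f)\<^sup>2) = edgeE ?A p (\<lambda>E. (f E)\<^sup>2) - (edgeE ?A p f)\<^sup>2"
  proof -
    define m where "m = edgeE ?A p f"
    have "edgeE ?A p (\<lambda>E. (f E - m)\<^sup>2) = edgeE ?A p (\<lambda>E. ((f E)\<^sup>2 - 2 * m * f E) + m\<^sup>2)"
      by (intro edgeE_cong) (simp add: power2_diff)
    also have "\<dots> = edgeE ?A p (\<lambda>E. (f E)\<^sup>2) - 2 * m * m + m\<^sup>2"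
      unfolding edgeE_add edgeE_diff edgeE_cmult edgeE_const[OF finite_all_edges] m_def ..
    finally show ?thesis by (simp add: m_def power2_eq_square)
  qed
  also have "\<dots> \<le> (\<Sum>e\<in>?A. p * (1 - p) * edgeE ?A p (\<lambda>E. (f (insert e E) - f (E - {e}))\<^sup>2))"
    using p by (intro efron_stein finite_all_edges) auto
  also have "\<dots> \<le> (\<Sum>e\<in>?A. p * edgeE ?A p (\<lambda>E. 2 * (N d e E)\<^sup>2 + 2 * (N (d + 1) e E)\<^sup>2))"
  proof (intro sum_mono mult_mono)
    fix e assume "e \<in> ?A"
    show "p * (1 - p) \<le> p" using p by (simp add: mult_left_le)
    show "edgeE ?A p (\<lambda>E. (f (insert e E) - f (E - {e}))\<^sup>2) \<le> edgeE ?A p (\<lambda>E. 2 * (N d e E)\<^sup>2 + 2 * (N (d + 1) e E)\<^sup>2)"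
      using p D by (intro edgeE_mono) auto
    show "0 \<le> edgeE ?A p (\<lambda>E. (f (insert e E) - f (E - {e}))\<^sup>2)" using p by (intro edgeE_nonneg) auto
  qed (use p in auto)
  also have "\<dots> = 2 * (\<Sum>e\<in>?A. p * edgeE ?A p (\<lambda>E. (N d e E)\<^sup>2)) + 2 * (\<Sum>e\<in>?A. p * edgeE ?A p (\<lambda>E. (N (d + 1) e E)\<^sup>2))"
    unfolding edgeE_add edgeE_cmult by (simp add: sum.distrib sum_distrib_left algebra_simps)
  also have "\<dots> \<le> 2 * (real (d choose 2) * 2 ^ d * (wn n p d)\<^sup>2 / \<kappa>)
      + 2 * (real ((d + 1) choose 2) * 2 ^ (d + 1) * (wn n p (d + 1))\<^sup>2 / \<kappa>)"
    unfolding N_def using w by (intro add_mono mult_left_mono pair_sum[OF p n \<kappa>]) auto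
  finally show ?thesis by (simp add: add_divide_distrib distrib_left)
qed

section \<open>Probabilities of local trees\<close>

lemma of_bool_mult_le: "(P \<Longrightarrow> Q \<Longrightarrow> R) \<Longrightarrow> of_bool P * of_bool Q \<le> (of_bool R :: real)"
  by auto

text \<open>The edges from different outside vertices to \<open>V\<close> are independent. For one
  vertex the union bound over \<open>I\<close> applies, each \<open>Y\<close> being completely
  joined to it with probability \<open>p ^ d\<close>.\<close>

lemma edgeE_outside:
  assumes p: "0 \<le> p" "p \<le> 1" and W: "finite W" "W \<inter> V = {}" and V: "finite V" and I: "finite I"
    and IV: "\<And>Y. Y \<in> I \<Longrightarrow> Y \<subseteq> V \<and> card Y = d" and small: "real (card I) * p ^ d \<le> 1"
  shows "(1 - real (card I) * p ^ d) ^ card W \<le>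
    edgeE (\<Union>w\<in>W. (\<lambda>v. {w, v}) ` V) p (\<lambda>E. of_bool (\<forall>w\<in>W. \<forall>Y\<in>I. \<exists>y\<in>Y. {w, y} \<notin> E))"
  using W
proof (induction W rule: finite_induct)
  case (insert w W)
  let ?A = "\<lambda>w. (\<lambda>v. {w, v}) ` V" and ?P = "\<lambda>w E. \<forall>Y\<in>I. \<exists>y\<in>Y. {w, y} \<notin> E"
  let ?B = "\<Union>w\<in>W. ?A w"
  have wV: "w \<notin> V" "W \<inter> V = {}" using insert.prems by auto
  have disj: "?A w \<inter> ?B = {}" using wV insert(2) by (auto simp: doubleton_eq_iff)
  have fin: "finite (?A w)" "finite ?B" using V insert(1) by auto
  have one: "1 - real (card I) * p ^ d \<le> edgeE (?A w) p (\<lambda>E. of_bool (?P w E))"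
  proof -
    have "1 - real (card I) * p ^ d = 1 - (\<Sum>Y\<in>I. edgeE (?A w) p (\<lambda>E. of_bool ((\<lambda>y. {w, y}) ` Y \<subseteq> E)))"
    proof -
      have "edgeE (?A w) p (\<lambda>E. of_bool ((\<lambda>y. {w, y}) ` Y \<subseteq> E)) = p ^ d" if Y: "Y \<in> I" for Y
      proof -
        have "inj_on (\<lambda>y. {w, y}) Y" using wV IV[OF Y] by (auto simp: inj_on_def doubleton_eq_iff)
        then have "card ((\<lambda>y. {w, y}) ` Y) = d" using IV[OF Y] by (simp add: card_image)
        moreover have "(\<lambda>y. {w, y}) ` Y \<subseteq> ?A w" using IV[OF Y] by auto
        ultimately show ?thesis using edgeE_superset[OF fin(1), of "(\<lambda>y. {w, y}) ` Y" p] by simp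
      qed
      then show ?thesis by simp
    qed
    also have "\<dots> = edgeE (?A w) p (\<lambda>E. 1 - (\<Sum>Y\<in>I. of_bool ((\<lambda>y. {w, y}) ` Y \<subseteq> E)))"
      unfolding edgeE_diff edgeE_sum edgeE_const[OF fin(1)] ..
    also have "\<dots> \<le> edgeE (?A w) p (\<lambda>E. of_bool (?P w E))"
    proof (rule edgeE_mono[OF p])
      fix E
      show "1 - (\<Sum>Y\<in>I. of_bool ((\<lambda>y. {w, y}) ` Y \<subseteq> E)) \<le> (of_bool (?P w E) :: real)"
      proof (cases "?P w E")
        case True
        have "0 \<le> (\<Sum>Y\<in>I. of_bool ((\<lambda>y. {w, y}) ` Y \<subseteq> E) :: real)" by (intro sum_nonneg) auto
        then show ?thesis using True by simp
      next
        case False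
        then obtain Y where Y: "Y \<in> I" "(\<lambda>y. {w, y}) ` Y \<subseteq> E" by auto
        then have "of_bool ((\<lambda>y. {w, y}) ` Y \<subseteq> E) \<le> (\<Sum>Y\<in>I. of_bool ((\<lambda>y. {w, y}) ` Y \<subseteq> E) :: real)"
          using I by (intro member_le_sum) auto
        then show ?thesis using False Y by simp
      qed
    qed
    finally show ?thesis .
  qed
  have nn: "0 \<le> 1 - real (card I) * p ^ d" using small by simp
  have "(1 - real (card I) * p ^ d) ^ card (insert w W)
      \<le> edgeE (?A w) p (\<lambda>E. of_bool (?P w E)) * edgeE ?B p (\<lambda>E. of_bool (\<forall>w\<in>W. ?P w E))"
    using insert(1,2) one insert.IH wV nn by (auto intro!: mult_mono)
  also have "\<dots> = edgeE (?A w \<union> ?B) p (\<lambda>E. of_bool (?P w (E \<inter> ?A w)) * of_bool (\<forall>w\<in>W. ?P w (E \<inter> ?B)))"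
    by (rule edgeE_indep[OF fin disj, symmetric])
  also have "\<dots> = edgeE (?A w \<union> ?B) p (\<lambda>E. of_bool (\<forall>w\<in>insert w W. ?P w E))"
  proof (intro edgeE_cong)
    fix E
    have m: "{w', y} \<in> ?A w'" if "Y \<in> I" "y \<in> Y" for w' y Y
      using IV[OF that(1)] that(2) by blast
    have mB: "{w', y} \<in> ?B" if "w' \<in> W" "Y \<in> I" "y \<in> Y" for w' y Y
      using m[OF that(2,3)] that(1) by blast
    have "?P w (E \<inter> ?A w) \<longleftrightarrow> ?P w E"
      by (rule ball_cong[OF refl], rule bex_cong[OF refl]) (use m in simp)
    moreover have "(\<forall>w\<in>W. ?P w (E \<inter> ?B)) \<longleftrightarrow> (\<forall>w\<in>W. ?P w E)"
      by (rule ball_cong[OF refl], rule ball_cong[OF refl], rule bex_cong[OF refl]) (use mB in \<open>simp del: UN_iff\<close>)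
    ultimately show "of_bool (?P w (E \<inter> ?A w)) * of_bool (\<forall>w\<in>W. ?P w (E \<inter> ?B)) = (of_bool (\<forall>w\<in>insert w W. ?P w E) :: real)"
      by simp
  qed
  finally show ?case by simp
qed simp

text \<open>The exploration equals \<open>L\<close> if the graph inside its vertex set has exactly
  the tree edges and no outside vertex completes an inner face to a coface. These two events concern
  disjoint sets of edges and are independent.\<close>

lemma tree_prob:
  assumes p: "0 \<le> p" "p \<le> 1" and d: "d > 0" and rt: "rooted d R xs L" and Vn: "set xs \<union> set_tree L \<subseteq> {1..n}"
    and small: "real (isize d R L) * p ^ d \<le> 1"
  shows "p ^ ((d choose 2) + d * msize d R L) * (1 - p) ^ ((d + msize d R L)\<^sup>2) * (1 - real (isize d R L) * p ^ d) ^ n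
    \<le> edgeE (all_edges n) p (\<lambda>E. of_bool (Kn (set xs) \<subseteq> E \<and> explore d R E {} xs = L))"
proof -
  let ?m = "msize d R L" and ?q = "isize d R L"
  define V where "V = set xs \<union> set_tree L"
  define H where "H = Kn (set xs) \<union> SE d R xs L"
  define W where "W = {1..n} - V"
  define I where "I = inner_faces d R xs L"
  define A1 where "A1 = (\<Union>w\<in>W. (\<lambda>v. {w, v}) ` V)"
  have L: "lt d R L" "length xs = d" "distinct xs" using rt by (auto simp: rooted_def)
  have finV: "finite V" unfolding V_def using Vn finite_subset by blast
  have cxs: "card (set xs) = d" using L distinct_card by auto
  have cV: "card V \<le> d + ?m"
    unfolding V_def using card_Un_le[of "set xs" "set_tree L"] card_set_tree_le[OF L(1)] cxs by simp
  have finI: "finite I" and cI: "card I \<le> ?q" using card_inner_faces by (auto simp: I_def)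
  have IV: "Y \<subseteq> V \<and> card Y = d" if Y: "Y \<in> I" for Y
  proof -
    obtain r e ys ws where "Y = set ys" "(Suc r, e, ys, ws) \<in> nd d R {} xs L"
      using Y by (auto simp: I_def inner_faces_def)
    then show ?thesis using nd_props[OF rt _, of "{}" "Suc r" e ys ws] distinct_card[of ys] by (auto simp: V_def)
  qed
  have HV: "H \<subseteq> Kn V"
  proof
    fix e assume "e \<in> H"
    then consider "e \<in> Kn (set xs)" | "e \<in> SE d R xs L" by (auto simp: H_def)
    then show "e \<in> Kn V"
    proof cases
      case 1
      then show ?thesis by (auto simp: Kn_def V_def)
    next
      case 2
      then obtain l y where "e = {l, y}" "l \<in> set_tree L" "y \<in> set xs \<union> set_tree L" "l \<noteq> y"
        using SE_props[OF rt] by blast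
      then show ?thesis by (auto simp: Kn_def V_def)
    qed
  qed
  have cH: "card H \<le> (d choose 2) + d * ?m"
  proof -
    have "card H \<le> card (Kn (set xs)) + card (SE d R xs L)" unfolding H_def by (rule card_Un_le)
    then show ?thesis using card_Kn[of "set xs"] card_SE_le[OF L(1,2)] cxs by simp
  qed
  have cKV: "card (Kn V) \<le> (d + ?m)\<^sup>2"
  proof -
    have "card (Kn V) \<le> card V choose 2" using card_Kn[OF finV] by simp
    also have "\<dots> \<le> card V ^ 2" by (cases "2 \<le> card V") (auto simp: binomial_le_pow binomial_eq_0)
    also have "\<dots> \<le> (d + ?m)\<^sup>2" using cV by (rule power_mono) simp
    finally show ?thesis .
  qed
  have finA: "finite (Kn V)" "finite A1" using finV finite_Kn by (auto simp: A1_def W_def)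
  have disj: "Kn V \<inter> A1 = {}" by (auto simp: Kn_def A1_def W_def)
  have sub: "Kn V \<union> A1 \<subseteq> all_edges n"
    using Vn by (auto simp: Kn_def A1_def W_def V_def all_edges_def card_insert_if)
  have sI: "real (card I) * p ^ d \<le> real ?q * p ^ d" using cI p by (intro mult_right_mono) auto
  \<comment> \<open>The exponents are simplified crudely: \<open>(d + m)^2\<close> in place of the
    number of absent inner pairs, and \<open>n\<close> in place of the number of outside vertices.
    Neither affects the limit.\<close>
  have "p ^ ((d choose 2) + d * ?m) * (1 - p) ^ ((d + ?m)\<^sup>2) * (1 - real ?q * p ^ d) ^ n
      \<le> (p ^ card H * (1 - p) ^ (card (Kn V) - card H)) * (1 - real (card I) * p ^ d) ^ card W"
  proof (intro mult_mono)
    show "p ^ ((d choose 2) + d * ?m) \<le> p ^ card H" using p cH by (intro power_decreasing) auto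
    show "(1 - p) ^ ((d + ?m)\<^sup>2) \<le> (1 - p) ^ (card (Kn V) - card H)" using p cKV by (intro power_decreasing) auto
    have "card W \<le> n" unfolding W_def using card_mono[of "{1..n}" "{1..n} - V"] by simp
    have "(1 - real ?q * p ^ d) ^ n \<le> (1 - real ?q * p ^ d) ^ card W"
      using small p \<open>card W \<le> n\<close> by (intro power_decreasing) auto
    also have "\<dots> \<le> (1 - real (card I) * p ^ d) ^ card W"
      using small sI by (intro power_mono) auto
    finally show "(1 - real ?q * p ^ d) ^ n \<le> (1 - real (card I) * p ^ d) ^ card W" .
  qed (use p small in auto)
  also have "\<dots> \<le> edgeE (Kn V) p (\<lambda>E. of_bool (E = H)) * edgeE A1 p (\<lambda>E. of_bool (\<forall>w\<in>W. \<forall>Y\<in>I. \<exists>y\<in>Y. {w, y} \<notin> E))"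
  proof (rule mult_mono)
    show "p ^ card H * (1 - p) ^ (card (Kn V) - card H) \<le> edgeE (Kn V) p (\<lambda>E. of_bool (E = H))"
      using edgeE_eq_set[OF finA(1) HV] by simp
    show "(1 - real (card I) * p ^ d) ^ card W \<le> edgeE A1 p (\<lambda>E. of_bool (\<forall>w\<in>W. \<forall>Y\<in>I. \<exists>y\<in>Y. {w, y} \<notin> E))"
      unfolding A1_def using sI small finV finI IV
      by (intro edgeE_outside p) (auto simp: W_def)
  qed (use p sI small in \<open>auto intro!: edgeE_nonneg\<close>)
  also have "\<dots> = edgeE (Kn V \<union> A1) p (\<lambda>E. of_bool (E \<inter> Kn V = H) * of_bool (\<forall>w\<in>W. \<forall>Y\<in>I. \<exists>y\<in>Y. {w, y} \<notin> E \<inter> A1))"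
    by (rule edgeE_indep[OF finA disj, symmetric])
  also have "\<dots> = edgeE (all_edges n) p (\<lambda>E. of_bool ((E \<inter> (Kn V \<union> A1)) \<inter> Kn V = H)
      * of_bool (\<forall>w\<in>W. \<forall>Y\<in>I. \<exists>y\<in>Y. {w, y} \<notin> (E \<inter> (Kn V \<union> A1)) \<inter> A1))"
    by (rule edgeE_restrict[OF finite_all_edges sub, symmetric])
  also have "\<dots> \<le> edgeE (all_edges n) p (\<lambda>E. of_bool (Kn (set xs) \<subseteq> E \<and> explore d R E {} xs = L))"
  proof (rule edgeE_mono[OF p])
    fix E assume E: "E \<subseteq> all_edges n"
    have "Kn (set xs) \<subseteq> E \<and> explore d R E {} xs = L"
      if in_H: "(E \<inter> (Kn V \<union> A1)) \<inter> Kn V = H" and out: "\<forall>w\<in>W. \<forall>Y\<in>I. \<exists>y\<in>Y. {w, y} \<notin> (E \<inter> (Kn V \<union> A1)) \<inter> A1"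
    proof
      have EH: "E \<inter> Kn V = H" using in_H by auto
      then show "Kn (set xs) \<subseteq> E" by (auto simp: H_def)
      show "explore d R E {} xs = L"
      proof (rule explore_eq[OF rt])
        fix r e ys ws' assume node: "(Suc r, e, ys, ws') \<in> nd d R {} xs L"
        have YI: "set ys \<in> I" using node by (auto simp: I_def inner_faces_def)
        then have YV: "set ys \<subseteq> V" "set ys \<noteq> {}" using IV[of "set ys"] d by auto
        show "cof E (set ys) - e = set ws'"
        proof (rule cof_eq_labels[OF rt node d])
          fix a b assume "a \<in> set xs \<union> set_tree L" "b \<in> set xs \<union> set_tree L" "a \<noteq> b"
          then have "{a, b} \<in> Kn V" by (simp add: Kn_def V_def)
          then show "{a, b} \<in> E \<longleftrightarrow> {a, b} \<in> Kn (set xs) \<union> SE d R xs L"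
            using EH unfolding H_def by blast
        next
          fix u assume u: "u \<notin> set xs \<union> set_tree L"
          show "\<exists>y\<in>set ys. {u, y} \<notin> E"
          proof (cases "u \<in> {1..n}")
            case True
            then have uW: "u \<in> W" using u by (simp add: W_def V_def)
            then obtain y where y: "y \<in> set ys" "{u, y} \<notin> (E \<inter> (Kn V \<union> A1)) \<inter> A1" using out YI by blast
            have "{u, y} \<in> A1" using uW y(1) YV unfolding A1_def by blast
            then show ?thesis using y by blast
          next
            case False
            obtain y where "y \<in> set ys" using YV(2) unfolding ex_in_conv[symmetric] by blast
            moreover have "{u, y} \<notin> E" using False E by (auto simp: all_edges_def)
            ultimately show ?thesis by blast
          qed
        qed
      qed
    qed
    then show "of_bool ((E \<inter> (Kn V \<union> A1)) \<inter> Kn V = H) * of_bool (\<forall>w\<in>W. \<forall>Y\<in>I. \<exists>y\<in>Y. {w, y} \<notin> (E \<inter> (Kn V \<union> A1)) \<inter> A1)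
        \<le> (of_bool (Kn (set xs) \<subseteq> E \<and> explore d R E {} xs = L) :: real)"
      by (rule of_bool_mult_le)
  qed
  finally show ?thesis .
qed

text \<open>A lower bound for the conditional probability that the neighbourhood of a given face has shape \<open>T\<close>: a choice of
  labels, the presence of the tree edges, the absence of other edges inside the tree, and no outside vertex joined to a whole
  inner face. It converges to \<open>wt d c R T\<close>.\<close>

definition Bn :: "nat \<Rightarrow> nat \<Rightarrow> real \<Rightarrow> nat \<Rightarrow> unit tree \<Rightarrow> real" where
  "Bn d n p R T = real (n - d - msize d R T) ^ msize d R T / fprod d R T * p ^ (d * msize d R T)
     * (1 - p) ^ ((d + msize d R T)\<^sup>2) * (1 - real (isize d R T) * p ^ d) ^ n"

text \<open>An exploration has only one outcome, so the events for different labellings exclude each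
  other and their probabilities add up; \<open>card_labs\<close> counts the labellings by vertices
  outside \<open>\<sigma>\<close>.\<close>

lemma shape_prob:
  assumes p: "0 \<le> p" "p \<le> 1" and d: "d > 0" and \<sigma>: "\<sigma> \<in> Sub n d" and T: "wft d R T"
    and small: "real (isize d R T) * p ^ d \<le> 1" and n: "d + msize d R T \<le> n"
  defines "xs \<equiv> sorted_list_of_set \<sigma>"
  shows "p ^ (d choose 2) * Bn d n p R T \<le> edgeE (all_edges n) p
     (\<lambda>E. of_bool (Kn \<sigma> \<subseteq> E \<and> rooted d R xs (explore d R E {} xs) \<and> shape (explore d R E {} xs) = T))"
proof -
  let ?m = "msize d R T"
  define S where "S = {1..n} - \<sigma>"
  note sp = Sub_props[OF \<sigma>]
  have xs: "length xs = d" "distinct xs" "set xs = \<sigma>" using sp by (auto simp: xs_def)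
  have \<sigma>n: "\<sigma> \<subseteq> {1..n}" using \<sigma> by (simp add: Sub_def)
  have cS: "card S = n - d" unfolding S_def using sp \<sigma>n by (simp add: card_Diff_subset)
  have finS: "finite S" by (simp add: S_def)
  have N0: "(n - d - ?m) + ?m \<le> card S" using n cS by simp
  note cl = card_labs[OF T finS N0]
  have Lp: "rooted d R xs L" "set xs \<union> set_tree L \<subseteq> {1..n}" "msize d R L = ?m" "isize d R L = isize d R T" "shape L = T"
    if "L \<in> labs d R T S" for L
  proof -
    have L: "lt d R L" "shape L = T" "set_tree L \<subseteq> S" using that by (auto simp: labs_eq[OF T])
    show "rooted d R xs L" using L xs by (auto simp: rooted_def S_def)
    show "set xs \<union> set_tree L \<subseteq> {1..n}" using L xs \<sigma>n by (auto simp: S_def)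
    show "msize d R L = ?m" "isize d R L = isize d R T" "shape L = T"
      using shape_invariants(4,5)[OF L(1)] L(2) by auto
  qed
  let ?b = "p ^ ((d choose 2) + d * ?m) * (1 - p) ^ ((d + ?m)\<^sup>2) * (1 - real (isize d R T) * p ^ d) ^ n"
  have b0: "0 \<le> ?b" using p small by auto
  have "p ^ (d choose 2) * Bn d n p R T = real (n - d - ?m) ^ ?m / fprod d R T * ?b"
    by (simp add: Bn_def power_add mult_ac)
  also have "\<dots> \<le> real (card (labs d R T S)) * ?b"
    using cl(2) b0 fprod_pos[of d R T] by (intro mult_right_mono) (auto simp: divide_le_eq mult.commute)
  also have "\<dots> = (\<Sum>L\<in>labs d R T S. ?b)" by simp
  also have "\<dots> \<le> (\<Sum>L\<in>labs d R T S. edgeE (all_edges n) p (\<lambda>E. of_bool (Kn \<sigma> \<subseteq> E \<and> explore d R E {} xs = L)))"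
  proof (rule sum_mono)
    fix L assume L: "L \<in> labs d R T S"
    show "?b \<le> edgeE (all_edges n) p (\<lambda>E. of_bool (Kn \<sigma> \<subseteq> E \<and> explore d R E {} xs = L))"
      using tree_prob[OF p d Lp(1,2)[OF L]] small unfolding Lp(3,4)[OF L] xs(3) by simp
  qed
  also have "\<dots> = edgeE (all_edges n) p (\<lambda>E. \<Sum>L\<in>labs d R T S. of_bool (Kn \<sigma> \<subseteq> E \<and> explore d R E {} xs = L))"
    by (rule edgeE_sum[symmetric])
  also have "\<dots> \<le> edgeE (all_edges n) p
     (\<lambda>E. of_bool (Kn \<sigma> \<subseteq> E \<and> rooted d R xs (explore d R E {} xs) \<and> shape (explore d R E {} xs) = T))"
  proof (rule edgeE_mono[OF p])
    fix E
    define L0 where "L0 = explore d R E {} xs"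
    have "(\<Sum>L\<in>labs d R T S. of_bool (Kn \<sigma> \<subseteq> E \<and> L0 = L)) = (\<Sum>L\<in>labs d R T S. if L = L0 then of_bool (Kn \<sigma> \<subseteq> E) else (0::real))"
      by (intro sum.cong) auto
    also have "\<dots> = (if L0 \<in> labs d R T S then of_bool (Kn \<sigma> \<subseteq> E) else 0)"
      using cl(1) by simp
    also have "\<dots> \<le> of_bool (Kn \<sigma> \<subseteq> E \<and> rooted d R xs L0 \<and> shape L0 = T)"
      using Lp(1,5)[of L0] by auto
    finally show "(\<Sum>L\<in>labs d R T S. of_bool (Kn \<sigma> \<subseteq> E \<and> explore d R E {} xs = L))
       \<le> (of_bool (Kn \<sigma> \<subseteq> E \<and> rooted d R xs (explore d R E {} xs) \<and> shape (explore d R E {} xs) = T) :: real)"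
      unfolding L0_def .
  qed
  finally show ?thesis .
qed

text \<open>Faces whose exploration is not a tree or has a shape outside \<open>\<T>\<close> are
  dropped, which only lowers the sum because \<open>\<Theta>\<close> is nonnegative.\<close>

lemma local_lower_bound:
  fixes \<Theta> :: "unit tree \<Rightarrow> real"
  assumes p: "0 \<le> p" "p \<le> 1" and d: "d > 0" and \<T>: "finite \<T>" "\<And>T. T \<in> \<T> \<Longrightarrow> wft d R T"
    and small: "\<And>T. T \<in> \<T> \<Longrightarrow> real (isize d R T) * p ^ d \<le> 1 \<and> d + msize d R T \<le> n"
    and \<Theta>: "\<And>T. \<Theta> T \<ge> 0"
  defines "L \<equiv> \<lambda>E \<sigma>. explore d R E {} (sorted_list_of_set \<sigma>)"
  shows "real (n choose d) * p ^ (d choose 2) * (\<Sum>T\<in>\<T>. \<Theta> T * Bn d n p R T) \<le> edgeE (all_edges n) p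
     (\<lambda>E. \<Sum>\<sigma>\<in>faces (clique_complex n E) d. if rooted d R (sorted_list_of_set \<sigma>) (L E \<sigma>) then \<Theta> (shape (L E \<sigma>)) else 0)"
proof -
  let ?Q = "\<lambda>E \<sigma> T. Kn \<sigma> \<subseteq> E \<and> rooted d R (sorted_list_of_set \<sigma>) (L E \<sigma>) \<and> shape (L E \<sigma>) = T"
  have "real (n choose d) * p ^ (d choose 2) * (\<Sum>T\<in>\<T>. \<Theta> T * Bn d n p R T)
      = (\<Sum>\<sigma>\<in>Sub n d. \<Sum>T\<in>\<T>. \<Theta> T * (p ^ (d choose 2) * Bn d n p R T))"
    by (simp add: card_Sub sum_distrib_left mult_ac)
  also have "\<dots> \<le> (\<Sum>\<sigma>\<in>Sub n d. \<Sum>T\<in>\<T>. \<Theta> T * edgeE (all_edges n) p (\<lambda>E. of_bool (?Q E \<sigma> T)))"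
    unfolding L_def using \<T> small
    by (intro sum_mono mult_left_mono \<Theta> shape_prob p d) auto
  also have "\<dots> = edgeE (all_edges n) p (\<lambda>E. \<Sum>\<sigma>\<in>Sub n d. \<Sum>T\<in>\<T>. \<Theta> T * of_bool (?Q E \<sigma> T))"
    unfolding edgeE_sum edgeE_cmult ..
  also have "\<dots> \<le> edgeE (all_edges n) p
     (\<lambda>E. \<Sum>\<sigma>\<in>faces (clique_complex n E) d. if rooted d R (sorted_list_of_set \<sigma>) (L E \<sigma>) then \<Theta> (shape (L E \<sigma>)) else 0)"
  proof (rule edgeE_mono[OF p])
    fix E
    have "(\<Sum>T\<in>\<T>. \<Theta> T * of_bool (?Q E \<sigma> T)) \<le> (if Kn \<sigma> \<subseteq> E then if rooted d R (sorted_list_of_set \<sigma>) (L E \<sigma>) then \<Theta> (shape (L E \<sigma>)) else 0 else 0)" for \<sigma>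
    proof -
      have "(\<Sum>T\<in>\<T>. \<Theta> T * of_bool (?Q E \<sigma> T)) = (\<Sum>T\<in>\<T>. if T = shape (L E \<sigma>) then
         \<Theta> (shape (L E \<sigma>)) * of_bool (Kn \<sigma> \<subseteq> E \<and> rooted d R (sorted_list_of_set \<sigma>) (L E \<sigma>)) else 0)"
        by (intro sum.cong) auto
      also have "\<dots> \<le> (if Kn \<sigma> \<subseteq> E then if rooted d R (sorted_list_of_set \<sigma>) (L E \<sigma>) then \<Theta> (shape (L E \<sigma>)) else 0 else 0)"
        using \<T>(1) \<Theta> by simp
      finally show ?thesis .
    qed
    then have "(\<Sum>\<sigma>\<in>Sub n d. \<Sum>T\<in>\<T>. \<Theta> T * of_bool (?Q E \<sigma> T))
      \<le> (\<Sum>\<sigma>\<in>Sub n d. if Kn \<sigma> \<subseteq> E then if rooted d R (sorted_list_of_set \<sigma>) (L E \<sigma>) then \<Theta> (shape (L E \<sigma>)) else 0 else 0)"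
      by (intro sum_mono)
    also have "\<dots> = (\<Sum>\<sigma>\<in>faces (clique_complex n E) d. if rooted d R (sorted_list_of_set \<sigma>) (L E \<sigma>) then \<Theta> (shape (L E \<sigma>)) else 0)"
      unfolding faces_eq using finite_Sub[of n d] by (simp add: sum.inter_filter)
    finally show "(\<Sum>\<sigma>\<in>Sub n d. \<Sum>T\<in>\<T>. \<Theta> T * of_bool (?Q E \<sigma> T))
      \<le> (\<Sum>\<sigma>\<in>faces (clique_complex n E) d. if rooted d R (sorted_list_of_set \<sigma>) (L E \<sigma>) then \<Theta> (shape (L E \<sigma>)) else 0)" .
  qed
  finally show ?thesis .
qed

section \<open>Convergence of the mean\<close>

lemma real_choose_two: "real (j choose 2) = real j * (real j - 1) / 2"
proof (cases j)
  case (Suc i)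
  have "2 dvd i * Suc i" by simp
  then show ?thesis using Suc by (simp add: choose_two real_of_nat_div mult.commute algebra_simps)
qed simp

lemma quot_powr: "0 < x \<Longrightarrow> 0 < y \<Longrightarrow> (x / y) powr a = x powr a * y powr (- a :: real)"
  by (subst powr_divide) (auto simp: powr_minus divide_inverse)

lemma choose_over_power_tendsto:
  "(\<lambda>n. real (n choose s) / real n ^ s) \<longlonglongrightarrow> 1 / fact s"
proof -
  have lim: "(\<lambda>n. (real (n - s) / real n) ^ s) \<longlonglongrightarrow> 1 ^ s"
  proof (intro tendsto_power)
    have "(\<lambda>n. 1 - real s / real n) \<longlonglongrightarrow> 1 - 0"
      by (intro tendsto_diff tendsto_const tendsto_divide_0[OF tendsto_const] filterlim_real_sequentially[THEN filterlim_mono[OF _ at_top_le_at_infinity order_refl]])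
    moreover have "eventually (\<lambda>n. real (n - s) / real n = 1 - real s / real n) sequentially"
      using eventually_gt_at_top[of s] by eventually_elim (simp add: of_nat_diff diff_divide_distrib)
    ultimately show "(\<lambda>n. real (n - s) / real n) \<longlonglongrightarrow> 1"
      by (simp add: tendsto_cong)
  qed
  have "(\<lambda>n. fact s * (real (n choose s) / real n ^ s)) \<longlonglongrightarrow> 1"
  proof (rule tendsto_sandwich[OF _ _ _ tendsto_const])
    show "(\<lambda>n. (real (n - s) / real n) ^ s) \<longlonglongrightarrow> 1" using lim by simp
    show "eventually (\<lambda>n. (real (n - s) / real n) ^ s \<le> fact s * (real (n choose s) / real n ^ s)) sequentially"
      using eventually_gt_at_top[of s]
    proof eventually_elim
      case (elim n)
      have "(n - s) ^ s \<le> fact s * (n choose s)" using falling_ge_power[of "n - s" s] elim by simp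
      then have "real ((n - s) ^ s) \<le> real (fact s * (n choose s))" by (rule of_nat_mono)
      then have "real (n - s) ^ s \<le> fact s * real (n choose s)" by simp
      then show ?case using elim by (simp add: power_divide divide_right_mono)
    qed
    show "eventually (\<lambda>n. fact s * (real (n choose s) / real n ^ s) \<le> 1) sequentially"
      using eventually_gt_at_top[of s]
    proof eventually_elim
      case (elim n)
      have "fact s * (n choose s) \<le> n ^ s"
        using binomial_fact_pow[of n s] by (simp add: mult.commute)
      then have "real (fact s * (n choose s)) \<le> real (n ^ s)" by (rule of_nat_mono)
      then have "fact s * real (n choose s) \<le> real n ^ s" by simp
      then show ?case using elim by (simp add: divide_le_eq)
    qed
  qed
  from tendsto_mult_left[OF this, of "1 / fact s"] show ?thesis by simp
qed

context poisson_tree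
begin

definition pn :: "nat \<Rightarrow> real" where
  "pn n = (c / real n) powr (1 / real d)"

text \<open>The normalisation: the mean number of faces is asymptotically
  \<open>W n / fact d\<close>. For \<open>d = k + 1\<close> it equals
  \<open>c powr (k/2) * n powr (k/2 + 1)\<close> by \<open>W_eq\<close>.\<close>

definition W :: "nat \<Rightarrow> real" where
  "W n = wn n (pn n) d"

lemma pn_power: "n > 0 \<Longrightarrow> pn n ^ m = (c / real n) powr (real m / real d)"
  using c_pos by (simp add: pn_def powr_powr flip: powr_realpow)

lemma pn_power_d: "n > 0 \<Longrightarrow> pn n ^ d = c / real n"
  using pn_power[of n d] d_pos c_pos by simp

lemma pn_props: "n > 0 \<Longrightarrow> 0 < pn n" "n > 0 \<Longrightarrow> real n \<ge> c \<Longrightarrow> pn n \<le> 1"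
proof -
  show "n > 0 \<Longrightarrow> 0 < pn n" using c_pos by (simp add: pn_def)
  assume "n > 0" "real n \<ge> c"
  then have "c / real n \<le> 1" using c_pos by simp
  then show "pn n \<le> 1" unfolding pn_def using c_pos \<open>n > 0\<close> by (intro powr_le1) auto
qed

lemma pn_tendsto: "pn \<longlonglongrightarrow> 0"
proof -
  have "(\<lambda>n. c / real n) \<longlonglongrightarrow> 0"
    by (intro tendsto_divide_0[OF tendsto_const] filterlim_real_sequentially[THEN filterlim_mono[OF _ at_top_le_at_infinity order_refl]])
  then have "(\<lambda>n. (c / real n) powr (1 / real d)) \<longlonglongrightarrow> 0"
    using c_pos d_pos by (intro tendsto_zero_powrI[OF _ tendsto_const]) auto
  then show ?thesis by (simp add: pn_def[abs_def])
qed

text \<open>For \<open>j \<le> d + 1\<close> one has \<open>(j choose 2) / d \<le> j / 2\<close>,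
  and \<open>c / n \<le> 1\<close>, so \<open>wn\<close> is at least
  \<open>(c * n) powr (j / 2)\<close>. The second bound supplies the gain
  \<open>\<kappa> = c * n\<close> in the variance.\<close>

lemma wn_ge:
  assumes n: "n > 0" "real n \<ge> c" "c * real n \<ge> 1" and j: "j \<le> d + 1"
  shows "wn n (pn n) j \<ge> 1" "2 \<le> j \<Longrightarrow> wn n (pn n) j \<ge> c * real n"
proof -
  have ratio: "0 < c / real n" "c / real n \<le> 1" using n c_pos by auto
  have "real (j choose 2) / real d \<le> real j / 2"
  proof (cases j)
    case (Suc i)
    then have "real i \<le> real d" using j by simp
    then have "real j * real i \<le> real j * real d" by (intro mult_left_mono) auto
    then show ?thesis using d_pos Suc unfolding real_choose_two by (simp add: field_simps)
  qed (simp add: numeral_2_eq_2)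
  then have "(c / real n) powr (real j / 2) \<le> pn n ^ (j choose 2)"
    unfolding pn_power[OF n(1)] using ratio by (intro powr_mono') auto
  then have "real n ^ j * (c / real n) powr (real j / 2) \<le> wn n (pn n) j"
    unfolding wn_def by (intro mult_left_mono) auto
  moreover have "real n ^ j * (c / real n) powr (real j / 2) = (c * real n) powr (real j / 2)"
  proof -
    have "real n ^ j = (real n * real n) powr (real j / 2)"
      using n unfolding powr_mult powr_add[symmetric] by (simp add: powr_realpow)
    moreover have "(real n * real n) powr (real j / 2) * (c / real n) powr (real j / 2) = (real n * real n * (c / real n)) powr (real j / 2)"
      by (rule powr_mult[symmetric]; use n c_pos in simp)
    ultimately have "real n ^ j * (c / real n) powr (real j / 2) = (real n * real n * (c / real n)) powr (real j / 2)"
      by (simp only:)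
    then show ?thesis using n by (simp add: mult.commute)
  qed
  ultimately have *: "(c * real n) powr (real j / 2) \<le> wn n (pn n) j" by simp
  moreover have "1 \<le> (c * real n) powr (real j / 2)" using n by (intro ge_one_powr_ge_zero) auto
  ultimately show "wn n (pn n) j \<ge> 1" by linarith
  assume "2 \<le> j"
  then have "(c * real n) powr 1 \<le> (c * real n) powr (real j / 2)" using n by (intro powr_mono) auto
  then show "wn n (pn n) j \<ge> c * real n" using * n by simp
qed

lemma eventually_large: "eventually (\<lambda>n. n > 0 \<and> real n \<ge> c \<and> c * real n \<ge> 1 \<and> real n \<ge> a) sequentially"
proof -
  have "eventually (\<lambda>n. real n \<ge> b) sequentially" for b
    using filterlim_real_sequentially by (simp add: filterlim_at_top)
  from this[of "1 + c + 1 / c + \<bar>a\<bar>"] show ?thesis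
  proof eventually_elim
    case (elim n)
    have "1 / c > 0" using c_pos by simp
    then have n: "real n \<ge> 1" "real n \<ge> c" "real n \<ge> 1 / c" "real n \<ge> a" using elim c_pos by linarith+
    then show ?case using c_pos by (simp add: field_simps)
  qed
qed

lemma W_Suc: "n > 0 \<Longrightarrow> wn n (pn n) (d + 1) = c * W n"
proof -
  assume n: "n > 0"
  have "(d + 1) choose 2 = (d choose 2) + d" by (simp add: numeral_2_eq_2)
  then have "wn n (pn n) (d + 1) = real n * pn n ^ d * W n"
    by (simp add: wn_def W_def power_add)
  then show ?thesis using n by (simp add: pn_power_d)
qed

lemma W_eq: "n > 0 \<Longrightarrow> W n = c powr ((real d - 1) / 2) * real n powr ((real d + 1) / 2)"
proof -
  assume n: "n > 0"
  have "pn n ^ (d choose 2) = (c / real n) powr ((real d - 1) / 2)"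
    unfolding pn_power[OF n] real_choose_two using d_pos by simp
  also have "\<dots> = c powr ((real d - 1) / 2) * real n powr (- ((real d - 1) / 2))"
    using n c_pos by (intro quot_powr) auto
  finally have "W n = c powr ((real d - 1) / 2) * (real n powr real d * real n powr (- ((real d - 1) / 2)))"
    unfolding W_def wn_def using n by (simp add: powr_realpow)
  also have "real n powr real d * real n powr (- ((real d - 1) / 2)) = real n powr ((real d + 1) / 2)"
    by (simp add: field_simps flip: powr_add)
  finally show ?thesis .
qed

lemma W_pos: "n > 0 \<Longrightarrow> W n > 0"
  using pn_props(1)[of n] by (simp add: W_def wn_def)

lemma faces_d_ratio: "(\<lambda>n. real (n choose d) * pn n ^ (d choose 2) / W n) \<longlonglongrightarrow> 1 / fact d"
proof -
  have "eventually (\<lambda>n. real (n choose d) * pn n ^ (d choose 2) / W n = real (n choose d) / real n ^ d) sequentially"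
    using eventually_gt_at_top[of 0]
  proof eventually_elim
    case (elim n)
    then show ?case using pn_props(1)[OF elim] by (simp add: W_def wn_def)
  qed
  then show ?thesis using choose_over_power_tendsto[of d] by (simp add: tendsto_cong)
qed

lemma faces_Suc_d_ratio:
  "(\<lambda>n. real (n choose (d + 1)) * pn n ^ ((d + 1) choose 2) / W n) \<longlonglongrightarrow> c / fact (d + 1)"
proof -
  have "eventually (\<lambda>n. real (n choose (d + 1)) * pn n ^ ((d + 1) choose 2) / W n = c * (real (n choose (d + 1)) / real n ^ (d + 1))) sequentially"
    using eventually_gt_at_top[of 0]
  proof eventually_elim
    case (elim n)
    have "wn n (pn n) (d + 1) = c * W n" by (rule W_Suc[OF elim])
    then have "pn n ^ ((d + 1) choose 2) = c * W n / real n ^ (d + 1)"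
      using elim by (simp only: wn_def) (simp add: field_simps)
    then show ?case using W_pos[OF elim] by (simp only:) simp
  qed
  moreover have "(\<lambda>n. c * (real (n choose (d + 1)) / real n ^ (d + 1))) \<longlonglongrightarrow> c * (1 / fact (d + 1))"
    by (intro tendsto_mult tendsto_const choose_over_power_tendsto)
  ultimately show ?thesis by (simp add: tendsto_cong)
qed

text \<open>The ratio is at most \<open>1 / (n * pn n ^ (d - 1))\<close>, a constant times
  \<open>n powr (- 1 / d)\<close>. This makes the difference between the Betti number and
  \<open>nu\<close> negligible.\<close>

lemma faces_lower_ratio: "(\<lambda>n. real (n choose (d - 1)) * pn n ^ ((d - 1) choose 2) / W n) \<longlonglongrightarrow> 0"
proof -
  have lim: "(\<lambda>n. c powr (- (real d - 1) / real d) * real n powr (- (1 / real d))) \<longlonglongrightarrow> c powr (- (real d - 1) / real d) * 0"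
    using d_pos by (intro tendsto_mult tendsto_const tendsto_neg_powr filterlim_real_sequentially) auto
  show ?thesis
  proof (rule tendsto_sandwich[OF _ _ tendsto_const])
    show "(\<lambda>n. c powr (- (real d - 1) / real d) * real n powr (- (1 / real d))) \<longlonglongrightarrow> 0" using lim by simp
    show "eventually (\<lambda>n. 0 \<le> real (n choose (d - 1)) * pn n ^ ((d - 1) choose 2) / W n) sequentially"
      using eventually_gt_at_top[of 0]
    proof eventually_elim
      case (elim n)
      show ?case using W_pos[OF elim] pn_props(1)[OF elim] by simp
    qed
    show "eventually (\<lambda>n. real (n choose (d - 1)) * pn n ^ ((d - 1) choose 2) / W n
        \<le> c powr (- (real d - 1) / real d) * real n powr (- (1 / real d))) sequentially"
      using eventually_gt_at_top[of 0]
    proof eventually_elim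
      case (elim n)
      note pp = pn_props(1)[OF elim]
      have d1: "d = Suc (d - 1)" using d_pos by simp
      have ch: "d choose 2 = ((d - 1) choose 2) + (d - 1)"
        by (subst d1) (simp add: numeral_2_eq_2 del: Suc_pred)
      have "n choose (d - 1) \<le> n ^ (d - 1)" by (cases "d - 1 \<le> n") (auto simp: binomial_le_pow binomial_eq_0)
      then have "real (n choose (d - 1)) \<le> real n ^ (d - 1)" unfolding of_nat_power[symmetric] of_nat_le_iff .
      then have "real (n choose (d - 1)) * pn n ^ ((d - 1) choose 2) / W n \<le> real n ^ (d - 1) * pn n ^ ((d - 1) choose 2) / W n"
        using pp W_pos[OF elim] by (intro divide_right_mono mult_right_mono) auto
      also have "\<dots> = 1 / (real n * pn n ^ (d - 1))"
      proof -
        have "W n = real n * pn n ^ (d - 1) * (real n ^ (d - 1) * pn n ^ ((d - 1) choose 2))"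
          unfolding W_def wn_def ch power_add by (subst (1) d1) (simp del: Suc_pred)
        then show ?thesis using elim pp by simp
      qed
      also have "\<dots> = c powr (- (real d - 1) / real d) * real n powr (- (1 / real d))"
      proof -
        have r: "real (d - 1) = real d - 1" using d_pos by (simp add: of_nat_diff)
        have e: "(real d - 1) / real d = 1 - 1 / real d" using d_pos by (simp add: diff_divide_distrib)
        have "real n * pn n ^ (d - 1) = real n powr 1 * (c powr (1 - 1 / real d) * real n powr (- (1 - 1 / real d)))"
        proof -
          have "0 < real n" using elim by simp
          then show ?thesis unfolding pn_power[OF elim] r e quot_powr[OF c_pos \<open>0 < real n\<close>] by simp
        qed
        also have "\<dots> = c powr (1 - 1 / real d) * (real n powr 1 * real n powr (- (1 - 1 / real d)))" by (simp only: mult.left_commute)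
        also have "real n powr 1 * real n powr (- (1 - 1 / real d)) = real n powr (1 / real d)"
          by (simp only: powr_add[symmetric]) simp
        finally have "1 / (real n * pn n ^ (d - 1)) = c powr (- (1 - 1 / real d)) * real n powr (- (1 / real d))"
          using elim c_pos by (simp only: powr_minus) (simp add: divide_inverse)
        moreover have "- (real d - 1) / real d = - (1 - 1 / real d)"
          unfolding e[symmetric] by (rule minus_divide_left[symmetric])
        ultimately show ?thesis by (simp only:)
      qed
      finally show ?case .
    qed
  qed
qed

text \<open>Since \<open>pn n ^ d = c / n\<close>, the choice of labels and the tree edges together
  give \<open>c ^ m\<close>; the absence of a bounded number of inner edges has probability tending
  to \<open>1\<close>, and the condition on outside vertices gives
  \<open>(1 - i * c / n) ^ n\<close>, with limit \<open>exp (- i * c)\<close> for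
  \<open>i = isize d R T\<close>.\<close>

lemma Bn_tendsto: "(\<lambda>n. Bn d n (pn n) R T) \<longlonglongrightarrow> wt d c R T"
proof -
  let ?m = "msize d R T" and ?q = "isize d R T"
  have inv: "(\<lambda>n. a / real n) \<longlonglongrightarrow> 0" for a
    by (intro tendsto_divide_0[OF tendsto_const] filterlim_real_sequentially[THEN filterlim_mono[OF _ at_top_le_at_infinity order_refl]])
  have l1: "(\<lambda>n. (1 - real (d + ?m) / real n) ^ ?m * c ^ ?m / fprod d R T) \<longlonglongrightarrow> (1 - 0) ^ ?m * c ^ ?m / fprod d R T"
    using fprod_pos[of d R T] by (intro tendsto_intros inv) auto
  have l2: "(\<lambda>n. (1 - pn n) ^ ((d + ?m)\<^sup>2)) \<longlonglongrightarrow> (1 - 0) ^ ((d + ?m)\<^sup>2)"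
    by (intro tendsto_intros pn_tendsto)
  have l3: "(\<lambda>n. (1 + (- real ?q * c) / real n) ^ n) \<longlonglongrightarrow> exp (- real ?q * c)"
    by (rule tendsto_exp_limit_sequentially)
  have "(\<lambda>n. ((1 - real (d + ?m) / real n) ^ ?m * c ^ ?m / fprod d R T) * (1 - pn n) ^ ((d + ?m)\<^sup>2) * (1 + (- real ?q * c) / real n) ^ n)
     \<longlonglongrightarrow> ((1 - 0) ^ ?m * c ^ ?m / fprod d R T) * (1 - 0) ^ ((d + ?m)\<^sup>2) * exp (- real ?q * c)"
    by (intro tendsto_mult l1 l2 l3)
  moreover have "((1 - 0) ^ ?m * c ^ ?m / fprod d R T) * (1 - 0) ^ ((d + ?m)\<^sup>2) * exp (- real ?q * c) = wt d c R T"
    unfolding wt_eq by (simp add: exp_of_nat_mult[symmetric])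
  moreover have "eventually (\<lambda>n. Bn d n (pn n) R T = ((1 - real (d + ?m) / real n) ^ ?m * c ^ ?m / fprod d R T)
      * (1 - pn n) ^ ((d + ?m)\<^sup>2) * (1 + (- real ?q * c) / real n) ^ n) sequentially"
    using eventually_gt_at_top[of "d + ?m"]
  proof eventually_elim
    case (elim n)
    then have n: "n > 0" by simp
    have "real (n - d - ?m) = real n * (1 - real (d + ?m) / real n)"
      using elim n by (simp add: of_nat_diff field_simps)
    then have "real (n - d - ?m) ^ ?m * (c / real n) ^ ?m = (1 - real (d + ?m) / real n) ^ ?m * c ^ ?m"
      using n by (simp add: power_mult_distrib power_divide)
    moreover have "pn n ^ (d * ?m) = (c / real n) ^ ?m" by (simp add: power_mult pn_power_d[OF n])
    ultimately have h1: "real (n - d - ?m) ^ ?m / fprod d R T * pn n ^ (d * ?m) = (1 - real (d + ?m) / real n) ^ ?m * c ^ ?m / fprod d R T"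
      by (simp add: field_simps)
    have h2: "1 - real ?q * pn n ^ d = 1 + (- real ?q * c) / real n" by (simp add: pn_power_d[OF n])
    show ?case unfolding Bn_def h1 h2 by (rule refl)
  qed
  ultimately show ?thesis by (simp add: tendsto_cong)
qed

lemma sum_Bn_tendsto: "(\<lambda>n. \<Sum>T\<in>\<T>. \<Theta> T * Bn d n (pn n) R T) \<longlonglongrightarrow> (\<Sum>T\<in>\<T>. \<Theta> T * wt d c R T)"
  by (intro tendsto_sum tendsto_mult tendsto_const Bn_tendsto)

lemma eventually_small:
  fixes \<T> :: "unit tree set"
  assumes "finite \<T>"
  shows "eventually (\<lambda>n. \<forall>T\<in>\<T>. real (isize d R T) * pn n ^ d \<le> 1 \<and> d + msize d R T \<le> n) sequentially"
proof (rule eventually_ball_finite[OF assms], rule ballI)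
  fix T :: "unit tree"
  show "eventually (\<lambda>n. real (isize d R T) * pn n ^ d \<le> 1 \<and> d + msize d R T \<le> n) sequentially"
    using eventually_large[of "real (isize d R T) * c + real (d + msize d R T)"]
  proof eventually_elim
    case (elim n)
    then have n: "n > 0" "real (isize d R T) * c \<le> real n" "real (d + msize d R T) \<le> real n"
      using c_pos by (auto simp: add_nonneg_nonneg intro: order_trans[rotated])
    then show ?case by (simp add: pn_power_d divide_le_eq)
  qed
qed

section \<open>Bounds for the normalised mean\<close>

definition meanW :: "nat \<Rightarrow> real" where
  "meanW n = edgeE (all_edges n) (pn n) (\<lambda>E. real (nu (clique_complex n E) d)) / W n"

text \<open>The bound of \<open>nu_upper\<close> is the number of faces minus the sum of
  \<open>1 - xval\<close> over faces with a tree exploration. This deficit is nonnegative, so a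
  lower bound of its mean suffices.\<close>

lemma meanW_upper:
  assumes "finite \<T>" "\<And>T. T \<in> \<T> \<Longrightarrow> wft d R T"
  shows "eventually (\<lambda>n. meanW n \<le> real (n choose d) * pn n ^ (d choose 2) / W n * (1 - (\<Sum>T\<in>\<T>. (1 - xval d R T) * Bn d n (pn n) R T))) sequentially"
  using eventually_small[OF assms(1), of R] eventually_large[of 0]
proof eventually_elim
  case (elim n)
  define p where "p = pn n"
  have n: "n > 0" using elim by simp
  have p: "0 \<le> p" "p \<le> 1" using pn_props[OF n] elim by (auto simp: p_def)
  let ?L = "\<lambda>E \<sigma>. explore d R E {} (sorted_list_of_set \<sigma>)" and ?K = "clique_complex n"
  let ?rt = "\<lambda>E \<sigma>. rooted d R (sorted_list_of_set \<sigma>) (?L E \<sigma>)"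
  have "edgeE (all_edges n) p (\<lambda>E. real (nu (?K E) d))
      \<le> edgeE (all_edges n) p (\<lambda>E. real (card (faces (?K E) d)) - (\<Sum>\<sigma>\<in>faces (?K E) d. if ?rt E \<sigma> then 1 - xval d R (shape (?L E \<sigma>)) else 0))"
  proof (rule edgeE_mono[OF p])
    fix E assume E: "E \<subseteq> all_edges n"
    have "real (nu (?K E) d) \<le> (\<Sum>\<sigma>\<in>faces (?K E) d. if ?rt E \<sigma> then xval d R (?L E \<sigma>) else 1)"
      by (rule nu_upper[OF E d_pos])
    also have "\<dots> = (\<Sum>\<sigma>\<in>faces (?K E) d. 1 - (if ?rt E \<sigma> then 1 - xval d R (shape (?L E \<sigma>)) else 0))"
      by (intro sum.cong refl) (auto simp: rooted_def shape_invariants(2))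
    finally show "real (nu (?K E) d) \<le> real (card (faces (?K E) d)) - (\<Sum>\<sigma>\<in>faces (?K E) d. if ?rt E \<sigma> then 1 - xval d R (shape (?L E \<sigma>)) else 0)"
      by (simp add: sum_subtractf)
  qed
  also have "\<dots> \<le> real (n choose d) * p ^ (d choose 2) - real (n choose d) * p ^ (d choose 2) * (\<Sum>T\<in>\<T>. (1 - xval d R T) * Bn d n p R T)"
    unfolding edgeE_diff edgeE_card_faces
    by (intro diff_left_mono local_lower_bound[OF p d_pos assms]) (use elim xval_le_1[OF d_pos] in \<open>auto simp: p_def\<close>)
  finally have "edgeE (all_edges n) p (\<lambda>E. real (nu (?K E) d)) \<le> real (n choose d) * p ^ (d choose 2) * (1 - (\<Sum>T\<in>\<T>. (1 - xval d R T) * Bn d n p R T))"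
    by (simp add: algebra_simps)
  then show ?case
    unfolding meanW_def p_def using W_pos[OF n] by (simp add: divide_right_mono)
qed

lemma meanW_lower:
  assumes "finite \<T>" "\<And>T. T \<in> \<T> \<Longrightarrow> wft d (Suc (Suc R)) T"
  defines "\<Theta> \<equiv> \<lambda>T :: unit tree. (if zval d (Suc R) T then 1 else 0) + real (psi d R T) / real (d + 1)"
  shows "eventually (\<lambda>n. real (n choose d) * pn n ^ (d choose 2) / W n * (\<Sum>T\<in>\<T>. \<Theta> T * Bn d n (pn n) (Suc (Suc R)) T)
    - real (n choose (d + 1)) * pn n ^ ((d + 1) choose 2) / W n \<le> meanW n) sequentially"
  using eventually_small[OF assms(1), of "Suc (Suc R)"] eventually_large[of 0]
proof eventually_elim
  case (elim n)
  define p where "p = pn n"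
  have n: "n > 0" using elim by simp
  have p: "0 \<le> p" "p \<le> 1" using pn_props[OF n] elim by (auto simp: p_def)
  let ?L = "\<lambda>E \<sigma>. explore d (Suc (Suc R)) E {} (sorted_list_of_set \<sigma>)" and ?K = "clique_complex n"
  let ?rt = "\<lambda>E \<sigma>. rooted d (Suc (Suc R)) (sorted_list_of_set \<sigma>) (?L E \<sigma>)"
  have \<Theta>0: "0 \<le> \<Theta> T" for T by (simp add: \<Theta>_def)
  have "real (n choose d) * p ^ (d choose 2) * (\<Sum>T\<in>\<T>. \<Theta> T * Bn d n p (Suc (Suc R)) T)
      \<le> edgeE (all_edges n) p (\<lambda>E. \<Sum>\<sigma>\<in>faces (?K E) d. if ?rt E \<sigma> then \<Theta> (shape (?L E \<sigma>)) else 0)"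
    by (intro local_lower_bound[OF p d_pos assms(1,2)]) (use elim \<Theta>0 in \<open>auto simp: p_def simp del: isize.simps msize.simps\<close>)
  also have "\<dots> \<le> edgeE (all_edges n) p (\<lambda>E. real (nu (?K E) d) + real (card (faces (?K E) (d + 1))))"
  proof (rule edgeE_mono[OF p])
    fix E assume E: "E \<subseteq> all_edges n"
    have "(\<Sum>\<sigma>\<in>faces (?K E) d. if ?rt E \<sigma> then \<Theta> (shape (?L E \<sigma>)) else 0)
        \<le> (\<Sum>\<sigma>\<in>faces (?K E) d. (if zval d (Suc R) (?L E \<sigma>) then 1 else 0) + real (psi d R (?L E \<sigma>)) / real (d + 1))"
    proof (rule sum_mono)
      fix \<sigma>
      show "(if ?rt E \<sigma> then \<Theta> (shape (?L E \<sigma>)) else 0) \<le> (if zval d (Suc R) (?L E \<sigma>) then 1 else 0) + real (psi d R (?L E \<sigma>)) / real (d + 1)"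
      proof (cases "?rt E \<sigma>")
        case True
        then have lt: "lt d (Suc (Suc R)) (?L E \<sigma>)" unfolding rooted_def by blast
        have "\<Theta> (shape (?L E \<sigma>)) = (if zval d (Suc R) (?L E \<sigma>) then 1 else 0) + real (psi d R (?L E \<sigma>)) / real (d + 1)"
          unfolding \<Theta>_def shape_psi[OF lt] shape_invariants(3)[OF lt le_SucI[OF order_refl]] ..
        then show ?thesis using True by (simp only: if_True order_refl)
      next
        case False
        have "0 \<le> (if zval d (Suc R) (?L E \<sigma>) then 1 else 0) + real (psi d R (?L E \<sigma>)) / real (d + 1)"
          by (intro add_nonneg_nonneg divide_nonneg_nonneg) auto
        then show ?thesis using False by (simp only: if_False)
      qed
    qed
    also have "\<dots> \<le> real (nu (?K E) d) + real (card (faces (?K E) (d + 1)))"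
      by (rule nu_lower[OF E d_pos])
    finally show "(\<Sum>\<sigma>\<in>faces (?K E) d. if ?rt E \<sigma> then \<Theta> (shape (?L E \<sigma>)) else 0) \<le> real (nu (?K E) d) + real (card (faces (?K E) (d + 1)))" .
  qed
  also have "\<dots> = edgeE (all_edges n) p (\<lambda>E. real (nu (?K E) d)) + real (n choose (d + 1)) * p ^ ((d + 1) choose 2)"
    unfolding edgeE_add edgeE_card_faces ..
  finally have "(real (n choose d) * p ^ (d choose 2) * (\<Sum>T\<in>\<T>. \<Theta> T * Bn d n p (Suc (Suc R)) T)) / W n
      \<le> (edgeE (all_edges n) p (\<lambda>E. real (nu (?K E) d)) + real (n choose (d + 1)) * p ^ ((d + 1) choose 2)) / W n"
    using W_pos[OF n] by (intro divide_right_mono) auto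
  then show ?case
    unfolding meanW_def p_def add_divide_distrib times_divide_eq_left by linarith
qed

text \<open>The case of \<open>nu_ge\<close> in which \<open>Z\<close> is the set of all faces; it
  yields the value of \<open>gfun\<close> at \<open>1\<close>.\<close>

lemma meanW_lower_euler:
  "eventually (\<lambda>n. real (n choose d) * pn n ^ (d choose 2) / W n - real (n choose (d + 1)) * pn n ^ ((d + 1) choose 2) / W n \<le> meanW n) sequentially"
  using eventually_large[of 0]
proof eventually_elim
  case (elim n)
  define p where "p = pn n"
  have n: "n > 0" using elim by simp
  have p: "0 \<le> p" "p \<le> 1" using pn_props[OF n] elim by (auto simp: p_def)
  let ?K = "clique_complex n"
  have "edgeE (all_edges n) p (\<lambda>E. real (card (faces (?K E) d)))
      \<le> edgeE (all_edges n) p (\<lambda>E. real (nu (?K E) d) + real (card (faces (?K E) (d + 1))))"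
  proof (rule edgeE_mono[OF p])
    fix E
    have "card (faces (?K E) d) \<le> nu (?K E) d + card {\<tau> \<in> faces (?K E) (d + 1). \<exists>u\<in>\<tau>. \<tau> - {u} \<in> faces (?K E) d}"
      by (rule nu_ge[OF finite_clique_complex order_refl])
    also have "card {\<tau> \<in> faces (?K E) (d + 1). \<exists>u\<in>\<tau>. \<tau> - {u} \<in> faces (?K E) d} \<le> card (faces (?K E) (d + 1))"
      by (intro card_mono finite_faces finite_clique_complex) auto
    finally show "real (card (faces (?K E) d)) \<le> real (nu (?K E) d) + real (card (faces (?K E) (d + 1)))" by simp
  qed
  then have "real (n choose d) * p ^ (d choose 2) \<le> edgeE (all_edges n) p (\<lambda>E. real (nu (?K E) d)) + real (n choose (d + 1)) * p ^ ((d + 1) choose 2)"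
    unfolding edgeE_add edgeE_card_faces .
  then have "real (n choose d) * p ^ (d choose 2) / W n \<le> (edgeE (all_edges n) p (\<lambda>E. real (nu (?K E) d)) + real (n choose (d + 1)) * p ^ ((d + 1) choose 2)) / W n"
    using W_pos[OF n] by (intro divide_right_mono) auto
  then show ?case unfolding meanW_def p_def add_divide_distrib by linarith
qed

definition hmax :: real where
  "hmax = max (gfun d c 1) (gfun d c (t_root d c))"

lemma surv_bound: "gfun d c surv \<le> hmax"
proof -
  have "0 < surv" by (subst surv_eq) simp
  moreover have "surv \<le> 1" by (simp add: surv_def)
  ultimately show ?thesis
    using gfun_root_le_max[OF _ _ surv_eq] by (auto simp: hmax_def max.commute)
qed

text \<open>Above: the mean of \<open>X\<close> is \<open>gfun d c surv\<close>, at most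
  \<open>hmax\<close>, and is approached at finite depth. Below: each entry of the maximum comes
  from its own bound, \<open>meanW_lower_euler\<close> or \<open>meanW_lower\<close> for
  sufficiently many rounds.\<close>

lemma meanW_tendsto: "meanW \<longlonglongrightarrow> hmax / fact d"
proof (rule order_tendstoI)
  fix u assume u: "hmax / fact d < u"
  then have uf: "hmax < u * fact d" by (simp add: divide_less_eq)
  have "0 \<le> gfun d c surv" using nn_integral_X_eq(2) unfolding gfun_def .
  then have pos: "0 < u * fact d" using surv_bound uf by linarith
  have "(\<integral>\<^sup>+\<omega>. X \<omega> \<partial>treeM) = ennreal (gfun d c surv)"
    unfolding nn_integral_X_eq(1) gfun_def ..
  also have "\<dots> < ennreal (u * fact d)"
    using surv_bound uf pos by (intro ennreal_lessI) auto
  finally have "(INF R. \<integral>\<^sup>+\<omega>. XR R \<omega> \<partial>treeM) < ennreal (u * fact d)" unfolding nn_integral_X .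
  then obtain R where R: "(\<integral>\<^sup>+\<omega>. XR R \<omega> \<partial>treeM) < ennreal (u * fact d)" unfolding INF_less_iff by blast
  then obtain x where x: "(\<integral>\<^sup>+\<omega>. XR R \<omega> \<partial>treeM) = ennreal x" "0 \<le> x"
    by (cases "\<integral>\<^sup>+\<omega>. XR R \<omega> \<partial>treeM") auto
  then have xu: "x < u * fact d" using R by (simp add: ennreal_less_iff)
  note x = x xu
  \<comment> \<open>The mean of \<open>xval\<close> lies below \<open>u * fact d\<close>, hence that
    of its complement exceeds \<open>e\<close>; the complement is what finitely many shapes
    approximate from below.\<close>
  define e where "e = 1 - u * fact d"
  let ?\<Theta> = "\<lambda>T :: unit tree. 1 - xval d R T"
  have \<Theta>0: "0 \<le> ?\<Theta> T" for T using xval_le_1[OF d_pos] by simp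
  have "(\<integral>\<^sup>+\<omega>. ennreal (xval d R (TR R \<omega>)) \<partial>treeM) + (\<integral>\<^sup>+\<omega>. ennreal (?\<Theta> (TR R \<omega>)) \<partial>treeM)
      = (\<integral>\<^sup>+\<omega>. ennreal (xval d R (TR R \<omega>)) + ennreal (?\<Theta> (TR R \<omega>)) \<partial>treeM)"
    by (intro nn_integral_add[symmetric]) measurable
  also have "\<dots> = (\<integral>\<^sup>+\<omega>. 1 \<partial>treeM)"
    using xval_pos[OF d_pos] \<Theta>0 by (intro nn_integral_cong, subst ennreal_plus[symmetric]) (auto intro: less_imp_le)
  also have "\<dots> = 1" using treeM.emeasure_space_1 by simp
  finally have s1: "ennreal x + (\<integral>\<^sup>+\<omega>. ennreal (?\<Theta> (TR R \<omega>)) \<partial>treeM) = 1"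
    using x(1) by (simp add: xval_TR)
  then obtain y where y: "(\<integral>\<^sup>+\<omega>. ennreal (?\<Theta> (TR R \<omega>)) \<partial>treeM) = ennreal y" "0 \<le> y"
    by (cases "\<integral>\<^sup>+\<omega>. ennreal (?\<Theta> (TR R \<omega>)) \<partial>treeM") auto
  then have "ennreal (x + y) = ennreal 1" using s1 x(2) by simp
  then have "x + y = 1" using x(2) y(2) by (subst (asm) ennreal_inj) auto
  then have ey: "e < y" using x(3) by (simp add: e_def)
  \<comment> \<open>\<open>ennreal\<close> sends negative reals to \<open>0\<close>, so the strict
    inequality transfers only for \<open>y > 0\<close>. If \<open>y = 0\<close>, then
    \<open>e\<close> is negative and the empty set of shapes suffices.\<close>
  obtain \<T> where \<T>: "finite \<T>" "\<And>T. T \<in> \<T> \<Longrightarrow> wft d R T" "e < (\<Sum>T\<in>\<T>. ?\<Theta> T * wt d c R T)"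
  proof (cases "y = 0")
    case True
    then show ?thesis using that[of "{}"] ey by simp
  next
    case False
    then have "ennreal e < (\<integral>\<^sup>+\<omega>. ennreal (?\<Theta> (TR R \<omega>)) \<partial>treeM)"
      using ey y by (auto intro!: ennreal_lessI)
    from finite_tree_sum[OF \<Theta>0 this] show ?thesis using that by blast
  qed
  have "(\<lambda>n. real (n choose d) * pn n ^ (d choose 2) / W n * (1 - (\<Sum>T\<in>\<T>. ?\<Theta> T * Bn d n (pn n) R T)))
      \<longlonglongrightarrow> 1 / fact d * (1 - (\<Sum>T\<in>\<T>. ?\<Theta> T * wt d c R T))"
    by (intro tendsto_mult faces_d_ratio tendsto_diff tendsto_const sum_Bn_tendsto)
  moreover have "1 / fact d * (1 - (\<Sum>T\<in>\<T>. ?\<Theta> T * wt d c R T)) < u"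
  proof -
    have "1 - (\<Sum>T\<in>\<T>. ?\<Theta> T * wt d c R T) < u * fact d" using \<T>(3) by (simp add: e_def)
    then show ?thesis by (simp add: divide_less_eq)
  qed
  ultimately have "eventually (\<lambda>n. real (n choose d) * pn n ^ (d choose 2) / W n * (1 - (\<Sum>T\<in>\<T>. ?\<Theta> T * Bn d n (pn n) R T)) < u) sequentially"
    by (rule order_tendstoD(2))
  moreover have "eventually (\<lambda>n. meanW n \<le> real (n choose d) * pn n ^ (d choose 2) / W n * (1 - (\<Sum>T\<in>\<T>. ?\<Theta> T * Bn d n (pn n) R T))) sequentially"
    by (rule meanW_upper[OF \<T>(1,2)])
  ultimately show "eventually (\<lambda>n. meanW n < u) sequentially"
    by eventually_elim (rule le_less_trans)
next
  fix l assume l: "l < hmax / fact d"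
  have fs: "fact (d + 1) = real (d + 1) * fact d" by (simp add: fact_Suc)
  consider "l < gfun d c 1 / fact d" | "l < gfun d c (t_root d c) / fact d"
    using l by (auto simp: hmax_def max_def split: if_splits)
  then show "eventually (\<lambda>n. l < meanW n) sequentially"
  proof cases
    case 1
    have "(\<lambda>n. real (n choose d) * pn n ^ (d choose 2) / W n - real (n choose (d + 1)) * pn n ^ ((d + 1) choose 2) / W n)
        \<longlonglongrightarrow> 1 / fact d - c / fact (d + 1)"
      by (intro tendsto_diff faces_d_ratio faces_Suc_d_ratio)
    moreover have "1 / fact d - c / fact (d + 1) = gfun d c 1 / fact d"
      unfolding gfun_1[OF d_pos] fs by (simp add: diff_divide_distrib del: of_nat_Suc of_nat_add)
    ultimately have "eventually (\<lambda>n. l < real (n choose d) * pn n ^ (d choose 2) / W n - real (n choose (d + 1)) * pn n ^ ((d + 1) choose 2) / W n) sequentially"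
      using 1 by (intro order_tendstoD(1)) auto
    with meanW_lower_euler show ?thesis by eventually_elim linarith
  next
    case 2
    have "(\<lambda>R. gfun d c (\<theta> (Suc R))) \<longlonglongrightarrow> gfun d c (t_root d c)"
      unfolding gfun_def by (intro tendsto_intros LIMSEQ_Suc[OF \<theta>_tendsto])
    moreover have "l * fact d < gfun d c (t_root d c)" using 2 by (simp add: less_divide_eq)
    ultimately have "eventually (\<lambda>R. l * fact d < gfun d c (\<theta> (Suc R))) sequentially"
      by (rule order_tendstoD(1))
    then obtain R where R: "l * fact d < gfun d c (\<theta> (Suc R))" by (auto simp: eventually_sequentially)
    define v where "v = \<theta> (Suc R) + c / real (d + 1) * ((1 - \<theta> (Suc R)) ^ d * (1 + real d * \<theta> (Suc R)))"
    \<comment> \<open>The excess \<open>c / (d + 1)\<close> is the limiting number of cofaces per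
      face, the total subtracted in \<open>meanW_lower\<close>; after the subtraction exactly
      \<open>gfun\<close> at \<open>\<theta> (Suc R)\<close> remains.\<close>
    have vg: "v = gfun d c (\<theta> (Suc R)) + c / real (d + 1)"
    proof -
      define q where "q = \<theta> (Suc R)"
      define P where "P = (1 - q) ^ d"
      define a where "a = c / real (d + 1)"
      have e: "c * q * P = a * (real (d + 1) * q * P)" by (simp add: a_def del: of_nat_Suc of_nat_add)
      have "gfun d c q + a = q + c * q * P - a * (1 - (1 - q) * P) + a"
        unfolding gfun_def P_def a_def by simp
      also have "\<dots> = q + a * (real (d + 1) * q * P + (1 - q) * P)"
        unfolding e by (simp only: right_diff_distrib distrib_left)
      also have "real (d + 1) * q * P + (1 - q) * P = P * (1 + real d * q)" by (simp add: algebra_simps)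
      finally show ?thesis unfolding v_def q_def[symmetric] P_def[symmetric] a_def by simp
    qed
    define e where "e = l * fact d + c / real (d + 1)"
    let ?\<Theta> = "\<lambda>T :: unit tree. (if zval d (Suc R) T then 1 else 0) + real (psi d R T) / real (d + 1)"
    have "e < v" using R vg by (simp add: e_def)
    moreover have "v > 0"
    proof -
      have "0 < \<theta> (Suc R)" by simp
      moreover have "0 \<le> c / real (d + 1) * ((1 - \<theta> (Suc R)) ^ d * (1 + real d * \<theta> (Suc R)))"
        using c_pos \<theta>_bounds[of "Suc R"] by (intro mult_nonneg_nonneg divide_nonneg_nonneg zero_le_power add_nonneg_nonneg) (auto simp del: \<theta>.simps)
      ultimately show ?thesis unfolding v_def by linarith
    qed
    ultimately have "ennreal e < (\<integral>\<^sup>+\<omega>. ennreal (?\<Theta> (TR (Suc (Suc R)) \<omega>)) \<partial>treeM)"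
      unfolding nn_integral_lower_functional v_def[symmetric] by (rule ennreal_lessI[rotated])
    moreover have "0 \<le> ?\<Theta> T" for T by simp
    ultimately obtain \<T> where \<T>: "finite \<T>" "\<And>T. T \<in> \<T> \<Longrightarrow> wft d (Suc (Suc R)) T"
      "e < (\<Sum>T\<in>\<T>. ?\<Theta> T * wt d c (Suc (Suc R)) T)"
      using finite_tree_sum[of ?\<Theta> e "Suc (Suc R)"] by blast
    have "(\<lambda>n. real (n choose d) * pn n ^ (d choose 2) / W n * (\<Sum>T\<in>\<T>. ?\<Theta> T * Bn d n (pn n) (Suc (Suc R)) T)
        - real (n choose (d + 1)) * pn n ^ ((d + 1) choose 2) / W n)
        \<longlonglongrightarrow> 1 / fact d * (\<Sum>T\<in>\<T>. ?\<Theta> T * wt d c (Suc (Suc R)) T) - c / fact (d + 1)"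
      by (intro tendsto_diff tendsto_mult faces_d_ratio faces_Suc_d_ratio sum_Bn_tendsto)
    moreover have "l < 1 / fact d * (\<Sum>T\<in>\<T>. ?\<Theta> T * wt d c (Suc (Suc R)) T) - c / fact (d + 1)"
    proof -
      have "l = (e - c / real (d + 1)) / fact d" by (simp add: e_def)
      also have "\<dots> = 1 / fact d * e - c / fact (d + 1)"
        unfolding fs by (simp add: diff_divide_distrib del: of_nat_Suc of_nat_add)
      also have "\<dots> < 1 / fact d * (\<Sum>T\<in>\<T>. ?\<Theta> T * wt d c (Suc (Suc R)) T) - c / fact (d + 1)"
        using \<T>(3) by (intro diff_strict_right_mono mult_strict_left_mono) auto
      finally show ?thesis .
    qed
    ultimately have "eventually (\<lambda>n. l < real (n choose d) * pn n ^ (d choose 2) / W n * (\<Sum>T\<in>\<T>. ?\<Theta> T * Bn d n (pn n) (Suc (Suc R)) T)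
        - real (n choose (d + 1)) * pn n ^ ((d + 1) choose 2) / W n) sequentially"
      by (rule order_tendstoD(1))
    moreover have "eventually (\<lambda>n. real (n choose d) * pn n ^ (d choose 2) / W n * (\<Sum>T\<in>\<T>. ?\<Theta> T * Bn d n (pn n) (Suc (Suc R)) T)
        - real (n choose (d + 1)) * pn n ^ ((d + 1) choose 2) / W n \<le> meanW n) sequentially"
      by (rule meanW_lower[OF \<T>(1,2)])
    ultimately show ?thesis by eventually_elim (rule less_le_trans)
  qed
qed

end

section \<open>Concentration and convergence of moments\<close>

text \<open>Below \<open>B\<close>, the power is at most \<open>D\<close> if
  \<open>D \<le> 1\<close> and at most \<open>B powr r\<close> otherwise; above \<open>B\<close>,
  one factor \<open>D / B\<close> is inserted. This splits an \<open>r\<close>-th moment into a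
  mean, which tends to zero, and a bounded higher moment divided by the free parameter
  \<open>B\<close>.\<close>

lemma powr_le_truncated:
  fixes D B r :: real
  assumes "0 \<le> D" "1 \<le> B" "1 \<le> r" "r + 1 \<le> real q"
  shows "D powr r \<le> B powr r * D + D ^ q / B"
proof (cases "D \<le> B")
  case True
  have "D powr r \<le> B powr r * D"
  proof (cases "D \<le> 1")
    case True
    have "D powr r \<le> D"
    proof (cases "D = 0")
      case False
      then have "D powr r \<le> D powr 1" using True assms by (intro powr_mono') auto
      then show ?thesis using assms by simp
    qed simp
    also have "1 * D \<le> B powr r * D" using assms by (intro mult_right_mono ge_one_powr_ge_zero) auto
    finally show ?thesis by simp
  next
    case False
    have "D powr r \<le> B powr r" using True assms by (intro powr_mono2) auto
    also have "B powr r * 1 \<le> B powr r * D" using False by (intro mult_left_mono) auto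
    finally show ?thesis by simp
  qed
  moreover have "0 \<le> D ^ q / B" using assms by simp
  ultimately show ?thesis by linarith
next
  case False
  have "B * D powr r \<le> D * D powr r" using False by (intro mult_right_mono) auto
  also have "D * D powr r = D powr (r + 1)" using False assms by (simp add: powr_add)
  also have "\<dots> \<le> D powr real q" using False assms by (intro powr_mono) auto
  also have "\<dots> = D ^ q" using False assms by (intro powr_realpow) auto
  finally have "D powr r \<le> D ^ q / B" using assms by (simp add: le_divide_eq mult.commute)
  moreover have "0 \<le> B powr r * D" using assms by simp
  ultimately show ?thesis by linarith
qed

lemma power_add_le: "0 \<le> a \<Longrightarrow> 0 \<le> b \<Longrightarrow> (a + b) ^ q \<le> 2 ^ q * (a ^ q + b ^ q)" for a b :: real
proof -
  assume ab: "0 \<le> a" "0 \<le> b"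
  have "(a + b) ^ q \<le> (2 * max a b) ^ q" using ab by (intro power_mono) auto
  also have "\<dots> = 2 ^ q * max a b ^ q" by (rule power_mult_distrib)
  also have "max a b ^ q \<le> a ^ q + b ^ q" using ab by (cases "a \<le> b") (auto simp: max_def)
  finally show ?thesis by simp
qed

context poisson_tree
begin

text \<open>The mean deviation is at most the standard deviation, and \<open>var_nu\<close> with
  \<open>\<kappa> = c * n\<close> makes the latter \<open>W n\<close> times a term of order
  \<open>1 / sqrt n\<close>.\<close>

lemma nu_deviation:
  assumes "n > 0" "real n \<ge> c" "c * real n \<ge> 1"
  defines "f \<equiv> \<lambda>E. real (nu (clique_complex n E) d)"
  defines "A \<equiv> all_edges n"
  shows "edgeE A (pn n) (\<lambda>E. \<bar>f E - edgeE A (pn n) f\<bar>)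
    \<le> W n * sqrt (2 * (real (d choose 2) * 2 ^ d + real ((d + 1) choose 2) * 2 ^ (d + 1) * c\<^sup>2) / c / real n)"
proof -
  define p where "p = pn n"
  have p: "0 < p" "p \<le> 1" using pn_props[OF assms(1)] assms(2) by (auto simp: p_def)
  define a b where "a = real (d choose 2) * 2 ^ d" and "b = real ((d + 1) choose 2) * 2 ^ (d + 1)"
  have cn: "0 < c * real n" using assms c_pos by simp
  have wS: "wn n p (d + 1) = c * W n" unfolding p_def by (rule W_Suc[OF assms(1)])
  have w0: "wn n p d = W n" by (simp add: W_def p_def)
  have "(edgeE A p (\<lambda>E. \<bar>f E - edgeE A p f\<bar>))\<^sup>2 \<le> edgeE A p (\<lambda>E. (f E - edgeE A p f)\<^sup>2)"
    using p by (intro edgeE_abs_le_sqrt) (auto simp: A_def finite_all_edges)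
  also have "\<dots> \<le> 2 * (a * (wn n p d)\<^sup>2 + b * (wn n p (d + 1))\<^sup>2) / (c * real n)"
    unfolding f_def A_def a_def b_def
    by (rule var_nu[OF p assms(1) cn]) (use wn_ge(2)[OF assms(1-3)] in \<open>auto simp: p_def\<close>)
  also have "\<dots> = 2 * (a * (W n)\<^sup>2 + b * (c * W n)\<^sup>2) / (c * real n)"
    unfolding wS w0 ..
  also have "\<dots> = (W n)\<^sup>2 * (2 * (a + b * c\<^sup>2) / c / real n)"
    by (simp add: power_mult_distrib distrib_left mult_ac)
  finally have "edgeE A p (\<lambda>E. \<bar>f E - edgeE A p f\<bar>) \<le> sqrt ((W n)\<^sup>2 * (2 * (a + b * c\<^sup>2) / c / real n))"
    by (rule real_le_rsqrt)
  also have "\<dots> = W n * sqrt (2 * (a + b * c\<^sup>2) / c / real n)"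
    unfolding real_sqrt_mult using W_pos[OF assms(1)] by simp
  finally show ?thesis unfolding p_def a_def b_def .
qed

lemma betti_deviation_tendsto:
  assumes d: "d = k + 1"
  shows "(\<lambda>n. edgeE (all_edges n) (pn n) (\<lambda>E. \<bar>real (betti k (clique_complex n E)) / W n - hmax / fact d\<bar>)) \<longlonglongrightarrow> 0"
proof -
  define K where "K = 2 * (real (d choose 2) * 2 ^ d + real ((d + 1) choose 2) * 2 ^ (d + 1) * c\<^sup>2) / c"
  define h where "h = hmax / fact d"
  \<comment> \<open>The three errors: passing from the Betti number to \<open>nu\<close>, the
    fluctuation of \<open>nu\<close>, and the distance of its normalised mean from the
    limit.\<close>
  define u where "u n = real (n choose (d - 1)) * pn n ^ ((d - 1) choose 2) / W n + sqrt (K / real n) + \<bar>meanW n - h\<bar>" for n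
  have "(\<lambda>n. K / real n) \<longlonglongrightarrow> 0"
    by (intro tendsto_divide_0[OF tendsto_const] filterlim_real_sequentially[THEN filterlim_mono[OF _ at_top_le_at_infinity order_refl]])
  then have "(\<lambda>n. sqrt (K / real n)) \<longlonglongrightarrow> sqrt 0" by (rule tendsto_real_sqrt)
  moreover have "(\<lambda>n. \<bar>meanW n - h\<bar>) \<longlonglongrightarrow> \<bar>h - h\<bar>"
    using meanW_tendsto unfolding h_def by (intro tendsto_rabs tendsto_diff tendsto_const)
  ultimately have "u \<longlonglongrightarrow> 0 + sqrt 0 + \<bar>h - h\<bar>"
    unfolding u_def[abs_def] by (intro tendsto_add faces_lower_ratio)
  then have ulim: "u \<longlonglongrightarrow> 0" by simp
  show ?thesis unfolding h_def[symmetric]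
  proof (rule tendsto_sandwich[OF _ _ tendsto_const ulim])
    show "eventually (\<lambda>n. 0 \<le> edgeE (all_edges n) (pn n) (\<lambda>E. \<bar>real (betti k (clique_complex n E)) / W n - h\<bar>)) sequentially"
      using eventually_large[of 0]
    proof eventually_elim
      case (elim n)
      then show ?case using pn_props[of n] by (intro edgeE_nonneg) auto
    qed
    show "eventually (\<lambda>n. edgeE (all_edges n) (pn n) (\<lambda>E. \<bar>real (betti k (clique_complex n E)) / W n - h\<bar>) \<le> u n) sequentially"
      using eventually_large[of 0]
    proof eventually_elim
      case (elim n)
      then have n: "n > 0" "real n \<ge> c" "c * real n \<ge> 1" by auto
      have p: "0 \<le> pn n" "pn n \<le> 1" using pn_props[OF n(1)] n by auto
      note W = W_pos[OF n(1)]
      let ?A = "all_edges n" and ?K = "clique_complex n"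
      define f where "f = (\<lambda>E. real (nu (?K E) d))"
      define e where "e = edgeE ?A (pn n) f"
      have dev: "edgeE ?A (pn n) (\<lambda>E. \<bar>f E - e\<bar>) \<le> W n * sqrt (K / real n)"
        unfolding K_def e_def f_def by (rule nu_deviation[OF n])
      have mW: "meanW n = e / W n" by (simp add: meanW_def e_def f_def)
      have "edgeE ?A (pn n) (\<lambda>E. \<bar>real (betti k (?K E)) / W n - h\<bar>)
        \<le> edgeE ?A (pn n) (\<lambda>E. 1 / W n * real (card (faces (?K E) k)) + 1 / W n * \<bar>f E - e\<bar> + \<bar>meanW n - h\<bar>)"
      proof (rule edgeE_mono[OF p])
        fix E
        have b: "real (betti k (?K E)) \<le> f E" "f E \<le> real (betti k (?K E)) + real (card (faces (?K E) k))"
          using betti_bounds[OF finite_clique_complex[of n E], of k] unfolding f_def d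
          by (simp, metis of_nat_add of_nat_mono)
        have "real (betti k (?K E)) / W n - h = 1 / W n * (real (betti k (?K E)) - f E) + 1 / W n * (f E - e) + (meanW n - h)"
          using W by (simp add: mW field_simps)
        also have "\<bar>\<dots>\<bar> \<le> \<bar>1 / W n * (real (betti k (?K E)) - f E)\<bar> + \<bar>1 / W n * (f E - e)\<bar> + \<bar>meanW n - h\<bar>"
          by linarith
        also have "\<bar>1 / W n * (real (betti k (?K E)) - f E)\<bar> \<le> 1 / W n * real (card (faces (?K E) k))"
          unfolding abs_mult using W b by (intro mult_mono) auto
        also have "\<bar>1 / W n * (f E - e)\<bar> = 1 / W n * \<bar>f E - e\<bar>"
          unfolding abs_mult using W by simp
        finally show "\<bar>real (betti k (?K E)) / W n - h\<bar> \<le> 1 / W n * real (card (faces (?K E) k)) + 1 / W n * \<bar>f E - e\<bar> + \<bar>meanW n - h\<bar>"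
          by simp
      qed
      also have "\<dots> = 1 / W n * (real (n choose k) * pn n ^ (k choose 2)) + 1 / W n * edgeE ?A (pn n) (\<lambda>E. \<bar>f E - e\<bar>) + \<bar>meanW n - h\<bar>"
        unfolding edgeE_add edgeE_cmult edgeE_card_faces edgeE_const[OF finite_all_edges] ..
      also have "\<dots> \<le> 1 / W n * (real (n choose k) * pn n ^ (k choose 2)) + 1 / W n * (W n * sqrt (K / real n)) + \<bar>meanW n - h\<bar>"
        using dev W by (intro add_right_mono add_left_mono mult_left_mono) auto
      also have "\<dots> = u n" using W d by (simp add: u_def)
      finally show ?case .
    qed
  qed
qed

text \<open>The Betti number is at most the number of faces, whose moments are controlled by
  \<open>moment_bound\<close>; the bound is uniform in \<open>n\<close>.\<close>

lemma betti_moment: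
  assumes d: "d = k + 1" and n: "n > 0" "real n \<ge> c" "c * real n \<ge> 1"
  shows "edgeE (all_edges n) (pn n) (\<lambda>E. \<bar>real (betti k (clique_complex n E)) / W n - h\<bar> ^ q)
     \<le> 2 ^ q * ((2 ^ (d * q)) ^ q + \<bar>h\<bar> ^ q)"
proof -
  have p: "0 < pn n" "pn n \<le> 1" using pn_props[OF n(1)] n by auto
  note W = W_pos[OF n(1)]
  let ?A = "all_edges n" and ?K = "clique_complex n"
  have "edgeE ?A (pn n) (\<lambda>E. \<bar>real (betti k (?K E)) / W n - h\<bar> ^ q)
      \<le> edgeE ?A (pn n) (\<lambda>E. 2 ^ q / W n ^ q * real (card (faces (?K E) d)) ^ q + 2 ^ q * \<bar>h\<bar> ^ q)"
  proof (rule edgeE_mono)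
    fix E
    have "betti k (?K E) \<le> card (faces (?K E) d)"
      using betti_bounds(1)[OF finite_clique_complex[of n E], of k] nu_le_faces[OF finite_clique_complex[of n E], of d] unfolding d by (rule le_trans)
    then have "real (betti k (?K E)) / W n \<le> real (card (faces (?K E) d)) / W n"
      using W by (intro divide_right_mono) auto
    moreover have "0 \<le> real (betti k (?K E)) / W n" using W by simp
    ultimately have "\<bar>real (betti k (?K E)) / W n - h\<bar> \<le> real (card (faces (?K E) d)) / W n + \<bar>h\<bar>" by linarith
    then have "\<bar>real (betti k (?K E)) / W n - h\<bar> ^ q \<le> (real (card (faces (?K E) d)) / W n + \<bar>h\<bar>) ^ q"
      by (intro power_mono) auto
    also have "\<dots> \<le> 2 ^ q * ((real (card (faces (?K E) d)) / W n) ^ q + \<bar>h\<bar> ^ q)"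
      using W by (intro power_add_le) auto
    finally show "\<bar>real (betti k (?K E)) / W n - h\<bar> ^ q \<le> 2 ^ q / W n ^ q * real (card (faces (?K E) d)) ^ q + 2 ^ q * \<bar>h\<bar> ^ q"
      by (simp add: power_divide distrib_left)
  qed (use p in auto)
  also have "\<dots> = 2 ^ q / W n ^ q * edgeE ?A (pn n) (\<lambda>E. real (card (faces (?K E) d)) ^ q) + 2 ^ q * \<bar>h\<bar> ^ q"
    unfolding edgeE_add edgeE_cmult edgeE_const[OF finite_all_edges] ..
  also have "\<dots> \<le> 2 ^ q / W n ^ q * ((2 ^ (d * q)) ^ q * W n ^ q) + 2 ^ q * \<bar>h\<bar> ^ q"
  proof (intro add_right_mono mult_left_mono)
    show "edgeE ?A (pn n) (\<lambda>E. real (card (faces (?K E) d)) ^ q) \<le> (2 ^ (d * q)) ^ q * W n ^ q"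
      unfolding W_def by (rule moment_bound[OF p n(1)]) (rule wn_ge(1)[OF n], simp)
  qed (use W in auto)
  also have "\<dots> = 2 ^ q * ((2 ^ (d * q)) ^ q + \<bar>h\<bar> ^ q)"
    using W by (simp add: distrib_left)
  finally show ?thesis .
qed

lemma betti_powr_deviation_tendsto:
  assumes d: "d = k + 1" and r: "r \<ge> 1"
  shows "(\<lambda>n. edgeE (all_edges n) (pn n) (\<lambda>E. \<bar>real (betti k (clique_complex n E)) / W n - hmax / fact d\<bar> powr r)) \<longlonglongrightarrow> 0"
proof (rule order_tendstoI)
  fix a :: real assume "a < 0"
  then show "eventually (\<lambda>n. a < edgeE (all_edges n) (pn n) (\<lambda>E. \<bar>real (betti k (clique_complex n E)) / W n - hmax / fact d\<bar> powr r)) sequentially"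
    using eventually_large[of 0]
  proof (elim eventually_mono)
    fix n assume "a < 0" "n > 0 \<and> real n \<ge> c \<and> c * real n \<ge> 1 \<and> real n \<ge> 0"
    moreover from this have "0 \<le> edgeE (all_edges n) (pn n) (\<lambda>E. \<bar>real (betti k (clique_complex n E)) / W n - hmax / fact d\<bar> powr r)"
      using pn_props[of n] by (intro edgeE_nonneg) auto
    ultimately show "a < edgeE (all_edges n) (pn n) (\<lambda>E. \<bar>real (betti k (clique_complex n E)) / W n - hmax / fact d\<bar> powr r)"
      by linarith
  qed
next
  fix a :: real assume a: "0 < a"
  define h where "h = hmax / fact d"
  define q where "q = nat \<lceil>r + 1\<rceil>"
  have q: "r + 1 \<le> real q" unfolding q_def by linarith
  define K :: real where "K = 2 ^ q * ((2 ^ (d * q)) ^ q + \<bar>h\<bar> ^ q)"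
  have K: "0 \<le> K" by (simp add: K_def)
  \<comment> \<open>With this choice the tail \<open>K / B\<close> is below \<open>a / 2\<close> for
    every \<open>n\<close>; the other half is left for the mean deviation, which tends to zero while
    \<open>B\<close> stays fixed.\<close>
  define B where "B = 1 + 2 * K / a"
  have B: "1 \<le> B" using K a by (simp add: B_def)
  have "K / B < a / 2"
  proof -
    have "2 * K < a * B" using a by (simp add: B_def distrib_left)
    then show ?thesis using B by (simp add: divide_less_eq)
  qed
  have "(\<lambda>n. B powr r * edgeE (all_edges n) (pn n) (\<lambda>E. \<bar>real (betti k (clique_complex n E)) / W n - h\<bar>)) \<longlonglongrightarrow> B powr r * 0"
    unfolding h_def by (intro tendsto_mult tendsto_const betti_deviation_tendsto d)
  then have "eventually (\<lambda>n. B powr r * edgeE (all_edges n) (pn n) (\<lambda>E. \<bar>real (betti k (clique_complex n E)) / W n - h\<bar>) < a / 2) sequentially"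
    using a by (intro order_tendstoD(2)) auto
  then show "eventually (\<lambda>n. edgeE (all_edges n) (pn n) (\<lambda>E. \<bar>real (betti k (clique_complex n E)) / W n - hmax / fact d\<bar> powr r) < a) sequentially"
    using eventually_large[of 0] unfolding h_def[symmetric]
  proof eventually_elim
    case (elim n)
    then have n: "n > 0" "real n \<ge> c" "c * real n \<ge> 1" by auto
    have p: "0 \<le> pn n" "pn n \<le> 1" using pn_props[OF n(1)] n by auto
    let ?D = "\<lambda>E. \<bar>real (betti k (clique_complex n E)) / W n - h\<bar>"
    have "edgeE (all_edges n) (pn n) (\<lambda>E. ?D E powr r)
        \<le> edgeE (all_edges n) (pn n) (\<lambda>E. B powr r * ?D E + 1 / B * ?D E ^ q)"
      using powr_le_truncated[OF abs_ge_zero B r q] by (intro edgeE_mono p) simp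
    also have "\<dots> = B powr r * edgeE (all_edges n) (pn n) ?D + 1 / B * edgeE (all_edges n) (pn n) (\<lambda>E. ?D E ^ q)"
      unfolding edgeE_add edgeE_cmult ..
    also have "1 / B * edgeE (all_edges n) (pn n) (\<lambda>E. ?D E ^ q) \<le> 1 / B * K"
      unfolding K_def using B by (intro mult_left_mono betti_moment[OF d n]) auto
    finally have "edgeE (all_edges n) (pn n) (\<lambda>E. ?D E powr r) \<le> B powr r * edgeE (all_edges n) (pn n) ?D + K / B" by simp
    also have "\<dots> < a / 2 + a / 2" using elim(1) \<open>K / B < a / 2\<close> by (rule add_strict_mono)
    finally show ?case by simp
  qed
qed

end

theorem theorem1p3:
  fixes k :: nat and c r :: real
  assumes "c > 0" and "r \<ge> 1"
  shows "(\<lambda>n. gnp_expectation n ((c / real n) powr (1 / real (k + 1)))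
            (\<lambda>E. \<bar>real (betti k (clique_complex n E)) / real n powr (real k / 2 + 1)
                  - c powr (real k / 2) * h_fun k c / fact (k + 1)\<bar> powr r))
         \<longlonglongrightarrow> 0"
proof -
  interpret poisson_tree c "k + 1" using assms(1) by unfold_locales auto
  define C where "C = c powr (real k / 2)"
  have C: "0 < C" using assms(1) by (simp add: C_def)
  have h: "hmax = h_fun k c" unfolding hmax_def h_fun_eq ..
  have "(\<lambda>n. C powr r * edgeE (all_edges n) (pn n) (\<lambda>E. \<bar>real (betti k (clique_complex n E)) / W n - hmax / fact (k + 1)\<bar> powr r)) \<longlonglongrightarrow> C powr r * 0"
    by (intro tendsto_mult tendsto_const betti_powr_deviation_tendsto refl assms(2))
  \<comment> \<open>For \<open>n > 0\<close> the two normalisations differ by the factor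
    \<open>C\<close>, since \<open>W n = C * real n powr (real k / 2 + 1)\<close>; it leaves the
    absolute value as \<open>C powr r\<close>.\<close>
  moreover have "eventually (\<lambda>n. gnp_expectation n ((c / real n) powr (1 / real (k + 1)))
            (\<lambda>E. \<bar>real (betti k (clique_complex n E)) / real n powr (real k / 2 + 1)
                  - c powr (real k / 2) * h_fun k c / fact (k + 1)\<bar> powr r)
     = C powr r * edgeE (all_edges n) (pn n) (\<lambda>E. \<bar>real (betti k (clique_complex n E)) / W n - hmax / fact (k + 1)\<bar> powr r)) sequentially"
    using eventually_gt_at_top[of 0]
  proof eventually_elim
    case (elim n)
    have e: "(real (k + 1) - 1) / 2 = real k / 2" "(real (k + 1) + 1) / 2 = real k / 2 + 1" by simp_all
    have N: "W n = C * real n powr (real k / 2 + 1)"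
      using W_eq[OF elim] unfolding e C_def .
    have "\<bar>b / real n powr (real k / 2 + 1) - C * h_fun k c / fact (k + 1)\<bar> powr r
        = C powr r * \<bar>b / W n - hmax / fact (k + 1)\<bar> powr r" for b
    proof -
      have "b / real n powr (real k / 2 + 1) - C * h_fun k c / fact (k + 1) = C * (b / W n - hmax / fact (k + 1))"
        unfolding N h using C by (simp add: right_diff_distrib del: fact_Suc)
      then show ?thesis using C by (simp add: abs_mult powr_mult del: fact_Suc)
    qed
    then show ?case
      unfolding gnp_expectation_eq C_def[symmetric] pn_def[symmetric]
      by (simp only: edgeE_cmult)
  qed
  ultimately show ?thesis by (simp add: tendsto_cong del: fact_Suc)
qed

end
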